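(* For all sufficiently large integer weights $r$ there are more Jacobi cusp forms of weight $r$ and scalar index $1$ on $\mathbb{H}_2\times\mathbb{C}^2$ than Fourier-Jacobi cusp forms of weight $r$ and index $1$. That is, there is $r_0$ such that for all $r\ge r_0$ the space $\{\Phi_1(F): F\in[\Gamma_3,r]_0\}$ of first Fourier-Jacobi coefficients of Siegel cusp forms of degree $3$ and weight $r$ is a proper subspace of the space $J^{cusp}_{r,1}$ of Jacobi cusp forms of weight $r$ and index $1$ on $\mathbb{H}_2\times\mathbb{C}^2$.
   Context: $\mathbb{H}_n$ is the Siegel upper half space of degree $n$; $\Gamma_n=Sp(n,\mathbb{Z})$ acts on it by $M(Z)=(AZ+B)(CZ+D)^{-1}$ for $M=\begin{pmatrix}A&B\\C&D\end{pmatrix}$. $[\Gamma_3,r]_0$ is the space of Siegel cusp forms of weight $r$ for $\Gamma_3$, i.e. cusp forms among holomorphic $F:\mathbb{H}_3\to\mathbb{C}$ with $F(M(Z))=\det(CZ+D)^rF(Z)$ for all $M\in\Gamma_3$. Write $Z\in\mathbb{H}_3$ as $Z=\begin{pmatrix}\widehat{Z}&\widehat{z}\\ \widehat{z}^t&z_{33}\end{pmatrix}$ with $\widehat{Z}\in\mathbb{H}_2$, $\widehat{z}\in\mathbb{C}^2$, $z_{33}\in\mathbb{H}_1$. A cusp form $F\in[\Gamma_3,r]_0$ has a Fourier-Jacobi expansion $F(Z)=\sum_{m\ge1}\Phi_m(F)(\widehat{Z},\widehat{z})e^{2\pi i m z_{33}}$. A Fourier-Jacobi cusp form of weight $r$ and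 index $1$ is a function of the form $\Phi_1(F)$ with $F\in[\Gamma_3,r]_0$. A Jacobi cusp form of weight $r$ and scalar index $1$ on $\mathbb{H}_2\times\mathbb{C}^2$ is a holomorphic function $\varphi:\mathbb{H}_2\times\mathbb{C}^2\to\mathbb{C}$ such that $\varphi(\widehat{Z},\widehat{z})e^{2\pi i z_{33}}$ transforms like a Siegel modular form of weight $r$ under the Jacobi subgroup $J_{2,1}\subset\Gamma_3$, that is: (1) for all $\begin{pmatrix}\widehat{A}&\widehat{B}\\ \widehat{C}&\widehat{D}\end{pmatrix}=\widehat{M}\in\Gamma_2$, $\varphi\big(\widehat{M}(\widehat{Z}),(\widehat{Z}\widehat{C}^t+\widehat{D}^t)^{-1}\widehat{z}\big)\,e^{-2\pi i\,\widehat{z}^t(\widehat{C}\widehat{Z}+\widehat{D})^{-1}\widehat{C}\widehat{z}}=\det(\widehat{C}\widehat{Z}+\widehat{D})^r\varphi(\widehat{Z},\widehat{z})$; (2) for all $\lambda,\mu\in\mathbb{Z}^2$, $\varphi(\widehat{Z},\widehat{z}+\widehat{Z}\lambda+\mu)=e^{-2\pi i(\lambda^t\widehat{Z}\lambda+2\lambda^t\widehat{z})}\varphi(\widehat{Z},\widehat{z})$; (3) (cusp condition) in the Fourier expansion $\varphi(\widehat{Z},\widehat{z})=\sum_{\widehat{T},t}c(\widehat{T},t)\,e^{2\pi i(\operatorname{tr}(\widehat{T}\widehat{Z})+t^t\widehat{z})}$, over half-integral symmetric $2\times2$ matrices $\widehat{T}$ (integral diagonal entries, off-diagonal entries in $\frac12\mathbb{Z}$)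 and $t\in\mathbb{Z}^2$, one has $c(\widehat{T},t)\ne0$ only if the $3\times 3$ matrix $\begin{pmatrix}\widehat{T}&\frac12t\\ \frac12t^t&1\end{pmatrix}$ is positive definite. The space of these functions is denoted $J^{cusp}_{r,1}$; it contains all Fourier-Jacobi cusp forms of weight $r$ and index $1$. *)

theory Defs
  imports "HOL-Analysis.Analysis" "HOL-Library.Function_Algebras"
begin

section \<open>Matrices\<close>

definition block_matrix ::
  "'a^'n^'n \<Rightarrow> 'a^'n^'n \<Rightarrow> 'a^'n^'n \<Rightarrow> 'a^'n^'n \<Rightarrow> 'a^('n::finite + 'n)^('n + 'n)" where
  "block_matrix A B C D = (\<chi> i j.
     case i of
       Inl a \<Rightarrow> (case j of Inl b \<Rightarrow> A $ a $ b | Inr b \<Rightarrow> B $ a $ b)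
     | Inr a \<Rightarrow> (case j of Inl b \<Rightarrow> C $ a $ b | Inr b \<Rightarrow> D $ a $ b))"

definition bordered_matrix :: "'a::zero^2^2 \<Rightarrow> 'a^2 \<Rightarrow> 'a \<Rightarrow> 'a^3^3" where
  "bordered_matrix X x w = vector
     [vector [X $ 1 $ 1, X $ 1 $ 2, x $ 1],
      vector [X $ 2 $ 1, X $ 2 $ 2, x $ 2],
      vector [x $ 1, x $ 2, w]]"

definition cmat :: "int^'n^'m \<Rightarrow> complex^'n^'m" where
  "cmat A = map_matrix of_int A"

definition cvec :: "int^'n \<Rightarrow> complex^'n" where
  "cvec v = (\<chi> i. of_int (v $ i))"

text \<open>The product \<open>x\<^sup>t y\<close>, without complex conjugation.\<close>

definition bilin :: "'a::comm_semiring_1^'n::finite \<Rightarrow> 'a^'n \<Rightarrow> 'a" where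
  "bilin x y = (\<Sum>i\<in>UNIV. x $ i * y $ i)"

definition positive_definite :: "real^'n^'n::finite \<Rightarrow> bool" where
  "positive_definite Y \<longleftrightarrow> transpose Y = Y \<and> (\<forall>x. x \<noteq> 0 \<longrightarrow> 0 < x \<bullet> (Y *v x))"

definition half_integral :: "(real^'n^'n) set" where
  "half_integral = {T. transpose T = T \<and> (\<forall>i. T $ i $ i \<in> \<int>) \<and> (\<forall>i j. 2 * T $ i $ j \<in> \<int>)}"

definition e2pi :: "complex \<Rightarrow> complex" where
  "e2pi w = exp (2 * of_real pi * \<i> * w)"


section \<open>The symplectic group and the Siegel upper half space\<close>

definition symplectic_group :: "(int^('n::finite + 'n)^('n + 'n)) set" where
  "symplectic_group =
     {M. transpose M ** block_matrix 0 (mat 1) (- mat 1) 0 ** M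
           = block_matrix 0 (mat 1) (- mat 1) 0}"

definition siegel_space :: "(complex^'n^'n::finite) set" where
  "siegel_space = {Z. transpose Z = Z \<and> positive_definite (map_matrix Im Z)}"

definition automorphy_matrix ::
  "int^'n^'n \<Rightarrow> int^'n^'n \<Rightarrow> complex^'n^'n \<Rightarrow> complex^'n^'n::finite" where
  "automorphy_matrix C D Z = cmat C ** Z + cmat D"

definition siegel_action ::
  "int^'n^'n \<Rightarrow> int^'n^'n \<Rightarrow> int^'n^'n \<Rightarrow> int^'n^'n \<Rightarrow> complex^'n^'n \<Rightarrow> complex^'n^'n::finite" where
  "siegel_action A B C D Z = (cmat A ** Z + cmat B) ** matrix_inv (automorphy_matrix C D Z)"


section \<open>Holomorphic functions of several variables\<close>

text \<open>
  Holomorphy is complex Frechet differentiability. The map \<open>sc\<close> is the multiplication by complex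
  scalars on the ambient space. Symmetric matrices form a proper complex subspace of all matrices,
  and the derivative is taken within the domain, so only symmetric directions matter; a complex
  linear form on that subspace always extends to the ambient space.
\<close>

definition holomorphic_wrt ::
  "(complex \<Rightarrow> 'a \<Rightarrow> 'a) \<Rightarrow> ('a::real_normed_vector \<Rightarrow> complex) \<Rightarrow> 'a set \<Rightarrow> bool" where
  "holomorphic_wrt sc f S \<longleftrightarrow>
     (\<forall>x\<in>S. \<exists>L. (f has_derivative L) (at x within S) \<and> (\<forall>c v. L (sc c v) = c * L v))"

definition mscale :: "complex \<Rightarrow> complex^'n^'m \<Rightarrow> complex^'n^'m" where
  "mscale c Z = map_matrix ((*) c) Z"


section \<open>Siegel cusp forms\<close>

text \<open>
  Functions on a domain are represented by total functions that vanish outside the domain, so that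
  equality in HOL is equality of functions on the domain.
\<close>

definition siegel_modular_transformation :: "int \<Rightarrow> (complex^'n^'n::finite \<Rightarrow> complex) \<Rightarrow> bool" where
  "siegel_modular_transformation r F \<longleftrightarrow>
     (\<forall>A B C D. block_matrix A B C D \<in> symplectic_group \<longrightarrow>
        (\<forall>Z\<in>siegel_space.
           F (siegel_action A B C D Z) = det (automorphy_matrix C D Z) powi r * F Z))"

definition siegel_fourier_expansion ::
  "(complex^'n^'n::finite \<Rightarrow> complex) \<Rightarrow> (real^'n^'n \<Rightarrow> complex) \<Rightarrow> bool" where
  "siegel_fourier_expansion F c \<longleftrightarrow>
     (\<forall>Z\<in>siegel_space.
        ((\<lambda>T. c T * e2pi (trace (map_matrix of_real T ** Z))) has_sum F Z) half_integral)"

definition siegel_cusp_forms :: "int \<Rightarrow> (complex^'n^'n::finite \<Rightarrow> complex) set" where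
  "siegel_cusp_forms r = {F.
     holomorphic_wrt mscale F siegel_space \<and>
     (\<forall>Z. Z \<notin> siegel_space \<longrightarrow> F Z = 0) \<and>
     siegel_modular_transformation r F \<and>
     (\<exists>c. siegel_fourier_expansion F c \<and>
          (\<forall>T\<in>half_integral. c T \<noteq> 0 \<longrightarrow> positive_definite T))}"


section \<open>Jacobi cusp forms of index 1\<close>

definition jacobi_domain :: "((complex^2^2) \<times> (complex^2)) set" where
  "jacobi_domain = siegel_space \<times> UNIV"

definition jacobi_modular_transformation ::
  "int \<Rightarrow> ((complex^2^2) \<times> (complex^2) \<Rightarrow> complex) \<Rightarrow> bool" where
  "jacobi_modular_transformation r \<phi> \<longleftrightarrow>
     (\<forall>A B C D. block_matrix A B C D \<in> symplectic_group \<longrightarrow>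
        (\<forall>Z\<in>siegel_space. \<forall>z.
           \<phi> (siegel_action A B C D Z,
              matrix_inv (Z ** transpose (cmat C) + transpose (cmat D)) *v z)
           * e2pi (- bilin z ((matrix_inv (automorphy_matrix C D Z) ** cmat C) *v z))
           = det (automorphy_matrix C D Z) powi r * \<phi> (Z, z)))"

definition jacobi_lattice_transformation ::
  "((complex^2^2) \<times> (complex^2) \<Rightarrow> complex) \<Rightarrow> bool" where
  "jacobi_lattice_transformation \<phi> \<longleftrightarrow>
     (\<forall>(l :: int^2) (m :: int^2). \<forall>Z\<in>siegel_space. \<forall>z.
        \<phi> (Z, z + Z *v cvec l + cvec m)
        = e2pi (- (bilin (cvec l) (Z *v cvec l) + 2 * bilin (cvec l) z)) * \<phi> (Z, z))"

definition jacobi_fourier_expansion ::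
  "((complex^2^2) \<times> (complex^2) \<Rightarrow> complex) \<Rightarrow> (real^2^2 \<Rightarrow> int^2 \<Rightarrow> complex) \<Rightarrow> bool" where
  "jacobi_fourier_expansion \<phi> c \<longleftrightarrow>
     (\<forall>Z\<in>siegel_space. \<forall>z.
        ((\<lambda>(T, t). c T t * e2pi (trace (map_matrix of_real T ** Z) + bilin (cvec t) z))
           has_sum \<phi> (Z, z)) (half_integral \<times> UNIV))"

definition jacobi_cusp_forms :: "int \<Rightarrow> ((complex^2^2) \<times> (complex^2) \<Rightarrow> complex) set" where
  "jacobi_cusp_forms r = {\<phi>.
     holomorphic_wrt (\<lambda>c (Z, z). (mscale c Z, c *s z)) \<phi> jacobi_domain \<and>
     (\<forall>x. x \<notin> jacobi_domain \<longrightarrow> \<phi> x = 0) \<and>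
     jacobi_modular_transformation r \<phi> \<and>
     jacobi_lattice_transformation \<phi> \<and>
     (\<exists>c. jacobi_fourier_expansion \<phi> c \<and>
          (\<forall>T\<in>half_integral. \<forall>t. c T t \<noteq> 0 \<longrightarrow>
             positive_definite (bordered_matrix T (\<chi> i. of_int (t $ i) / 2) 1)))}"


section \<open>Fourier-Jacobi cusp forms of index 1\<close>

text \<open>
  If \<open>bordered_matrix Z z w\<close> lies in the Siegel upper half space of degree 3, then \<open>Z\<close> lies in that
  of degree 2, and for given \<open>(Z, z)\<close> in the Jacobi domain this holds for all \<open>w\<close> with sufficiently
  large imaginary part. Hence the coefficients \<open>\<Phi> m\<close> with \<open>m \<ge> 1\<close> are uniquely determined by \<open>F\<close>.
\<close>

definition fourier_jacobi_expansion ::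
  "(complex^3^3 \<Rightarrow> complex) \<Rightarrow> (nat \<Rightarrow> (complex^2^2) \<times> (complex^2) \<Rightarrow> complex) \<Rightarrow> bool" where
  "fourier_jacobi_expansion F \<Phi> \<longleftrightarrow>
     (\<forall>m x. x \<notin> jacobi_domain \<longrightarrow> \<Phi> m x = 0) \<and>
     (\<forall>Z z w. bordered_matrix Z z w \<in> siegel_space \<longrightarrow>
        ((\<lambda>m. \<Phi> m (Z, z) * e2pi (of_nat m * w)) has_sum F (bordered_matrix Z z w)) {1..})"

definition fourier_jacobi_cusp_forms :: "int \<Rightarrow> ((complex^2^2) \<times> (complex^2) \<Rightarrow> complex) set" where
  "fourier_jacobi_cusp_forms r =
     {\<Phi> 1 | F \<Phi>. F \<in> siegel_cusp_forms r \<and> fourier_jacobi_expansion F \<Phi>}"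

end

theory Submission
  imports Defs "HOL-Complex_Analysis.Complex_Analysis"
begin

no_notation fps_nth (infixl \<open>$\<close> 75)

section \<open>Sums of characters\<close>

lemma e2pi_add: "e2pi (a + b) = e2pi a * e2pi b"
  by (simp add: e2pi_def distrib_left exp_add)

lemma e2pi_0 [simp]: "e2pi 0 = 1"
  by (simp add: e2pi_def)

lemma e2pi_nonzero [simp]: "e2pi a \<noteq> 0"
  by (simp add: e2pi_def)

lemma e2pi_minus: "e2pi (- a) = inverse (e2pi a)"
  by (simp add: e2pi_def exp_minus)

lemma e2pi_diff: "e2pi (a - b) = e2pi a / e2pi b"
  by (simp add: e2pi_def right_diff_distrib exp_diff)

lemma e2pi_of_nat_mult: "e2pi (of_nat n * a) = e2pi a ^ n"
  by (simp add: e2pi_def exp_of_nat_mult[symmetric] mult_ac)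

lemma e2pi_sum: "finite S \<Longrightarrow> e2pi (sum f S) = (\<Prod>x\<in>S. e2pi (f x))"
  by (simp add: e2pi_def sum_distrib_left exp_sum)

lemma e2pi_int [simp]: "z \<in> \<int> \<Longrightarrow> e2pi z = 1"
  by (auto simp: e2pi_def exp_eq_1 Ints_def)

lemma norm_e2pi: "norm (e2pi a) = exp (- (2 * pi * Im a))"
  by (simp add: e2pi_def norm_exp_eq_Re)

lemma e2pi_half: "e2pi (1 / 2) = -1"
  by (simp add: e2pi_def)

lemma has_sum_eqI:
  "(f has_sum s) A \<Longrightarrow> (\<And>x. x \<in> A \<Longrightarrow> f x = g x) \<Longrightarrow> s = t \<Longrightarrow> (g has_sum t) A"
  using has_sum_cong[of A f g] by simp

text \<open>Averaging \<open>g \<mapsto> (f(g) + f(g + h) / \<chi>\<^sub>m(h)) / 2\<close> keeps the character \<open>\<chi>\<^sub>m\<close>, kills any character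
  whose value at \<open>h\<close> is \<open>-\<chi>\<^sub>m(h)\<close>, and does not enlarge the other coefficients. Finitely many such
  averages isolate one coefficient up to a small tail; this replaces integration over a torus.\<close>
lemma characters_independent:
  fixes ch :: "'i \<Rightarrow> 'g::ab_group_add \<Rightarrow> complex"
  assumes hom: "\<And>i g h. i \<in> I \<Longrightarrow> ch i (g + h) = ch i g * ch i h"
    and unit: "\<And>i g. i \<in> I \<Longrightarrow> norm (ch i g) = 1"
    and sep: "\<And>i j. i \<in> I \<Longrightarrow> j \<in> I \<Longrightarrow> i \<noteq> j \<Longrightarrow> \<exists>g. ch i g = - ch j g"
    and sum: "\<And>g. ((\<lambda>i. c i * ch i g) has_sum 0) I"
    and m: "m \<in> I"
  shows "c m = 0"
proof (rule ccontr)
  assume nz: "c m \<noteq> 0"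
  have "(\<lambda>i. norm (c i * ch i 0)) summable_on I"
    using has_sum_imp_summable[OF sum[of 0]] by (simp only: summable_on_iff_abs_summable_on_complex)
  then have abs: "(\<lambda>i. norm (c i)) summable_on I"
    by (rule summable_on_cong[THEN iffD1, rotated]) (simp add: norm_mult unit)
  have kill: "\<exists>d. (\<forall>i\<in>I. norm (d i) \<le> norm (c i)) \<and> d m = c m \<and> (\<forall>i\<in>F. d i = 0)
      \<and> (\<forall>g. ((\<lambda>i. d i * ch i g) has_sum 0) I)" if "finite F" "F \<subseteq> I - {m}" for F
    using that
  proof (induction F rule: finite_induct)
    case empty
    then show ?case using sum by (intro exI[of _ c]) auto
  next
    case (insert n F)
    then obtain d where d: "\<And>i. i \<in> I \<Longrightarrow> norm (d i) \<le> norm (c i)" "d m = c m"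
        "\<And>i. i \<in> F \<Longrightarrow> d i = 0" "\<And>g. ((\<lambda>i. d i * ch i g) has_sum 0) I"
      by auto
    from insert.prems m obtain h where h: "ch n h = - ch m h"
      using sep[of n m] by auto
    have mh: "ch m h \<noteq> 0"
      using unit[OF m, of h] by auto
    define d' where "d' i = (d i + d i * ch i h / ch m h) / 2" for i
    have "norm (d' i) \<le> norm (c i)" if "i \<in> I" for i
    proof -
      have "norm (d' i) \<le> (norm (d i) + norm (d i * ch i h / ch m h)) / 2"
        unfolding d'_def norm_divide[of _ 2] norm_numeral
        by (intro divide_right_mono norm_triangle_ineq) simp
      also have "\<dots> = norm (d i)"
        using that m by (simp add: norm_divide norm_mult unit)
      finally show ?thesis using d(1)[OF that] by simp
    qed
    moreover have "d' m = c m"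
      using mh d(2) by (simp add: d'_def)
    moreover have "d' i = 0" if "i \<in> insert n F" for i
      using that d(3) mh by (auto simp: d'_def h)
    moreover have "((\<lambda>i. d' i * ch i g) has_sum 0) I" for g
    proof -
      have "((\<lambda>i. (d i * ch i g + d i * ch i (g + h) * (1 / ch m h)) * (1/2)) has_sum
              (0 + 0 * (1 / ch m h)) * (1/2)) I"
        by (intro has_sum_cmult_left has_sum_add d(4))
      then show ?thesis
        by (rule has_sum_eqI) (use hom mh in \<open>auto simp: d'_def field_simps\<close>)
    qed
    ultimately show ?case by blast
  qed
  have "norm (c m) / 2 > 0" using nz by simp
  with has_sum_finite_approximation[OF has_sum_infsum[OF abs], of "norm (c m) / 2"]
  obtain F where F: "finite F" "F \<subseteq> I"
      "dist (sum (\<lambda>i. norm (c i)) F) (infsum (\<lambda>i. norm (c i)) I) \<le> norm (c m) / 2"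
    using infsum_finite_approximation[OF abs, of "norm (c m) / 2"] by metis
  obtain d where d: "\<And>i. i \<in> I \<Longrightarrow> norm (d i) \<le> norm (c i)" "d m = c m"
        "\<And>i. i \<in> F - {m} \<Longrightarrow> d i = 0" "\<And>g. ((\<lambda>i. d i * ch i g) has_sum 0) I"
    using kill[of "F - {m}"] F(1,2) by blast
  let ?R = "I - insert m F"
  have split: "I = insert m F \<union> ?R" "finite (insert m F)" using F m by auto
  have 1: "((\<lambda>i. norm (c i)) has_sum infsum (\<lambda>i. norm (c i)) ?R) ?R"
    by (rule has_sum_infsum, rule summable_on_subset_banach[OF abs]) auto
  have "((\<lambda>i. d i * ch i 0) has_sum (\<Sum>i\<in>insert m F. d i * ch i 0)) (insert m F)"
    using F by auto
  also have "(\<Sum>i\<in>insert m F. d i * ch i 0) = d m * ch m 0 + (\<Sum>i\<in>F - {m}. d i * ch i 0)"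
    using F by (simp add: sum.insert_remove)
  also have "\<dots> = c m * ch m 0" using d by simp
  finally have 2: "((\<lambda>i. d i * ch i 0) has_sum c m * ch m 0) (insert m F)" .
  have "(\<lambda>i. d i * ch i 0) summable_on ?R"
    by (rule summable_on_subset_banach[of _ I]) (use d(4) has_sum_imp_summable in auto)
  then have 3: "((\<lambda>i. d i * ch i 0) has_sum infsum (\<lambda>i. d i * ch i 0) ?R) ?R"
    by simp
  have "((\<lambda>i. d i * ch i 0) has_sum (c m * ch m 0 + infsum (\<lambda>i. d i * ch i 0) ?R)) (insert m F \<union> ?R)"
    by (rule has_sum_Un_disjoint[OF 2 3]) auto
  with d(4)[of 0] split(1) have "c m * ch m 0 + infsum (\<lambda>i. d i * ch i 0) ?R = 0"
    using has_sum_unique by metis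
  then have "norm (c m * ch m 0) = norm (infsum (\<lambda>i. d i * ch i 0) ?R)"
    by (metis add_eq_0_iff norm_minus_cancel)
  then have "norm (c m) = norm (infsum (\<lambda>i. d i * ch i 0) ?R)"
    using m by (simp add: norm_mult unit)
  also have "\<dots> \<le> infsum (\<lambda>i. norm (c i)) ?R"
    by (rule norm_infsum_le[OF 3 1]) (use d(1) in \<open>auto simp: norm_mult unit\<close>)
  finally have le: "norm (c m) \<le> infsum (\<lambda>i. norm (c i)) ?R" .
  have "infsum (\<lambda>i. norm (c i)) I = sum (\<lambda>i. norm (c i)) (insert m F) + infsum (\<lambda>i. norm (c i)) ?R"
    using infsum_Un_disjoint[of "\<lambda>i. norm (c i)" "insert m F" ?R] split 1 has_sum_imp_summable
    by (metis Diff_disjoint infsum_finite summable_on_finite)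
  with F(3) le have "sum (\<lambda>i. norm (c i)) (insert m F) \<le> sum (\<lambda>i. norm (c i)) F - norm (c m) / 2"
    unfolding dist_real_def by linarith
  moreover have "sum (\<lambda>i. norm (c i)) F \<le> sum (\<lambda>i. norm (c i)) (insert m F)"
    by (rule sum_mono2) (use F in auto)
  moreover have "norm (c m) > 0" using nz by simp
  ultimately show False by linarith
qed

lemma fourier_coefficients_zero:
  fixes h :: "'i \<Rightarrow> 'v::real_inner"
  assumes inj: "inj_on h I"
    and sum: "\<And>x. ((\<lambda>i. c i * e2pi (of_real (h i \<bullet> x))) has_sum 0) I"
    and m: "m \<in> I"
  shows "c m = 0"
proof (rule characters_independent[OF _ _ _ sum m])
  fix i j assume ij: "i \<in> I" "j \<in> I" "i \<noteq> j"
  define d where "d = h i - h j"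
  have d: "d \<noteq> 0" using inj ij by (auto simp: d_def inj_on_def)
  define x where "x = (1 / (2 * (d \<bullet> d))) *\<^sub>R d"
  have "d \<bullet> x = 1 / 2" using d by (simp add: x_def)
  then have hx: "h i \<bullet> x = h j \<bullet> x + 1 / 2" by (simp add: d_def inner_diff_left)
  have "e2pi (of_real (h i \<bullet> x)) = e2pi (of_real (h j \<bullet> x)) * e2pi (1/2)"
    unfolding hx e2pi_add[symmetric] by simp
  then show "\<exists>x. e2pi (of_real (h i \<bullet> x)) = - e2pi (of_real (h j \<bullet> x))"
    by (metis e2pi_half mult.commute mult_minus1)
qed (auto simp: inner_add_right e2pi_add norm_e2pi)

lemma fourier_coefficients_unique:
  fixes h :: "'i \<Rightarrow> 'v::real_inner"
  assumes inj: "inj_on h I"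
    and c: "\<And>x. ((\<lambda>i. c i * e2pi (of_real (h i \<bullet> x))) has_sum f x) I"
    and d: "\<And>x. ((\<lambda>i. d i * e2pi (of_real (h i \<bullet> x))) has_sum f x) I"
    and m: "m \<in> I"
  shows "c m = d m"
proof -
  have "((\<lambda>i. (c i - d i) * e2pi (of_real (h i \<bullet> x))) has_sum 0) I" for x
    using has_sum_add[OF c[of x] has_sum_uminusI[OF d[of x]]] by (simp add: algebra_simps)
  from fourier_coefficients_zero[OF inj this m] show ?thesis by simp
qed


section \<open>Holomorphy of series of exponentials\<close>

text \<open>If the terms remain summable with the weight \<open>exp (\<rho> M\<^sub>i)\<close>, where \<open>M\<^sub>i\<close> bounds the linear form
  \<open>l\<^sub>i\<close>, then the second-order remainders of all terms are dominated at once.\<close>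
lemma exp_series_has_derivative:
  fixes l :: "'i \<Rightarrow> 'a::real_normed_vector \<Rightarrow> complex"
  assumes lin: "\<And>i. i \<in> I \<Longrightarrow> linear (l i)"
    and bound: "\<And>i v. i \<in> I \<Longrightarrow> norm (l i v) \<le> M i * norm v"
    and M0: "\<And>i. i \<in> I \<Longrightarrow> M i \<ge> 0"
    and rho: "\<rho> > 0"
    and summable: "(\<lambda>i. norm (c i * exp (l i x)) * exp (\<rho> * M i)) summable_on I"
    and f: "\<And>y. y \<in> S \<Longrightarrow> ((\<lambda>i. c i * exp (l i y)) has_sum f y) I"
    and x: "x \<in> S"
  shows "(f has_derivative (\<lambda>v. infsum (\<lambda>i. c i * exp (l i x) * l i v) I)) (at x within S)"
    and "\<And>v. (\<lambda>i. c i * exp (l i x) * l i v) summable_on I"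
proof -
  define K where "K = infsum (\<lambda>i. norm (c i * exp (l i x)) * exp (\<rho> * M i)) I"
  have K: "((\<lambda>i. norm (c i * exp (l i x)) * exp (\<rho> * M i)) has_sum K) I"
    unfolding K_def using summable by simp
  have M_le: "M i \<le> exp (\<rho> * M i) / \<rho>" if "i \<in> I" for i
  proof -
    have "\<rho> * M i \<le> exp (\<rho> * M i)" using exp_ge_add_one_self[of "\<rho> * M i"] by linarith
    then show ?thesis using rho by (simp add: field_simps)
  qed
  have bd: "norm (c i * exp (l i x) * l i v) \<le> norm (c i * exp (l i x)) * exp (\<rho> * M i) * (norm v / \<rho>)"
    if "i \<in> I" for i v
  proof -
    have "norm (l i v) \<le> exp (\<rho> * M i) / \<rho> * norm v"
      using bound[OF that, of v] mult_right_mono[OF M_le[OF that] norm_ge_zero, of v] by linarith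
    then have "norm (c i * exp (l i x)) * norm (l i v)
        \<le> norm (c i * exp (l i x)) * (exp (\<rho> * M i) / \<rho> * norm v)"
      by (intro mult_left_mono) auto
    then show ?thesis by (simp add: norm_mult mult_ac)
  qed
  have Kv: "((\<lambda>i. norm (c i * exp (l i x)) * exp (\<rho> * M i) * (norm v / \<rho>)) has_sum K * (norm v / \<rho>)) I" for v
    using has_sum_cmult_left[OF K] .
  show sm: "(\<lambda>i. c i * exp (l i x) * l i v) summable_on I" for v
    by (rule abs_summable_summable, rule Infinite_Sum.abs_summable_on_comparison_test'[OF has_sum_imp_summable[OF Kv[of v]]])
       (use bd in auto)
  define L where "L v = infsum (\<lambda>i. c i * exp (l i x) * l i v) I" for v
  have L: "((\<lambda>i. c i * exp (l i x) * l i v) has_sum L v) I" for v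
    unfolding L_def using sm by simp
  have "bounded_linear L"
  proof (rule bounded_linear_intro)
    fix u v
    have "((\<lambda>i. c i * exp (l i x) * l i u + c i * exp (l i x) * l i v) has_sum L u + L v) I"
      by (intro has_sum_add L)
    then have "((\<lambda>i. c i * exp (l i x) * l i (u + v)) has_sum L u + L v) I"
      by (rule has_sum_cong[THEN iffD1, rotated]) (simp add: linear_add[OF lin] algebra_simps)
    with L show "L (u + v) = L u + L v" using has_sum_unique by blast
  next
    fix a v
    have "((\<lambda>i. of_real a * (c i * exp (l i x) * l i v)) has_sum of_real a * L v) I"
      by (intro has_sum_cmult_right L)
    then have "((\<lambda>i. c i * exp (l i x) * l i (a *\<^sub>R v)) has_sum of_real a * L v) I"
      by (rule has_sum_cong[THEN iffD1, rotated]) (simp add: linear_scale[OF lin] scaleR_conv_of_real)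
    with L show "L (a *\<^sub>R v) = a *\<^sub>R L v" using has_sum_unique by (metis scaleR_conv_of_real)
  next
    fix v
    show "norm (L v) \<le> norm v * (K / \<rho>)"
      using norm_infsum_le[OF L Kv bd, of v] by (simp add: mult_ac)
  qed
  moreover have "((\<lambda>y. norm (f y - f x - L (y - x)) / norm (y - x)) \<longlongrightarrow> 0) (at x within S)"
  proof -
    define B where "B = 8 / \<rho>^2 * K"
    have est: "norm (f y - f x - L (y - x)) \<le> B * norm (y - x) ^ 2" if y: "y \<in> S" "norm (y - x) \<le> \<rho> / 2" for y
    proof -
      let ?v = "y - x"
      have hs: "((\<lambda>i. c i * exp (l i y) - c i * exp (l i x) - c i * exp (l i x) * l i ?v)
          has_sum f y - f x - L ?v) I"
        using has_sum_add[OF has_sum_add[OF f[OF y(1)] has_sum_uminusI[OF f[OF x]]]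
            has_sum_uminusI[OF L[of ?v]]] by simp
      have "norm (c i * exp (l i y) - c i * exp (l i x) - c i * exp (l i x) * l i ?v)
          \<le> norm (c i * exp (l i x)) * exp (\<rho> * M i) * (8 / \<rho>^2 * norm ?v ^ 2)" if i: "i \<in> I" for i
      proof -
        define h where "h = l i ?v"
        have ly: "l i y = l i x + h"
          using linear_diff[OF lin[OF i], of y x] by (simp add: h_def)
        have h: "norm h \<le> M i * norm ?v" using bound[OF i] by (simp add: h_def)
        have "norm (exp h - (\<Sum>k\<le>1. h ^ k / fact k)) \<le> exp \<bar>Re h\<bar> * (norm h) ^ Suc 1 / fact 1"
          by (rule Taylor_exp)
        then have "norm (exp h - 1 - h) \<le> exp \<bar>Re h\<bar> * norm h ^ 2"
          by (simp add: power2_eq_square algebra_simps)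
        also have "\<dots> \<le> exp (M i * (\<rho> / 2)) * (M i * norm ?v) ^ 2"
        proof (intro mult_mono power_mono h)
          have "\<bar>Re h\<bar> \<le> M i * norm ?v" using abs_Re_le_cmod[of h] h by linarith
          also have "\<dots> \<le> M i * (\<rho> / 2)" by (intro mult_left_mono y M0 i)
          finally show "exp \<bar>Re h\<bar> \<le> exp (M i * (\<rho> / 2))" by simp
        qed auto
        also have "\<dots> = exp (M i * (\<rho> / 2)) * M i ^ 2 * norm ?v ^ 2"
          by (simp add: power_mult_distrib)
        also have "M i ^ 2 \<le> exp (M i * (\<rho> / 2)) * (8 / \<rho>^2)"
        proof -
          let ?t = "M i * (\<rho> / 2)"
          have "?t ^ 2 \<le> 2 * exp ?t"
          proof -
            have "?t \<ge> 0" using M0[OF i] rho by simp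
            then have "1 + ?t + ?t ^ 2 / 2 \<le> exp ?t" by (rule exp_lower_Taylor_quadratic)
            with \<open>?t \<ge> 0\<close> show ?thesis by linarith
          qed
          then show ?thesis using rho by (simp add: field_simps power2_eq_square)
        qed
        then have "exp (M i * (\<rho> / 2)) * M i ^ 2 * norm ?v ^ 2
            \<le> exp (M i * (\<rho> / 2)) * (exp (M i * (\<rho> / 2)) * (8 / \<rho>^2)) * norm ?v ^ 2"
          by (intro mult_right_mono mult_left_mono) auto
        also have "\<dots> = exp (\<rho> * M i) * (8 / \<rho>^2 * norm ?v ^ 2)"
          using exp_add[of "M i * (\<rho> / 2)" "M i * (\<rho> / 2)"] by (simp add: mult_ac)
        finally have "norm (exp h - 1 - h) \<le> exp (\<rho> * M i) * (8 / \<rho>^2 * norm ?v ^ 2)" .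
        then have "norm (c i * exp (l i x)) * norm (exp h - 1 - h)
            \<le> norm (c i * exp (l i x)) * (exp (\<rho> * M i) * (8 / \<rho>^2 * norm ?v ^ 2))"
          by (intro mult_left_mono) auto
        moreover have "c i * exp (l i y) - c i * exp (l i x) - c i * exp (l i x) * l i ?v
            = c i * exp (l i x) * (exp h - 1 - h)"
          unfolding ly h_def[symmetric] by (simp add: exp_add algebra_simps)
        ultimately show ?thesis by (simp add: norm_mult mult_ac)
      qed
      from norm_infsum_le[OF hs has_sum_cmult_left[OF K] this]
      show ?thesis by (simp add: B_def mult_ac)
    qed
    show ?thesis
    proof (rule Lim_null_comparison)
      show "\<forall>\<^sub>F y in at x within S. norm (norm (f y - f x - L (y - x)) / norm (y - x)) \<le> B * norm (y - x)"
        unfolding eventually_at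
      proof (intro exI[of _ "\<rho> / 2"] conjI ballI impI)
        fix y assume "y \<in> S" and "y \<noteq> x \<and> dist y x < \<rho> / 2"
        then have y: "norm (y - x) \<le> \<rho> / 2" "norm (y - x) > 0" by (auto simp: dist_norm)
        have "norm (f y - f x - L (y - x)) / norm (y - x) \<le> B * norm (y - x) ^ 2 / norm (y - x)"
          using est[OF \<open>y \<in> S\<close> y(1)] by (intro divide_right_mono) auto
        then show "norm (norm (f y - f x - L (y - x)) / norm (y - x)) \<le> B * norm (y - x)"
          using y by (simp add: power2_eq_square)
      qed (use rho in auto)
      have "((\<lambda>y. B * norm (y - x)) \<longlongrightarrow> B * norm (x - x)) (at x within S)"
        by (intro tendsto_intros)
      then show "((\<lambda>y. B * norm (y - x)) \<longlongrightarrow> 0) (at x within S)" by simp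
    qed
  qed
  ultimately show "(f has_derivative L) (at x within S)"
    unfolding has_derivative_iff_norm by simp
qed

section \<open>Integral symplectic matrices in blocks\<close>

lemma sum_sum_type: "(\<Sum>k\<in>(UNIV :: ('n::finite + 'm::finite) set). f k)
    = (\<Sum>a\<in>UNIV. f (Inl a)) + (\<Sum>a\<in>UNIV. f (Inr a))"
  by (simp add: UNIV_Plus_UNIV[symmetric] sum.Plus del: UNIV_Plus_UNIV)

lemma block_matrix_nth [simp]:
  "block_matrix A B C D $ Inl a $ Inl b = A $ a $ b"
  "block_matrix A B C D $ Inl a $ Inr b = B $ a $ b"
  "block_matrix A B C D $ Inr a $ Inl b = C $ a $ b"
  "block_matrix A B C D $ Inr a $ Inr b = D $ a $ b"
  by (simp_all add: block_matrix_def)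

lemma block_matrix_eqI:
  assumes "\<And>a b. M $ Inl a $ Inl b = N $ Inl a $ Inl b" "\<And>a b. M $ Inl a $ Inr b = N $ Inl a $ Inr b"
    "\<And>a b. M $ Inr a $ Inl b = N $ Inr a $ Inl b" "\<And>a b. M $ Inr a $ Inr b = N $ Inr a $ Inr b"
  shows "M = N"
  unfolding vec_eq_iff using assms by (metis sum.exhaust)

lemma block_matrix_eq_iff:
  "block_matrix A B C D = block_matrix A' B' C' D' \<longleftrightarrow> A = A' \<and> B = B' \<and> C = C' \<and> D = D'"
  by (metis block_matrix_nth vec_eq_iff)

lemma transpose_block_matrix:
  "transpose (block_matrix A B C D)
     = block_matrix (transpose A) (transpose C) (transpose B) (transpose D)"
  by (rule block_matrix_eqI) (simp_all add: transpose_def)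

lemma block_matrix_mult:
  fixes A :: "'a::comm_ring_1^'n^'n::finite"
  shows "block_matrix A B C D ** block_matrix A' B' C' D'
    = block_matrix (A ** A' + B ** C') (A ** B' + B ** D') (C ** A' + D ** C') (C ** B' + D ** D')"
  by (rule block_matrix_eqI) (simp_all add: matrix_matrix_mult_def sum_sum_type)

lemma matrix_minus_mult:
  fixes A :: "'a::comm_ring_1^'n^'m" and B :: "'a^'k^'n::finite"
  shows "(- A) ** B = - (A ** B)" "A ** (- B) = - (A ** B)"
  by (simp_all add: matrix_matrix_mult_def vec_eq_iff sum_negf)

lemma transpose_add: "transpose (A + B) = transpose A + transpose (B :: 'a::plus^'n^'m)"
  and transpose_minus: "transpose (- C) = - transpose (C :: 'b::uminus^'n^'m)"
  and transpose_diff: "transpose (E - F) = transpose E - transpose (F :: 'c::minus^'n^'m)"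
  by (simp_all add: transpose_def vec_eq_iff)

lemma transpose_0 [simp]: "transpose (0 :: 'a::zero^'n^'m) = 0"
  by (simp add: transpose_def vec_eq_iff)

lemma transpose_mult: "transpose (A ** B) = transpose B ** transpose (A :: 'a::comm_semiring_1^'n::finite^'m)"
  by (rule matrix_transpose_mul)

lemma block_in_symplectic_iff:
  fixes A :: "int^'n^'n::finite"
  shows "block_matrix A B C D \<in> symplectic_group \<longleftrightarrow>
    transpose A ** C = transpose C ** A \<and> transpose B ** D = transpose D ** B \<and>
    transpose A ** D - transpose C ** B = mat 1"
proof -
  have "transpose B ** C - transpose D ** A = - transpose (transpose A ** D - transpose C ** B)"
    by (simp add: transpose_diff transpose_mult)
  moreover have "- transpose E = - mat 1 \<longleftrightarrow> E = mat 1" for E :: "int^'n^'n"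
    by (metis neg_equal_iff_equal transpose_mat transpose_transpose)
  ultimately have *: "transpose B ** C - transpose D ** A = - mat 1
      \<longleftrightarrow> transpose A ** D - transpose C ** B = mat 1" by metis
  have "transpose (block_matrix A B C D) ** block_matrix 0 (mat 1) (- mat 1) 0 ** block_matrix A B C D
     = block_matrix (transpose A ** C - transpose C ** A) (transpose A ** D - transpose C ** B)
         (transpose B ** C - transpose D ** A) (transpose B ** D - transpose D ** B)"
    by (simp add: transpose_block_matrix block_matrix_mult matrix_minus_mult)
  then show ?thesis
    unfolding symplectic_group_def mem_Collect_eq by (auto simp: block_matrix_eq_iff *)
qed

lemma symplectic_mult:
  assumes "M \<in> symplectic_group" "N \<in> symplectic_group"
  shows "M ** N \<in> symplectic_group"
proof -
  let ?J = "block_matrix 0 (mat 1) (- mat 1) 0"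
  have "transpose (M ** N) ** ?J ** (M ** N) = transpose N ** (transpose M ** ?J ** M) ** N"
    by (simp add: transpose_mult matrix_mul_assoc)
  with assms show ?thesis by (simp add: symplectic_group_def)
qed

definition unit_entry :: "'n \<Rightarrow> 'a::zero_neq_one^'n^'n" where
  "unit_entry i = (\<chi> a b. if a = i \<and> b = i then 1 else 0)"

definition unit_except :: "'n \<Rightarrow> 'a::zero_neq_one^'n^'n" where
  "unit_except i = (\<chi> a b. if a = b \<and> a \<noteq> i then 1 else 0)"

lemma unit_entry_mult:
  fixes A :: "'a::comm_ring_1^'m^'n::finite"
  shows "(unit_entry i ** A) $ a $ b = (if a = i then A $ i $ b else 0)"
    and "(unit_except i ** A) $ a $ b = (if a = i then 0 else A $ a $ b)"
  unfolding unit_entry_def unit_except_def matrix_matrix_mult_def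
  by (simp_all add: if_distrib[of "\<lambda>x. x * _"] cong: if_cong)

lemma mat_unit_symmetric [simp]: "transpose (unit_entry i) = unit_entry i" "transpose (unit_except i) = unit_except i"
  by (auto simp: transpose_def unit_entry_def unit_except_def vec_eq_iff)

lemma unit_products [simp]:
  fixes i :: "'n::finite"
  shows "unit_entry i ** unit_entry i = (unit_entry i :: int^'n^'n)"
    "unit_entry i ** unit_except i = (0 :: int^'n^'n)"
    "unit_except i ** unit_entry i = (0 :: int^'n^'n)"
    "unit_except i ** unit_except i = (unit_except i :: int^'n^'n)"
    "unit_except i + unit_entry i = (mat 1 :: int^'n^'n)"
  by (auto simp: vec_eq_iff unit_entry_mult; auto simp: unit_entry_def unit_except_def mat_def)+

lemma translation_symplectic:
  "transpose B = B \<Longrightarrow> block_matrix (mat 1) B 0 (mat 1) \<in> symplectic_group"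
  by (simp add: block_in_symplectic_iff transpose_mat)

lemma linear_symplectic:
  "transpose U ** W = mat 1 \<Longrightarrow> block_matrix U 0 0 W \<in> symplectic_group"
  by (simp add: block_in_symplectic_iff)

lemma inversion_symplectic:
  "block_matrix (unit_except i) (- unit_entry i) (unit_entry i) (unit_except i) \<in> symplectic_group"
  by (simp add: block_in_symplectic_iff matrix_minus_mult transpose_minus)


lemma matrix_add_rdistrib': "(A + B) ** C = A ** C + B ** (C :: 'a::semiring_1^'k^'n::finite)"
  by (simp add: matrix_matrix_mult_def vec_eq_iff sum.distrib distrib_right)

lemma matrix_diff_distribs:
  fixes A :: "'a::comm_ring_1^'n^'m" and B :: "'a^'k^'n::finite"
  shows "(A - A') ** B = A ** B - A' ** B" "A ** (B - B') = A ** B - A ** B'"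
  by (simp_all add: matrix_matrix_mult_def vec_eq_iff sum_subtractf left_diff_distrib right_diff_distrib)

lemma cmat_nth [simp]: "cmat A $ i $ j = of_int (A $ i $ j)"
  by (simp add: cmat_def)

lemma cmat_simps [simp]:
  "cmat 0 = 0" "cmat (mat k :: int^'n^'n) = mat (of_int k)" "cmat (A + B) = cmat A + cmat B"
  "cmat (A - B) = cmat A - cmat B" "cmat (- A) = - cmat A"
  by (simp_all add: vec_eq_iff mat_def)

lemma cmat_mult: "cmat (A ** B) = cmat A ** cmat (B :: int^'k^'n::finite)"
  by (simp add: vec_eq_iff matrix_matrix_mult_def)

lemma cmat_transpose: "cmat (transpose A) = transpose (cmat A)"
  by (simp add: vec_eq_iff transpose_def)

lemma cmat_inj: "cmat A = cmat B \<longleftrightarrow> A = B"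
  by (simp add: vec_eq_iff)

text \<open>Over the integers a one-sided inverse of a square matrix is two-sided because it is so over the
  complex numbers.\<close>
lemma int_matrix_left_right_inverse:
  fixes A :: "int^'n^'n::finite"
  shows "A ** B = mat 1 \<longleftrightarrow> B ** A = mat 1"
proof -
  have *: "X ** Y = mat 1 \<longleftrightarrow> cmat X ** cmat Y = mat 1" for X Y :: "int^'n^'n"
    unfolding cmat_inj[symmetric] cmat_mult by simp
  show ?thesis unfolding * by (rule matrix_left_right_inverse)
qed


section \<open>Generators of the symplectic group of degree 2\<close>

text \<open>A set of integral symplectic matrices that contains the translations, the linear substitutions
  and the partial inversions in single coordinates, and is closed under products. It is the whole
  group: the Euclidean algorithm on the pairs \<open>(a\<^sub>i\<^sub>j, c\<^sub>i\<^sub>j)\<close> and on the first column clears the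
  lower left block.\<close>
locale symplectic_generators =
  fixes S :: "int^2^2 \<Rightarrow> int^2^2 \<Rightarrow> int^2^2 \<Rightarrow> int^2^2 \<Rightarrow> bool"
  assumes translation: "\<And>B. transpose B = B \<Longrightarrow> S (mat 1) B 0 (mat 1)"
    and linear: "\<And>U W. transpose U ** W = mat 1 \<Longrightarrow> S U 0 0 W"
    and inversion: "\<And>i. S (unit_except i) (- unit_entry i) (unit_entry i) (unit_except i)"
    and mult: "\<And>A B C D A' B' C' D'. S A B C D \<Longrightarrow> S A' B' C' D' \<Longrightarrow>
      S (A ** A' + B ** C') (A ** B' + B ** D') (C ** A' + D ** C') (C ** B' + D ** D')"
begin

lemma parabolic:
  assumes "block_matrix A B 0 D \<in> symplectic_group"
  shows "S A B 0 D"
proof -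
  from assms have 1: "transpose B ** D = transpose D ** B" "transpose A ** D = mat 1"
    by (simp_all add: block_in_symplectic_iff)
  have DA: "D ** transpose A = mat 1" using int_matrix_left_right_inverse[THEN iffD1, OF 1(2)] .
  have AD: "A ** transpose D = mat 1"
    using arg_cong[OF DA, of transpose] by (simp add: transpose_mult)
  define X where "X = B ** transpose A"
  have XD: "X ** D = B" unfolding X_def by (simp add: matrix_mul_assoc[symmetric] 1)
  have "transpose X = A ** transpose B ** (D ** transpose A)"
    unfolding X_def DA by (simp add: transpose_mult)
  also have "\<dots> = A ** (transpose B ** D) ** transpose A"
    by (simp only: matrix_mul_assoc)
  also have "\<dots> = (A ** transpose D) ** X"
    unfolding 1(1) X_def by (simp only: matrix_mul_assoc)
  finally have "transpose X = X" by (simp add: AD)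
  from mult[OF translation[OF this] linear[OF 1(2)]] show ?thesis by (simp add: XD)
qed

lemma euclid_row:
  fixes A B C D :: "int^2^2" and i j :: 2
  assumes sp: "block_matrix A B C D \<in> symplectic_group"
    and reduced: "\<And>A' B' C' D' :: int^2^2. block_matrix A' B' C' D' \<in> symplectic_group \<Longrightarrow> C' $ i $ j = 0 \<Longrightarrow>
      (\<And>k l :: 2. k \<noteq> i \<Longrightarrow> A' $ k $ l = A $ k $ l \<and> C' $ k $ l = C $ k $ l) \<Longrightarrow>
      (\<And>l :: 2. A $ i $ l = 0 \<Longrightarrow> C $ i $ l = 0 \<Longrightarrow> A' $ i $ l = 0 \<and> C' $ i $ l = 0) \<Longrightarrow> S A' B' C' D'"
  shows "S A B C D"
  using assms
proof (induction "nat \<bar>C $ i $ j\<bar>" arbitrary: A B C D rule: less_induct)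
  case less
  show ?case
  proof (cases "C $ i $ j = 0")
    case True
    show ?thesis by (rule less.prems(2)[OF less.prems(1) True]) auto
  next
    case False
    define q where "q = A $ i $ j div C $ i $ j"
    define Q :: "int^2^2" where "Q = (\<chi> a b. if a = i \<and> b = i then q else 0)"
    have Qt: "transpose Q = Q" "transpose (- Q) = - Q"
      by (auto simp: Q_def transpose_def vec_eq_iff)
    have Qm: "(Q ** X) $ a $ b = (if a = i then q * X $ i $ b else 0)" for X a b
      using exhaust_2[of i] by (auto simp: Q_def matrix_matrix_mult_def sum_2)
    let ?E = "unit_entry i :: int^2^2" let ?F = "unit_except i :: int^2^2"
    define A1 where "A1 = A - Q ** C"
    define B1 where "B1 = B - Q ** D"
    define A2 where "A2 = ?F ** A1 + ?E ** C"
    define B2 where "B2 = ?F ** B1 + ?E ** D"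
    define C2 where "C2 = ?F ** C - ?E ** A1"
    define D2 where "D2 = ?F ** D - ?E ** B1"
    have undo: "?F ** A2 - ?E ** C2 = A1" "?F ** B2 - ?E ** D2 = B1"
      "?E ** A2 + ?F ** C2 = C" "?E ** B2 + ?F ** D2 = D"
      by (auto simp: vec_eq_iff A2_def B2_def C2_def D2_def unit_entry_mult)
    have "block_matrix (mat 1) (- Q) 0 (mat 1) ** block_matrix A B C D \<in> symplectic_group"
      by (intro symplectic_mult translation_symplectic less.prems(1) Qt)
    then have sp1: "block_matrix A1 B1 C D \<in> symplectic_group"
      by (simp add: block_matrix_mult A1_def B1_def matrix_minus_mult)
    have "block_matrix ?F ?E (- ?E) ?F \<in> symplectic_group"
      by (simp add: block_in_symplectic_iff matrix_minus_mult transpose_minus)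
    from symplectic_mult[OF this sp1]
    have sp2: "block_matrix A2 B2 C2 D2 \<in> symplectic_group"
      by (simp add: block_matrix_mult A2_def B2_def C2_def D2_def matrix_minus_mult add_ac)
    have A2: "A2 $ k $ l = (if k = i then C $ i $ l else A $ k $ l)" for k l
      by (simp add: A2_def A1_def unit_entry_mult Qm)
    have C2: "C2 $ k $ l = (if k = i then q * C $ i $ l - A $ i $ l else C $ k $ l)" for k l
      by (simp add: C2_def A1_def unit_entry_mult Qm)
    have "C2 $ i $ j = - (A $ i $ j mod C $ i $ j)"
      by (simp add: C2 q_def minus_mod_eq_div_mult[symmetric])
    then have dec: "nat \<bar>C2 $ i $ j\<bar> < nat \<bar>C $ i $ j\<bar>"
      using False abs_mod_less[of "C $ i $ j" "A $ i $ j"] by simp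
    have S2: "S A2 B2 C2 D2"
    proof (rule less.hyps[OF dec sp2])
      fix A' B' C' D' :: "int^2^2"
      assume sp': "block_matrix A' B' C' D' \<in> symplectic_group" and C': "C' $ i $ j = 0"
        and rows: "\<And>k l. k \<noteq> i \<Longrightarrow> A' $ k $ l = A2 $ k $ l \<and> C' $ k $ l = C2 $ k $ l"
        and cols: "\<And>l. A2 $ i $ l = 0 \<Longrightarrow> C2 $ i $ l = 0 \<Longrightarrow> A' $ i $ l = 0 \<and> C' $ i $ l = 0"
      have rows': "A' $ k $ l = A $ k $ l \<and> C' $ k $ l = C $ k $ l" if "k \<noteq> i" for k l
        using rows[OF that, of l] that by (simp add: A2 C2)
      have cols': "A' $ i $ l = 0 \<and> C' $ i $ l = 0" if "A $ i $ l = 0" "C $ i $ l = 0" for l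
        using cols[of l] that by (simp add: A2 C2)
      show "S A' B' C' D'"
        using rows' cols' by (intro less.prems(2)[OF sp' C'])
    qed
    from mult[OF inversion[of i] S2] have "S A1 B1 C D"
      using undo by (simp add: matrix_minus_mult)
    from mult[OF translation[OF Qt(1)] this] show ?thesis
      by (simp add: A1_def B1_def)
  qed
qed

lemma euclid_column:
  fixes A B C D :: "int^2^2"
  assumes sp: "block_matrix A B C D \<in> symplectic_group" and C0: "C $ 1 $ 1 = 0" "C $ 2 $ 1 = 0"
    and reduced: "\<And>A' B' C' D' :: int^2^2. block_matrix A' B' C' D' \<in> symplectic_group \<Longrightarrow>
      C' $ 1 $ 1 = 0 \<Longrightarrow> C' $ 2 $ 1 = 0 \<Longrightarrow> A' $ 2 $ 1 = 0 \<Longrightarrow> S A' B' C' D'"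
  shows "S A B C D"
  using assms
proof (induction "nat \<bar>A $ 2 $ 1\<bar>" arbitrary: A B C D rule: less_induct)
  case less
  show ?case
  proof (cases "A $ 2 $ 1 = 0")
    case True
    with less.prems show ?thesis by blast
  next
    case False
    define q where "q = A $ 1 $ 1 div A $ 2 $ 1"
    define P where "P = (vector [vector [0, 1], vector [1, - q]] :: int^2^2)"
    define Q where "Q = (vector [vector [q, 1], vector [1, 0]] :: int^2^2)"
    have tr: "transpose P = P" "transpose Q = Q"
      by (simp_all add: P_def Q_def transpose_def vec_eq_iff forall_2)
    have PQ: "P ** Q = mat 1" "Q ** P = mat 1"
      by (simp_all add: P_def Q_def matrix_matrix_mult_def mat_def vec_eq_iff forall_2 sum_2)
    have "block_matrix P 0 0 Q \<in> symplectic_group"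
      by (rule linear_symplectic) (simp add: tr PQ)
    from symplectic_mult[OF this less.prems(1)]
    have sp1: "block_matrix (P ** A) (P ** B) (Q ** C) (Q ** D) \<in> symplectic_group"
      by (simp add: block_matrix_mult)
    have A': "(P ** A) $ 2 $ 1 = A $ 1 $ 1 mod A $ 2 $ 1"
      by (simp add: P_def matrix_matrix_mult_def sum_2 q_def minus_div_mult_eq_mod)
    have dec: "nat \<bar>(P ** A) $ 2 $ 1\<bar> < nat \<bar>A $ 2 $ 1\<bar>"
      unfolding A' using False abs_mod_less[of "A $ 2 $ 1" "A $ 1 $ 1"] by simp
    have "S (P ** A) (P ** B) (Q ** C) (Q ** D)"
      by (rule less.hyps[OF dec sp1])
         (use less.prems in \<open>simp_all add: matrix_matrix_mult_def sum_2\<close>)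
    from mult[OF linear[of Q P] this] show ?thesis
      by (simp add: tr PQ matrix_mul_assoc)
  qed
qed

theorem generate:
  assumes "block_matrix A B C D \<in> symplectic_group"
  shows "S A B C D"
proof (rule euclid_row[OF assms, where i = 1 and j = 1], rule euclid_row[where i = 2 and j = 1],
    assumption, rule euclid_column)
  fix A B C D :: "int^2^2"
  assume sp: "block_matrix A B C D \<in> symplectic_group"
    and 0: "C $ 1 $ 1 = 0" "C $ 2 $ 1 = 0" "A $ 2 $ 1 = 0"
  from sp have C: "transpose A ** C = transpose C ** A"
    and AD: "transpose A ** D - transpose C ** B = mat 1"
    by (simp_all add: block_in_symplectic_iff)
  have "(transpose A ** D - transpose C ** B) $ 1 $ 1 = 1" "(transpose A ** C) $ 1 $ 2 = (transpose C ** A) $ 1 $ 2"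
    by (simp_all add: AD C mat_def)
  then have "A $ 1 $ 1 * D $ 1 $ 1 = 1" "A $ 1 $ 1 * C $ 1 $ 2 = 0"
    using 0 by (simp_all add: matrix_matrix_mult_def transpose_def sum_2)
  then have C12: "C $ 1 $ 2 = 0" by auto
  show "S A B C D"
  proof (rule euclid_row[OF sp, where i = 2 and j = 2])
    fix A' B' C' D' :: "int^2^2"
    assume sp': "block_matrix A' B' C' D' \<in> symplectic_group" and "C' $ 2 $ 2 = 0"
      "\<And>k l. k \<noteq> 2 \<Longrightarrow> A' $ k $ l = A $ k $ l \<and> C' $ k $ l = C $ k $ l"
      "\<And>l. A $ 2 $ l = 0 \<Longrightarrow> C $ 2 $ l = 0 \<Longrightarrow> A' $ 2 $ l = 0 \<and> C' $ 2 $ l = 0"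
    then have "C' = 0" using 0 C12 by (simp add: vec_eq_iff forall_2)
    with sp' show "S A' B' C' D'" using parabolic by simp
  qed
qed auto

end

section \<open>Jacobi forms from the generators of the symplectic group\<close>

lemma bilin_add: "bilin x (y + z) = bilin x y + bilin x z" "bilin (x + y) z = bilin x z + bilin y z"
  by (simp_all add: bilin_def algebra_simps sum.distrib)

lemma bilin_commute: "bilin x y = bilin y x"
  by (simp add: bilin_def mult.commute)

lemma bilin_matrix: "bilin x (A *v y) = bilin (transpose A *v x) y"
  by (simp add: bilin_def matrix_vector_mult_def transpose_def sum_distrib_left sum_distrib_right mult_ac
      del: transpose_matrix_vector) (rule sum.swap)

lemma matrix_inv_inverse:
  assumes "invertible A"
  shows "A ** matrix_inv A = mat 1" "matrix_inv A ** A = mat 1"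
  using someI_ex[OF assms[unfolded invertible_def]] by (simp_all add: matrix_inv_def)

lemma matrix_inv_eqI:
  fixes A :: "'a::field^'n^'n"
  assumes "A ** B = mat 1"
  shows "matrix_inv A = B" "invertible A"
proof -
  show inv: "invertible A" using assms invertible_right_inverse by blast
  have "matrix_inv A = matrix_inv A ** (A ** B)" by (simp add: assms)
  also have "\<dots> = B" by (simp add: matrix_mul_assoc matrix_inv_inverse[OF inv])
  finally show "matrix_inv A = B" .
qed

lemma matrix_inv_transpose:
  fixes A :: "'a::field^'n^'n"
  assumes "invertible A"
  shows "matrix_inv (transpose A) = transpose (matrix_inv A)"
  by (rule matrix_inv_eqI) (simp add: transpose_mult[symmetric] matrix_inv_inverse[OF assms])

lemma siegel_space_symmetric: "Z \<in> siegel_space \<Longrightarrow> transpose Z = Z"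
  by (simp add: siegel_space_def)

lemma siegel_space_sym_nth: "Z \<in> siegel_space \<Longrightarrow> Z $ i $ j = Z $ j $ i"
  using arg_cong[OF siegel_space_symmetric[of Z], of "\<lambda>M. M $ i $ j"] by (simp add: transpose_def)

lemma positive_definite_diagonal:
  assumes "positive_definite Y" shows "0 < Y $ i $ i"
proof -
  have "0 < axis i 1 \<bullet> (Y *v axis i 1)"
    using assms by (simp add: positive_definite_def axis_eq_0_iff)
  then show ?thesis
    by (simp add: inner_axis' matrix_vector_mult_basis column_def)
qed

lemma siegel_space_diagonal:
  assumes "Z \<in> siegel_space" shows "0 < Im (Z $ i $ i)" "Z $ i $ i \<noteq> 0"
  using positive_definite_diagonal[of "map_matrix Im Z" i] assms by (auto simp: siegel_space_def)

lemma quadratic_form_2: "(x :: real^2) \<bullet> (Y *v x)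
    = Y $ 1 $ 1 * (x $ 1)\<^sup>2 + (Y $ 1 $ 2 + Y $ 2 $ 1) * x $ 1 * x $ 2 + Y $ 2 $ 2 * (x $ 2)\<^sup>2"
  by (simp add: inner_vec_def matrix_vector_mult_def sum_2 power2_eq_square algebra_simps)

lemma positive_definite_2_iff:
  fixes Y :: "real^2^2"
  shows "positive_definite Y \<longleftrightarrow> Y $ 1 $ 2 = Y $ 2 $ 1 \<and> 0 < Y $ 1 $ 1 \<and> 0 < Y $ 1 $ 1 * Y $ 2 $ 2 - (Y $ 1 $ 2)\<^sup>2"
    (is "?L \<longleftrightarrow> ?R")
proof
  assume L: ?L
  then have sym: "Y $ 1 $ 2 = Y $ 2 $ 1"
  proof -
    have "transpose Y = Y" using L by (simp add: positive_definite_def)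
    from arg_cong[OF this, of "\<lambda>M. M $ 1 $ 2"] show ?thesis by (simp add: transpose_def)
  qed
  have Y11: "0 < Y $ 1 $ 1" using L by (rule positive_definite_diagonal)
  define x :: "real^2" where "x = vector [Y $ 1 $ 2, - Y $ 1 $ 1]"
  have "x \<noteq> 0" using Y11 by (auto simp: x_def vec_eq_iff forall_2)
  then have "0 < x \<bullet> (Y *v x)" using L by (simp add: positive_definite_def)
  also have "x \<bullet> (Y *v x) = Y $ 1 $ 1 * (Y $ 1 $ 1 * Y $ 2 $ 2 - (Y $ 1 $ 2)\<^sup>2)"
    by (simp add: quadratic_form_2 x_def sym[symmetric] power2_eq_square algebra_simps)
  finally show ?R using sym Y11 by (simp add: zero_less_mult_iff)
next
  assume R: ?R
  have "0 < x \<bullet> (Y *v x)" if "x \<noteq> 0" for x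
  proof -
    have eq: "Y $ 1 $ 1 * (x \<bullet> (Y *v x)) = (Y $ 1 $ 1 * x $ 1 + Y $ 1 $ 2 * x $ 2)\<^sup>2
        + (Y $ 1 $ 1 * Y $ 2 $ 2 - (Y $ 1 $ 2)\<^sup>2) * (x $ 2)\<^sup>2"
      using R by (simp add: quadratic_form_2 power2_eq_square algebra_simps)
    have "0 < \<dots>"
    proof (cases "x $ 2 = 0")
      case True
      with that have "x $ 1 \<noteq> 0" by (auto simp: vec_eq_iff forall_2)
      with True R show ?thesis by simp
    next
      case False
      with R show ?thesis by (intro add_nonneg_pos) auto
    qed
    with eq have "0 < Y $ 1 $ 1 * (x \<bullet> (Y *v x))" by simp
    with R show ?thesis by (simp add: zero_less_mult_iff)
  qed
  with R show ?L
    by (auto simp: positive_definite_def transpose_def vec_eq_iff forall_2)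
qed

lemma siegel_space_2_iff:
  fixes Z :: "complex^2^2"
  shows "Z \<in> siegel_space \<longleftrightarrow> Z $ 1 $ 2 = Z $ 2 $ 1 \<and> 0 < Im (Z $ 1 $ 1)
     \<and> 0 < Im (Z $ 1 $ 1) * Im (Z $ 2 $ 2) - (Im (Z $ 1 $ 2))\<^sup>2"
  unfolding siegel_space_def mem_Collect_eq positive_definite_2_iff
  by (auto simp: transpose_def vec_eq_iff forall_2)

text \<open>The conditions on a modular substitution under which a Jacobi form transforms as it should,
  including that the substitution is defined on the half space; in this form they are inherited by
  products.\<close>
definition jacobi_law where
  "jacobi_law r \<phi> A B C D \<longleftrightarrow> block_matrix A B C D \<in> symplectic_group \<and>
     (\<forall>Z \<in> (siegel_space :: (complex^2^2) set).
        invertible (automorphy_matrix C D Z) \<and> siegel_action A B C D Z \<in> siegel_space \<and>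
        (\<forall>z. \<phi> (siegel_action A B C D Z, transpose (matrix_inv (automorphy_matrix C D Z)) *v z)
           * e2pi (- bilin z ((matrix_inv (automorphy_matrix C D Z) ** cmat C) *v z))
           = det (automorphy_matrix C D Z) powi r * \<phi> (Z, z)))"

lemma jacobi_law_mult:
  assumes L1: "jacobi_law r \<phi> A1 B1 C1 D1" and L2: "jacobi_law r \<phi> A2 B2 C2 D2"
  shows "jacobi_law r \<phi> (A1 ** A2 + B1 ** C2) (A1 ** B2 + B1 ** D2) (C1 ** A2 + D1 ** C2) (C1 ** B2 + D1 ** D2)"
    (is "jacobi_law r \<phi> ?A ?B ?C ?D")
proof -
  from L1 L2 have sp: "block_matrix A1 B1 C1 D1 \<in> symplectic_group" "block_matrix A2 B2 C2 D2 \<in> symplectic_group"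
    by (simp_all add: jacobi_law_def)
  then have sp2: "transpose A2 ** C2 = transpose C2 ** A2"
      "transpose A2 ** D2 - transpose C2 ** B2 = mat 1"
    by (simp_all add: block_in_symplectic_iff)
  have spm: "block_matrix ?A ?B ?C ?D \<in> symplectic_group"
    using symplectic_mult[OF sp] by (simp add: block_matrix_mult)
  have "invertible (automorphy_matrix ?C ?D Z) \<and> siegel_action ?A ?B ?C ?D Z \<in> siegel_space \<and>
        (\<forall>z. \<phi> (siegel_action ?A ?B ?C ?D Z, transpose (matrix_inv (automorphy_matrix ?C ?D Z)) *v z)
           * e2pi (- bilin z ((matrix_inv (automorphy_matrix ?C ?D Z) ** cmat ?C) *v z))
           = det (automorphy_matrix ?C ?D Z) powi r * \<phi> (Z, z))"
    if Z: "Z \<in> siegel_space" for Z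
  proof -
    define Z2 where "Z2 = siegel_action A2 B2 C2 D2 Z"
    define j2 where "j2 = automorphy_matrix C2 D2 Z"
    define j1 where "j1 = automorphy_matrix C1 D1 Z2"
    define i1 where "i1 = matrix_inv j1"
    define i2 where "i2 = matrix_inv j2"
    have inv2: "invertible j2" and Z2: "Z2 \<in> siegel_space"
      using L2 Z by (simp_all add: jacobi_law_def j2_def Z2_def)
    have inv1: "invertible j1" and act1: "siegel_action A1 B1 C1 D1 Z2 \<in> siegel_space"
      using L1 Z2 by (simp_all add: jacobi_law_def j1_def)
    have ij: "j1 ** i1 = mat 1" "i1 ** j1 = mat 1" "j2 ** i2 = mat 1" "i2 ** j2 = mat 1"
      using matrix_inv_inverse inv1 inv2 by (simp_all add: i1_def i2_def)
    have Z2j: "Z2 ** j2 = cmat A2 ** Z + cmat B2"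
      by (simp add: Z2_def siegel_action_def j2_def[symmetric] i2_def[symmetric] matrix_mul_assoc[symmetric] ij)
    have j: "automorphy_matrix ?C ?D Z = j1 ** j2"
    proof -
      have "j1 ** j2 = cmat C1 ** (Z2 ** j2) + cmat D1 ** j2"
        by (simp add: j1_def automorphy_matrix_def matrix_add_rdistrib' matrix_mul_assoc)
      also have "\<dots> = automorphy_matrix ?C ?D Z"
        unfolding Z2j unfolding j2_def automorphy_matrix_def
        by (simp add: cmat_mult matrix_add_ldistrib matrix_add_rdistrib' matrix_mul_assoc add_ac)
      finally show ?thesis by simp
    qed
    have ii: "matrix_inv (j1 ** j2) = i2 ** i1"
    proof (rule matrix_inv_eqI)
      have "j1 ** j2 ** (i2 ** i1) = j1 ** (j2 ** i2) ** i1" by (simp only: matrix_mul_assoc)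
      then show "j1 ** j2 ** (i2 ** i1) = mat 1" by (simp add: ij)
    qed
    have act: "siegel_action ?A ?B ?C ?D Z = siegel_action A1 B1 C1 D1 Z2"
    proof -
      have "siegel_action ?A ?B ?C ?D Z
          = (cmat A1 ** (cmat A2 ** Z + cmat B2) + cmat B1 ** j2) ** i2 ** i1"
        unfolding siegel_action_def j ii
        by (simp add: cmat_mult matrix_add_ldistrib matrix_add_rdistrib' matrix_mul_assoc add_ac
            j2_def automorphy_matrix_def)
      also have "\<dots> = (cmat A1 ** Z2 ** j2 + cmat B1 ** j2) ** i2 ** i1"
        unfolding Z2j[symmetric] by (simp add: matrix_mul_assoc)
      also have "\<dots> = (cmat A1 ** Z2 + cmat B1) ** (j2 ** i2) ** i1"
        by (simp add: matrix_mul_assoc matrix_add_rdistrib')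
      finally show ?thesis by (simp add: ij siegel_action_def j1_def i1_def)
    qed
    have A2: "cmat A2 = Z2 ** cmat C2 + transpose i2"
    proof -
      have tj2: "transpose j2 = Z ** transpose (cmat C2) + transpose (cmat D2)"
        by (simp add: j2_def automorphy_matrix_def transpose_add transpose_mult siegel_space_symmetric[OF Z])
      have Z2t: "Z2 = transpose i2 ** (Z ** transpose (cmat A2) + transpose (cmat B2))"
      proof -
        have "transpose Z2 = transpose i2 ** (Z ** transpose (cmat A2) + transpose (cmat B2))"
          by (simp add: Z2_def siegel_action_def j2_def[symmetric] i2_def[symmetric] transpose_add
              transpose_mult siegel_space_symmetric[OF Z])
        then show ?thesis by (simp add: siegel_space_symmetric[OF Z2])
      qed
      have c1: "transpose (cmat A2) ** cmat C2 = transpose (cmat C2) ** cmat A2"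
        using arg_cong[OF sp2(1), of cmat] by (simp add: cmat_mult cmat_transpose)
      have "transpose (transpose A2 ** D2 - transpose C2 ** B2) = mat 1" by (simp add: sp2)
      then have "transpose D2 ** A2 - transpose B2 ** C2 = mat 1"
        by (simp add: transpose_diff transpose_mult)
      then have c2: "transpose (cmat D2) ** cmat A2 - transpose (cmat B2) ** cmat C2 = mat 1"
      proof -
        assume "transpose D2 ** A2 - transpose B2 ** C2 = mat 1"
        then have "cmat (transpose D2 ** A2 - transpose B2 ** C2) = cmat (mat 1)" by (rule arg_cong)
        then show ?thesis by (simp add: cmat_mult cmat_transpose)
      qed
      have "(Z ** transpose (cmat A2) + transpose (cmat B2)) ** cmat C2 + mat 1
          = Z ** (transpose (cmat A2) ** cmat C2) + transpose (cmat D2) ** cmat A2"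
        unfolding c2[symmetric] by (simp add: matrix_add_rdistrib' matrix_mul_assoc)
      also have "\<dots> = transpose j2 ** cmat A2"
        unfolding c1 tj2 by (simp add: matrix_add_rdistrib' matrix_mul_assoc)
      finally have *: "(Z ** transpose (cmat A2) + transpose (cmat B2)) ** cmat C2 + mat 1 = transpose j2 ** cmat A2" .
      have "Z2 ** cmat C2 + transpose i2
          = transpose i2 ** ((Z ** transpose (cmat A2) + transpose (cmat B2)) ** cmat C2 + mat 1)"
        by (subst Z2t) (simp add: matrix_add_ldistrib matrix_mul_assoc)
      also have "\<dots> = transpose (j2 ** i2) ** cmat A2"
        unfolding * by (simp add: matrix_mul_assoc transpose_mult)
      finally show ?thesis by (simp add: ij)
    qed
    have N: "i2 ** i1 ** cmat ?C = i2 ** cmat C2 + i2 ** i1 ** cmat C1 ** transpose i2"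
    proof -
      have "cmat ?C = j1 ** cmat C2 + cmat C1 ** transpose i2"
        by (simp add: cmat_mult A2 j1_def automorphy_matrix_def matrix_add_ldistrib matrix_add_rdistrib'
            matrix_mul_assoc add_ac)
      then have "i2 ** i1 ** cmat ?C = i2 ** (i1 ** j1) ** cmat C2 + i2 ** i1 ** cmat C1 ** transpose i2"
        by (simp add: matrix_add_ldistrib matrix_mul_assoc)
      then show ?thesis by (simp add: ij)
    qed
    have law: "\<phi> (siegel_action ?A ?B ?C ?D Z, transpose (i2 ** i1) *v z)
           * e2pi (- bilin z ((i2 ** i1 ** cmat ?C) *v z)) = det (j1 ** j2) powi r * \<phi> (Z, z)" for z
    proof -
      define z2 where "z2 = transpose i2 *v z"
      have e1: "\<phi> (siegel_action A1 B1 C1 D1 Z2, transpose i1 *v z2) * e2pi (- bilin z2 ((i1 ** cmat C1) *v z2))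
           = det j1 powi r * \<phi> (Z2, z2)"
        using L1 Z2 by (simp add: jacobi_law_def j1_def i1_def del: transpose_matrix_vector)
      have e2: "\<phi> (Z2, z2) * e2pi (- bilin z ((i2 ** cmat C2) *v z)) = det j2 powi r * \<phi> (Z, z)"
        using L2 Z by (simp add: jacobi_law_def j2_def i2_def z2_def Z2_def del: transpose_matrix_vector)
      have z: "transpose (i2 ** i1) *v z = transpose i1 *v z2"
        by (simp only: z2_def transpose_mult matrix_vector_mul_assoc)
      have q: "bilin z ((i2 ** i1 ** cmat ?C) *v z) = bilin z2 ((i1 ** cmat C1) *v z2) + bilin z ((i2 ** cmat C2) *v z)"
      proof -
        have "bilin z2 ((i1 ** cmat C1) *v z2) = bilin z (i2 *v ((i1 ** cmat C1) *v (transpose i2 *v z)))"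
          unfolding z2_def bilin_matrix[of z i2] ..
        also have "\<dots> = bilin z ((i2 ** i1 ** cmat C1 ** transpose i2) *v z)"
          by (simp only: matrix_vector_mul_assoc matrix_mul_assoc)
        finally show ?thesis unfolding N by (simp add: matrix_vector_mult_add_rdistrib bilin_add)
      qed
      have "\<phi> (siegel_action A1 B1 C1 D1 Z2, transpose i1 *v z2) * e2pi (- bilin z2 ((i1 ** cmat C1) *v z2))
          * e2pi (- bilin z ((i2 ** cmat C2) *v z)) = det j1 powi r * (det j2 powi r * \<phi> (Z, z))"
        unfolding e1 by (simp only: mult.assoc e2)
      then show ?thesis
        unfolding act z q minus_add_distrib e2pi_add det_mul power_int_mult_distrib
        by (simp only: mult.assoc)
    qed
    have inv: "invertible (j1 ** j2)" by (rule invertible_mult[OF inv1 inv2])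
    have mem: "siegel_action ?A ?B ?C ?D Z \<in> siegel_space" using act1 by (simp only: act)
    show ?thesis unfolding j ii by (intro conjI allI inv mem law)
  qed
  note main = this
  show ?thesis
    unfolding jacobi_law_def by (rule conjI[OF spm], rule ballI, rule main)
qed

lemma automorphy_transpose:
  "Z \<in> siegel_space \<Longrightarrow> Z ** transpose (cmat C) + transpose (cmat D) = transpose (automorphy_matrix C D Z)"
  by (simp add: automorphy_matrix_def transpose_add transpose_mult siegel_space_symmetric)

definition partial_inversion :: "'n \<Rightarrow> complex^'n^'n \<Rightarrow> complex^'n^'n" where
  "partial_inversion i Z = (\<chi> a b.
     if a = i then if b = i then - 1 / Z $ i $ i else Z $ i $ b / Z $ i $ i
     else if b = i then Z $ a $ i / Z $ i $ i else Z $ a $ b - Z $ a $ i * Z $ i $ b / Z $ i $ i)"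

definition partial_inversion_vec :: "'n \<Rightarrow> complex^'n^'n \<Rightarrow> complex^'n \<Rightarrow> complex^'n" where
  "partial_inversion_vec i Z z = (\<chi> a. if a = i then z $ i / Z $ i $ i else z $ a - Z $ a $ i * z $ i / Z $ i $ i)"

definition inversion_factor :: "'n \<Rightarrow> complex^'n^'n \<Rightarrow> complex^'n^'n" where
  "inversion_factor i Z = (\<chi> a b. if a = i then (if b = i then 1 / Z $ i $ i else - Z $ i $ b / Z $ i $ i)
     else if a = b then 1 else 0)"

lemma cmat_units [simp]: "cmat (unit_entry i) = unit_entry i" "cmat (unit_except i) = unit_except i"
  by (auto simp: vec_eq_iff unit_entry_def unit_except_def)

lemma automorphy_inversion_nth:
  "automorphy_matrix (unit_entry i) (unit_except i) Z $ a $ b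
     = (if a = i then Z $ i $ b else if a = b then 1 else 0)"
  by (auto simp: automorphy_matrix_def unit_entry_mult unit_except_def)

lemma inversion_action:
  fixes Z :: "complex^'n^'n::finite"
  assumes nz: "Z $ i $ i \<noteq> 0"
  shows "matrix_inv (automorphy_matrix (unit_entry i) (unit_except i) Z) = inversion_factor i Z"
    and "invertible (automorphy_matrix (unit_entry i) (unit_except i) Z)"
    and "siegel_action (unit_except i) (- unit_entry i) (unit_entry i) (unit_except i) Z = partial_inversion i Z"
proof -
  have "automorphy_matrix (unit_entry i) (unit_except i) Z ** inversion_factor i Z = mat 1"
    unfolding vec_eq_iff
  proof (intro allI)
    fix a b
    show "(automorphy_matrix (unit_entry i) (unit_except i) Z ** inversion_factor i Z) $ a $ b = mat 1 $ a $ b"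
      using nz by (cases "a = i"; cases "b = i")
        (simp_all add: matrix_matrix_mult_def automorphy_inversion_nth inversion_factor_def mat_def
          sum.remove[of UNIV i] if_distrib[of "\<lambda>x. x * _"] if_distrib[of "\<lambda>x. _ * x"] cong: if_cong)
  qed
  from matrix_inv_eqI[OF this]
  show inv: "matrix_inv (automorphy_matrix (unit_entry i) (unit_except i) Z) = inversion_factor i Z"
    and "invertible (automorphy_matrix (unit_entry i) (unit_except i) Z)" by auto
  define N where "N = cmat (unit_except i) ** Z + cmat (- unit_entry i)"
  have N: "N $ a $ b = (if a = i then (if b = i then -1 else 0) else Z $ a $ b)" for a b
    by (simp add: N_def unit_entry_mult) (simp add: unit_entry_def)
  show "siegel_action (unit_except i) (- unit_entry i) (unit_entry i) (unit_except i) Z = partial_inversion i Z"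
    unfolding siegel_action_def inv N_def[symmetric] vec_eq_iff
  proof (intro allI)
    fix a b
    show "(N ** inversion_factor i Z) $ a $ b = partial_inversion i Z $ a $ b"
      using nz by (cases "a = i"; cases "b = i")
        (simp_all add: matrix_matrix_mult_def N inversion_factor_def partial_inversion_def
          sum.remove[of UNIV i] if_distrib[of "\<lambda>x. x * _"] if_distrib[of "\<lambda>x. _ * x"] cong: if_cong)
  qed
qed

lemma partial_inversion_siegel_2:
  fixes Z :: "complex^2^2"
  assumes Z: "Z \<in> siegel_space"
  shows "partial_inversion i Z \<in> siegel_space"
proof -
  have key: "Im (- 1 / t) > 0 \<and>
      Im (- 1 / t) * Im (s - w * w / t) - (Im (w / t))\<^sup>2 > 0"
    if t: "Im t > 0" and d: "Im t * Im s - (Im w)\<^sup>2 > 0" for t s w :: complex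
  proof -
    define N where "N = (Re t)\<^sup>2 + (Im t)\<^sup>2"
    have N: "N > 0" using t by (auto simp: N_def intro: add_nonneg_pos)
    have 1: "Im (- 1 / t) = Im t / N" by (simp add: Im_divide N_def)
    have 2: "Im (w / t) = (Im w * Re t - Re w * Im t) / N" by (simp add: Im_divide N_def)
    have 3: "Im (s - w * w / t) = Im s - (2 * Re w * Im w * Re t - ((Re w)\<^sup>2 - (Im w)\<^sup>2) * Im t) / N"
      by (simp add: Im_divide N_def power2_eq_square algebra_simps)
    have "N * N * (Im (- 1 / t) * Im (s - w * w / t) - (Im (w / t))\<^sup>2)
        = N * Im t * Im s - Im t * (2 * Re w * Im w * Re t - ((Re w)\<^sup>2 - (Im w)\<^sup>2) * Im t)
          - (Im w * Re t - Re w * Im t)\<^sup>2"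
      unfolding 1 2 3 using N by (simp add: field_simps power2_eq_square)
    also have "\<dots> = N * (Im t * Im s - (Im w)\<^sup>2)"
      unfolding N_def by (simp add: power2_eq_square algebra_simps)
    also have "\<dots> > 0" using N d by simp
    finally have "Im (- 1 / t) * Im (s - w * w / t) - (Im (w / t))\<^sup>2 > 0"
      using N by (simp add: zero_less_mult_iff)
    with 1 N t show ?thesis by simp
  qed
  have Z': "Z $ 2 $ 1 = Z $ 1 $ 2" "Im (Z $ 1 $ 1) > 0" "Im (Z $ 1 $ 1) * Im (Z $ 2 $ 2) - (Im (Z $ 1 $ 2))\<^sup>2 > 0"
  proof -
    show "Z $ 2 $ 1 = Z $ 1 $ 2" by (rule siegel_space_sym_nth[OF Z])
    show "Im (Z $ 1 $ 1) > 0" by (rule siegel_space_diagonal[OF Z])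
    show "Im (Z $ 1 $ 1) * Im (Z $ 2 $ 2) - (Im (Z $ 1 $ 2))\<^sup>2 > 0"
      using Z unfolding siegel_space_2_iff by (elim conjE)
  qed
  have d2: "Im (Z $ 2 $ 2) > 0" using siegel_space_diagonal[OF Z] by simp
  have pos: "0 < b" if "0 < a * b - c\<^sup>2" "0 < a" for a b c :: real
    using that by (smt (verit) mult_nonneg_nonpos zero_le_power2)
  consider "i = 1" | "i = 2" using exhaust_2 by blast
  then show ?thesis
  proof cases
    case 1
    with key[OF Z'(2,3)] show ?thesis
      by (simp add: siegel_space_2_iff partial_inversion_def Z'(1))
  next
    case 2
    have "Im (Z $ 2 $ 2) * Im (Z $ 1 $ 1) - (Im (Z $ 1 $ 2))\<^sup>2 > 0" using Z'(3) by (simp add: mult.commute)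
    from key[OF d2 this] have k: "Im (- 1 / Z $ 2 $ 2) > 0"
      "0 < Im (- 1 / Z $ 2 $ 2) * Im (Z $ 1 $ 1 - Z $ 1 $ 2 * Z $ 1 $ 2 / Z $ 2 $ 2) - (Im (Z $ 1 $ 2 / Z $ 2 $ 2))\<^sup>2"
      by simp_all
    from pos[OF k(2,1)] k 2 show ?thesis
      by (simp add: siegel_space_2_iff partial_inversion_def Z'(1) mult.commute)
  qed
qed

lemma linear_siegel:
  fixes U W :: "int^'n^'n::finite"
  assumes Z: "Z \<in> siegel_space" and UW: "transpose U ** W = mat 1"
  shows "cmat U ** Z ** transpose (cmat U) \<in> siegel_space"
proof -
  have Z': "transpose Z = Z" "positive_definite (map_matrix Im Z)" using Z by (simp_all add: siegel_space_def)
  define R :: "real^'n^'n" where "R = map_matrix of_int U"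
  have im: "map_matrix Im (cmat U ** Z ** transpose (cmat U)) = R ** map_matrix Im Z ** transpose R"
    by (simp add: vec_eq_iff matrix_matrix_mult_def transpose_def R_def)
  have UWr: "transpose R ** map_matrix of_int W = mat 1"
    using arg_cong[OF UW, of "map_matrix (of_int :: int \<Rightarrow> real)"]
    by (simp add: vec_eq_iff R_def matrix_matrix_mult_def transpose_def mat_def)
  have inj: "transpose R *v x \<noteq> 0" if "x \<noteq> 0" for x
  proof
    assume "transpose R *v x = 0"
    then have "map_matrix of_int W *v (transpose R *v x) = (0 :: real^'n)" by simp
    moreover have "map_matrix of_int W ** transpose R = (mat 1 :: real^'n^'n)"
      using UWr by (simp only: matrix_left_right_inverse)
    ultimately show False using that by (simp only: matrix_vector_mul_assoc) simp
  qed
  have "0 < x \<bullet> ((R ** map_matrix Im Z ** transpose R) *v x)" if "x \<noteq> 0" for x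
  proof -
    have "x \<bullet> ((R ** map_matrix Im Z ** transpose R) *v x)
        = (transpose R *v x) \<bullet> (map_matrix Im Z *v (transpose R *v x))"
      by (simp only: dot_lmul_matrix matrix_vector_mul_assoc[symmetric] transpose_matrix_vector)
    with Z'(2) inj[OF that] show ?thesis by (simp add: positive_definite_def)
  qed
  moreover have "transpose (cmat U ** Z ** transpose (cmat U)) = cmat U ** Z ** transpose (cmat U)"
    by (simp add: transpose_mult Z' matrix_mul_assoc)
  moreover have "transpose (R ** map_matrix Im Z ** transpose R) = R ** map_matrix Im Z ** transpose R"
    using Z'(2) by (simp add: transpose_mult positive_definite_def matrix_mul_assoc)
  ultimately show ?thesis by (simp add: siegel_space_def im positive_definite_def)
qed

lemma linear_action:
  fixes U W :: "int^'n^'n::finite"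
  assumes UW: "transpose U ** W = mat 1"
  shows "matrix_inv (automorphy_matrix 0 W Z) = transpose (cmat U)"
    and "invertible (automorphy_matrix 0 W Z)"
    and "siegel_action U 0 0 W Z = cmat U ** Z ** transpose (cmat U)"
    and "automorphy_matrix 0 W Z = cmat W"
proof -
  show a: "automorphy_matrix 0 W Z = cmat W" by (simp add: automorphy_matrix_def)
  have "cmat W ** transpose (cmat U) = mat 1"
    using int_matrix_left_right_inverse[THEN iffD1, OF UW]
    by (simp add: cmat_transpose[symmetric] cmat_mult[symmetric])
  from matrix_inv_eqI[OF this]
  show "matrix_inv (automorphy_matrix 0 W Z) = transpose (cmat U)" "invertible (automorphy_matrix 0 W Z)"
    by (simp_all add: a)
  then show "siegel_action U 0 0 W Z = cmat U ** Z ** transpose (cmat U)"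
    by (simp add: siegel_action_def)
qed

lemma det_unimodular:
  fixes U W :: "int^'n^'n::finite"
  assumes UW: "transpose U ** W = mat 1"
  shows "det U = 1 \<or> det U = - 1" "det W = det U"
proof -
  have "det U * det W = 1" using arg_cong[OF UW, of det] by (simp add: det_mul)
  then show "det U = 1 \<or> det U = - 1" "det W = det U"
    by (metis zmult_eq_1_iff)+
qed

lemma translation_siegel:
  assumes Z: "Z \<in> siegel_space" and B: "transpose B = B"
  shows "Z + map_matrix of_real B \<in> siegel_space"
proof -
  have "map_matrix Im (Z + map_matrix of_real B) = map_matrix Im Z" by (simp add: vec_eq_iff)
  moreover have "transpose (map_matrix of_real B) = map_matrix of_real B"
    using B by (simp add: transpose_def vec_eq_iff)
  ultimately show ?thesis using Z by (simp add: siegel_space_def transpose_add)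
qed

lemma translation_siegel_int:
  assumes Z: "Z \<in> siegel_space" and B: "transpose B = B"
  shows "Z + cmat B \<in> siegel_space"
proof -
  have "transpose (map_matrix of_int B) = map_matrix of_int B"
    using B by (simp add: transpose_def vec_eq_iff)
  from translation_siegel[OF Z this]
  have "Z + map_matrix of_real (map_matrix of_int B) \<in> siegel_space" .
  also have "map_matrix of_real (map_matrix of_int B) = cmat B" by (simp add: vec_eq_iff)
  finally show ?thesis .
qed

lemma det_cmat_2: "det (cmat U) = of_int (det (U :: int^2^2))"
  by (simp add: det_2)

lemma det_cmat_3: "det (cmat U) = of_int (det (U :: int^3^3))"
  by (simp add: det_3)

theorem jacobi_modular_transformationI:
  fixes \<phi> :: "(complex^2^2) \<times> (complex^2) \<Rightarrow> complex"
  assumes translation: "\<And>B Z z. Z \<in> siegel_space \<Longrightarrow> transpose B = B \<Longrightarrow> \<phi> (Z + cmat B, z) = \<phi> (Z, z)"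
    and linear: "\<And>U W Z z. Z \<in> siegel_space \<Longrightarrow> transpose U ** W = mat 1 \<Longrightarrow>
      \<phi> (cmat U ** Z ** transpose (cmat U), cmat U *v z) = of_int (det U) powi r * \<phi> (Z, z)"
    and inversion: "\<And>i Z z. Z \<in> siegel_space \<Longrightarrow>
      \<phi> (partial_inversion i Z, partial_inversion_vec i Z z) * e2pi (- ((z $ i)\<^sup>2 / Z $ i $ i))
        = Z $ i $ i powi r * \<phi> (Z, z)"
  shows "jacobi_modular_transformation r \<phi>"
proof -
  interpret symplectic_generators "jacobi_law r \<phi>"
  proof
    fix B :: "int^2^2" assume B: "transpose B = B"
    have [simp]: "matrix_inv (mat 1 :: complex^2^2) = mat 1" "invertible (mat 1 :: complex^2^2)"
      by (rule matrix_inv_eqI, simp)+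
    have [simp]: "bilin z 0 = 0" for z :: "complex^2" by (simp add: bilin_def)
    show "jacobi_law r \<phi> (mat 1) B 0 (mat 1)"
      unfolding jacobi_law_def using translation[OF _ B] translation_siegel_int[OF _ B]
      by (auto simp: translation_symplectic[OF B] automorphy_matrix_def siegel_action_def
          simp del: transpose_matrix_vector)
  next
    fix U W :: "int^2^2" assume UW: "transpose U ** W = mat 1"
    have [simp]: "bilin z 0 = 0" for z :: "complex^2" by (simp add: bilin_def)
    show "jacobi_law r \<phi> U 0 0 W"
      unfolding jacobi_law_def using linear[OF _ UW] linear_siegel[OF _ UW] linear_action[OF UW]
      by (auto simp: linear_symplectic[OF UW] det_cmat_2 det_unimodular(2)[OF UW]
          simp del: transpose_matrix_vector)
  next
    fix i :: 2
    have "jacobi_law r \<phi> (unit_except i) (- unit_entry i) (unit_entry i) (unit_except i)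
      \<longleftrightarrow> (\<forall>Z \<in> siegel_space. \<forall>z. \<phi> (partial_inversion i Z, partial_inversion_vec i Z z)
           * e2pi (- ((z $ i)\<^sup>2 / Z $ i $ i)) = Z $ i $ i powi r * \<phi> (Z, z))"
    proof -
      have 1: "transpose (inversion_factor i Z) *v z = partial_inversion_vec i Z z"
        if "Z \<in> siegel_space" for Z :: "complex^2^2" and z
        using exhaust_2[of i] siegel_space_sym_nth[OF that, of 1 2]
        by (auto simp: vec_eq_iff forall_2 matrix_vector_mult_def transpose_def sum_2
            inversion_factor_def partial_inversion_vec_def simp del: transpose_matrix_vector)
      have 2: "bilin z ((inversion_factor i Z ** unit_entry i) *v z) = (z $ i)\<^sup>2 / Z $ i $ i"
        for Z :: "complex^2^2" and z
        using exhaust_2[of i]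
        by (auto simp: bilin_def matrix_vector_mult_def matrix_matrix_mult_def sum_2
            inversion_factor_def unit_entry_def power2_eq_square)
      have 3: "det (automorphy_matrix (unit_entry i) (unit_except i) Z) = Z $ i $ i" for Z :: "complex^2^2"
        using exhaust_2[of i] by (auto simp: det_2 automorphy_inversion_nth)
      show ?thesis
        unfolding jacobi_law_def
        by (auto simp: inversion_symplectic inversion_action siegel_space_diagonal partial_inversion_siegel_2
            1 2 3 simp del: transpose_matrix_vector)
    qed
    then show "jacobi_law r \<phi> (unit_except i) (- unit_entry i) (unit_entry i) (unit_except i)"
      using inversion by simp
  qed (rule jacobi_law_mult)
  show ?thesis
    unfolding jacobi_modular_transformation_def
  proof (intro allI impI ballI)
    fix A B C D :: "int^2^2" and Z :: "complex^2^2" and z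
    assume "block_matrix A B C D \<in> symplectic_group" and Z: "Z \<in> siegel_space"
    from generate[OF this(1)] have law: "jacobi_law r \<phi> A B C D" .
    with Z have inv: "invertible (automorphy_matrix C D Z)" by (simp add: jacobi_law_def)
    from law Z show "\<phi> (siegel_action A B C D Z, matrix_inv (Z ** transpose (cmat C) + transpose (cmat D)) *v z)
           * e2pi (- bilin z ((matrix_inv (automorphy_matrix C D Z) ** cmat C) *v z))
           = det (automorphy_matrix C D Z) powi r * \<phi> (Z, z)"
      by (simp add: jacobi_law_def automorphy_transpose[OF Z] matrix_inv_transpose[OF inv]
          del: transpose_matrix_vector)
  qed
qed

section \<open>Expansions determine their coefficients\<close>

lemma trace_real_shift:
  fixes T B :: "real^'n^'n::finite"
  assumes T: "transpose T = T"
  shows "trace (map_matrix of_real T ** (Z + map_matrix of_real ((1/2) *\<^sub>R (B + transpose B))))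
    = trace (map_matrix of_real T ** Z) + complex_of_real (T \<bullet> B)"
proof -
  have sym: "T $ i $ j = T $ j $ i" for i j
    using arg_cong[OF T, of "\<lambda>M. M $ i $ j"] by (simp add: transpose_def)
  have 1: "T \<bullet> B = (\<Sum>i\<in>UNIV. \<Sum>j\<in>UNIV. T $ i $ j * B $ i $ j)"
    by (simp add: inner_vec_def)
  have 2: "T \<bullet> B = (\<Sum>i\<in>UNIV. \<Sum>j\<in>UNIV. T $ i $ j * B $ j $ i)"
    unfolding 1 by (subst sum.swap) (simp add: sym[symmetric])
  have "(\<Sum>i\<in>UNIV. \<Sum>j\<in>UNIV. T $ i $ j * ((B $ j $ i + B $ i $ j) / 2)) = T \<bullet> B"
  proof -
    have "(\<Sum>i\<in>UNIV. \<Sum>j\<in>UNIV. T $ i $ j * ((B $ j $ i + B $ i $ j) / 2)) = (T \<bullet> B + T \<bullet> B) / 2"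
      by (subst (1) 2, subst 1) (simp add: sum_divide_distrib sum.distrib[symmetric] algebra_simps add_divide_distrib)
    then show ?thesis by simp
  qed
  then have "complex_of_real (\<Sum>i\<in>UNIV. \<Sum>j\<in>UNIV. T $ i $ j * ((B $ j $ i + B $ i $ j) / 2)) = of_real (T \<bullet> B)"
    by simp
  then show ?thesis
    by (simp add: trace_def matrix_matrix_mult_def transpose_def distrib_left sum.distrib add_divide_distrib)
qed

lemma symmetric_part_siegel:
  assumes "Z \<in> siegel_space"
  shows "Z + map_matrix of_real ((1/2) *\<^sub>R (B + transpose B)) \<in> siegel_space"
  by (rule translation_siegel[OF assms]) (simp add: transpose_def vec_eq_iff add.commute)

lemma siegel_space_nonempty: "(\<chi> i j. if i = j then \<i> else 0) \<in> (siegel_space :: (complex^'n^'n::finite) set)"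
proof -
  have "map_matrix Im (\<chi> i j. if i = j then \<i> else 0) = (mat 1 :: real^'n^'n)"
    by (simp add: vec_eq_iff mat_def)
  then show ?thesis
    by (simp add: siegel_space_def positive_definite_def) (simp add: transpose_def vec_eq_iff)
qed

lemma siegel_fourier_unique:
  fixes F :: "complex^'n^'n::finite \<Rightarrow> complex"
  assumes c: "siegel_fourier_expansion F c" and d: "siegel_fourier_expansion F d"
    and T: "T \<in> half_integral"
  shows "c T = d T"
proof -
  obtain Z :: "complex^'n^'n" where Z: "Z \<in> siegel_space" using siegel_space_nonempty by blast
  let ?e = "\<lambda>T. e2pi (trace (map_matrix of_real T ** Z))"
  have "((\<lambda>T. (c T * ?e T) * e2pi (of_real (T \<bullet> B))) has_sum
      F (Z + map_matrix of_real ((1/2) *\<^sub>R (B + transpose B)))) half_integral"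
    if c: "siegel_fourier_expansion F c" for c B
    by (rule has_sum_eqI[OF c[unfolded siegel_fourier_expansion_def, rule_format, OF symmetric_part_siegel[OF Z, of B]]])
       (auto simp: half_integral_def trace_real_shift e2pi_add)
  from fourier_coefficients_unique[of "\<lambda>T. T", OF _ this[OF c] this[OF d] T]
  have "c T * ?e T = d T * ?e T" by simp
  then show ?thesis by simp
qed

lemma jacobi_fourier_unique:
  assumes c: "jacobi_fourier_expansion \<phi> c" and d: "jacobi_fourier_expansion \<phi> d"
    and T: "T \<in> half_integral"
  shows "c T t = d T t"
proof -
  obtain Z :: "complex^2^2" where Z: "Z \<in> siegel_space" using siegel_space_nonempty by blast
  let ?e = "\<lambda>(T, t). e2pi (trace (map_matrix of_real T ** Z))"
  let ?h = "\<lambda>(T :: real^2^2, t :: int^2). (T, \<chi> i. real_of_int (t $ i))"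
  have *: "((\<lambda>i. ((\<lambda>(T, t). c T t) i * ?e i) * e2pi (of_real (?h i \<bullet> B))) has_sum
      \<phi> (Z + map_matrix of_real ((1/2) *\<^sub>R (fst B + transpose (fst B))), \<chi> i. of_real (snd B $ i))) (half_integral \<times> UNIV)"
    if c: "jacobi_fourier_expansion \<phi> c" for c and B :: "(real^2^2) \<times> (real^2)"
  proof (rule has_sum_eqI[OF c[unfolded jacobi_fourier_expansion_def, rule_format,
          OF symmetric_part_siegel[OF Z, of "fst B"], of "\<chi> i. of_real (snd B $ i)"]])
    fix i :: "(real^2^2) \<times> (int^2)" assume i: "i \<in> half_integral \<times> UNIV"
    obtain T t where Tt: "i = (T, t)" by (cases i)
    have b: "bilin (cvec t) (\<chi> i. of_real (snd B $ i)) = complex_of_real ((\<chi> i. real_of_int (t $ i)) \<bullet> snd B)"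
      by (simp add: bilin_def cvec_def inner_vec_def)
    have t: "trace (map_matrix of_real T ** (Z + map_matrix of_real ((1/2) *\<^sub>R (fst B + transpose (fst B)))))
      = trace (map_matrix of_real T ** Z) + complex_of_real (T \<bullet> fst B)"
      using i by (intro trace_real_shift) (simp add: Tt half_integral_def)
    show "(case i of (T, t) \<Rightarrow> c T t * e2pi (trace (map_matrix of_real T **
          (Z + map_matrix of_real ((1/2) *\<^sub>R (fst B + transpose (fst B))))) + bilin (cvec t) (\<chi> i. of_real (snd B $ i))))
        = ((\<lambda>(T, t). c T t) i * ?e i) * e2pi (of_real (?h i \<bullet> B))"
      unfolding Tt prod.case t b by (simp add: inner_prod_def e2pi_add)
  qed simp
  have inj: "inj_on ?h (half_integral \<times> UNIV)"
    by (auto simp: inj_on_def vec_eq_iff)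
  have mem: "(T, t) \<in> half_integral \<times> UNIV" using T by simp
  from fourier_coefficients_unique[OF inj *[OF c] *[OF d] mem]
  show ?thesis by simp
qed


section \<open>Holomorphy of Jacobi Fourier series\<close>

lemma positive_definite_2_lower:
  fixes Y :: "real^2^2"
  assumes "positive_definite Y"
  obtains \<delta> where "\<delta> > 0"
    "\<And>a b. \<delta> * (a\<^sup>2 + b\<^sup>2) \<le> Y $ 1 $ 1 * a\<^sup>2 + 2 * Y $ 1 $ 2 * a * b + Y $ 2 $ 2 * b\<^sup>2"
proof -
  define D where "D = Y $ 1 $ 1 * Y $ 2 $ 2 - (Y $ 1 $ 2)\<^sup>2"
  define t where "t = Y $ 1 $ 1 + Y $ 2 $ 2"
  have pos: "Y $ 1 $ 1 > 0" "Y $ 2 $ 2 > 0" "D > 0"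
    using assms[unfolded positive_definite_2_iff] positive_definite_diagonal[OF assms]
    unfolding D_def by blast+
  then have t: "t > 0" by (simp add: t_def)
  define \<delta> where "\<delta> = D / t"
  have \<delta>: "\<delta> > 0" "\<delta> * t = D" using pos t by (simp_all add: \<delta>_def)
  have "(Y $ 1 $ 1 - \<delta>) * t = (Y $ 1 $ 1)\<^sup>2 + (Y $ 1 $ 2)\<^sup>2"
    using \<delta>(2) by (simp add: left_diff_distrib) (simp add: t_def D_def power2_eq_square algebra_simps)
  moreover have "(Y $ 1 $ 1)\<^sup>2 + (Y $ 1 $ 2)\<^sup>2 > 0" using pos by (intro add_pos_nonneg) auto
  ultimately have d1: "Y $ 1 $ 1 - \<delta> > 0" using t by (metis zero_less_mult_pos2)
  have "(Y $ 1 $ 1 - \<delta>) * (Y $ 1 $ 1 * a\<^sup>2 + 2 * Y $ 1 $ 2 * a * b + Y $ 2 $ 2 * b\<^sup>2 - \<delta> * (a\<^sup>2 + b\<^sup>2))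
      = ((Y $ 1 $ 1 - \<delta>) * a + Y $ 1 $ 2 * b)\<^sup>2 + (D - \<delta> * t + \<delta>\<^sup>2) * b\<^sup>2" for a b
    by (simp add: D_def t_def power2_eq_square algebra_simps)
  also have "\<dots> a b \<ge> 0" for a b by (simp add: \<delta>(2))
  finally have "Y $ 1 $ 1 * a\<^sup>2 + 2 * Y $ 1 $ 2 * a * b + Y $ 2 $ 2 * b\<^sup>2 - \<delta> * (a\<^sup>2 + b\<^sup>2) \<ge> 0" for a b
    using d1 by (simp add: zero_le_mult_iff)
  then show thesis using that[OF \<delta>(1)] by simp
qed

lemma summable_on_sum:
  fixes f :: "'a \<Rightarrow> 'b \<Rightarrow> real"
  assumes "finite A" "\<And>a. a \<in> A \<Longrightarrow> f a summable_on I"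
  shows "(\<lambda>i. \<Sum>a\<in>A. f a i) summable_on I"
  using assms by (induction A rule: finite_induct) (auto intro!: summable_on_add)

definition jacobi_exponent :: "(real^2^2) \<times> (int^2) \<Rightarrow> (complex^2^2) \<times> (complex^2) \<Rightarrow> complex" where
  "jacobi_exponent i v = 2 * of_real pi * \<i> *
     (trace (map_matrix of_real (fst i) ** fst v) + bilin (cvec (snd i)) (snd v))"

lemma jacobi_exponent_alt: "jacobi_exponent (T, t) (Z, z) = 2 * of_real pi * \<i> *
    (of_real (T $ 1 $ 1) * Z $ 1 $ 1 + of_real (T $ 1 $ 2) * Z $ 2 $ 1
     + of_real (T $ 2 $ 1) * Z $ 1 $ 2 + of_real (T $ 2 $ 2) * Z $ 2 $ 2
     + of_int (t $ 1) * z $ 1 + of_int (t $ 2) * z $ 2)"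
  by (simp add: jacobi_exponent_def trace_def matrix_matrix_mult_def bilin_def cvec_def sum_2 algebra_simps)

definition exponent_size :: "(real^2^2) \<times> (int^2) \<Rightarrow> real" where
  "exponent_size = (\<lambda>(T, t). 2 * pi * (\<bar>T $ 1 $ 1\<bar> + 2 * \<bar>T $ 1 $ 2\<bar> + \<bar>T $ 2 $ 2\<bar> + \<bar>of_int (t $ 1)\<bar> + \<bar>of_int (t $ 2)\<bar>))"

text \<open>Moving \<open>Z\<close> and \<open>z\<close> a little in all real sign directions of the imaginary part stays in the
  domain; one of these finitely many moves multiplies the given term by \<open>exp (\<epsilon> M)\<close>.\<close>
lemma jacobi_series_weighted_summable:
  assumes exp: "jacobi_fourier_expansion \<phi> c" and Z: "Z \<in> siegel_space"
  obtains \<epsilon> where "\<epsilon> > 0"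
    "(\<lambda>i. norm ((\<lambda>(T, t). c T t) i * exp (jacobi_exponent i (Z, z))) * exp (\<epsilon> * exponent_size i))
       summable_on half_integral \<times> UNIV"
proof -
  have "positive_definite (map_matrix Im Z)" using Z by (simp add: siegel_space_def)
  then obtain \<delta> where \<delta>: "\<delta> > 0" "\<And>a b. \<delta> * (a\<^sup>2 + b\<^sup>2)
      \<le> Im (Z $ 1 $ 1) * a\<^sup>2 + 2 * Im (Z $ 1 $ 2) * a * b + Im (Z $ 2 $ 2) * b\<^sup>2"
    using positive_definite_2_lower[of "map_matrix Im Z"] by auto
  have Zs: "Z $ 2 $ 1 = Z $ 1 $ 2" by (rule siegel_space_sym_nth[OF Z])
  define \<epsilon> where "\<epsilon> = \<delta> / 4"
  have \<epsilon>: "\<epsilon> > 0" using \<delta> by (simp add: \<epsilon>_def)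
  define A where "A = ({-1, 1} :: real set) \<times> ({-1, 1} :: real set) \<times> ({-1, 1} :: real set) \<times> ({-1, 1} :: real set) \<times> ({-1, 1} :: real set)"
  have A: "finite A" by (simp add: A_def)
  define ZZ :: "real \<times> real \<times> real \<times> real \<times> real \<Rightarrow> complex^2^2" where
    "ZZ = (\<lambda>(p, q, r, u, v). Z - vector [vector [\<i> * of_real (\<epsilon> * p), \<i> * of_real (\<epsilon> * q)], vector [\<i> * of_real (\<epsilon> * q), \<i> * of_real (\<epsilon> * r)]])"
  define zz :: "real \<times> real \<times> real \<times> real \<times> real \<Rightarrow> complex^2" where
    "zz = (\<lambda>(p, q, r, u, v). z - vector [\<i> * of_real (\<epsilon> * u), \<i> * of_real (\<epsilon> * v)])"
  have mem: "ZZ s \<in> siegel_space" if s: "s \<in> A" for s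
  proof -
    obtain p q r u v where pq: "s = (p, q, r, u, v)" by (cases s) auto
    have b: "\<bar>p\<bar> = 1" "\<bar>q\<bar> = 1" "\<bar>r\<bar> = 1" using s by (auto simp: A_def pq)
    have quad: "0 < (Im (Z $ 1 $ 1) - \<epsilon> * p) * a\<^sup>2 + 2 * (Im (Z $ 1 $ 2) - \<epsilon> * q) * a * b + (Im (Z $ 2 $ 2) - \<epsilon> * r) * b\<^sup>2"
      if ab: "a \<noteq> 0 \<or> b \<noteq> 0" for a b :: real
    proof -
      have "p * a\<^sup>2 \<le> a\<^sup>2" "r * b\<^sup>2 \<le> b\<^sup>2"
        using b by (auto intro!: mult_left_le_one_le simp: abs_if split: if_splits)
      moreover have "2 * q * a * b \<le> a\<^sup>2 + b\<^sup>2"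
      proof -
        have "q = 1 \<or> q = - 1" using b(2) by linarith
        then show ?thesis
          using sum_squares_bound[of a b] sum_squares_bound[of "- a" b] by auto
      qed
      ultimately have "p * a\<^sup>2 + 2 * q * a * b + r * b\<^sup>2 \<le> a\<^sup>2 + (a\<^sup>2 + b\<^sup>2) + b\<^sup>2"
        by (intro add_mono)
      also have "\<dots> = 2 * (a\<^sup>2 + b\<^sup>2)" by simp
      finally have "p * a\<^sup>2 + 2 * q * a * b + r * b\<^sup>2 \<le> 2 * (a\<^sup>2 + b\<^sup>2)" .
      then have "\<epsilon> * (p * a\<^sup>2 + 2 * q * a * b + r * b\<^sup>2) \<le> \<epsilon> * (2 * (a\<^sup>2 + b\<^sup>2))"
        using \<epsilon> by (intro mult_left_mono) auto
      also have "\<dots> < \<delta> * (a\<^sup>2 + b\<^sup>2)"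
      proof -
        have "a\<^sup>2 + b\<^sup>2 > 0" using ab by (simp add: sum_power2_gt_zero_iff)
        then have "\<delta> * (a\<^sup>2 + b\<^sup>2) > 0" using \<delta>(1) by simp
        then show ?thesis unfolding \<epsilon>_def by linarith
      qed
      also note \<delta>(2)[of a b]
      finally show ?thesis by (simp add: algebra_simps)
    qed
    have "transpose (ZZ s) = ZZ s"
      using Zs by (simp add: ZZ_def pq transpose_def vec_eq_iff forall_2)
    moreover have "0 < x \<bullet> (map_matrix Im (ZZ s) *v x)" if x: "x \<noteq> 0" for x
    proof -
      have "x $ 1 \<noteq> 0 \<or> x $ 2 \<noteq> 0" using x by (auto simp: vec_eq_iff forall_2)
      from quad[OF this] show ?thesis
        by (simp add: quadratic_form_2 ZZ_def pq Zs)
    qed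
    moreover have "transpose (map_matrix Im (ZZ s)) = map_matrix Im (ZZ s)"
      using Zs by (simp add: ZZ_def pq transpose_def vec_eq_iff forall_2)
    ultimately show ?thesis by (simp add: siegel_space_def positive_definite_def)
  qed
  define f where "f Z z i = norm ((\<lambda>(T, t). c T t) i * exp (jacobi_exponent i (Z, z)))" for Z z i
  have sm: "f Z' z' summable_on half_integral \<times> UNIV" if "Z' \<in> siegel_space" for Z' z'
  proof -
    have "((\<lambda>i. (\<lambda>(T, t). c T t) i * exp (jacobi_exponent i (Z', z'))) has_sum \<phi> (Z', z')) (half_integral \<times> UNIV)"
      by (rule has_sum_eqI[OF exp[unfolded jacobi_fourier_expansion_def, rule_format, OF that]])
         (auto simp: jacobi_exponent_def e2pi_def)
    from has_sum_imp_summable[OF this] show ?thesis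
      unfolding f_def by (simp only: summable_on_iff_abs_summable_on_complex)
  qed
  have "(\<lambda>i. \<Sum>s\<in>A. f (ZZ s) (zz s) i) summable_on half_integral \<times> UNIV"
    by (rule summable_on_sum[OF A]) (rule sm[OF mem])
  then have "(\<lambda>i. norm (f Z z i * exp (\<epsilon> * exponent_size i))) summable_on half_integral \<times> UNIV"
  proof (rule Infinite_Sum.abs_summable_on_comparison_test')
    fix i :: "(real^2^2) \<times> (int^2)" assume i: "i \<in> half_integral \<times> UNIV"
    obtain T t where Tt: "i = (T, t)" by (cases i)
    have Ts: "T $ 2 $ 1 = T $ 1 $ 2"
    proof -
      have "transpose T = T" using i by (simp add: Tt half_integral_def)
      from arg_cong[OF this, of "\<lambda>M. M $ 1 $ 2"] show ?thesis by (simp add: transpose_def)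
    qed
    define sg :: "real \<Rightarrow> real" where "sg x = (if x \<ge> 0 then 1 else - 1)" for x
    have sg: "sg x * x = \<bar>x\<bar>" "sg x \<in> {-1, 1}" for x by (simp_all add: sg_def)
    let ?s = "(sg (T $ 1 $ 1), sg (T $ 1 $ 2), sg (T $ 2 $ 2), sg (of_int (t $ 1)), sg (of_int (t $ 2)))"
    have s: "?s \<in> A" unfolding A_def by (intro SigmaI sg(2))
    have "jacobi_exponent i (ZZ ?s, zz ?s) = jacobi_exponent i (Z, z) + of_real (\<epsilon> * exponent_size i)"
    proof -
      have "jacobi_exponent i (ZZ ?s, zz ?s) = jacobi_exponent i (Z, z) + 2 * of_real pi *
          of_real (\<epsilon> * (sg (T $ 1 $ 1) * T $ 1 $ 1 + 2 * (sg (T $ 1 $ 2) * T $ 1 $ 2) + sg (T $ 2 $ 2) * T $ 2 $ 2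
            + sg (of_int (t $ 1)) * of_int (t $ 1) + sg (of_int (t $ 2)) * of_int (t $ 2)))"
        by (simp add: Tt jacobi_exponent_alt ZZ_def zz_def Ts algebra_simps)
      then show ?thesis by (simp add: sg(1) exponent_size_def Tt)
    qed
    then have "f (ZZ ?s) (zz ?s) i = f Z z i * exp (\<epsilon> * exponent_size i)"
      by (simp add: f_def norm_mult exp_add del: of_real_mult)
    moreover have "f (ZZ ?s) (zz ?s) i \<le> (\<Sum>s\<in>A. f (ZZ s) (zz s) i)"
      by (rule member_le_sum[OF s _ A]) (simp add: f_def)
    ultimately show "norm (f Z z i * exp (\<epsilon> * exponent_size i)) \<le> (\<Sum>s\<in>A. f (ZZ s) (zz s) i)"
      by (simp add: f_def)
  qed
  then show thesis using that[OF \<epsilon>] by (simp add: f_def)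
qed

lemma jacobi_series_holomorphic:
  assumes exp: "jacobi_fourier_expansion \<phi> c"
  shows "holomorphic_wrt (\<lambda>c (Z, z). (mscale c Z, c *s z)) \<phi> jacobi_domain"
  unfolding holomorphic_wrt_def
proof
  fix x assume x: "x \<in> jacobi_domain"
  obtain Z z where Zz: "x = (Z, z)" "Z \<in> siegel_space" using x by (cases x) (auto simp: jacobi_domain_def)
  let ?I = "half_integral \<times> (UNIV :: (int^2) set)"
  obtain \<epsilon> where \<epsilon>: "\<epsilon> > 0"
    "(\<lambda>i. norm ((\<lambda>(T, t). c T t) i * exp (jacobi_exponent i x)) * exp (\<epsilon> * exponent_size i)) summable_on ?I"
    unfolding Zz(1) by (rule jacobi_series_weighted_summable[OF exp Zz(2), of z]) blast
  have lin: "linear (jacobi_exponent i)" for i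
  proof (rule linearI)
    fix u v :: "(complex^2^2) \<times> (complex^2)" and a :: real
    obtain T t where i: "i = (T, t)" by (cases i)
    obtain U p where u: "u = (U, p)" by (cases u)
    obtain V q where v: "v = (V, q)" by (cases v)
    show "jacobi_exponent i (u + v) = jacobi_exponent i u + jacobi_exponent i v"
      by (simp add: i u v jacobi_exponent_alt algebra_simps)
    show "jacobi_exponent i (a *\<^sub>R v) = a *\<^sub>R jacobi_exponent i v"
      unfolding i v scaleR_Pair jacobi_exponent_alt vector_scaleR_component
      by (simp add: scaleR_conv_of_real algebra_simps)
  qed
  have bound: "norm (jacobi_exponent i v) \<le> exponent_size i * norm v" if i: "i \<in> ?I" for i v
  proof -
    obtain T t where Tt: "i = (T, t)" by (cases i)
    obtain W w where Ww: "v = (W, w)" by (cases v)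
    have Ts: "T $ 2 $ 1 = T $ 1 $ 2"
    proof -
      have "transpose T = T" using i by (simp add: Tt half_integral_def)
      from arg_cong[OF this, of "\<lambda>M. M $ 1 $ 2"] show ?thesis by (simp add: transpose_def)
    qed
    have W: "norm (W $ a $ b) \<le> norm v" for a b
      using Finite_Cartesian_Product.norm_nth_le[of W a] Finite_Cartesian_Product.norm_nth_le[of "W $ a" b] norm_fst_le[of W w] by (simp add: Ww)
    have w: "norm (w $ a) \<le> norm v" for a
      using Finite_Cartesian_Product.norm_nth_le[of w a] norm_snd_le[of w W] by (simp add: Ww)
    have n: "norm (a1 + a2 + a3 + a4 + a5 + a6) \<le> norm a1 + norm a2 + norm a3 + norm a4 + norm a5 + norm a6"
      for a1 a2 a3 a4 a5 a6 :: complex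
      using norm_triangle_ineq[of "a1+a2+a3+a4+a5" a6] norm_triangle_ineq[of "a1+a2+a3+a4" a5]
        norm_triangle_ineq[of "a1+a2+a3" a4] norm_triangle_ineq[of "a1+a2" a3] norm_triangle_ineq[of a1 a2] by linarith
    have "norm (jacobi_exponent i v) = 2 * pi * norm (of_real (T $ 1 $ 1) * W $ 1 $ 1 + of_real (T $ 1 $ 2) * W $ 2 $ 1
     + of_real (T $ 1 $ 2) * W $ 1 $ 2 + of_real (T $ 2 $ 2) * W $ 2 $ 2
     + of_int (t $ 1) * w $ 1 + of_int (t $ 2) * w $ 2)"
      by (simp add: Tt Ww jacobi_exponent_alt Ts norm_mult)
    also have "\<dots> \<le> 2 * pi * (\<bar>T $ 1 $ 1\<bar> * norm (W $ 1 $ 1) + \<bar>T $ 1 $ 2\<bar> * norm (W $ 2 $ 1)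
     + \<bar>T $ 1 $ 2\<bar> * norm (W $ 1 $ 2) + \<bar>T $ 2 $ 2\<bar> * norm (W $ 2 $ 2)
     + \<bar>of_int (t $ 1)\<bar> * norm (w $ 1) + \<bar>of_int (t $ 2)\<bar> * norm (w $ 2))"
      by (intro mult_left_mono order_trans[OF n]) (simp_all add: norm_mult)
    also have "\<dots> \<le> 2 * pi * (\<bar>T $ 1 $ 1\<bar> * norm v + \<bar>T $ 1 $ 2\<bar> * norm v
     + \<bar>T $ 1 $ 2\<bar> * norm v + \<bar>T $ 2 $ 2\<bar> * norm v
     + \<bar>of_int (t $ 1)\<bar> * norm v + \<bar>of_int (t $ 2)\<bar> * norm v)"
      by (intro mult_left_mono add_mono W w) auto
    also have "\<dots> = exponent_size i * norm v" by (simp add: exponent_size_def Tt algebra_simps)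
    finally show ?thesis .
  qed
  have size: "exponent_size i \<ge> 0" for i by (cases i) (simp add: exponent_size_def)
  have sums: "((\<lambda>i. (\<lambda>(T, t). c T t) i * exp (jacobi_exponent i y)) has_sum \<phi> y) ?I" if yd: "y \<in> jacobi_domain" for y
  proof -
    obtain Z' z' where y: "y = (Z', z')" "Z' \<in> siegel_space" using yd by (cases y) (auto simp: jacobi_domain_def)
    show ?thesis unfolding y(1)
      by (rule has_sum_eqI[OF exp[unfolded jacobi_fourier_expansion_def, rule_format, OF y(2)]])
         (auto simp: jacobi_exponent_def e2pi_def)
  qed
  let ?L = "\<lambda>v. \<Sum>\<^sub>\<infinity>i\<in>?I. (\<lambda>(T, t). c T t) i * exp (jacobi_exponent i x) * jacobi_exponent i v"
  have "(\<phi> has_derivative ?L) (at x within jacobi_domain)"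
    by (rule exp_series_has_derivative[OF lin bound size \<epsilon> sums x])
  moreover have "?L ((\<lambda>(Z, z). (mscale a Z, a *s z)) v) = a * ?L v" for a v
  proof -
    have "jacobi_exponent i ((\<lambda>(Z, z). (mscale a Z, a *s z)) v) = a * jacobi_exponent i v" for i
      by (cases i; cases v) (simp add: jacobi_exponent_alt mscale_def algebra_simps)
    then show ?thesis by (simp add: infsum_cmult_right'[symmetric] mult_ac)
  qed
  ultimately show "\<exists>L. (\<phi> has_derivative L) (at x within jacobi_domain)
      \<and> (\<forall>a v. L ((\<lambda>(Z, z). (mscale a Z, a *s z)) v) = a * L v)"
    by blast
qed

section \<open>Fourier-Jacobi coefficients are Jacobi forms\<close>

lemma bordered_matrix_nth [simp]:
  "bordered_matrix X x w $ 1 $ 1 = X $ 1 $ 1" "bordered_matrix X x w $ 1 $ 2 = X $ 1 $ 2"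
  "bordered_matrix X x w $ 2 $ 1 = X $ 2 $ 1" "bordered_matrix X x w $ 2 $ 2 = X $ 2 $ 2"
  "bordered_matrix X x w $ 1 $ 3 = x $ 1" "bordered_matrix X x w $ 2 $ 3 = x $ 2"
  "bordered_matrix X x w $ 3 $ 1 = x $ 1" "bordered_matrix X x w $ 3 $ 2 = x $ 2"
  "bordered_matrix X x w $ 3 $ 3 = w"
  by (simp_all add: bordered_matrix_def)

lemma bordered_siegel:
  assumes Z: "Z \<in> siegel_space"
  obtains h where "\<And>w. Im w > h \<Longrightarrow> bordered_matrix Z z w \<in> siegel_space"
proof -
  have "positive_definite (map_matrix Im Z)" using Z by (simp add: siegel_space_def)
  then obtain \<delta> where \<delta>: "\<delta> > 0" "\<And>a b. \<delta> * (a\<^sup>2 + b\<^sup>2)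
      \<le> Im (Z $ 1 $ 1) * a\<^sup>2 + 2 * Im (Z $ 1 $ 2) * a * b + Im (Z $ 2 $ 2) * b\<^sup>2"
    using positive_definite_2_lower[of "map_matrix Im Z"] by auto
  have Zs: "Z $ 2 $ 1 = Z $ 1 $ 2" by (rule siegel_space_sym_nth[OF Z])
  define y1 y2 where "y1 = Im (z $ 1)" and "y2 = Im (z $ 2)"
  have "bordered_matrix Z z w \<in> siegel_space" if w: "Im w > (y1\<^sup>2 + y2\<^sup>2) / \<delta>" for w
  proof -
    have "0 < x \<bullet> (map_matrix Im (bordered_matrix Z z w) *v x)" if x: "x \<noteq> 0" for x
    proof -
      define a b c where "a = x $ 1" and "b = x $ 2" and "c = x $ 3"
      have abc: "a \<noteq> 0 \<or> b \<noteq> 0 \<or> c \<noteq> 0" using x by (auto simp: vec_eq_iff forall_3 a_def b_def c_def)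
      have eq: "x \<bullet> (map_matrix Im (bordered_matrix Z z w) *v x)
        = (Im (Z $ 1 $ 1) * a\<^sup>2 + 2 * Im (Z $ 1 $ 2) * a * b + Im (Z $ 2 $ 2) * b\<^sup>2)
          + 2 * c * (y1 * a + y2 * b) + Im w * c\<^sup>2"
        by (simp add: inner_vec_def matrix_vector_mult_def sum_3 Zs a_def b_def c_def y1_def y2_def
            power2_eq_square algebra_simps)
      have "\<delta> * (\<delta> * (a\<^sup>2 + b\<^sup>2) + 2 * c * (y1 * a + y2 * b) + Im w * c\<^sup>2)
          = (\<delta> * a + c * y1)\<^sup>2 + (\<delta> * b + c * y2)\<^sup>2 + (\<delta> * Im w - (y1\<^sup>2 + y2\<^sup>2)) * c\<^sup>2"
        by (simp add: power2_eq_square algebra_simps)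
      also have "\<dots> > 0"
      proof -
        have d: "\<delta> * Im w - (y1\<^sup>2 + y2\<^sup>2) > 0" using w \<delta>(1) by (simp add: field_simps)
        show ?thesis
        proof (cases "c = 0")
          case True
          with abc have "a \<noteq> 0 \<or> b \<noteq> 0" by simp
          then show ?thesis using True \<delta>(1) by (simp add: sum_power2_gt_zero_iff)
        next
          case False
          with d show ?thesis by (intro add_nonneg_pos) auto
        qed
      qed
      finally have "0 < \<delta> * (a\<^sup>2 + b\<^sup>2) + 2 * c * (y1 * a + y2 * b) + Im w * c\<^sup>2"
        using \<delta>(1) by (simp add: zero_less_mult_iff)
      with \<delta>(2)[of a b] show ?thesis unfolding eq by linarith
    qed
    then show ?thesis
      unfolding siegel_space_def positive_definite_def
      by (auto simp: transpose_def vec_eq_iff forall_3 Zs)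
  qed
  then show thesis using that by blast
qed

text \<open>A Fourier-Jacobi expansion is a power series in \<open>e(w)\<close>, so it can be compared coefficientwise
  on a horizontal line far up.\<close>
lemma fourier_jacobi_coefficient_unique:
  assumes a: "\<And>w. Im w > h \<Longrightarrow> ((\<lambda>m. a m * e2pi (of_nat m * w)) has_sum G w) {1..}"
    and b: "\<And>w. Im w > h' \<Longrightarrow> ((\<lambda>m. b m * e2pi (of_nat m * w)) has_sum G w) {1..}"
    and m: "m \<ge> (1 :: nat)"
  shows "a m = b m"
proof -
  define w0 where "w0 = \<i> * of_real (max h h' + 1)"
  have w0: "Im (w0 + of_real x) > h" "Im (w0 + of_real x) > h'" for x by (simp_all add: w0_def)
  have *: "((\<lambda>m. (a m * e2pi (of_nat m * w0)) * e2pi (of_real (real m \<bullet> x))) has_sum G (w0 + of_real x)) {1..}"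
    if "\<And>w. Im w > h'' \<Longrightarrow> ((\<lambda>m. a m * e2pi (of_nat m * w)) has_sum G w) {1..}"
      "Im (w0 + of_real x) > h''" for a h'' x
    by (rule has_sum_eqI[OF that(1)[OF that(2)]]) (auto simp: distrib_left e2pi_add)
  have "inj_on real {1..}" by (simp add: inj_on_def)
  from fourier_coefficients_unique[OF this *[OF a w0(1)] *[OF b w0(2)]] m
  have "a m * e2pi (of_nat m * w0) = b m * e2pi (of_nat m * w0)" by simp
  then show ?thesis by simp
qed

lemma fourier_jacobi_transform:
  assumes FJ: "fourier_jacobi_expansion F \<Phi>" and Z: "Z \<in> siegel_space" and Z': "Z' \<in> siegel_space"
    and tr: "\<And>w. bordered_matrix Z z w \<in> siegel_space \<Longrightarrow>
      F (bordered_matrix Z' z' (w + \<kappa>)) = j * F (bordered_matrix Z z w)"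
    and m: "m \<ge> 1"
  shows "\<Phi> m (Z', z') * e2pi (of_nat m * \<kappa>) = j * \<Phi> m (Z, z)"
proof -
  obtain h where h: "\<And>w. Im w > h \<Longrightarrow> bordered_matrix Z z w \<in> siegel_space"
    using bordered_siegel[OF Z, of z] by metis
  obtain h' where h': "\<And>w. Im w > h' \<Longrightarrow> bordered_matrix Z' z' w \<in> siegel_space"
    using bordered_siegel[OF Z', of z'] by metis
  have sum: "((\<lambda>m. \<Phi> m (Z, z) * e2pi (of_nat m * w)) has_sum F (bordered_matrix Z z w)) {1..}"
    if "bordered_matrix Z z w \<in> siegel_space" for Z z w
    using FJ that by (simp add: fourier_jacobi_expansion_def)
  define H where "H = max h (h' - Im \<kappa>)"
  show ?thesis
  proof (rule fourier_jacobi_coefficient_unique[OF _ _ m])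
    fix w assume "Im w > H"
    then have w: "Im w > h" "Im (w + \<kappa>) > h'" by (auto simp: H_def)
    show "((\<lambda>m. (\<Phi> m (Z', z') * e2pi (of_nat m * \<kappa>)) * e2pi (of_nat m * w)) has_sum j * F (bordered_matrix Z z w)) {1..}"
      by (rule has_sum_eqI[OF sum[OF h'[OF w(2)]]]) (simp_all add: tr h w distrib_left e2pi_add)
    show "((\<lambda>m. (j * \<Phi> m (Z, z)) * e2pi (of_nat m * w)) has_sum j * F (bordered_matrix Z z w)) {1..}"
      by (rule has_sum_eqI[OF has_sum_cmult_right[where c = j, OF sum[OF h[OF w(1)]]]]) simp_all
  qed
qed

context
  fixes r :: int and F :: "complex^3^3 \<Rightarrow> complex"
  assumes F: "siegel_modular_transformation r F"
begin

lemma siegel_form_translation: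
  assumes Z: "Z \<in> siegel_space" and B: "transpose B = B"
  shows "F (Z + cmat B) = F Z"
proof -
  have "matrix_inv (mat 1 :: complex^3^3) = mat 1" by (rule matrix_inv_eqI) simp
  then show ?thesis
    using F[unfolded siegel_modular_transformation_def, rule_format, OF translation_symplectic[OF B] Z]
    by (simp add: siegel_action_def automorphy_matrix_def)
qed

lemma siegel_form_linear:
  assumes Z: "Z \<in> siegel_space" and UW: "transpose U ** W = mat 1"
  shows "F (cmat U ** Z ** transpose (cmat U)) = of_int (det U) powi r * F Z"
  using F[unfolded siegel_modular_transformation_def, rule_format, OF linear_symplectic[OF UW] Z]
  by (simp add: linear_action[OF UW] det_cmat_3 det_unimodular(2)[OF UW])

lemma siegel_form_inversion:
  assumes Z: "Z \<in> siegel_space"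
  shows "F (partial_inversion i Z) = Z $ i $ i powi r * F Z"
proof -
  have "det (automorphy_matrix (unit_entry i) (unit_except i) Z) = Z $ i $ i"
    using exhaust_3[of i] by (auto simp: det_3 automorphy_inversion_nth)
  then show ?thesis
    using F[unfolded siegel_modular_transformation_def, rule_format, OF inversion_symplectic Z]
    by (simp add: inversion_action siegel_space_diagonal[OF Z])
qed

lemma fourier_jacobi_modular:
  assumes FJ: "fourier_jacobi_expansion F \<Phi>"
  shows "jacobi_modular_transformation r (\<Phi> 1)"
proof (rule jacobi_modular_transformationI)
  fix B :: "int^2^2" and Z :: "complex^2^2" and z
  assume Z: "Z \<in> siegel_space" and B: "transpose B = B"
  have B12: "B $ 2 $ 1 = B $ 1 $ 2" using arg_cong[OF B, of "\<lambda>M. M $ 1 $ 2"] by (simp add: transpose_def)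
  have "\<Phi> 1 (Z + cmat B, z) * e2pi (of_nat 1 * 0) = 1 * \<Phi> 1 (Z, z)"
  proof (rule fourier_jacobi_transform[OF FJ Z translation_siegel_int[OF Z B]])
    fix w assume bs: "bordered_matrix Z z w \<in> siegel_space"
    have "bordered_matrix (Z + cmat B) z (w + 0) = bordered_matrix Z z w + cmat (bordered_matrix B 0 0)"
      by (simp add: vec_eq_iff forall_3)
    moreover have "transpose (bordered_matrix B 0 0) = bordered_matrix B 0 0"
      by (simp add: vec_eq_iff forall_3 transpose_def B12)
    ultimately show "F (bordered_matrix (Z + cmat B) z (w + 0)) = 1 * F (bordered_matrix Z z w)"
      using siegel_form_translation[OF bs] by simp
  qed simp
  then show "\<Phi> 1 (Z + cmat B, z) = \<Phi> 1 (Z, z)" by simp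
next
  fix U W :: "int^2^2" and Z :: "complex^2^2" and z
  assume Z: "Z \<in> siegel_space" and UW: "transpose U ** W = mat 1"
  define V :: "int^3^3" where "V = vector [vector [U $ 1 $ 1, U $ 1 $ 2, 0], vector [U $ 2 $ 1, U $ 2 $ 2, 0], vector [0, 0, 1]]"
  define V' :: "int^3^3" where "V' = vector [vector [W $ 1 $ 1, W $ 1 $ 2, 0], vector [W $ 2 $ 1, W $ 2 $ 2, 0], vector [0, 0, 1]]"
  have VV: "transpose V ** V' = mat 1"
  proof -
    have "(transpose U ** W) $ i $ j = mat 1 $ i $ j" for i j by (simp add: UW)
    from this[of 1 1] this[of 1 2] this[of 2 1] this[of 2 2] show ?thesis
      by (simp add: vec_eq_iff forall_3 matrix_matrix_mult_def transpose_def sum_3 sum_2 mat_def V_def V'_def)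
  qed
  have det: "det V = det U" by (simp add: det_2 det_3 V_def)
  have "\<Phi> 1 (cmat U ** Z ** transpose (cmat U), cmat U *v z) * e2pi (of_nat 1 * 0)
      = of_int (det U) powi r * \<Phi> 1 (Z, z)"
  proof (rule fourier_jacobi_transform[OF FJ Z linear_siegel[OF Z UW]])
    fix w assume bs: "bordered_matrix Z z w \<in> siegel_space"
    have "bordered_matrix (cmat U ** Z ** transpose (cmat U)) (cmat U *v z) (w + 0)
        = cmat V ** bordered_matrix Z z w ** transpose (cmat V)"
      by (simp add: vec_eq_iff forall_3 matrix_matrix_mult_def matrix_vector_mult_def transpose_def
          sum_3 sum_2 V_def algebra_simps)
    with siegel_form_linear[OF bs VV]
    show "F (bordered_matrix (cmat U ** Z ** transpose (cmat U)) (cmat U *v z) (w + 0))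
        = of_int (det U) powi r * F (bordered_matrix Z z w)"
      by (simp add: det)
  qed simp
  then show "\<Phi> 1 (cmat U ** Z ** transpose (cmat U), cmat U *v z) = of_int (det U) powi r * \<Phi> 1 (Z, z)"
    by simp
next
  fix i :: 2 and Z :: "complex^2^2" and z
  assume Z: "Z \<in> siegel_space"
  define k :: 3 where "k = (if i = 1 then 1 else 2)"
  have "\<Phi> 1 (partial_inversion i Z, partial_inversion_vec i Z z) * e2pi (of_nat 1 * (- ((z $ i)\<^sup>2 / Z $ i $ i)))
      = Z $ i $ i powi r * \<Phi> 1 (Z, z)"
  proof (rule fourier_jacobi_transform[OF FJ Z partial_inversion_siegel_2[OF Z]])
    fix w assume bs: "bordered_matrix Z z w \<in> siegel_space"
    have "bordered_matrix (partial_inversion i Z) (partial_inversion_vec i Z z) (w + - ((z $ i)\<^sup>2 / Z $ i $ i))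
        = partial_inversion k (bordered_matrix Z z w)"
      using exhaust_2[of i] siegel_space_sym_nth[OF Z, of 1 2]
      by (auto simp: vec_eq_iff forall_3 partial_inversion_def partial_inversion_vec_def k_def power2_eq_square)
    moreover have "bordered_matrix Z z w $ k $ k = Z $ i $ i"
      using exhaust_2[of i] by (auto simp: k_def)
    ultimately show "F (bordered_matrix (partial_inversion i Z) (partial_inversion_vec i Z z) (w + - ((z $ i)\<^sup>2 / Z $ i $ i)))
        = Z $ i $ i powi r * F (bordered_matrix Z z w)"
      using siegel_form_inversion[OF bs, of k] by simp
  qed simp
  then show "\<Phi> 1 (partial_inversion i Z, partial_inversion_vec i Z z) * e2pi (- ((z $ i)\<^sup>2 / Z $ i $ i))
      = Z $ i $ i powi r * \<Phi> 1 (Z, z)"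
    by simp
qed

lemma fourier_jacobi_lattice:
  assumes FJ: "fourier_jacobi_expansion F \<Phi>"
  shows "jacobi_lattice_transformation (\<Phi> 1)"
  unfolding jacobi_lattice_transformation_def
proof (intro allI ballI)
  fix l m :: "int^2" and Z :: "complex^2^2" and z
  assume Z: "Z \<in> siegel_space"
  have Zs: "Z $ 2 $ 1 = Z $ 1 $ 2" by (rule siegel_space_sym_nth[OF Z])
  define V :: "int^3^3" where "V = vector [vector [1, 0, 0], vector [0, 1, 0], vector [l $ 1, l $ 2, 1]]"
  define V' :: "int^3^3" where "V' = vector [vector [1, 0, - l $ 1], vector [0, 1, - l $ 2], vector [0, 0, 1]]"
  have VV: "transpose V ** V' = mat 1"
    by (simp add: vec_eq_iff forall_3 matrix_matrix_mult_def transpose_def sum_3 mat_def V_def V'_def)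
  have det: "det V = 1" by (simp add: det_3 V_def)
  define k where "k = bilin (cvec l) (Z *v cvec l) + 2 * bilin (cvec l) z"
  have "\<Phi> 1 (Z, z + Z *v cvec l + cvec m) * e2pi (of_nat 1 * k) = 1 * \<Phi> 1 (Z, z)"
  proof (rule fourier_jacobi_transform[OF FJ Z Z])
    fix w assume bs: "bordered_matrix Z z w \<in> siegel_space"
    let ?Y = "cmat V ** bordered_matrix Z z w ** transpose (cmat V)"
    have "bordered_matrix Z (z + Z *v cvec l + cvec m) (w + k) = ?Y + cmat (bordered_matrix 0 m 0)"
      by (simp add: vec_eq_iff forall_3 matrix_matrix_mult_def matrix_vector_mult_def transpose_def
          sum_3 sum_2 V_def k_def bilin_def cvec_def Zs algebra_simps)
    moreover have "transpose (bordered_matrix 0 m 0) = bordered_matrix 0 m 0"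
      by (simp add: vec_eq_iff forall_3 transpose_def)
    moreover have "?Y \<in> siegel_space" by (rule linear_siegel[OF bs VV])
    ultimately show "F (bordered_matrix Z (z + Z *v cvec l + cvec m) (w + k)) = 1 * F (bordered_matrix Z z w)"
      using siegel_form_translation[of ?Y "bordered_matrix 0 m 0"] siegel_form_linear[OF bs VV] by (simp add: det)
  qed simp
  then have "\<Phi> 1 (Z, z + Z *v cvec l + cvec m) * e2pi k = \<Phi> 1 (Z, z)" by simp
  then show "\<Phi> 1 (Z, z + Z *v cvec l + cvec m)
      = e2pi (- (bilin (cvec l) (Z *v cvec l) + 2 * bilin (cvec l) z)) * \<Phi> 1 (Z, z)"
    unfolding k_def[symmetric] e2pi_minus by (simp add: field_simps)
qed

end

lemma trace_bordered:
  "trace (map_matrix of_real (bordered_matrix T (\<chi> i. of_int (t $ i) / 2) m) ** bordered_matrix Z z w)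
    = trace (map_matrix of_real T ** Z) + bilin (cvec t) z + of_real m * w"
  by (simp add: trace_def matrix_matrix_mult_def sum_3 sum_2 bilin_def cvec_def)

lemma half_integral_bordered_bij:
  "bij_betw (\<lambda>(T, t). bordered_matrix T (\<chi> i. of_int (t $ i) / 2) 1)
     (half_integral \<times> (UNIV :: (int^2) set)) {T \<in> half_integral. T $ 3 $ 3 = 1}"
proof -
  define g :: "real^3^3 \<Rightarrow> (real^2^2) \<times> (int^2)" where
    "g T = (vector [vector [T $ 1 $ 1, T $ 1 $ 2], vector [T $ 2 $ 1, T $ 2 $ 2]],
      vector [\<lfloor>2 * T $ 1 $ 3\<rfloor>, \<lfloor>2 * T $ 2 $ 3\<rfloor>])" for T
  show ?thesis
  proof (rule bij_betwI[where g = g])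
  show "(\<lambda>(T, t). bordered_matrix T (\<chi> i. of_int (t $ i) / 2) 1)
      \<in> half_integral \<times> (UNIV :: (int^2) set) \<rightarrow> {T \<in> half_integral. T $ 3 $ 3 = 1}"
  proof
    fix x :: "(real^2^2) \<times> (int^2)" assume "x \<in> half_integral \<times> UNIV"
    then obtain T t where x: "x = (T, t)" and T: "transpose T = T" "\<And>i. T $ i $ i \<in> \<int>" "\<And>i j. 2 * T $ i $ j \<in> \<int>"
      by (cases x) (auto simp: half_integral_def)
    have "T $ 2 $ 1 = T $ 1 $ 2" using arg_cong[OF T(1), of "\<lambda>M. M $ 1 $ 2"] by (simp add: transpose_def)
    then show "(\<lambda>(T, t). bordered_matrix T (\<chi> i. of_int (t $ i) / 2) 1) x \<in> {T \<in> half_integral. T $ 3 $ 3 = 1}"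
      using T(2,3) by (simp add: x half_integral_def transpose_def vec_eq_iff forall_3)
  qed
next
  show "g
      \<in> {T \<in> half_integral. T $ 3 $ 3 = 1} \<rightarrow> half_integral \<times> (UNIV :: (int^2) set)"
  proof
    fix T :: "real^3^3" assume "T \<in> {T \<in> half_integral. T $ 3 $ 3 = 1}"
    then have T: "transpose T = T" "\<And>i. T $ i $ i \<in> \<int>" "\<And>i j. 2 * T $ i $ j \<in> \<int>"
      by (auto simp: half_integral_def)
    have "T $ 2 $ 1 = T $ 1 $ 2" using arg_cong[OF T(1), of "\<lambda>M. M $ 1 $ 2"] by (simp add: transpose_def)
    then show "g T \<in> half_integral \<times> (UNIV :: (int^2) set)"
      using T(2,3) by (simp add: g_def half_integral_def transpose_def vec_eq_iff forall_2)
  qed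
next
  fix x :: "(real^2^2) \<times> (int^2)" assume "x \<in> half_integral \<times> UNIV"
  show "g ((\<lambda>(T, t). bordered_matrix T (\<chi> i. of_int (t $ i) / 2) 1) x) = x"
    by (cases x) (simp add: g_def vec_eq_iff forall_2)
next
  fix T :: "real^3^3" assume T: "T \<in> {T \<in> half_integral. T $ 3 $ 3 = 1}"
  then have sym: "transpose T = T" and int: "\<And>i j. 2 * T $ i $ j \<in> \<int>" and "T $ 3 $ 3 = 1"
    by (simp_all add: half_integral_def)
  have s: "T $ i $ j = T $ j $ i" for i j
    using arg_cong[OF sym, of "\<lambda>M. M $ i $ j"] by (simp add: transpose_def)
  have fl: "real_of_int \<lfloor>2 * T $ i $ j\<rfloor> = 2 * T $ i $ j" for i j
    using int[of i j] by (auto elim!: Ints_cases)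
  show "(\<lambda>(T, t). bordered_matrix T (\<chi> i. of_int (t $ i) / 2) 1)
      (g T) = T"
    using \<open>T $ 3 $ 3 = 1\<close> by (simp add: g_def vec_eq_iff forall_3 s[of 3 1] s[of 3 2] fl)
  qed
qed

lemma fourier_jacobi_fourier:
  assumes a: "siegel_fourier_expansion F a" and cusp: "\<And>T. T \<in> half_integral \<Longrightarrow> a T \<noteq> 0 \<Longrightarrow> positive_definite T"
    and FJ: "fourier_jacobi_expansion F \<Phi>"
  shows "jacobi_fourier_expansion (\<Phi> 1) (\<lambda>T t. a (bordered_matrix T (\<chi> i. of_int (t $ i) / 2) 1))"
  unfolding jacobi_fourier_expansion_def
proof (intro ballI allI)
  fix Z :: "complex^2^2" and z :: "complex^2" assume Z: "Z \<in> siegel_space"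
  obtain h where h: "\<And>w. Im w > h \<Longrightarrow> bordered_matrix Z z w \<in> siegel_space"
    using bordered_siegel[OF Z, of z] by metis
  define X :: "nat \<Rightarrow> (real^3^3) set" where "X m = {T \<in> half_integral. T $ 3 $ 3 = real m}" for m
  define f where "f w T = a T * e2pi (trace (map_matrix of_real T ** bordered_matrix Z z w))" for w T
  have tr: "trace (map_matrix of_real T ** bordered_matrix Z z w)
      = trace (map_matrix of_real T ** bordered_matrix Z z 0) + of_real (T $ 3 $ 3) * w" for T w
    by (simp add: trace_def matrix_matrix_mult_def sum_3)
  have f: "f w T = f 0 T * e2pi (of_nat m * w)" if "T \<in> X m" for T m w
    using that by (simp add: f_def tr[of _ w] e2pi_add X_def)
  define g where "g m = infsum (f 0) (X m)" for m
  have hs: "(f w has_sum F (bordered_matrix Z z w)) (\<Union>m\<in>{1..}. X m)" if w: "Im w > h" for w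
  proof -
    have "(f w has_sum F (bordered_matrix Z z w)) half_integral"
      using a h[OF w] by (simp add: siegel_fourier_expansion_def f_def[abs_def])
    moreover have "f w T = 0" if T: "T \<in> half_integral - (\<Union>m\<in>{1..}. X m)" for T
    proof (rule ccontr)
      assume "f w T \<noteq> 0"
      then have "positive_definite T" using cusp T by (auto simp: f_def)
      then have pos: "T $ 3 $ 3 > 0" by (rule positive_definite_diagonal)
      have "T $ 3 $ 3 \<in> \<int>" using T by (auto simp: half_integral_def)
      then obtain k :: int where k: "T $ 3 $ 3 = of_int k" by (auto elim: Ints_cases)
      with pos have "T \<in> X (nat k)" "nat k \<ge> 1" using T by (auto simp: X_def)
      then show False using T by auto
    qed
    ultimately show ?thesis
      by (subst has_sum_cong_neutral[where T = half_integral and g = "f w"]) (auto simp: X_def)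
  qed
  have g: "(f 0 has_sum g m) (X m)" if m: "m \<ge> 1" for m
  proof -
    define w where "w = \<i> * of_real (h + 1)"
    have "f w summable_on (\<Union>m\<in>{1..}. X m)"
      using hs[of w] has_sum_imp_summable by (simp add: w_def)
    then have "f w summable_on X m" by (rule summable_on_subset_banach) (use m in auto)
    then have "(\<lambda>T. f w T * inverse (e2pi (of_nat m * w))) summable_on X m" by (rule summable_on_cmult_left)
    then have "f 0 summable_on X m"
      by (rule summable_on_cong[THEN iffD1, rotated]) (simp add: f[of _ m w])
    then show ?thesis by (simp add: g_def)
  qed
  have gw: "((\<lambda>m. g m * e2pi (of_nat m * w)) has_sum F (bordered_matrix Z z w)) {1..}" if w: "Im w > h" for w
  proof (rule has_sum_SigmaD)
    have inj: "inj_on snd (SIGMA m:{1..}. X m)" by (auto simp: inj_on_def X_def)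
    have im: "snd ` (SIGMA m:{1..}. X m) = (\<Union>m\<in>{1..}. X m)" by force
    have "((f w \<circ> snd) has_sum F (bordered_matrix Z z w)) (SIGMA m:{1..}. X m)"
      unfolding has_sum_reindex[OF inj, symmetric] im by (rule hs[OF w])
    then show "((\<lambda>p. f w (snd p)) has_sum F (bordered_matrix Z z w)) (SIGMA m:{1..}. X m)" by (simp add: o_def)
    fix m :: nat assume "m \<in> {1..}"
    then have "m \<ge> 1" by simp
    show "((\<lambda>T. f w (snd (m, T))) has_sum g m * e2pi (of_nat m * w)) (X m)"
      by (rule has_sum_eqI[OF has_sum_cmult_left[where c = "e2pi (of_nat m * w)", OF g[OF \<open>m \<ge> 1\<close>]]]) (simp_all add: f[of _ m w])
  qed
  have "\<Phi> 1 (Z, z) = g 1"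
  proof (rule fourier_jacobi_coefficient_unique[OF _ gw])
    fix w assume "Im w > h"
    then show "((\<lambda>m. \<Phi> m (Z, z) * e2pi (of_nat m * w)) has_sum F (bordered_matrix Z z w)) {1..}"
      using FJ h by (simp add: fourier_jacobi_expansion_def)
  qed auto
  with g[of 1] have "(f 0 has_sum \<Phi> 1 (Z, z)) {T \<in> half_integral. T $ 3 $ 3 = 1}" by (simp add: X_def)
  then have "((\<lambda>p. f 0 ((\<lambda>(T, t). bordered_matrix T (\<chi> i. of_int (t $ i) / 2) 1) p)) has_sum \<Phi> 1 (Z, z))
      (half_integral \<times> UNIV)"
    by (subst has_sum_reindex_bij_betw[OF half_integral_bordered_bij])
  then show "((\<lambda>(T, t). a (bordered_matrix T (\<chi> i. of_int (t $ i) / 2) 1) *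
      e2pi (trace (map_matrix of_real T ** Z) + bilin (cvec t) z)) has_sum \<Phi> 1 (Z, z)) (half_integral \<times> UNIV)"
    by (rule has_sum_eqI) (auto simp: f_def trace_bordered)
qed

theorem fourier_jacobi_subset: "fourier_jacobi_cusp_forms r \<subseteq> jacobi_cusp_forms r"
proof
  fix \<phi> assume "\<phi> \<in> fourier_jacobi_cusp_forms r"
  then obtain F \<Phi> where \<phi>: "\<phi> = \<Phi> 1" and F: "F \<in> siegel_cusp_forms r" and FJ: "fourier_jacobi_expansion F \<Phi>"
    by (auto simp: fourier_jacobi_cusp_forms_def)
  from F obtain a where a: "siegel_fourier_expansion F a" "\<And>T. T \<in> half_integral \<Longrightarrow> a T \<noteq> 0 \<Longrightarrow> positive_definite T"
    and modular: "siegel_modular_transformation r F"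
    by (auto simp: siegel_cusp_forms_def)
  note exp = fourier_jacobi_fourier[OF a FJ]
  have "bordered_matrix T (\<chi> i. of_int (t $ i) / 2) 1 \<in> half_integral" if "T \<in> half_integral" for T and t :: "int^2"
    using bij_betw_apply[OF half_integral_bordered_bij, of "(T, t)"] that by simp
  with a(2) have "\<exists>c. jacobi_fourier_expansion (\<Phi> 1) c \<and> (\<forall>T\<in>half_integral. \<forall>t. c T t \<noteq> 0 \<longrightarrow>
             positive_definite (bordered_matrix T (\<chi> i. of_int (t $ i) / 2) 1))"
    using exp by blast
  moreover have "\<forall>x. x \<notin> jacobi_domain \<longrightarrow> \<Phi> 1 x = 0"
    using FJ by (simp add: fourier_jacobi_expansion_def)
  ultimately show "\<phi> \<in> jacobi_cusp_forms r"
    unfolding jacobi_cusp_forms_def \<phi> mem_Collect_eq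
    using jacobi_series_holomorphic[OF exp] fourier_jacobi_modular[OF modular FJ] fourier_jacobi_lattice[OF modular FJ]
    by (intro conjI)
qed


lemma siegel_cusp_forms_add:
  assumes "F \<in> siegel_cusp_forms r" "G \<in> siegel_cusp_forms r"
  shows "(\<lambda>Z. F Z + G Z) \<in> siegel_cusp_forms r"
proof -
  from assms obtain c d where c: "siegel_fourier_expansion F c" "\<forall>T\<in>half_integral. c T \<noteq> 0 \<longrightarrow> positive_definite T"
    and d: "siegel_fourier_expansion G d" "\<forall>T\<in>half_integral. d T \<noteq> 0 \<longrightarrow> positive_definite T"
    by (auto simp: siegel_cusp_forms_def)
  have "holomorphic_wrt mscale (\<lambda>Z. F Z + G Z) siegel_space"
    unfolding holomorphic_wrt_def
  proof
    fix Z :: "complex^'a^'a" assume Z: "Z \<in> siegel_space"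
    have hol: "holomorphic_wrt mscale F siegel_space" "holomorphic_wrt mscale G siegel_space"
      using assms by (simp_all add: siegel_cusp_forms_def)
    obtain L where "(F has_derivative L) (at Z within siegel_space)" "\<forall>c v. L (mscale c v) = c * L v"
      using hol(1) Z unfolding holomorphic_wrt_def by blast
    moreover obtain M where "(G has_derivative M) (at Z within siegel_space)" "\<forall>c v. M (mscale c v) = c * M v"
      using hol(2) Z unfolding holomorphic_wrt_def by blast
    ultimately show "\<exists>L. ((\<lambda>Z. F Z + G Z) has_derivative L) (at Z within siegel_space) \<and> (\<forall>c v. L (mscale c v) = c * L v)"
      by (intro exI[of _ "\<lambda>v. L v + M v"] conjI has_derivative_add) (auto simp: distrib_left)
  qed
  moreover have "siegel_modular_transformation r (\<lambda>Z. F Z + G Z)"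
    using assms by (auto simp: siegel_cusp_forms_def siegel_modular_transformation_def distrib_left)
  moreover have "siegel_fourier_expansion (\<lambda>Z. F Z + G Z) (\<lambda>T. c T + d T)"
    using c(1) d(1) by (auto simp: siegel_fourier_expansion_def distrib_right intro!: has_sum_add)
  moreover have "\<forall>T\<in>half_integral. c T + d T \<noteq> 0 \<longrightarrow> positive_definite T"
    using c(2) d(2) by force
  ultimately show ?thesis
    using assms unfolding siegel_cusp_forms_def mem_Collect_eq by (intro conjI exI[of _ "\<lambda>T. c T + d T"]) auto
qed

lemma siegel_cusp_forms_scale:
  assumes "F \<in> siegel_cusp_forms r"
  shows "(\<lambda>Z. a * F Z) \<in> siegel_cusp_forms r"
proof -
  from assms obtain c where c: "siegel_fourier_expansion F c" "\<forall>T\<in>half_integral. c T \<noteq> 0 \<longrightarrow> positive_definite T"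
    by (auto simp: siegel_cusp_forms_def)
  have "holomorphic_wrt mscale (\<lambda>Z. a * F Z) siegel_space"
    unfolding holomorphic_wrt_def
  proof
    fix Z :: "complex^'a^'a" assume Z: "Z \<in> siegel_space"
    have "holomorphic_wrt mscale F siegel_space"
      using assms by (simp add: siegel_cusp_forms_def)
    with Z obtain L where "(F has_derivative L) (at Z within siegel_space)" "\<forall>c v. L (mscale c v) = c * L v"
      unfolding holomorphic_wrt_def by blast
    then show "\<exists>L. ((\<lambda>Z. a * F Z) has_derivative L) (at Z within siegel_space) \<and> (\<forall>c v. L (mscale c v) = c * L v)"
      by (intro exI[of _ "\<lambda>v. a * L v"] conjI has_derivative_mult_right) auto
  qed
  moreover have "siegel_modular_transformation r (\<lambda>Z. a * F Z)"
    using assms by (auto simp: siegel_cusp_forms_def siegel_modular_transformation_def)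
  moreover have "siegel_fourier_expansion (\<lambda>Z. a * F Z) (\<lambda>T. a * c T)"
    using c(1) by (auto simp: siegel_fourier_expansion_def mult.assoc intro!: has_sum_cmult_right)
  moreover have "\<forall>T\<in>half_integral. a * c T \<noteq> 0 \<longrightarrow> positive_definite T"
    using c(2) by force
  ultimately show ?thesis
    using assms unfolding siegel_cusp_forms_def mem_Collect_eq by (intro conjI exI[of _ "\<lambda>T. a * c T"]) auto
qed

lemma siegel_cusp_forms_zero: "(\<lambda>Z. 0) \<in> siegel_cusp_forms r"
  unfolding siegel_cusp_forms_def mem_Collect_eq holomorphic_wrt_def siegel_modular_transformation_def
    siegel_fourier_expansion_def
  by (intro conjI exI[of _ "\<lambda>T. 0"] ballI exI[of _ "\<lambda>v. 0"] has_derivative_const) auto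

theorem fourier_jacobi_subspace:
  "module.subspace (\<lambda>(a :: complex) \<phi> x. a * \<phi> x) (fourier_jacobi_cusp_forms r)"
proof -
  have m: "module (\<lambda>(a :: complex) (\<phi> :: (complex^2^2) \<times> (complex^2) \<Rightarrow> complex) x. a * \<phi> x)"
    by unfold_locales (auto simp: fun_eq_iff algebra_simps)
  show ?thesis
    unfolding module.subspace_def[OF m]
  proof (intro conjI ballI allI)
    have "fourier_jacobi_expansion (\<lambda>Z. 0) (\<lambda>m x. 0)" by (simp add: fourier_jacobi_expansion_def)
    then show "0 \<in> fourier_jacobi_cusp_forms r"
      unfolding fourier_jacobi_cusp_forms_def mem_Collect_eq using siegel_cusp_forms_zero
      by (intro exI[of _ "\<lambda>Z. 0"] exI[of _ "\<lambda>m x. 0"] conjI) (auto simp: fun_eq_iff)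
  next
    fix \<phi> \<psi> assume "\<phi> \<in> fourier_jacobi_cusp_forms r" "\<psi> \<in> fourier_jacobi_cusp_forms r"
    then obtain F \<Phi> G \<Psi> where *: "\<phi> = \<Phi> 1" "F \<in> siegel_cusp_forms r" "fourier_jacobi_expansion F \<Phi>"
      "\<psi> = \<Psi> 1" "G \<in> siegel_cusp_forms r" "fourier_jacobi_expansion G \<Psi>"
      by (auto simp: fourier_jacobi_cusp_forms_def)
    then have "fourier_jacobi_expansion (\<lambda>Z. F Z + G Z) (\<lambda>m x. \<Phi> m x + \<Psi> m x)"
      by (auto simp: fourier_jacobi_expansion_def distrib_right intro!: has_sum_add)
    with * siegel_cusp_forms_add show "\<phi> + \<psi> \<in> fourier_jacobi_cusp_forms r"
      unfolding fourier_jacobi_cusp_forms_def mem_Collect_eq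
      by (intro exI[of _ "\<lambda>Z. F Z + G Z"] exI[of _ "\<lambda>m x. \<Phi> m x + \<Psi> m x"] conjI) (auto simp: fun_eq_iff)
  next
    fix a \<phi> assume "\<phi> \<in> fourier_jacobi_cusp_forms r"
    then obtain F \<Phi> where *: "\<phi> = \<Phi> 1" "F \<in> siegel_cusp_forms r" "fourier_jacobi_expansion F \<Phi>"
      by (auto simp: fourier_jacobi_cusp_forms_def)
    then have "fourier_jacobi_expansion (\<lambda>Z. a * F Z) (\<lambda>m x. a * \<Phi> m x)"
      by (auto simp: fourier_jacobi_expansion_def mult.assoc intro!: has_sum_cmult_right)
    with * siegel_cusp_forms_scale show "(\<lambda>x. a * \<phi> x) \<in> fourier_jacobi_cusp_forms r"
      unfolding fourier_jacobi_cusp_forms_def mem_Collect_eq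
      by (intro exI[of _ "\<lambda>Z. a * F Z"] exI[of _ "\<lambda>m x. a * \<Phi> m x"] conjI) (auto simp: fun_eq_iff)
  qed
qed

definition reverse3 :: "'a::zero^3^3 \<Rightarrow> 'a^3^3" where
  "reverse3 M = vector [vector [M $ 3 $ 3, M $ 3 $ 2, M $ 3 $ 1], vector [M $ 2 $ 3, M $ 2 $ 2, M $ 2 $ 1],
     vector [M $ 1 $ 3, M $ 1 $ 2, M $ 1 $ 1]]"

text \<open>Reversing the order of the three variables is a unimodular substitution of determinant \<open>-1\<close>. It
  moves the distinguished diagonal entry, so it is not visible in the group under which Jacobi forms
  transform.\<close>
lemma siegel_coefficient_reverse:
  assumes modular: "siegel_modular_transformation r F" and a: "siegel_fourier_expansion F a"
    and r: "even r" and T: "T \<in> half_integral"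
  shows "a (reverse3 T) = a T"
proof (rule siegel_fourier_unique[OF _ a T])
  define V :: "int^3^3" where "V = vector [vector [0, 0, 1], vector [0, 1, 0], vector [1, 0, 0]]"
  have VV: "transpose V ** V = mat 1"
    by (simp add: vec_eq_iff forall_3 matrix_matrix_mult_def transpose_def sum_3 mat_def V_def)
  have det: "det V = - 1" by (simp add: det_3 V_def)
  have VZ: "cmat V ** Z ** transpose (cmat V) = reverse3 Z" for Z
    by (simp add: vec_eq_iff forall_3 matrix_matrix_mult_def transpose_def sum_3 V_def reverse3_def)
  have inv: "reverse3 (reverse3 M) = M" for M :: "'b::zero^3^3"
    by (simp add: vec_eq_iff forall_3 reverse3_def)
  have half: "reverse3 T \<in> half_integral" if "T \<in> half_integral" for T
  proof -
    from that have T: "transpose T = T" "\<And>i. T $ i $ i \<in> \<int>" "\<And>i j. 2 * T $ i $ j \<in> \<int>"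
      by (auto simp: half_integral_def)
    have s: "T $ i $ j = T $ j $ i" for i j
      using arg_cong[OF T(1), of "\<lambda>M. M $ i $ j"] by (simp add: transpose_def)
    show ?thesis
      using T(2,3) by (simp add: half_integral_def transpose_def vec_eq_iff forall_3 reverse3_def
          s[of 2 1] s[of 3 1] s[of 3 2])
  qed
  have bij: "bij_betw reverse3 half_integral half_integral"
    by (rule bij_betwI[where g = reverse3]) (auto simp: inv half)
  show "siegel_fourier_expansion F (\<lambda>T. a (reverse3 T))"
    unfolding siegel_fourier_expansion_def
  proof
    fix Z :: "complex^3^3" assume Z: "Z \<in> siegel_space"
    have Z': "reverse3 Z \<in> siegel_space" using linear_siegel[OF Z VV] by (simp add: VZ)
    have FZ: "F (reverse3 Z) = F Z"
      using siegel_form_linear[OF modular Z VV] r by (simp add: VZ det)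
    have "((\<lambda>T. a T * e2pi (trace (map_matrix of_real T ** reverse3 Z))) has_sum F (reverse3 Z)) half_integral"
      using a Z' by (simp add: siegel_fourier_expansion_def)
    then have "((\<lambda>T. a (reverse3 T) * e2pi (trace (map_matrix of_real (reverse3 T) ** reverse3 Z))) has_sum F Z) half_integral"
      unfolding FZ by (subst has_sum_reindex_bij_betw[OF bij])
    then show "((\<lambda>T. a (reverse3 T) * e2pi (trace (map_matrix of_real T ** Z))) has_sum F Z) half_integral"
    proof (rule has_sum_eqI)
      fix T :: "real^3^3"
      have "trace (map_matrix of_real (reverse3 T) ** reverse3 Z) = trace (map_matrix of_real T ** Z)"
        by (simp add: trace_def matrix_matrix_mult_def sum_3 reverse3_def algebra_simps)
      then show "a (reverse3 T) * e2pi (trace (map_matrix of_real (reverse3 T) ** reverse3 Z))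
          = a (reverse3 T) * e2pi (trace (map_matrix of_real T ** Z))" by simp
    qed simp
  qed
qed

lemma siegel_form_odd_zero:
  fixes F :: "complex^3^3 \<Rightarrow> complex"
  assumes modular: "siegel_modular_transformation r F" and r: "odd r" and Z: "Z \<in> siegel_space"
  shows "F Z = 0"
proof -
  define V :: "int^3^3" where "V = vector [vector [- 1, 0, 0], vector [0, - 1, 0], vector [0, 0, - 1]]"
  have VV: "transpose V ** V = mat 1"
    by (simp add: vec_eq_iff forall_3 matrix_matrix_mult_def transpose_def sum_3 mat_def V_def)
  have det: "det V = - 1" by (simp add: det_3 V_def)
  have VZ: "cmat V ** Z ** transpose (cmat V) = Z"
    by (simp add: vec_eq_iff forall_3 matrix_matrix_mult_def transpose_def sum_3 V_def)
  have "F Z = - F Z"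
    using siegel_form_linear[OF modular Z VV] r by (simp add: VZ det)
  then show ?thesis by (simp add: eq_neg_iff_add_eq_0)
qed

definition binary_form :: "real \<Rightarrow> real \<Rightarrow> real \<Rightarrow> real^2^2" where
  "binary_form a b d = vector [vector [a, b], vector [b, d]]"

lemma fourier_jacobi_coefficients_even:
  assumes \<phi>: "\<phi> \<in> fourier_jacobi_cusp_forms r" and c: "jacobi_fourier_expansion \<phi> c" and r: "even r"
  shows "c (binary_form 1 (of_int b / 2) (of_int d)) (vector [s, t])
    = c (binary_form 1 (of_int t / 2) (of_int d)) (vector [s, b])"
proof -
  from \<phi> obtain F \<Phi> where \<Phi>: "\<phi> = \<Phi> 1" and F: "F \<in> siegel_cusp_forms r" and FJ: "fourier_jacobi_expansion F \<Phi>"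
    by (auto simp: fourier_jacobi_cusp_forms_def)
  from F obtain a where a: "siegel_fourier_expansion F a" "\<And>T. T \<in> half_integral \<Longrightarrow> a T \<noteq> 0 \<Longrightarrow> positive_definite T"
    and modular: "siegel_modular_transformation r F"
    by (auto simp: siegel_cusp_forms_def)
  have half: "binary_form 1 (of_int b / 2) (of_int d) \<in> half_integral" for b d
    by (simp add: half_integral_def binary_form_def transpose_def vec_eq_iff forall_2)
  have ca: "c (binary_form 1 (of_int b / 2) (of_int d)) u
      = a (bordered_matrix (binary_form 1 (of_int b / 2) (of_int d)) (\<chi> i. of_int (u $ i) / 2) 1)" for b d u
    by (rule jacobi_fourier_unique[OF c fourier_jacobi_fourier[OF a FJ, folded \<Phi>] half])
  let ?M = "\<lambda>b u. bordered_matrix (binary_form 1 (of_int b / 2) (of_int d)) (\<chi> i. of_int (u $ i) / 2) (1 :: real)"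
  have "?M b (vector [s, t]) \<in> half_integral"
    using bij_betw_apply[OF half_integral_bordered_bij, of "(binary_form 1 (of_int b / 2) (of_int d), vector [s, t])"] half
    by simp
  from siegel_coefficient_reverse[OF modular a(1) r this]
  have "a (?M b (vector [s, t])) = a (reverse3 (?M b (vector [s, t])))" by simp
  also have "reverse3 (?M b (vector [s, t])) = ?M t (vector [s, b])"
    by (simp add: vec_eq_iff forall_3 reverse3_def binary_form_def)
  finally show ?thesis by (simp only: ca)
qed

lemma fourier_jacobi_coefficients_odd:
  assumes \<phi>: "\<phi> \<in> fourier_jacobi_cusp_forms r" and c: "jacobi_fourier_expansion \<phi> c" and r: "odd r"
    and T: "T \<in> half_integral"
  shows "c T t = 0"
proof -
  from \<phi> obtain F \<Phi> where \<Phi>: "\<phi> = \<Phi> 1" and F: "F \<in> siegel_cusp_forms r" and FJ: "fourier_jacobi_expansion F \<Phi>"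
    by (auto simp: fourier_jacobi_cusp_forms_def)
  from F obtain a where a: "siegel_fourier_expansion F a" "\<And>T. T \<in> half_integral \<Longrightarrow> a T \<noteq> 0 \<Longrightarrow> positive_definite T"
    and modular: "siegel_modular_transformation r F"
    by (auto simp: siegel_cusp_forms_def)
  have zero: "siegel_fourier_expansion F (\<lambda>T. 0)"
    using siegel_form_odd_zero[OF modular r] by (simp add: siegel_fourier_expansion_def)
  show ?thesis
    using jacobi_fourier_unique[OF c fourier_jacobi_fourier[OF zero _ FJ, folded \<Phi>] T] by simp
qed

section \<open>Fourier expansion of entire periodic functions\<close>

lemma circlepath_series:
  fixes K :: "'i \<Rightarrow> complex \<Rightarrow> complex"
  assumes "\<rho> > 0" and cont: "\<And>n. continuous_on (sphere 0 \<rho>) (K n)"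
    and bound: "\<And>n u. norm u = \<rho> \<Longrightarrow> norm (K n u) \<le> b n" and b: "b summable_on UNIV"
    and sum: "\<And>u. norm u = \<rho> \<Longrightarrow> ((\<lambda>n. K n u) has_sum k u) UNIV"
  shows "((\<lambda>n. contour_integral (circlepath 0 \<rho>) (K n)) has_sum contour_integral (circlepath 0 \<rho>) k) UNIV"
proof -
  have int: "K n contour_integrable_on circlepath 0 \<rho>" for n
    using cont[of n] \<open>\<rho> > 0\<close> by (intro contour_integrable_continuous_circlepath) simp
  have ul: "uniform_limit (sphere 0 \<rho>) (\<lambda>X u. \<Sum>n\<in>X. K n u) k (finite_subsets_at_top UNIV)"
    by (rule Weierstrass_m_test_general'[where M = b]) (use bound b sum in auto)
  have ev: "\<forall>\<^sub>F X in finite_subsets_at_top UNIV. (\<lambda>u. \<Sum>n\<in>X. K n u) contour_integrable_on circlepath 0 \<rho>"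
    by (intro eventually_finite_subsets_at_top_weakI contour_integrable_sum int)
  have "((\<lambda>X. contour_integral (circlepath 0 \<rho>) (\<lambda>u. \<Sum>n\<in>X. K n u)) \<longlongrightarrow> contour_integral (circlepath 0 \<rho>) k)
      (finite_subsets_at_top UNIV)"
    by (rule contour_integral_uniform_limit_circlepath[OF ev ul]) (use \<open>\<rho> > 0\<close> in auto)
  also have "?this \<longleftrightarrow> ((\<lambda>X. \<Sum>n\<in>X. contour_integral (circlepath 0 \<rho>) (K n)) \<longlongrightarrow> contour_integral (circlepath 0 \<rho>) k)
      (finite_subsets_at_top UNIV)"
    by (intro tendsto_cong eventually_finite_subsets_at_top_weakI contour_integral_sum int)
  finally show ?thesis by (simp add: has_sum_def)
qed

lemma has_sum_geometric:
  fixes q :: complex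
  assumes "norm q < 1" shows "((\<lambda>n. q ^ n) has_sum 1 / (1 - q)) UNIV"
  by (rule norm_summable_imp_has_sum)
     (use assms in \<open>auto simp: norm_power summable_geometric geometric_sums\<close>)

lemma summable_on_geometric_real: "0 \<le> q \<Longrightarrow> q < 1 \<Longrightarrow> (\<lambda>n::nat. c * q ^ n :: real) summable_on UNIV"
  by (intro summable_on_cmult_right summable_nonneg_imp_summable_on summable_geometric) auto

text \<open>Cauchy's formula on an annulus, obtained from the homotopy between its boundary circles, and
  the geometric series for the Cauchy kernel.\<close>
lemma laurent_expansion:
  assumes hol: "F holomorphic_on - {0}" and r: "0 < r" "r < R"
  obtains p q s where "\<And>w. r < norm w \<Longrightarrow> norm w < R \<Longrightarrow> ((\<lambda>n. p n * w ^ n) has_sum s w) (UNIV :: nat set)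
      \<and> ((\<lambda>n. q n * inverse w ^ Suc n) has_sum (F w - s w)) (UNIV :: nat set)"
proof -
  have contF: "continuous_on (sphere 0 \<rho>) F" if "\<rho> > 0" for \<rho>
    by (rule continuous_on_subset[OF holomorphic_on_imp_continuous_on[OF hol]]) (use that in auto)
  have bnd: "\<exists>B\<ge>0. \<forall>u. norm u = \<rho> \<longrightarrow> norm (F u) \<le> B" if "\<rho> > 0" for \<rho>
  proof -
    have "bounded (F ` sphere 0 \<rho>)"
      by (intro compact_imp_bounded compact_continuous_image contF that) auto
    then obtain B where "\<forall>u\<in>sphere 0 \<rho>. norm (F u) \<le> B" by (auto simp: bounded_iff)
    then have "norm (F u) \<le> max B 0" if "norm u = \<rho>" for u
      using that by (simp add: le_max_iff_disj)
    then show ?thesis by (intro exI[of _ "max B 0"]) auto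
  qed
  let ?I = "\<lambda>\<rho>. contour_integral (circlepath 0 \<rho>)"
  define p where "p n = ?I R (\<lambda>u. F u / u ^ Suc n) / (2 * of_real pi * \<i>)" for n
  define q where "q n = ?I r (\<lambda>u. F u * u ^ n) / (2 * of_real pi * \<i>)" for n
  define s where "s w = ?I R (\<lambda>u. F u / (u - w)) / (2 * of_real pi * \<i>)" for w
  have "((\<lambda>n. p n * w ^ n) has_sum s w) (UNIV :: nat set)
      \<and> ((\<lambda>n. q n * inverse w ^ Suc n) has_sum (F w - s w)) (UNIV :: nat set)"
    if w: "r < norm w" "norm w < R" for w
  proof -
    have w0: "w \<noteq> 0" and R: "R > 0" and nw: "norm w > 0" using w r by auto
    obtain BR where BR: "BR \<ge> 0" "\<And>u. norm u = R \<Longrightarrow> norm (F u) \<le> BR" using bnd[OF R] by auto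
    obtain Br where Br: "Br \<ge> 0" "\<And>u. norm u = r \<Longrightarrow> norm (F u) \<le> Br" using bnd[OF r(1)] by auto
    have 1: "((\<lambda>n. ?I R (\<lambda>u. w ^ n * (F u / u ^ Suc n))) has_sum ?I R (\<lambda>u. F u / (u - w))) UNIV"
    proof (rule circlepath_series[OF R, where b = "\<lambda>n. BR / R * (norm w / R) ^ n"])
      show "continuous_on (sphere 0 R) (\<lambda>u. w ^ n * (F u / u ^ Suc n))" for n
        using R by (intro continuous_intros contF) auto
      fix u :: complex and n :: nat assume u: "norm u = R"
      have "norm w ^ n * (norm (F u) / R ^ Suc n) \<le> norm w ^ n * (BR / R ^ Suc n)"
        by (intro mult_left_mono divide_right_mono BR(2) u) (use R in auto)
      then show "norm (w ^ n * (F u / u ^ Suc n)) \<le> BR / R * (norm w / R) ^ n"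
        by (simp add: norm_mult norm_divide norm_power u power_divide mult_ac)
    next
      show "(\<lambda>n. BR / R * (norm w / R) ^ n) summable_on UNIV"
        by (rule summable_on_geometric_real) (use w R in auto)
    next
      fix u :: complex assume u: "norm u = R"
      have "norm (w / u) < 1" using u w R by (simp add: norm_divide)
      from has_sum_cmult_right[OF has_sum_geometric[OF this], of "F u / u"]
      have "((\<lambda>n. F u / u * (w / u) ^ n) has_sum F u / u * (1 / (1 - w / u))) UNIV" .
      moreover have "F u / u * (1 / (1 - w / u)) = F u / (u - w)"
      proof -
        have "u \<noteq> 0" "u \<noteq> w" using u R w by auto
        then show ?thesis by (simp add: divide_simps)
      qed
      ultimately show "((\<lambda>n. w ^ n * (F u / u ^ Suc n)) has_sum F u / (u - w)) UNIV"
        by (elim has_sum_eqI) (simp_all add: power_divide)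
    qed
    have 2: "((\<lambda>n. ?I r (\<lambda>u. - (inverse w ^ Suc n) * (F u * u ^ n))) has_sum ?I r (\<lambda>u. F u / (u - w))) UNIV"
    proof (rule circlepath_series[OF r(1), where b = "\<lambda>n. Br / norm w * (r / norm w) ^ n"])
      show "continuous_on (sphere 0 r) (\<lambda>u. - (inverse w ^ Suc n) * (F u * u ^ n))" for n
        by (intro continuous_intros contF r)
      fix u :: complex and n :: nat assume u: "norm u = r"
      have "inverse (norm w) ^ Suc n * (norm (F u) * r ^ n) \<le> inverse (norm w) ^ Suc n * (Br * r ^ n)"
        by (intro mult_left_mono mult_right_mono Br(2) u) (use r in auto)
      then show "norm (- (inverse w ^ Suc n) * (F u * u ^ n)) \<le> Br / norm w * (r / norm w) ^ n"
        by (simp add: norm_mult norm_inverse norm_power u power_divide divide_inverse power_mult_distrib mult_ac)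
    next
      show "(\<lambda>n. Br / norm w * (r / norm w) ^ n) summable_on UNIV"
        by (rule summable_on_geometric_real) (use w r nw in \<open>auto simp: divide_less_eq_1_pos\<close>)
    next
      fix u :: complex assume u: "norm u = r"
      have "norm (u / w) < 1" using u w r nw by (simp add: norm_divide divide_less_eq_1_pos)
      from has_sum_cmult_right[OF has_sum_geometric[OF this], of "- F u / w"]
      have "((\<lambda>n. - F u / w * (u / w) ^ n) has_sum - F u / w * (1 / (1 - u / w))) UNIV" .
      moreover have "- F u / w * (1 / (1 - u / w)) = F u / (u - w)"
      proof -
        have "u \<noteq> w" using u w by auto
        then have "1 - u / w \<noteq> 0" "u - w \<noteq> 0" using w0 by auto
        then show ?thesis using w0 by (simp add: divide_simps) (simp add: algebra_simps)
      qed
      ultimately show "((\<lambda>n. - (inverse w ^ Suc n) * (F u * u ^ n)) has_sum F u / (u - w)) UNIV"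
        by (elim has_sum_eqI) (simp_all add: power_divide divide_inverse power_mult_distrib power_inverse)
    qed
    have sR: "?I R (\<lambda>u. w ^ n * (F u / u ^ Suc n)) = w ^ n * ?I R (\<lambda>u. F u / u ^ Suc n)" for n
      using R by (intro contour_integral_lmul contour_integrable_continuous_circlepath continuous_intros) (auto intro: contF)
    have sr: "?I r (\<lambda>u. - (inverse w ^ Suc n) * (F u * u ^ n)) = - (inverse w ^ Suc n) * ?I r (\<lambda>u. F u * u ^ n)" for n
      using r by (intro contour_integral_lmul contour_integrable_continuous_circlepath continuous_intros) (auto intro: contF)
    define G where "G u = (if u = w then deriv F w else (F u - F w) / (u - w))" for u
    have holG: "G holomorphic_on - {0}"
      unfolding G_def by (rule pole_lemma_open[OF hol]) auto
    have hom: "homotopic_loops (- {0}) (circlepath 0 R) (circlepath 0 r)"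
    proof (rule homotopic_loops_linear)
      fix t x :: real
      show "closed_segment (circlepath 0 R x) (circlepath 0 r x) \<subseteq> - {0 :: complex}"
      proof
        fix y assume "y \<in> closed_segment (circlepath 0 R x) (circlepath 0 r x)"
        then obtain a where a: "0 \<le> a" "a \<le> 1" "y = (1 - a) *\<^sub>R circlepath 0 R x + a *\<^sub>R circlepath 0 r x"
          by (auto simp: closed_segment_def)
        define c where "c = (1 - a) * R + a * r"
        have "y = of_real c * exp (2 * of_real pi * \<i> * of_real x)"
          by (simp add: c_def a circlepath scaleR_conv_of_real algebra_simps)
        moreover have "c > 0"
          unfolding c_def using a r R by (cases "a = 1") (auto intro: add_pos_nonneg)
        ultimately show "y \<in> - {0}" by simp
      qed
    qed auto
    have "?I R G = ?I r G"
      by (rule Cauchy_theorem_homotopic_loops[OF hom _ holG]) auto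
    moreover have "?I R G = ?I R (\<lambda>u. F u / (u - w)) - F w * (2 * of_real pi * \<i>)"
    proof -
      have "((\<lambda>u. 1 / (u - w)) has_contour_integral (2 * of_real pi * \<i> * 1)) (circlepath 0 R)"
        by (rule Cauchy_integral_circlepath_simple) (use w in auto)
      then have h1: "((\<lambda>u. F w * (1 / (u - w))) has_contour_integral F w * (2 * of_real pi * \<i> * 1)) (circlepath 0 R)"
        by (rule has_contour_integral_lmul)
      have h2: "((\<lambda>u. F u / (u - w)) has_contour_integral ?I R (\<lambda>u. F u / (u - w))) (circlepath 0 R)"
        using w R by (intro has_contour_integral_integral contour_integrable_continuous_circlepath continuous_intros) (auto intro: contF)
      have "(G has_contour_integral ?I R (\<lambda>u. F u / (u - w)) - F w * (2 * of_real pi * \<i> * 1)) (circlepath 0 R)"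
        by (rule has_contour_integral_eq[OF has_contour_integral_diff[OF h2 h1]])
           (use w R in \<open>auto simp: G_def diff_divide_distrib\<close>)
      then show ?thesis by (simp add: contour_integral_unique)
    qed
    moreover have "?I r G = ?I r (\<lambda>u. F u / (u - w))"
    proof -
      have "((\<lambda>u. F w * (1 / (u - w))) has_contour_integral 0) (circlepath 0 r)"
        by (rule Cauchy_theorem_convex_simple[where S = "ball 0 (norm w)"])
           (use w r in \<open>auto intro!: holomorphic_intros\<close>)
      moreover have "((\<lambda>u. F u / (u - w)) has_contour_integral ?I r (\<lambda>u. F u / (u - w))) (circlepath 0 r)"
        using w r by (intro has_contour_integral_integral contour_integrable_continuous_circlepath continuous_intros) (auto intro: contF)
      ultimately have "(G has_contour_integral ?I r (\<lambda>u. F u / (u - w)) - 0) (circlepath 0 r)"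
        by (intro has_contour_integral_eq[OF has_contour_integral_diff])
           (use w r in \<open>auto simp: G_def diff_divide_distrib\<close>)
      then show ?thesis by (simp add: contour_integral_unique)
    qed
    ultimately have F: "F w = s w - ?I r (\<lambda>u. F u / (u - w)) / (2 * of_real pi * \<i>)"
      by (simp add: s_def field_simps)
    from has_sum_divide_const[OF 1, of "2 * of_real pi * \<i>"]
    have "((\<lambda>n. p n * w ^ n) has_sum s w) UNIV"
      unfolding sR by (simp add: p_def s_def mult_ac)
    moreover from has_sum_divide_const[OF has_sum_uminusI[OF 2], of "2 * of_real pi * \<i>"]
    have "((\<lambda>n. q n * inverse w ^ Suc n) has_sum (F w - s w)) UNIV"
      unfolding sr by (simp add: q_def F mult_ac)
    ultimately show ?thesis by blast
  qed
  then show thesis using that by blast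
qed

lemma e2pi_eq_imp:
  assumes "e2pi a = e2pi b" obtains n :: int where "a = b + of_int n"
proof -
  from assms obtain n :: int where "2 * of_real pi * \<i> * a = 2 * of_real pi * \<i> * b + (2 * of_int n * of_real pi) * \<i>"
    unfolding e2pi_def exp_eq by auto
  then have "2 * of_real pi * \<i> * a = 2 * of_real pi * \<i> * (b + of_int n)" by (simp add: algebra_simps)
  then show thesis by (intro that[of n]) simp
qed

lemma periodic_int:
  fixes f :: "complex \<Rightarrow> 'a"
  assumes per: "\<And>y. f (y + 1) = f y"
  shows "f (y + of_int n) = f y"
proof -
  have nat: "f (y + of_nat k) = f y" for k y
  proof (induction k)
    case (Suc k)
    have "f (y + of_nat (Suc k)) = f ((y + of_nat k) + 1)" by (simp add: add_ac)
    also have "\<dots> = f (y + of_nat k)" by (rule per)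
    finally show ?case using Suc by simp
  qed simp
  show ?thesis
  proof (cases "n \<ge> 0")
    case True
    then show ?thesis using nat[of y "nat n"] by simp
  next
    case False
    then show ?thesis using nat[of "y + of_int n" "nat (- n)"] by simp
  qed
qed

lemma entire_periodic_fourier:
  assumes hol: "f holomorphic_on UNIV" and per: "\<And>y. f (y + 1) = f y" and R: "R > 0"
  obtains a :: "int \<Rightarrow> complex" where
    "\<And>y. \<bar>Im y\<bar> < R \<Longrightarrow> ((\<lambda>n. a n * e2pi (of_int n * y)) has_sum f y) UNIV"
proof -
  have well: "f a = f b" if "e2pi a = e2pi b" for a b
    by (rule e2pi_eq_imp[OF that]) (simp add: periodic_int[of f, OF per])
  define F where "F w = f (Ln w / (2 * of_real pi * \<i>))" for w
  have FF: "F (e2pi y) = f y" for y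
    unfolding F_def by (rule well) (simp add: e2pi_def)
  have comp: "(\<lambda>w. f (h w)) holomorphic_on S" if "h holomorphic_on S" for h S
    using holomorphic_on_compose_gen[OF that hol] by (simp add: o_def)
  have "(\<lambda>w. Ln w / (2 * of_real pi * \<i>)) holomorphic_on - \<real>\<^sub>\<le>\<^sub>0"
    by (intro holomorphic_on_divide holomorphic_on_const holomorphic_on_Ln) auto
  from comp[OF this] have 1: "F holomorphic_on - \<real>\<^sub>\<le>\<^sub>0"
    by (simp only: F_def[abs_def])
  have neg: "- w \<notin> \<real>\<^sub>\<le>\<^sub>0" if "w \<in> - \<real>\<^sub>\<ge>\<^sub>0" for w :: complex
    using that by (simp add: complex_nonpos_Reals_iff complex_nonneg_Reals_iff)
  have "(\<lambda>w. Ln (- w) / (2 * of_real pi * \<i>) + 1 / 2) holomorphic_on - \<real>\<^sub>\<ge>\<^sub>0"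
    by (intro holomorphic_on_add holomorphic_on_divide holomorphic_on_const
        holomorphic_on_Ln' neg holomorphic_on_minus holomorphic_on_ident) auto
  then have h2: "(\<lambda>w. f (Ln (- w) / (2 * of_real pi * \<i>) + 1 / 2)) holomorphic_on - \<real>\<^sub>\<ge>\<^sub>0"
    by (rule comp[of "\<lambda>w. Ln (- w) / (2 * of_real pi * \<i>) + 1 / 2"])
  have eq2: "F w = f (Ln (- w) / (2 * of_real pi * \<i>) + 1 / 2)" if "w \<in> - \<real>\<^sub>\<ge>\<^sub>0" for w
  proof -
    have "w \<noteq> 0" using that by auto
    then show ?thesis unfolding F_def
      by (intro well) (simp add: e2pi_add e2pi_half, simp add: e2pi_def)
  qed
  have 2: "F holomorphic_on - \<real>\<^sub>\<ge>\<^sub>0"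
    by (rule holomorphic_transform[OF h2]) (rule eq2[symmetric])
  have "F holomorphic_on (- \<real>\<^sub>\<le>\<^sub>0 \<union> - \<real>\<^sub>\<ge>\<^sub>0)"
    by (rule holomorphic_on_Un[OF 1 2]) (auto simp: closed_nonpos_Reals_complex closed_nonneg_Reals_complex open_Compl)
  moreover have "- {0} \<subseteq> - \<real>\<^sub>\<le>\<^sub>0 \<union> (- \<real>\<^sub>\<ge>\<^sub>0 :: complex set)"
    by (auto simp: complex_nonpos_Reals_iff complex_nonneg_Reals_iff complex_eq_iff)
  ultimately have hF: "F holomorphic_on - {0}" by (rule holomorphic_on_subset)
  have "exp (- (2 * pi * R)) < exp (2 * pi * R)" using R by simp
  then obtain p q s where pq: "\<And>w. exp (- (2 * pi * R)) < norm w \<Longrightarrow> norm w < exp (2 * pi * R) \<Longrightarrow>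
      ((\<lambda>n. p n * w ^ n) has_sum s w) (UNIV :: nat set)
      \<and> ((\<lambda>n. q n * inverse w ^ Suc n) has_sum (F w - s w)) (UNIV :: nat set)"
    by (rule laurent_expansion[OF hF exp_gt_zero]) blast
  define a :: "int \<Rightarrow> complex" where "a n = (if n \<ge> 0 then p (nat n) else q (nat (- n - 1)))" for n
  show thesis
  proof
    fix y assume y: "\<bar>Im y\<bar> < R"
    let ?w = "e2pi y"
    have "- (2 * pi * R) < - (2 * pi * Im y)" "- (2 * pi * Im y) < 2 * pi * R"
    proof -
      have "2 * pi * Im y < 2 * pi * R" "2 * pi * (- Im y) < 2 * pi * R"
        using y by (intro mult_strict_left_mono; simp)+
      then show "- (2 * pi * R) < - (2 * pi * Im y)" "- (2 * pi * Im y) < 2 * pi * R" by simp_all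
    qed
    then have w: "exp (- (2 * pi * R)) < norm ?w" "norm ?w < exp (2 * pi * R)"
      by (simp_all add: norm_e2pi)
    have "((\<lambda>n. a n * e2pi (of_int n * y)) has_sum s ?w) (range int)"
    proof -
      have "(((\<lambda>n. a n * e2pi (of_int n * y)) \<circ> int) has_sum s ?w) UNIV"
        using pq[OF w] by (simp add: o_def a_def e2pi_of_nat_mult)
      then show ?thesis by (subst has_sum_reindex) (auto simp: inj_def)
    qed
    moreover have "((\<lambda>n. a n * e2pi (of_int n * y)) has_sum (F ?w - s ?w)) (range (\<lambda>n. - int n - 1))"
    proof -
      have "e2pi (of_int (- int n - 1) * y) = inverse ?w ^ Suc n" for n
      proof -
        have "of_int (- int n - 1) * y = - (of_nat (Suc n) * y)" by (simp add: algebra_simps)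
        then show ?thesis by (simp only: e2pi_minus e2pi_of_nat_mult power_inverse)
      qed
      then have "(((\<lambda>n. a n * e2pi (of_int n * y)) \<circ> (\<lambda>n. - int n - 1)) has_sum (F ?w - s ?w)) UNIV"
        using pq[OF w] by (simp add: o_def a_def del: of_int_diff of_int_minus)
      then show ?thesis by (subst has_sum_reindex) (auto simp: inj_def)
    qed
    ultimately have "((\<lambda>n. a n * e2pi (of_int n * y)) has_sum (s ?w + (F ?w - s ?w)))
        (range int \<union> range (\<lambda>n. - int n - 1))"
      by (rule has_sum_Un_disjoint) auto
    moreover have "range int \<union> range (\<lambda>n. - int n - 1) = UNIV"
    proof -
      have "i \<in> range int \<union> range (\<lambda>n. - int n - 1)" for i
      proof (cases "i \<ge> 0")
        case True then have "i = int (nat i)" by simp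
        then show ?thesis by blast
      next
        case False then have "i = - int (nat (- i - 1)) - 1" by simp
        then show ?thesis by blast
      qed
      then show ?thesis by blast
    qed
    ultimately show "((\<lambda>n. a n * e2pi (of_int n * y)) has_sum f y) UNIV"
      by (simp add: FF)
  qed
qed

section \<open>The inversion formula of the theta function\<close>

lemma summable_on_geometric_int:
  fixes q :: real
  assumes "0 \<le> q" "q < 1"
  shows "(\<lambda>n::int. q ^ nat \<bar>n\<bar>) summable_on UNIV"
proof -
  have g: "(\<lambda>n::nat. q ^ n) summable_on UNIV"
    using summable_on_geometric_real[OF assms, of 1] by simp
  have "((\<lambda>n::int. q ^ nat \<bar>n\<bar>) \<circ> int) summable_on UNIV" using g by (simp add: o_def)
  then have 1: "(\<lambda>n::int. q ^ nat \<bar>n\<bar>) summable_on range int"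
    by (subst summable_on_reindex) (auto simp: inj_def)
  have "((\<lambda>n::int. q ^ nat \<bar>n\<bar>) \<circ> (\<lambda>n. - int n)) summable_on UNIV" using g by (simp add: o_def)
  then have 2: "(\<lambda>n::int. q ^ nat \<bar>n\<bar>) summable_on range (\<lambda>n. - int n)"
    by (subst summable_on_reindex) (auto simp: inj_def)
  have "i \<in> range int \<union> range (\<lambda>n. - int n)" for i
  proof (cases "i \<ge> 0")
    case True then have "i = int (nat i)" by simp
    then show ?thesis by blast
  next
    case False then have "i = - int (nat (- i))" by simp
    then show ?thesis by blast
  qed
  then have "range int \<union> range (\<lambda>n. - int n) = UNIV" by blast
  with summable_on_union[OF 1 2] show ?thesis by simp
qed

lemma summable_on_gaussian:
  fixes a b :: real
  assumes a: "a > 0"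
  shows "(\<lambda>n::int. exp (- a * (of_int n)\<^sup>2 + b * \<bar>of_int n\<bar>)) summable_on UNIV"
proof -
  have "(\<lambda>n::int. exp ((b + 1)\<^sup>2 / (4 * a)) * exp (- 1) ^ nat \<bar>n\<bar>) summable_on UNIV"
    by (intro summable_on_cmult_right summable_on_geometric_int) auto
  then have "(\<lambda>n::int. norm (exp (- a * (of_int n)\<^sup>2 + b * \<bar>of_int n\<bar>))) summable_on UNIV"
  proof (rule Infinite_Sum.abs_summable_on_comparison_test')
    fix n :: int
    let ?x = "\<bar>real_of_int n\<bar>"
    have "0 \<le> (2 * a * ?x - (b + 1))\<^sup>2 / (4 * a)" using a by simp
    also have "\<dots> = a * ?x\<^sup>2 - (b + 1) * ?x + (b + 1)\<^sup>2 / (4 * a)"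
      using a by (simp add: power2_diff field_simps power2_eq_square)
    finally have "- a * (of_int n)\<^sup>2 + b * ?x \<le> (b + 1)\<^sup>2 / (4 * a) - ?x" by (simp add: algebra_simps)
    then have "exp (- a * (of_int n)\<^sup>2 + b * ?x) \<le> exp ((b + 1)\<^sup>2 / (4 * a)) * exp (- ?x)"
      by (simp add: exp_diff exp_minus field_simps flip: exp_add)
    also have "exp (- ?x) = exp (- 1) ^ nat \<bar>n\<bar>"
      by (simp flip: exp_of_nat_mult)
    finally show "norm (exp (- a * (of_int n)\<^sup>2 + b * ?x)) \<le> exp ((b + 1)\<^sup>2 / (4 * a)) * exp (- 1) ^ nat \<bar>n\<bar>"
      by simp
  qed
  then show ?thesis by simp
qed

definition theta :: "complex \<Rightarrow> complex \<Rightarrow> complex" where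
  "theta \<tau> y = (\<Sum>\<^sub>\<infinity>n::int. e2pi ((of_int n)\<^sup>2 * \<tau> / 2 + of_int n * y))"

lemma summable_gaussian_dominated:
  fixes f :: "int \<Rightarrow> real"
  assumes "a > 0" "\<And>n. \<bar>f n\<bar> \<le> exp (- a * (of_int n)\<^sup>2 + b * \<bar>of_int n\<bar>)"
  shows "f summable_on UNIV"
proof -
  have "(\<lambda>n. norm (f n)) summable_on UNIV"
    by (rule Infinite_Sum.abs_summable_on_comparison_test'[OF summable_on_gaussian[OF assms(1), of b]])
       (use assms(2) in simp)
  then show ?thesis by (rule abs_summable_summable)
qed

lemma theta_abs_summable:
  assumes \<tau>: "Im \<tau> > 0"
  shows "(\<lambda>n::int. norm (e2pi ((of_int n)\<^sup>2 * \<tau> / 2 + of_int n * y))) summable_on UNIV"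
proof (rule summable_gaussian_dominated[of "pi * Im \<tau>" _ "2 * pi * \<bar>Im y\<bar>"])
  fix n :: int
  have "- (of_int n * Im y) \<le> \<bar>of_int n * Im y\<bar>" by linarith
  then have "- (of_int n * Im y) \<le> \<bar>Im y\<bar> * \<bar>of_int n\<bar>" by (simp add: abs_mult mult.commute)
  then have "2 * pi * (- (of_int n * Im y)) \<le> 2 * pi * (\<bar>Im y\<bar> * \<bar>of_int n\<bar>)"
    by (intro mult_left_mono) auto
  then show "\<bar>norm (e2pi ((of_int n)\<^sup>2 * \<tau> / 2 + of_int n * y))\<bar>
      \<le> exp (- (pi * Im \<tau>) * (of_int n)\<^sup>2 + 2 * pi * \<bar>Im y\<bar> * \<bar>of_int n\<bar>)"
    by (simp add: norm_e2pi algebra_simps)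
qed (use \<tau> in simp)

lemma theta_has_sum:
  assumes "Im \<tau> > 0"
  shows "((\<lambda>n::int. e2pi ((of_int n)\<^sup>2 * \<tau> / 2 + of_int n * y)) has_sum theta \<tau> y) UNIV"
  unfolding theta_def by (rule has_sum_infsum, rule abs_summable_summable, rule theta_abs_summable[OF assms])

lemma exp_series_holomorphic_on:
  fixes c m :: "'i \<Rightarrow> complex"
  assumes summable: "\<And>x. x \<in> S \<Longrightarrow> \<exists>\<rho>>0. (\<lambda>n. norm (c n * exp (m n * x)) * exp (\<rho> * norm (m n))) summable_on I"
    and f: "\<And>x. x \<in> S \<Longrightarrow> ((\<lambda>n. c n * exp (m n * x)) has_sum f x) I"
  shows "f holomorphic_on S"
proof (rule holomorphic_onI)
  fix x assume x: "x \<in> S"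
  then obtain \<rho> where \<rho>: "\<rho> > 0" "(\<lambda>n. norm (c n * exp (m n * x)) * exp (\<rho> * norm (m n))) summable_on I"
    using summable by blast
  have lin: "linear (\<lambda>v. m n * v)" for n
    by (rule linearI) (simp_all add: algebra_simps)
  have "(f has_derivative (\<lambda>v. infsum (\<lambda>n. c n * exp (m n * x) * (m n * v)) I)) (at x within S)"
    by (rule exp_series_has_derivative[where M = "\<lambda>n. norm (m n)", OF lin _ _ \<rho> f x]) (simp_all add: norm_mult)
  also have "(\<lambda>v. infsum (\<lambda>n. c n * exp (m n * x) * (m n * v)) I)
      = (*) (infsum (\<lambda>n. c n * exp (m n * x) * m n) I)"
    by (simp add: fun_eq_iff infsum_cmult_left'[symmetric] mult.assoc)
  finally show "f field_differentiable at x within S"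
    unfolding field_differentiable_def has_field_derivative_def by blast
qed

lemma theta_line_holomorphic: "(\<lambda>\<sigma>. theta \<sigma> (a * \<sigma> + b)) holomorphic_on {\<sigma>. Im \<sigma> > 0}"
proof (rule exp_series_holomorphic_on)
  let ?m = "\<lambda>n::int. 2 * of_real pi * \<i> * ((of_int n)\<^sup>2 / 2 + of_int n * a)"
  fix x assume "x \<in> {\<sigma>. Im \<sigma> > 0}"
  then have x: "Im x > 0" by simp
  have eq: "e2pi (of_int n * b) * exp (?m n * x) = e2pi ((of_int n)\<^sup>2 * x / 2 + of_int n * (a * x + b))" for n
    unfolding e2pi_def exp_add[symmetric] by (rule arg_cong[of _ _ exp]) (simp add: algebra_simps)
  show "((\<lambda>n. e2pi (of_int n * b) * exp (?m n * x)) has_sum theta x (a * x + b)) UNIV"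
    unfolding eq by (rule theta_has_sum[OF x])
  define \<rho> where "\<rho> = Im x / 2"
  have \<rho>: "\<rho> > 0" using x by (simp add: \<rho>_def)
  have "(\<lambda>n. norm (e2pi (of_int n * b) * exp (?m n * x)) * exp (\<rho> * norm (?m n))) summable_on UNIV"
  proof (rule summable_gaussian_dominated[of "pi * \<rho>" _ "2 * pi * norm (a * x + b) + \<rho> * (2 * pi * norm a)"])
    fix n :: int
    have 1: "- (of_int n * Im (a * x + b)) \<le> norm (a * x + b) * \<bar>of_int n\<bar>"
    proof -
      have "- (of_int n * Im (a * x + b)) \<le> \<bar>of_int n\<bar> * \<bar>Im (a * x + b)\<bar>"
        by (metis abs_ge_minus_self abs_mult)
      also have "\<dots> \<le> \<bar>of_int n\<bar> * norm (a * x + b)" by (intro mult_left_mono abs_Im_le_cmod) auto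
      finally show ?thesis by (simp add: mult.commute)
    qed
    have "norm (?m n) \<le> 2 * pi * (norm ((of_int n)\<^sup>2 / 2 :: complex) + norm (of_int n * a))"
      unfolding norm_mult[of "2 * of_real pi * \<i>"] by (intro mult_mono norm_triangle_ineq) (auto simp: norm_mult)
    also have "\<dots> = pi * (of_int n)\<^sup>2 + 2 * pi * norm a * \<bar>of_int n\<bar>"
      by (simp add: norm_mult norm_divide norm_power algebra_simps)
    finally have 2: "\<rho> * norm (?m n) \<le> \<rho> * (pi * (of_int n)\<^sup>2 + 2 * pi * norm a * \<bar>of_int n\<bar>)"
      using \<rho> by (intro mult_left_mono) auto
    have "norm (e2pi (of_int n * b) * exp (?m n * x)) * exp (\<rho> * norm (?m n))
        = exp (- (2 * pi * ((of_int n)\<^sup>2 * Im x / 2 + of_int n * Im (a * x + b))) + \<rho> * norm (?m n))"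
      unfolding eq norm_e2pi exp_add by (simp add: algebra_simps)
    also have "\<dots> \<le> exp (- (2 * pi * ((of_int n)\<^sup>2 * Im x / 2)) + 2 * pi * (norm (a * x + b) * \<bar>of_int n\<bar>)
        + \<rho> * (pi * (of_int n)\<^sup>2 + 2 * pi * norm a * \<bar>of_int n\<bar>))"
    proof -
      have "2 * pi * (- (of_int n * Im (a * x + b))) \<le> 2 * pi * (norm (a * x + b) * \<bar>of_int n\<bar>)"
        by (intro mult_left_mono 1) auto
      then show ?thesis using 2 by (simp add: algebra_simps)
    qed
    also have "\<dots> = exp (- (pi * \<rho>) * (of_int n)\<^sup>2 + (2 * pi * norm (a * x + b) + \<rho> * (2 * pi * norm a)) * \<bar>of_int n\<bar>)"
      by (simp add: \<rho>_def algebra_simps)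
    finally show "\<bar>norm (e2pi (of_int n * b) * exp (?m n * x)) * exp (\<rho> * norm (?m n))\<bar>
        \<le> exp (- (pi * \<rho>) * (of_int n)\<^sup>2 + (2 * pi * norm (a * x + b) + \<rho> * (2 * pi * norm a)) * \<bar>of_int n\<bar>)"
      by simp
  qed (use \<rho> in simp)
  with \<rho> show "\<exists>\<rho>>0. (\<lambda>n. norm (e2pi (of_int n * b) * exp (?m n * x)) * exp (\<rho> * norm (?m n))) summable_on UNIV"
    by blast
qed

lemma theta_entire:
  assumes \<tau>: "Im \<tau> > 0" shows "theta \<tau> holomorphic_on UNIV"
proof (rule exp_series_holomorphic_on)
  let ?m = "\<lambda>n::int. 2 * of_real pi * \<i> * of_int n" let ?c = "\<lambda>n::int. e2pi ((of_int n)\<^sup>2 * \<tau> / 2)"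
  fix y :: complex
  have eq: "?c n * exp (?m n * y) = e2pi ((of_int n)\<^sup>2 * \<tau> / 2 + of_int n * y)" for n
    by (simp add: e2pi_def exp_add[symmetric] algebra_simps)
  show "((\<lambda>n. ?c n * exp (?m n * y)) has_sum theta \<tau> y) UNIV"
    unfolding eq by (rule theta_has_sum[OF \<tau>])
  have "(\<lambda>n. norm (?c n * exp (?m n * y)) * exp (1 * norm (?m n))) summable_on UNIV"
  proof (rule summable_gaussian_dominated[of "pi * Im \<tau>" _ "2 * pi * (norm y + 1)"])
    fix n :: int
    have "- (of_int n * Im y) \<le> \<bar>of_int n\<bar> * \<bar>Im y\<bar>" by (metis abs_ge_minus_self abs_mult)
    also have "\<dots> \<le> \<bar>of_int n\<bar> * norm y" by (intro mult_left_mono abs_Im_le_cmod) auto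
    finally have "2 * pi * (- (of_int n * Im y)) \<le> 2 * pi * (\<bar>of_int n\<bar> * norm y)"
      by (intro mult_left_mono) auto
    then show "\<bar>norm (?c n * exp (?m n * y)) * exp (1 * norm (?m n))\<bar>
        \<le> exp (- (pi * Im \<tau>) * (of_int n)\<^sup>2 + 2 * pi * (norm y + 1) * \<bar>of_int n\<bar>)"
      unfolding eq by (simp add: norm_e2pi norm_mult exp_add[symmetric] algebra_simps)
  qed (use \<tau> in simp)
  then show "\<exists>\<rho>>0. (\<lambda>n. norm (?c n * exp (?m n * y)) * exp (\<rho> * norm (?m n))) summable_on UNIV"
    by (intro exI[of _ 1]) simp
qed

lemma theta_plus_1: "theta \<tau> (y + 1) = theta \<tau> y"
  unfolding theta_def by (rule infsum_cong) (simp add: distrib_left e2pi_add)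

lemma theta_plus_tau: "theta \<tau> (y + \<tau>) = e2pi (- y - \<tau> / 2) * theta \<tau> y"
proof -
  have "theta \<tau> y = (\<Sum>\<^sub>\<infinity>n::int. e2pi ((of_int (n + 1))\<^sup>2 * \<tau> / 2 + of_int (n + 1) * y))"
    unfolding theta_def by (rule infsum_reindex_bij_betw[symmetric, of "\<lambda>n. n + 1"])
      (rule bij_betwI[where g = "\<lambda>n. n - 1"]; simp)
  also have "\<dots> = (\<Sum>\<^sub>\<infinity>n::int. e2pi (y + \<tau> / 2) * e2pi ((of_int n)\<^sup>2 * \<tau> / 2 + of_int n * (y + \<tau>)))"
    by (rule infsum_cong) (simp only: e2pi_add[symmetric], rule arg_cong[of _ _ e2pi],
        simp add: power2_eq_square field_simps)
  also have "\<dots> = e2pi (y + \<tau> / 2) * theta \<tau> (y + \<tau>)"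
    unfolding theta_def by (rule infsum_cmult_right')
  finally have "theta \<tau> y = e2pi (y + \<tau> / 2) * theta \<tau> (y + \<tau>)" .
  moreover have "e2pi (- y - \<tau> / 2) * e2pi (y + \<tau> / 2) = 1" by (simp add: e2pi_add[symmetric])
  ultimately show ?thesis by (simp flip: mult.assoc)
qed

text \<open>The quasi-periodicity is a first-order recursion for the Fourier coefficients, so the theta
  function is the only solution up to a factor.\<close>
lemma quasi_periodic_unique:
  assumes \<tau>: "Im \<tau> > 0" and hol: "f holomorphic_on UNIV"
    and per: "\<And>y. f (y + 1) = f y" and quasi: "\<And>y. f (y + \<tau>) = e2pi (- y - \<tau> / 2) * f y"
  shows "f y * theta \<tau> 0 = f 0 * theta \<tau> y"
proof -
  define R where "R = \<bar>Im y\<bar> + Im \<tau> + 1"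
  have R: "R > 0" using \<tau> by (simp add: R_def)
  obtain a :: "int \<Rightarrow> complex" where
    a: "\<And>y. \<bar>Im y\<bar> < R \<Longrightarrow> ((\<lambda>n. a n * e2pi (of_int n * y)) has_sum f y) UNIV"
    using entire_periodic_fourier[OF hol per R] by blast
  have rec: "a (n + 1) = a n * e2pi (of_int n * \<tau> + \<tau> / 2)" for n
  proof -
    have 1: "((\<lambda>n. (a n * e2pi (of_int n * \<tau>)) * e2pi (of_real (real_of_int n \<bullet> x))) has_sum f (of_real x + \<tau>)) UNIV" for x
      by (rule has_sum_eqI[OF a[of "of_real x + \<tau>"]]) (use \<tau> in \<open>auto simp: R_def distrib_left e2pi_add mult_ac\<close>)
    have 2: "((\<lambda>n. (a (n + 1) * e2pi (- (\<tau> / 2))) * e2pi (of_real (real_of_int n \<bullet> x))) has_sum f (of_real x + \<tau>)) UNIV" for x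
    proof -
      have "((\<lambda>n. a n * e2pi (of_int n * of_real x)) has_sum f (of_real x)) UNIV"
        by (rule a) (use \<tau> in \<open>simp add: R_def\<close>)
      moreover have bij: "bij_betw (\<lambda>n::int. n + 1) UNIV UNIV"
        by (rule bij_betwI[where g = "\<lambda>n. n - 1"]) auto
      ultimately have "((\<lambda>n. a (n + 1) * e2pi (of_int (n + 1) * of_real x)) has_sum f (of_real x)) UNIV"
        using has_sum_reindex_bij_betw[OF bij, of "\<lambda>n. a n * e2pi (of_int n * of_real x)"] by simp
      from has_sum_cmult_right[OF this, of "e2pi (- of_real x - \<tau> / 2)"] show ?thesis
      proof (rule has_sum_eqI)
        fix n :: int
        have "e2pi (- of_real x - \<tau> / 2) * e2pi (of_int (n + 1) * of_real x)
            = e2pi (- (\<tau> / 2)) * e2pi (of_real (real_of_int n \<bullet> x))"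
          by (simp only: e2pi_add[symmetric]) (rule arg_cong[of _ _ e2pi], simp add: algebra_simps)
        then show "e2pi (- of_real x - \<tau> / 2) * (a (n + 1) * e2pi (of_int (n + 1) * of_real x))
            = a (n + 1) * e2pi (- (\<tau> / 2)) * e2pi (of_real (real_of_int n \<bullet> x))"
          by (metis mult.assoc mult.left_commute)
      qed (simp only: quasi)
    qed
    have "inj_on real_of_int UNIV" by (simp add: inj_on_def)
    from fourier_coefficients_unique[OF this 1 2, of n]
    have "a n * e2pi (of_int n * \<tau>) = a (n + 1) * e2pi (- (\<tau> / 2))" by simp
    then have "a (n + 1) * e2pi (- (\<tau> / 2)) * e2pi (\<tau> / 2) = a n * e2pi (of_int n * \<tau>) * e2pi (\<tau> / 2)"
      by (rule arg_cong[of _ _ "\<lambda>u. u * e2pi (\<tau> / 2)", symmetric])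
    moreover have "a (n + 1) * e2pi (- (\<tau> / 2)) * e2pi (\<tau> / 2) = a (n + 1)"
      by (simp add: e2pi_minus)
    ultimately show ?thesis by (simp only: e2pi_add mult.assoc)
  qed
  have an: "a n = a 0 * e2pi ((of_int n)\<^sup>2 * \<tau> / 2)" for n
  proof (induction n rule: int_induct[where k = 0])
    case (step1 i)
    have "a (i + 1) = a 0 * (e2pi ((of_int i)\<^sup>2 * \<tau> / 2) * e2pi (of_int i * \<tau> + \<tau> / 2))"
      by (simp add: rec step1 mult.assoc)
    also have "e2pi ((of_int i)\<^sup>2 * \<tau> / 2) * e2pi (of_int i * \<tau> + \<tau> / 2) = e2pi ((of_int (i + 1))\<^sup>2 * \<tau> / 2)"
      by (simp add: e2pi_add[symmetric] power2_eq_square field_simps)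
    finally show ?case .
  next
    case (step2 i)
    have "a 0 * e2pi ((of_int i)\<^sup>2 * \<tau> / 2) = a (i - 1) * e2pi (of_int (i - 1) * \<tau> + \<tau> / 2)"
      using rec[of "i - 1"] step2 by simp
    also have "e2pi ((of_int i)\<^sup>2 * \<tau> / 2) = e2pi ((of_int (i - 1))\<^sup>2 * \<tau> / 2) * e2pi (of_int (i - 1) * \<tau> + \<tau> / 2)"
      by (simp add: e2pi_add[symmetric] power2_eq_square field_simps)
    finally show ?case by simp
  qed simp
  have f: "f x = a 0 * theta \<tau> x" if x: "\<bar>Im x\<bar> < R" for x
  proof (rule has_sum_unique[OF a[OF x]])
    show "((\<lambda>n. a n * e2pi (of_int n * x)) has_sum a 0 * theta \<tau> x) UNIV"
    proof (rule has_sum_eqI[OF has_sum_cmult_right[OF theta_has_sum[OF \<tau>], of "a 0" x]])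
      fix n
      show "a 0 * e2pi ((of_int n)\<^sup>2 * \<tau> / 2 + of_int n * x) = a n * e2pi (of_int n * x)"
        unfolding an[of n] e2pi_add by (rule mult.assoc[symmetric])
    qed simp
  qed
  show ?thesis using f[of y] f[of 0] \<tau> by (simp add: R_def)
qed

definition theta_dual :: "complex \<Rightarrow> complex \<Rightarrow> complex" where
  "theta_dual \<tau> y = e2pi (- (y\<^sup>2 / (2 * \<tau>))) * theta (- 1 / \<tau>) (y / \<tau>)"

lemma Im_inverse_pos: "Im \<tau> > 0 \<Longrightarrow> Im (- 1 / \<tau>) > 0"
  by (simp add: Im_divide) (metis less_irrefl sum_power2_gt_zero_iff zero_less_divide_iff)

lemma theta_dual_proportional:
  assumes \<tau>: "Im \<tau> > 0"
  shows "theta_dual \<tau> y * theta \<tau> 0 = theta (- 1 / \<tau>) 0 * theta \<tau> y"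
proof -
  have t0: "\<tau> \<noteq> 0" using \<tau> by auto
  have "theta_dual \<tau> y * theta \<tau> 0 = theta_dual \<tau> 0 * theta \<tau> y"
  proof (rule quasi_periodic_unique[OF \<tau>])
    have "(\<lambda>y. theta (- 1 / \<tau>) (y / \<tau>)) holomorphic_on UNIV"
      using holomorphic_on_compose_gen[OF _ theta_entire[OF Im_inverse_pos[OF \<tau>]], of "\<lambda>y. y / \<tau>" UNIV] t0
      by (simp add: o_def holomorphic_on_divide)
    moreover have "(\<lambda>y. e2pi (- (y\<^sup>2 / (2 * \<tau>)))) holomorphic_on UNIV"
      unfolding e2pi_def using t0 by (intro holomorphic_intros) auto
    ultimately show "theta_dual \<tau> holomorphic_on UNIV"
      unfolding theta_dual_def[abs_def] by (rule holomorphic_on_mult[rotated])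
  next
    fix y
    have "theta (- 1 / \<tau>) (y / \<tau>) = theta (- 1 / \<tau>) ((y + 1) / \<tau> + (- 1 / \<tau>))"
      by (simp add: add_divide_distrib)
    also have "\<dots> = e2pi (- ((y + 1) / \<tau>) - (- 1 / \<tau>) / 2) * theta (- 1 / \<tau>) ((y + 1) / \<tau>)"
      by (rule theta_plus_tau)
    finally have *: "theta (- 1 / \<tau>) (y / \<tau>) = e2pi (- ((y + 1) / \<tau>) - (- 1 / \<tau>) / 2) * theta (- 1 / \<tau>) ((y + 1) / \<tau>)" .
    have "- (y\<^sup>2 / (2 * \<tau>)) + (- ((y + 1) / \<tau>) - (- 1 / \<tau>) / 2) = - ((y + 1)\<^sup>2 / (2 * \<tau>))"
      using t0 by (simp add: power2_eq_square field_simps)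
    then show "theta_dual \<tau> (y + 1) = theta_dual \<tau> y"
      unfolding theta_dual_def * by (simp add: e2pi_add[symmetric] flip: mult.assoc)
  next
    fix y
    have "(y + \<tau>) / \<tau> = y / \<tau> + 1" using t0 by (simp add: field_simps)
    then have *: "theta (- 1 / \<tau>) ((y + \<tau>) / \<tau>) = theta (- 1 / \<tau>) (y / \<tau>)"
      by (simp only: theta_plus_1)
    have "- ((y + \<tau>)\<^sup>2 / (2 * \<tau>)) = (- y - \<tau> / 2) + - (y\<^sup>2 / (2 * \<tau>))"
      using t0 by (simp add: power2_eq_square field_simps)
    then show "theta_dual \<tau> (y + \<tau>) = e2pi (- y - \<tau> / 2) * theta_dual \<tau> y"
      unfolding theta_dual_def * by (simp only: e2pi_add mult.assoc)
  qed
  then show ?thesis by (simp add: theta_dual_def)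
qed


lemma has_sum_finite_sum:
  fixes f :: "'a \<Rightarrow> 'b \<Rightarrow> 'c::topological_comm_monoid_add"
  assumes "finite A" "\<And>a. a \<in> A \<Longrightarrow> (f a has_sum s a) I"
  shows "((\<lambda>i. \<Sum>a\<in>A. f a i) has_sum (\<Sum>a\<in>A. s a)) I"
  using assms by (induction A rule: finite_induct) (auto intro!: has_sum_add)

lemma sum_roots_of_unity:
  assumes "N > 0"
  shows "(\<Sum>j<N. e2pi (of_int n * (of_nat j / of_nat N))) = (if int N dvd n then of_nat N else 0)"
proof (cases "int N dvd n")
  case True
  then obtain m where "n = int N * m" by auto
  then have "of_int n * (of_nat j / of_nat N) \<in> (\<int> :: complex set)" for j
    using assms by simp
  then show ?thesis using True by simp
next
  case False
  define q where "q = e2pi (of_int n / of_nat N)"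
  have "q \<noteq> 1"
  proof
    assume "q = 1"
    then have "e2pi (of_int n / of_nat N) = e2pi 0" by (simp add: q_def)
    then obtain m :: int where "of_int n / of_nat N = 0 + complex_of_int m" by (rule e2pi_eq_imp)
    then have "complex_of_int n = of_int (int N * m)" using assms by (simp add: field_simps)
    then have "n = int N * m" by (simp only: of_int_eq_iff)
    with False show False by simp
  qed
  moreover have "q ^ N = 1"
    using assms by (simp add: q_def e2pi_of_nat_mult[symmetric])
  moreover have "(\<Sum>j<N. e2pi (of_int n * (of_nat j / of_nat N))) = (\<Sum>j<N. q ^ j)"
    by (simp add: q_def e2pi_of_nat_mult[symmetric] mult_ac)
  ultimately show ?thesis using False by (simp add: geometric_sum)
qed

lemma theta_average:
  assumes \<tau>: "Im \<tau> > 0" and N: "N > 0"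
  shows "(\<Sum>j<N. theta \<tau> (of_nat j / of_nat N)) = of_nat N * theta (of_nat N ^ 2 * \<tau>) 0"
proof -
  let ?g = "\<lambda>n::int. of_nat N * e2pi ((of_int n)\<^sup>2 * \<tau> / 2)"
  let ?s = "\<Sum>j<N. theta \<tau> (of_nat j / of_nat N)"
  have "((\<lambda>n::int. \<Sum>j<N. e2pi ((of_int n)\<^sup>2 * \<tau> / 2 + of_int n * (of_nat j / of_nat N))) has_sum ?s) UNIV"
    by (rule has_sum_finite_sum[OF finite_lessThan]) (rule theta_has_sum[OF \<tau>])
  then have all: "((\<lambda>n. if int N dvd n then ?g n else 0) has_sum ?s) UNIV"
  proof (rule has_sum_eqI)
    fix n :: int
    have "(\<Sum>j<N. e2pi ((of_int n)\<^sup>2 * \<tau> / 2 + of_int n * (of_nat j / of_nat N)))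
      = e2pi ((of_int n)\<^sup>2 * \<tau> / 2) * (\<Sum>j<N. e2pi (of_int n * (of_nat j / of_nat N)))"
      by (simp only: e2pi_add sum_distrib_left)
    then show "(\<Sum>j<N. e2pi ((of_int n)\<^sup>2 * \<tau> / 2 + of_int n * (of_nat j / of_nat N)))
      = (if int N dvd n then ?g n else 0)"
      by (simp only: sum_roots_of_unity[OF N]) simp
  qed simp
  have "(?g has_sum ?s) (range (\<lambda>m. int N * m))"
  proof (rule has_sum_cong_neutral[THEN iffD1, OF _ _ _ all])
    fix n assume "n \<in> range ((*) (int N)) - UNIV"
    then show "?g n = 0" by simp
  qed auto
  then have "((?g \<circ> (\<lambda>m. int N * m)) has_sum ?s) UNIV"
    using N by (subst has_sum_reindex[symmetric]) (auto simp: inj_def)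
  moreover have "((?g \<circ> (\<lambda>m. int N * m)) has_sum of_nat N * theta (of_nat N ^ 2 * \<tau>) 0) UNIV"
  proof (rule has_sum_eqI[OF has_sum_cmult_right[OF theta_has_sum, of "of_nat N ^ 2 * \<tau>" "of_nat N" 0]])
    show "0 < Im (of_nat N ^ 2 * \<tau>)" using \<tau> N by (simp add: power2_eq_square)
  qed (simp_all add: power_mult_distrib mult_ac)
  ultimately show ?thesis by (rule has_sum_unique)
qed

lemma has_sum_int_residues:
  fixes f :: "int \<Rightarrow> complex"
  assumes N: "N > 0" and f: "(f has_sum s) UNIV" and g: "\<And>j. j < N \<Longrightarrow> ((\<lambda>n. f (int N * n - int j)) has_sum g j) UNIV"
  shows "s = (\<Sum>j<N. g j)"
proof -
  let ?h = "\<lambda>(j, n). int N * n - int j"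
  have bij: "bij_betw ?h ({..<N} \<times> UNIV) UNIV"
  proof (rule bij_betwI[where g = "\<lambda>k. (nat ((- k) mod int N), (k + (- k) mod int N) div int N)"])
    fix x :: "nat \<times> int" assume "x \<in> {..<N} \<times> UNIV"
    then obtain j n where x: "x = (j, n)" and j: "j < N" by auto
    have "(- ?h x) mod int N = int j"
    proof -
      have "- ?h x = int j + int N * (- n)" by (simp add: x)
      then have "(- ?h x) mod int N = int j mod int N" by (simp only: mod_mult_self2)
      then show ?thesis using j by simp
    qed
    then show "(nat ((- ?h x) mod int N), (?h x + (- ?h x) mod int N) div int N) = x"
      using N by (simp add: x)
  next
    fix k :: int
    have "k + (- k) mod int N = int N * (- ((- k) div int N))"
      using minus_mult_div_eq_mod[of "- k" "int N"] by simp
    then have "int N dvd k + (- k) mod int N" by simp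
    then show "?h (nat ((- k) mod int N), (k + (- k) mod int N) div int N) = k"
      using N by simp
  next
    show "(\<lambda>k. (nat ((- k) mod int N), (k + (- k) mod int N) div int N)) \<in> UNIV \<rightarrow> {..<N} \<times> UNIV"
      using N by (auto simp: nat_less_iff)
  qed auto
  have "((\<lambda>p. f (?h p)) has_sum s) ({..<N} \<times> UNIV)"
    by (subst has_sum_reindex_bij_betw[OF bij]) (rule f)
  then have "(g has_sum s) {..<N}"
    by (rule has_sum_SigmaD) (use g in auto)
  then show ?thesis by (simp add: has_sum_finite_iff)
qed

lemma theta_dual_has_sum:
  assumes \<tau>: "Im \<tau> > 0"
  shows "((\<lambda>n. e2pi (- ((of_int n - y)\<^sup>2 / (2 * \<tau>)))) has_sum theta_dual \<tau> y) UNIV"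
proof (rule has_sum_eqI)
  show "((\<lambda>n. e2pi (- (y\<^sup>2 / (2 * \<tau>))) * e2pi ((of_int n)\<^sup>2 * (- 1 / \<tau>) / 2 + of_int n * (y / \<tau>)))
      has_sum theta_dual \<tau> y) UNIV"
    unfolding theta_dual_def by (intro has_sum_cmult_right theta_has_sum Im_inverse_pos \<tau>)
  fix n :: int
  have "\<tau> \<noteq> 0" using \<tau> by auto
  then show "e2pi (- (y\<^sup>2 / (2 * \<tau>))) * e2pi ((of_int n)\<^sup>2 * (- 1 / \<tau>) / 2 + of_int n * (y / \<tau>))
      = e2pi (- ((of_int n - y)\<^sup>2 / (2 * \<tau>)))"
    unfolding e2pi_add[symmetric]
    by (intro arg_cong[of _ _ e2pi]) (simp add: power2_eq_square field_simps)
qed simp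

lemma theta_dual_average:
  assumes \<tau>: "Im \<tau> > 0" and N: "N > 0"
  shows "(\<Sum>j<N. theta_dual \<tau> (of_nat j / of_nat N)) = theta (- 1 / (of_nat N ^ 2 * \<tau>)) 0"
proof (rule has_sum_int_residues[OF N, symmetric])
  have im: "Im (of_nat N ^ 2 * \<tau>) > 0"
    using \<tau> N by (simp add: power2_eq_square)
  show "((\<lambda>n. e2pi (- ((of_int n)\<^sup>2 / (2 * (of_nat N ^ 2 * \<tau>))))) has_sum theta (- 1 / (of_nat N ^ 2 * \<tau>)) 0) UNIV"
    using theta_dual_has_sum[OF im, of 0] by (simp add: theta_dual_def)
  fix j
  show "((\<lambda>n. e2pi (- ((of_int (int N * n - int j))\<^sup>2 / (2 * (of_nat N ^ 2 * \<tau>))))) has_sum theta_dual \<tau> (of_nat j / of_nat N)) UNIV"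
  proof (rule has_sum_eqI[OF theta_dual_has_sum[OF \<tau>]])
    fix n :: int
    have "of_int (int N * n - int j) = of_nat N * (of_int n - of_nat j / of_nat N :: complex)"
      using N by (simp add: field_simps)
    then have "(of_int (int N * n - int j))\<^sup>2 = of_nat N ^ 2 * (of_int n - of_nat j / of_nat N :: complex)\<^sup>2"
      by (simp only: power_mult_distrib)
    then show "e2pi (- ((of_int n - of_nat j / of_nat N)\<^sup>2 / (2 * \<tau>)))
        = e2pi (- ((of_int (int N * n - int j))\<^sup>2 / (2 * (of_nat N ^ 2 * \<tau>))))"
      using N by simp
  qed simp
qed

lemma theta_imaginary_nonzero:
  assumes t: "t > 0" shows "theta (\<i> * of_real t) 0 \<noteq> 0"
proof -
  have "((\<lambda>n::int. e2pi ((of_int n)\<^sup>2 * (\<i> * of_real t) / 2 + of_int n * 0)) has_sum theta (\<i> * of_real t) 0) UNIV"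
    by (rule theta_has_sum) (use t in simp)
  moreover have "e2pi ((of_int n)\<^sup>2 * (\<i> * of_real t) / 2 + of_int n * 0) = of_real (exp (- (pi * t * (of_int n)\<^sup>2)))" for n :: int
  proof -
    have "2 * of_real pi * \<i> * ((of_int n)\<^sup>2 * (\<i> * of_real t) / 2 + of_int n * 0)
        = complex_of_real (- (pi * t * (of_int n)\<^sup>2))"
      by (simp add: algebra_simps)
    then show ?thesis unfolding e2pi_def by (simp only: exp_of_real)
  qed
  ultimately have "((\<lambda>n::int. complex_of_real (exp (- (pi * t * (of_int n)\<^sup>2)))) has_sum theta (\<i> * of_real t) 0) UNIV"
    by simp
  from has_sum_Re[OF this]
  have "((\<lambda>n::int. exp (- (pi * t * (of_int n)\<^sup>2))) has_sum Re (theta (\<i> * of_real t) 0)) UNIV"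
    by simp
  from finite_sum_le_has_sum[OF this, of "{0}"] show ?thesis by auto
qed

text \<open>The factor of proportionality. Averaging over \<open>N\<close>-division points shows \<open>c(N\<^sup>2 t) = N c(t)\<close>,
  hence \<open>c(q\<^sup>2) = q\<close> for rational \<open>q\<close>, and continuity does the rest; no Gaussian integral is needed.\<close>
definition theta_ratio :: "real \<Rightarrow> complex" where
  "theta_ratio t = theta (- 1 / (\<i> * of_real t)) 0 / theta (\<i> * of_real t) 0"

lemma theta_ratio_scale:
  assumes t: "t > 0" and N: "N > (0 :: nat)"
  shows "theta_ratio (real N ^ 2 * t) = of_nat N * theta_ratio t"
proof -
  let ?\<tau> = "\<i> * of_real t"
  have \<tau>: "Im ?\<tau> > 0" using t by simp
  have eq: "\<i> * of_real (real N ^ 2 * t) = of_nat N ^ 2 * ?\<tau>" by simp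
  have nz: "theta ?\<tau> 0 \<noteq> 0" "theta (of_nat N ^ 2 * ?\<tau>) 0 \<noteq> 0"
    using theta_imaginary_nonzero[OF t] theta_imaginary_nonzero[of "real N ^ 2 * t"] t N by (simp_all add: eq[symmetric] mult_ac)
  have "theta (- 1 / (of_nat N ^ 2 * ?\<tau>)) 0 * theta ?\<tau> 0
      = (\<Sum>j<N. theta_dual ?\<tau> (of_nat j / of_nat N) * theta ?\<tau> 0)"
    by (simp only: theta_dual_average[OF \<tau> N, symmetric] sum_distrib_right)
  also have "\<dots> = theta (- 1 / ?\<tau>) 0 * (of_nat N * theta (of_nat N ^ 2 * ?\<tau>) 0)"
    by (simp only: theta_dual_proportional[OF \<tau>] sum_distrib_left[symmetric] theta_average[OF \<tau> N])
  finally show ?thesis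
    unfolding theta_ratio_def eq using nz by (simp add: field_simps)
qed

lemma theta_ratio_continuous: "continuous_on {0<..} theta_ratio"
proof -
  have c: "continuous_on {\<sigma>. Im \<sigma> > 0} (\<lambda>\<sigma>. theta \<sigma> 0)"
    using theta_line_holomorphic[of 0 0] by (simp add: holomorphic_on_imp_continuous_on)
  have "continuous_on {0<..} (\<lambda>t. theta (\<i> * of_real t) 0)"
    by (rule continuous_on_compose2[OF c]) (auto intro!: continuous_intros)
  moreover have "continuous_on {0<..} (\<lambda>t. theta (- 1 / (\<i> * of_real t)) 0)"
    by (rule continuous_on_compose2[OF c]) (auto intro!: continuous_intros Im_inverse_pos simp del: divide_minus_left)
  ultimately show ?thesis
    unfolding theta_ratio_def[abs_def] by (intro continuous_on_divide) (auto simp: theta_imaginary_nonzero)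
qed

lemma theta_ratio_rational:
  assumes "q \<in> \<rat>" "q > 0"
  shows "theta_ratio (q\<^sup>2) = of_real q"
proof -
  obtain m n :: nat where n: "n \<noteq> 0" and "\<bar>q\<bar> = real m / real n"
    using Rats_abs_nat_div_natE[OF assms(1)] by metis
  then have q: "q = real m / real n" using assms(2) by simp
  have m: "m \<noteq> 0"
  proof
    assume "m = 0"
    with q assms(2) show False by simp
  qed
  have one: "theta_ratio 1 = 1"
    using theta_imaginary_nonzero[of 1] by (simp add: theta_ratio_def divide_simps)
  have "of_nat n * theta_ratio (q\<^sup>2) = theta_ratio (real n ^ 2 * q\<^sup>2)"
    using theta_ratio_scale[of "q\<^sup>2" n] n assms(2) by simp
  also have "real n ^ 2 * q\<^sup>2 = real m ^ 2 * 1" using n by (simp add: q field_simps)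
  also have "theta_ratio (real m ^ 2 * 1) = of_nat m"
    using theta_ratio_scale[of 1 m] m one by simp
  finally show ?thesis using n by (simp add: q field_simps)
qed

lemma theta_ratio_sqrt:
  assumes t: "t > 0" shows "theta_ratio t = of_real (sqrt t)"
proof -
  define g where "g s = theta_ratio (s\<^sup>2) - of_real s" for s
  have cont: "continuous_on {0<..} g"
    unfolding g_def by (intro continuous_intros continuous_on_compose2[OF theta_ratio_continuous]) auto
  define s where "s = sqrt t"
  have s: "s > 0" using t by (simp add: s_def)
  have "g s = 0"
  proof (rule ccontr)
    assume nz: "g s \<noteq> 0"
    have "(g \<longlongrightarrow> g s) (at s)"
      using continuous_on_eq_continuous_at[of "{0<..}" g] cont s by (simp add: continuous_at)
    from tendsto_imp_eventually_ne[OF this nz]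
    obtain d where d: "d > 0" "\<And>x. x \<noteq> s \<Longrightarrow> dist x s < d \<Longrightarrow> g x \<noteq> 0"
      by (auto simp: eventually_at)
    obtain q where q: "q \<in> \<rat>" "s < q" "q < s + d"
      using Rats_dense_in_real[of s "s + d"] d(1) by auto
    have "g q = 0" using theta_ratio_rational[OF q(1)] q(2) s by (simp add: g_def)
    moreover have "g q \<noteq> 0" by (rule d(2)) (use q in \<open>auto simp: dist_real_def\<close>)
    ultimately show False by simp
  qed
  then show ?thesis using t by (simp add: g_def s_def)
qed

theorem theta_inversion:
  assumes \<tau>: "Im \<tau> > 0"
  shows "theta (- 1 / \<tau>) (y / \<tau>) = csqrt (- \<i> * \<tau>) * e2pi (y\<^sup>2 / (2 * \<tau>)) * theta \<tau> y"
proof -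
  let ?H = "{\<sigma>. Im \<sigma> > 0}"
  define f where "f \<tau> = theta (- 1 / \<tau>) (y / \<tau>) - csqrt (- \<i> * \<tau>) * e2pi (y\<^sup>2 / (2 * \<tau>)) * theta \<tau> y" for \<tau>
  have "f \<tau> = 0"
  proof (rule analytic_continuation[where S = ?H and U = "(\<lambda>t. \<i> * of_real t) ` {0<..}" and \<xi> = \<i> and f = f])
    have "(\<lambda>\<tau>. theta (- 1 / \<tau>) (- y * (- 1 / \<tau>) + 0)) holomorphic_on ?H"
      by (rule holomorphic_on_compose_gen[OF _ theta_line_holomorphic, of "\<lambda>\<tau>. - 1 / \<tau>", unfolded o_def])
         (auto intro!: holomorphic_on_divide holomorphic_on_const holomorphic_on_ident Im_inverse_pos simp del: divide_minus_left)
    moreover have "(\<lambda>\<tau>. theta \<tau> y) holomorphic_on ?H"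
      using theta_line_holomorphic[of 0 y] by simp
    moreover have "(\<lambda>\<tau>. csqrt (- \<i> * \<tau>)) holomorphic_on ?H"
      by (rule holomorphic_on_compose_gen[OF _ holomorphic_on_csqrt, of _ ?H, unfolded o_def])
         (auto intro!: holomorphic_intros simp: complex_nonpos_Reals_iff)
    moreover have "(\<lambda>\<tau>. e2pi (y\<^sup>2 / (2 * \<tau>))) holomorphic_on ?H"
      unfolding e2pi_def by (auto intro!: holomorphic_intros)
    ultimately show "f holomorphic_on ?H"
      unfolding f_def[abs_def] by (intro holomorphic_on_diff holomorphic_on_mult) simp_all
    show "open ?H" by (rule open_halfspace_Im_gt)
    show "connected ?H" by (rule convex_connected[OF convex_halfspace_Im_gt])
    show "(\<lambda>t. \<i> * of_real t) ` {0<..} \<subseteq> ?H" by auto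
    show "\<i> islimpt (\<lambda>t. \<i> * of_real t) ` {0<..}"
      unfolding islimpt_approachable
    proof (intro allI impI)
      fix e :: real assume e: "e > 0"
      have "\<i> * of_real (1 + e / 2) \<noteq> \<i>" using e by (auto simp: complex_eq_iff)
      moreover have "dist (\<i> * of_real (1 + e / 2)) \<i> < e"
      proof -
        have "\<i> * of_real (1 + e / 2) - \<i> = \<i> * of_real (e / 2)" by (simp add: algebra_simps)
        then show ?thesis using e by (simp add: dist_norm norm_mult del: of_real_divide)
      qed
      moreover have "\<i> * of_real (1 + e / 2) \<in> (\<lambda>t. \<i> * of_real t) ` {0<..}" using e by (intro imageI) simp
      ultimately show "\<exists>x'\<in>(\<lambda>t. \<i> * of_real t) ` {0<..}. x' \<noteq> \<i> \<and> dist x' \<i> < e" by blast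
    qed
    fix \<sigma> assume "\<sigma> \<in> (\<lambda>t. \<i> * of_real t) ` {0<..}"
    then obtain t where t: "t > 0" and \<sigma>: "\<sigma> = \<i> * of_real t" by auto
    have im: "Im \<sigma> > 0" using t by (simp add: \<sigma>)
    have nz: "theta \<sigma> 0 \<noteq> 0" using theta_imaginary_nonzero[OF t] by (simp add: \<sigma>)
    have "theta (- 1 / \<sigma>) 0 = of_real (sqrt t) * theta \<sigma> 0"
      using theta_ratio_sqrt[OF t] nz unfolding theta_ratio_def \<sigma>[symmetric] by (simp add: field_simps)
    with theta_dual_proportional[OF im, of y] nz have "theta_dual \<sigma> y = of_real (sqrt t) * theta \<sigma> y" by simp
    then have "theta (- 1 / \<sigma>) (y / \<sigma>) = of_real (sqrt t) * e2pi (y\<^sup>2 / (2 * \<sigma>)) * theta \<sigma> y"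
      unfolding theta_dual_def e2pi_minus by (simp add: field_simps)
    moreover have "csqrt (- \<i> * \<sigma>) = of_real (sqrt t)" using t by (simp add: \<sigma> flip: mult.assoc)
    ultimately show "f \<sigma> = 0" by (simp add: f_def)
  qed (use \<tau> in auto)
  then show ?thesis by (simp add: f_def)
qed

section \<open>The lattice \<open>E\<^sub>8\<close> and its theta function\<close>

definition shifted_integers :: "real \<Rightarrow> (real^8) set" where
  "shifted_integers a = {x. \<forall>i. x $ i - a \<in> \<int>}"

text \<open>The even unimodular lattice in its \<open>D\<^sub>8\<close> coordinates: all entries integral or all half-odd, with
  even coordinate sum.\<close>
definition E8 :: "(real^8) set" where
  "E8 = {x. (x \<in> shifted_integers 0 \<or> x \<in> shifted_integers (1/2)) \<and> (\<Sum>i\<in>UNIV. x $ i) / 2 \<in> \<int>}"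

definition half_integers :: "(real^8) set" where
  "half_integers = {x. \<forall>i. 2 * x $ i \<in> \<int>}"

lemma shifted_integers_half: "shifted_integers 0 \<subseteq> half_integers" "shifted_integers (1/2) \<subseteq> half_integers"
proof -
  have "2 * x \<in> \<int>" if "x - 0 \<in> \<int>" for x :: real using that by (auto elim!: Ints_cases)
  then show "shifted_integers 0 \<subseteq> half_integers" by (auto simp: shifted_integers_def half_integers_def)
  have "2 * x \<in> \<int>" if "x - 1 / 2 \<in> \<int>" for x :: real
  proof -
    from that obtain n :: int where "x - 1 / 2 = of_int n" by (auto elim: Ints_cases)
    then have "2 * x = of_int (2 * n + 1)" by simp
    then show ?thesis by (metis Ints_of_int)
  qed
  then show "shifted_integers (1/2) \<subseteq> half_integers" by (auto simp: shifted_integers_def half_integers_def)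
qed

lemma E8_half_integers: "E8 \<subseteq> half_integers"
  using shifted_integers_half by (auto simp: E8_def)

definition rc :: "real^'n \<Rightarrow> complex^'n" where
  "rc x = (\<chi> i. of_real (x $ i))"

lemma rc_nth [simp]: "rc x $ i = of_real (x $ i)"
  by (simp add: rc_def)

lemma rc_linear: "rc (x + y) = rc x + rc y" "rc (a *\<^sub>R x) = of_real a *s rc x"
  by (simp_all add: vec_eq_iff)

lemma bilin_scale: "bilin (c *s x) y = c * bilin x y" "bilin x (c *s y) = c * bilin x y"
  by (simp_all add: bilin_def sum_distrib_left mult_ac)

lemma bilin_rc: "bilin (rc x) (rc y) = of_real (x \<bullet> y)"
  by (simp add: bilin_def inner_vec_def)

lemma norm_bilin_rc: "norm (bilin (rc x) y) \<le> norm x * (\<Sum>i\<in>UNIV. norm (y $ i))"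
proof -
  have "norm (bilin (rc x) y) \<le> (\<Sum>i\<in>UNIV. norm (rc x $ i * y $ i))"
    unfolding bilin_def by (rule norm_sum)
  also have "\<dots> \<le> (\<Sum>i\<in>UNIV. norm x * norm (y $ i))"
    by (rule sum_mono) (simp add: norm_mult mult_right_mono component_le_norm_cart)
  finally show ?thesis by (simp add: sum_distrib_left)
qed

text \<open>Sums of product functions over boxes of vectors. The summability of a positive product comes for
  free: a non-summable family has the sum \<open>0\<close> by convention, whereas the product of the sums is
  positive.\<close>
lemma vec_box_bij: "bij_betw vec_lambda (PiE UNIV (\<lambda>_. A)) {x :: 'a^'n. \<forall>i. x $ i \<in> A}"
  by (rule bij_betwI[where g = vec_nth]) auto

lemma infsum_vec_box:
  fixes f :: "'n::finite \<Rightarrow> 'a \<Rightarrow> complex"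
  assumes "\<And>i. (\<lambda>t. norm (f i t)) summable_on A"
  shows "infsum (\<lambda>x. \<Prod>i\<in>UNIV. f i (x $ i)) {x. \<forall>i. x $ i \<in> A} = (\<Prod>i\<in>UNIV. infsum (f i) A)"
proof -
  have "infsum (\<lambda>x. \<Prod>i\<in>UNIV. f i (x $ i)) {x. \<forall>i. x $ i \<in> A}
      = infsum (\<lambda>g. \<Prod>i\<in>UNIV. f i (g i)) (PiE UNIV (\<lambda>_. A))"
    by (subst infsum_reindex_bij_betw[OF vec_box_bij, symmetric]) simp
  also have "\<dots> = (\<Prod>i\<in>UNIV. infsum (f i) A)"
    by (rule infsum_prod_PiE_abs) (use assms in auto)
  finally show ?thesis .
qed

lemma summable_on_vec_box:
  fixes f :: "'a \<Rightarrow> real"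
  assumes f: "f summable_on A" and pos: "\<And>t. t \<in> A \<Longrightarrow> f t > 0" and A: "c \<in> A"
  shows "(\<lambda>x :: 'a^'n::finite. \<Prod>i\<in>UNIV. f (x $ i)) summable_on {x. \<forall>i. x $ i \<in> A}"
proof -
  have "0 < f c" using pos A by simp
  also have "f c \<le> infsum f A"
    using finite_sum_le_infsum[OF f, of "{c}"] A pos by (simp add: less_imp_le)
  finally have S: "infsum f A > 0" .
  have "(\<lambda>t. norm (f t)) summable_on A"
    using f by (rule summable_on_cong[THEN iffD1, rotated]) (simp add: less_imp_le pos)
  then have "infsum (\<lambda>g. \<Prod>i\<in>(UNIV :: 'n set). f (g i)) (PiE UNIV (\<lambda>_. A)) = (\<Prod>i\<in>(UNIV :: 'n set). infsum f A)"
    by (intro infsum_prod_PiE_abs) auto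
  also have "\<dots> > 0" using S by (intro prod_pos) auto
  finally have "infsum (\<lambda>g. \<Prod>i\<in>(UNIV :: 'n set). f (g i)) (PiE UNIV (\<lambda>_. A)) \<noteq> 0" by simp
  then have "(\<lambda>g. \<Prod>i\<in>(UNIV :: 'n set). f (g i)) summable_on (PiE UNIV (\<lambda>_. A))"
    using infsum_not_exists by blast
  then show ?thesis
    by (subst summable_on_reindex_bij_betw[OF vec_box_bij, symmetric]) simp
qed

lemma half_integers_gaussian:
  assumes a: "a > 0"
  shows "(\<lambda>x. exp (- a * (norm x)\<^sup>2)) summable_on half_integers"
proof -
  let ?A = "{t :: real. 2 * t \<in> \<int>}"
  have bij: "bij_betw (\<lambda>n::int. of_int n / 2) UNIV ?A"
    by (rule bij_betwI[where g = "\<lambda>t. \<lfloor>2 * t\<rfloor>"]) (auto elim!: Ints_cases)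
  have "(\<lambda>n::int. exp (- a * (of_int n / 2)\<^sup>2)) summable_on UNIV"
    using summable_on_gaussian[of "a / 4" 0] a by (simp add: power_divide)
  then have "(\<lambda>t. exp (- a * t\<^sup>2)) summable_on ?A"
    by (subst summable_on_reindex_bij_betw[OF bij, symmetric]) 
  then have "(\<lambda>x :: real^8. \<Prod>i\<in>UNIV. exp (- a * (x $ i)\<^sup>2)) summable_on {x. \<forall>i. x $ i \<in> ?A}"
    by (rule summable_on_vec_box[where c = 0]) auto
  moreover have "(\<Prod>i\<in>UNIV. exp (- a * (x $ i)\<^sup>2)) = exp (- a * (norm x)\<^sup>2)" for x :: "real^8"
    by (simp add: exp_sum[symmetric] norm_vec_def L2_set_def sum_nonneg sum_distrib_left sum_negf)
  ultimately show ?thesis by (simp add: half_integers_def)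
qed

lemma quadratic_exp_bound:
  fixes a b u :: real
  assumes "a > 0"
  shows "exp (- a * u\<^sup>2 + b * u) \<le> exp (b\<^sup>2 / (2 * a)) * exp (- (a / 2) * u\<^sup>2)"
proof -
  have "0 \<le> (a * u - b)\<^sup>2 / (2 * a)" using assms by simp
  also have "\<dots> = a / 2 * u\<^sup>2 - b * u + b\<^sup>2 / (2 * a)"
    using assms by (simp add: power2_diff field_simps power2_eq_square)
  finally have "- a * u\<^sup>2 + b * u \<le> b\<^sup>2 / (2 * a) + - (a / 2) * u\<^sup>2" by simp
  then show ?thesis by (simp only: exp_add[symmetric] exp_le_cancel_iff)
qed

lemma half_integers_dominated:
  fixes f :: "real^8 \<Rightarrow> 'b::real_normed_vector"
  assumes a: "a > 0" and bound: "\<And>x. norm (f x) \<le> exp (- a * (norm x)\<^sup>2 + b * norm x)"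
  shows "(\<lambda>x. norm (f x)) summable_on half_integers"
proof (rule Infinite_Sum.abs_summable_on_comparison_test')
  show "(\<lambda>x. exp (b\<^sup>2 / (2 * a)) * exp (- (a / 2) * (norm x)\<^sup>2)) summable_on half_integers"
    by (rule summable_on_cmult_right, rule half_integers_gaussian) (use a in simp)
  show "norm (f x) \<le> exp (b\<^sup>2 / (2 * a)) * exp (- (a / 2) * (norm x)\<^sup>2)" for x
    using bound quadratic_exp_bound[OF a] by (rule order_trans)
qed

definition lattice_exp :: "complex \<Rightarrow> complex^8 \<Rightarrow> real^8 \<Rightarrow> complex" where
  "lattice_exp \<tau> y x = e2pi (of_real (x \<bullet> x) * \<tau> / 2 + bilin (rc x) y)"

lemma norm_lattice_exp:
  "norm (lattice_exp \<tau> y x) \<le> exp (- (pi * Im \<tau>) * (norm x)\<^sup>2 + 2 * pi * (\<Sum>i\<in>UNIV. norm (y $ i)) * norm x)"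
proof -
  have "- Im (bilin (rc x) y) \<le> norm x * (\<Sum>i\<in>UNIV. norm (y $ i))"
    using norm_bilin_rc[of x y] abs_Im_le_cmod[of "bilin (rc x) y"] by linarith
  then have "2 * pi * (- Im (bilin (rc x) y)) \<le> 2 * pi * (norm x * (\<Sum>i\<in>UNIV. norm (y $ i)))"
    by (intro mult_left_mono) auto
  moreover have "- (2 * pi * Im (of_real (x \<bullet> x) * \<tau> / 2 + bilin (rc x) y))
      = - (pi * Im \<tau>) * (norm x)\<^sup>2 + 2 * pi * (- Im (bilin (rc x) y))"
    unfolding power2_norm_eq_inner by (simp add: algebra_simps)
  ultimately have "- (2 * pi * Im (of_real (x \<bullet> x) * \<tau> / 2 + bilin (rc x) y))
      \<le> - (pi * Im \<tau>) * (norm x)\<^sup>2 + 2 * pi * (\<Sum>i\<in>UNIV. norm (y $ i)) * norm x"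
    by (simp only: mult_ac)
  then show ?thesis
    unfolding lattice_exp_def norm_e2pi by (simp only: exp_le_cancel_iff)
qed

lemma lattice_exp_summable:
  assumes "Im \<tau> > 0"
  shows "(\<lambda>x. norm (lattice_exp \<tau> y x) * exp (c * norm x)) summable_on half_integers"
proof -
  have "(\<lambda>x. norm (norm (lattice_exp \<tau> y x) * exp (c * norm x))) summable_on half_integers"
  proof (rule half_integers_dominated[of "pi * Im \<tau>" _ "2 * pi * (\<Sum>i\<in>UNIV. norm (y $ i)) + c"])
    fix x
    have "norm (lattice_exp \<tau> y x) * exp (c * norm x) \<le>
        exp (- (pi * Im \<tau>) * (norm x)\<^sup>2 + 2 * pi * (\<Sum>i\<in>UNIV. norm (y $ i)) * norm x) * exp (c * norm x)"
      by (rule mult_right_mono[OF norm_lattice_exp]) simp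
    then show "norm (norm (lattice_exp \<tau> y x) * exp (c * norm x))
        \<le> exp (- (pi * Im \<tau>) * (norm x)\<^sup>2 + (2 * pi * (\<Sum>i\<in>UNIV. norm (y $ i)) + c) * norm x)"
      by (simp add: exp_add[symmetric] algebra_simps)
  qed (use assms in simp)
  then show ?thesis by simp
qed

definition theta_char :: "real \<Rightarrow> real \<Rightarrow> complex \<Rightarrow> complex \<Rightarrow> complex" where
  "theta_char a b \<tau> y = e2pi (of_real (a\<^sup>2) * \<tau> / 2 + of_real a * (y + of_real b)) * theta \<tau> (y + of_real b + of_real a * \<tau>)"

lemma theta_char_sum:
  assumes \<tau>: "Im \<tau> > 0"
  shows "((\<lambda>t. e2pi (of_real (t\<^sup>2) * \<tau> / 2 + of_real t * (y + of_real b))) has_sum theta_char a b \<tau> y) {t. t - a \<in> \<int>}"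
    and "(\<lambda>t. norm (e2pi (of_real (t\<^sup>2) * \<tau> / 2 + of_real t * (y + of_real b)))) summable_on {t. t - a \<in> \<int>}"
proof -
  let ?f = "\<lambda>t. e2pi (of_real (t\<^sup>2) * \<tau> / 2 + of_real t * (y + of_real b))"
  have bij: "bij_betw (\<lambda>n::int. of_int n + a) UNIV {t. t - a \<in> \<int>}"
    by (rule bij_betwI[where g = "\<lambda>t. \<lfloor>t - a\<rfloor>"]) (auto elim!: Ints_cases)
  have "((\<lambda>n. ?f (of_int n + a)) has_sum theta_char a b \<tau> y) UNIV"
    unfolding theta_char_def
    by (rule has_sum_eqI[OF has_sum_cmult_right[OF theta_has_sum[OF \<tau>]]])
       (simp_all only: e2pi_add[symmetric], rule arg_cong[of _ _ e2pi], simp add: power2_eq_square field_simps)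
  then show 1: "(?f has_sum theta_char a b \<tau> y) {t. t - a \<in> \<int>}"
    by (subst (asm) has_sum_reindex_bij_betw[OF bij])
  show "(\<lambda>t. norm (?f t)) summable_on {t. t - a \<in> \<int>}"
    using has_sum_imp_summable[OF 1] by (simp only: summable_on_iff_abs_summable_on_complex)
qed

lemma theta_char_inversion:
  assumes \<tau>: "Im \<tau> > 0" and a: "a = 0 \<or> a = 1 / 2"
  shows "theta_char a b (- 1 / \<tau>) (y / \<tau>)
    = csqrt (- \<i> * \<tau>) * e2pi (y\<^sup>2 / (2 * \<tau>)) * e2pi (- of_real (a * b)) * theta_char b a \<tau> y"
proof -
  have t0: "\<tau> \<noteq> 0" using \<tau> by auto
  define Y where "Y = y + of_real b * \<tau> - of_real a"
  have "y / \<tau> + of_real b + of_real a * (- 1 / \<tau>) = Y / \<tau>"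
    using t0 by (simp add: Y_def field_simps)
  then have 1: "theta_char a b (- 1 / \<tau>) (y / \<tau>)
      = e2pi (of_real (a\<^sup>2) * (- 1 / \<tau>) / 2 + of_real a * (y / \<tau> + of_real b))
        * (csqrt (- \<i> * \<tau>) * e2pi (Y\<^sup>2 / (2 * \<tau>)) * theta \<tau> Y)"
    unfolding theta_char_def by (simp only: theta_inversion[OF \<tau>])
  have 2: "theta \<tau> Y = theta \<tau> (y + of_real a + of_real b * \<tau>)"
  proof (cases "a = 0")
    case False
    with a have "a + a = 1" by auto
    then have "complex_of_real a + of_real a = 1" by (simp only: of_real_add[symmetric] of_real_1)
    then have "y + of_real a + of_real b * \<tau> = Y + 1" by (simp add: Y_def algebra_simps)
    then show ?thesis by (simp only: theta_plus_1)
  qed (simp add: Y_def)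
  have 3: "e2pi (of_real (a\<^sup>2) * (- 1 / \<tau>) / 2 + of_real a * (y / \<tau> + of_real b)) * e2pi (Y\<^sup>2 / (2 * \<tau>))
      = e2pi (y\<^sup>2 / (2 * \<tau>)) * e2pi (- of_real (a * b))
        * e2pi (of_real (b\<^sup>2) * \<tau> / 2 + of_real b * (y + of_real a))"
    unfolding e2pi_add[symmetric] using t0
    by (intro arg_cong[of _ _ e2pi]) (simp add: Y_def power2_eq_square field_simps)
  have "theta_char a b (- 1 / \<tau>) (y / \<tau>) = csqrt (- \<i> * \<tau>)
      * (e2pi (of_real (a\<^sup>2) * (- 1 / \<tau>) / 2 + of_real a * (y / \<tau> + of_real b)) * e2pi (Y\<^sup>2 / (2 * \<tau>)))
      * theta \<tau> (y + of_real a + of_real b * \<tau>)"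
    unfolding 1 2 by (simp only: mult_ac)
  then show ?thesis
    unfolding 3 unfolding theta_char_def by (simp only: mult_ac)
qed

definition box_theta :: "real \<Rightarrow> real \<Rightarrow> complex \<Rightarrow> complex^8 \<Rightarrow> complex" where
  "box_theta a b \<tau> y = infsum (\<lambda>x. lattice_exp \<tau> y x * e2pi (of_real (b * (\<Sum>i\<in>UNIV. x $ i)))) (shifted_integers a)"

lemma box_theta_prod:
  assumes \<tau>: "Im \<tau> > 0"
  shows "box_theta a b \<tau> y = (\<Prod>i\<in>UNIV. theta_char a b \<tau> (y $ i))"
proof -
  have "lattice_exp \<tau> y x * e2pi (of_real (b * (\<Sum>i\<in>UNIV. x $ i)))
      = (\<Prod>i\<in>UNIV. e2pi (of_real ((x $ i)\<^sup>2) * \<tau> / 2 + of_real (x $ i) * (y $ i + of_real b)))" for x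
    unfolding lattice_exp_def e2pi_add[symmetric] e2pi_sum[OF finite, symmetric]
    by (rule arg_cong[of _ _ e2pi])
       (simp add: inner_vec_def bilin_def sum_distrib_left sum_distrib_right sum_divide_distrib
          sum.distrib power2_eq_square distrib_left mult_ac)
  then have "box_theta a b \<tau> y = infsum (\<lambda>x. \<Prod>i\<in>UNIV. e2pi (of_real ((x $ i)\<^sup>2) * \<tau> / 2 + of_real (x $ i) * (y $ i + of_real b)))
      {x. \<forall>i. x $ i \<in> {t. t - a \<in> \<int>}}"
    by (simp add: box_theta_def shifted_integers_def)
  also have "\<dots> = (\<Prod>i\<in>UNIV. infsum (\<lambda>t. e2pi (of_real (t\<^sup>2) * \<tau> / 2 + of_real t * (y $ i + of_real b))) {t. t - a \<in> \<int>})"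
    by (rule infsum_vec_box) (rule theta_char_sum(2)[OF \<tau>])
  also have "\<dots> = (\<Prod>i\<in>UNIV. theta_char a b \<tau> (y $ i))"
    by (intro prod.cong refl infsumI theta_char_sum(1)[OF \<tau>])
  finally show ?thesis .
qed

lemma box_theta_inversion:
  assumes \<tau>: "Im \<tau> > 0" and a: "a = 0 \<or> a = 1 / 2" and b: "b = 0 \<or> b = 1 / 2"
  shows "box_theta a b (- 1 / \<tau>) ((1 / \<tau>) *s y) = \<tau> ^ 4 * e2pi (bilin y y / (2 * \<tau>)) * box_theta b a \<tau> y"
proof -
  have "box_theta a b (- 1 / \<tau>) ((1 / \<tau>) *s y) = (\<Prod>i\<in>UNIV. theta_char a b (- 1 / \<tau>) (y $ i / \<tau>))"
    unfolding box_theta_prod[OF Im_inverse_pos[OF \<tau>]] by simp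
  also have "\<dots> = csqrt (- \<i> * \<tau>) ^ 8 * (\<Prod>i\<in>UNIV. e2pi ((y $ i)\<^sup>2 / (2 * \<tau>))) * e2pi (- of_real (a * b)) ^ 8
      * (\<Prod>i\<in>UNIV. theta_char b a \<tau> (y $ i))"
    by (simp only: theta_char_inversion[OF \<tau> a] prod.distrib prod_constant) simp
  also have "csqrt (- \<i> * \<tau>) ^ 8 = \<tau> ^ 4"
  proof -
    have "csqrt (- \<i> * \<tau>) ^ 8 = ((csqrt (- \<i> * \<tau>))\<^sup>2) ^ 4"
      using power_mult[of "csqrt (- \<i> * \<tau>)" 2 4] by (simp del: power2_csqrt)
    also have "\<dots> = (- \<i> * \<tau>) ^ 4" by (simp only: power2_csqrt)
    also have "\<dots> = \<tau> ^ 4" by (simp add: power_mult_distrib)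
    finally show ?thesis .
  qed
  also have "e2pi (- of_real (a * b)) ^ 8 = 1"
  proof -
    have "e2pi (- of_real (a * b)) ^ 8 = e2pi (of_nat 8 * (- of_real (a * b)))"
      by (simp only: e2pi_of_nat_mult)
    also have "\<dots> = 1"
    proof (rule e2pi_int)
      show "of_nat 8 * (- of_real (a * b)) \<in> (\<int> :: complex set)"
        using a b by (elim disjE) (hypsubst, simp)+
    qed
    finally show ?thesis .
  qed
  also have "(\<Prod>i\<in>UNIV. e2pi ((y $ i)\<^sup>2 / (2 * \<tau>))) = e2pi (bilin y y / (2 * \<tau>))"
    by (simp add: e2pi_sum[symmetric] bilin_def sum_divide_distrib power2_eq_square)
  finally show ?thesis by (simp add: box_theta_prod[OF \<tau>])
qed

definition E8_theta :: "complex \<Rightarrow> complex^8 \<Rightarrow> complex" where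
  "E8_theta \<tau> y = infsum (lattice_exp \<tau> y) E8"

text \<open>The parity condition on the coordinate sum is detected by the character with \<open>b = 1/2\<close>.\<close>
lemma E8_theta_boxes:
  assumes \<tau>: "Im \<tau> > 0"
  shows "E8_theta \<tau> y = (box_theta 0 0 \<tau> y + box_theta 0 (1/2) \<tau> y + box_theta (1/2) 0 \<tau> y + box_theta (1/2) (1/2) \<tau> y) / 2"
proof -
  define E where "E a = {x \<in> shifted_integers a. (\<Sum>i\<in>UNIV. x $ i) / 2 \<in> \<int>}" for a
  have sm: "lattice_exp \<tau> y summable_on half_integers"
    by (rule abs_summable_summable) (use lattice_exp_summable[OF \<tau>, of y 0] in simp)
  have half: "infsum (lattice_exp \<tau> y) (E a) = (box_theta a 0 \<tau> y + box_theta a (1/2) \<tau> y) / 2"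
    if a: "a = 0 \<or> a = 1 / 2" for a
  proof -
    have sub: "shifted_integers a \<subseteq> half_integers" 
      using a by (elim disjE) (simp_all only: shifted_integers_half)
    have s: "(\<lambda>x. lattice_exp \<tau> y x * e2pi (of_real (b * (\<Sum>i\<in>UNIV. x $ i)))) summable_on shifted_integers a" for b
    proof (rule abs_summable_summable)
      have "(\<lambda>x. norm (lattice_exp \<tau> y x)) summable_on shifted_integers a"
        by (rule summable_on_subset_banach[OF _ sub]) (use lattice_exp_summable[OF \<tau>, of y 0] in simp)
      then show "(\<lambda>x. norm (lattice_exp \<tau> y x * e2pi (of_real (b * (\<Sum>i\<in>UNIV. x $ i))))) summable_on shifted_integers a"
        by (simp add: norm_mult norm_e2pi)
    qed
    have int: "(\<Sum>i\<in>UNIV. x $ i) \<in> \<int>" if "x \<in> shifted_integers a" for x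
    proof -
      have "(\<Sum>i\<in>UNIV. x $ i - a) \<in> \<int>" using that by (intro Ints_sum) (simp add: shifted_integers_def)
      moreover have "(\<Sum>i\<in>UNIV. x $ i - a) = (\<Sum>i\<in>UNIV. x $ i) - 8 * a" by (simp add: sum_subtractf)
      moreover have "8 * a \<in> \<int>" using a by (elim disjE) (hypsubst, simp)+
      ultimately have "((\<Sum>i\<in>UNIV. x $ i) - 8 * a) + 8 * a \<in> \<int>" by (intro Ints_add) simp_all
      then show ?thesis by simp
    qed
    have "(box_theta a 0 \<tau> y + box_theta a (1/2) \<tau> y) / 2
        = infsum (\<lambda>x. (lattice_exp \<tau> y x * e2pi (of_real (0 * (\<Sum>i\<in>UNIV. x $ i)))
            + lattice_exp \<tau> y x * e2pi (of_real ((1/2) * (\<Sum>i\<in>UNIV. x $ i)))) * (1 / 2)) (shifted_integers a)"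
      unfolding box_theta_def infsum_add[OF s s, symmetric] by (subst infsum_cmult_left') simp
    also have "\<dots> = infsum (lattice_exp \<tau> y) (E a)"
    proof (rule infsum_cong_neutral)
      fix x assume x: "x \<in> E a - shifted_integers a"
      then have False by (auto simp: E_def)
      then show "lattice_exp \<tau> y x = 0" ..
    next
      fix x assume x: "x \<in> shifted_integers a - E a"
      from x have "(\<Sum>i\<in>UNIV. x $ i) \<in> \<int>" by (intro int) simp
      then obtain k :: int where k: "(\<Sum>i\<in>UNIV. x $ i) = of_int k" by (rule Ints_cases)
      have "odd k"
      proof
        assume "even k"
        then obtain l where "k = 2 * l" by auto
        then have "(\<Sum>i\<in>UNIV. x $ i) / 2 = of_int l" by (simp add: k)
        then show False using x by (auto simp: E_def)
      qed
      then obtain l where "k = 2 * l + 1" by (elim oddE)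
      then have "complex_of_real ((1/2) * (\<Sum>i\<in>UNIV. x $ i)) = of_int l + 1 / 2" by (simp add: k field_simps)
      then have "e2pi (of_real ((1/2) * (\<Sum>i\<in>UNIV. x $ i))) = - 1"
        by (simp only: e2pi_add e2pi_half) simp
      then show "(lattice_exp \<tau> y x * e2pi (of_real (0 * (\<Sum>i\<in>UNIV. x $ i)))
            + lattice_exp \<tau> y x * e2pi (of_real ((1/2) * (\<Sum>i\<in>UNIV. x $ i)))) * (1 / 2) = 0" by simp
    next
      fix x assume x: "x \<in> shifted_integers a \<inter> E a"
      then have "(\<Sum>i\<in>UNIV. x $ i) / 2 \<in> \<int>" by (simp add: E_def)
      then obtain l :: int where "(\<Sum>i\<in>UNIV. x $ i) / 2 = of_int l" by (rule Ints_cases)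
      then have "complex_of_real ((1/2) * (\<Sum>i\<in>UNIV. x $ i)) = of_int l" by simp
      then have "e2pi (of_real ((1/2) * (\<Sum>i\<in>UNIV. x $ i))) = 1" by (simp only: e2pi_int Ints_of_int)
      then show "(lattice_exp \<tau> y x * e2pi (of_real (0 * (\<Sum>i\<in>UNIV. x $ i)))
            + lattice_exp \<tau> y x * e2pi (of_real ((1/2) * (\<Sum>i\<in>UNIV. x $ i)))) * (1 / 2) = lattice_exp \<tau> y x" by simp
    qed
    finally show ?thesis by simp
  qed
  have E8: "E8 = E 0 \<union> E (1/2)" by (auto simp: E8_def E_def)
  have disj: "E 0 \<inter> E (1/2) = {}"
  proof -
    have False if "t - 0 \<in> \<int>" "t - 1 / 2 \<in> \<int>" for t :: real
    proof -
      have "(t - 0) - (t - 1 / 2) \<in> \<int>" by (rule Ints_diff[OF that])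
      then have "1 / 2 \<in> (\<int> :: real set)" by simp
      then obtain n :: int where "1 / 2 = real_of_int n" by (rule Ints_cases)
      then have "real_of_int 1 = real_of_int (2 * n)" by simp
      then have "1 = 2 * n" by (simp only: of_int_eq_iff)
      then show False by presburger
    qed
    then have "x \<notin> shifted_integers 0 \<inter> shifted_integers (1/2)" for x
      unfolding shifted_integers_def by blast
    then show ?thesis by (auto simp: E_def)
  qed
  have "E 0 \<subseteq> half_integers" "E (1/2) \<subseteq> half_integers"
    using shifted_integers_half by (auto simp: E_def)
  then have "lattice_exp \<tau> y summable_on E 0" "lattice_exp \<tau> y summable_on E (1/2)"
    by (auto intro: summable_on_subset_banach[OF sm])
  from infsum_Un_disjoint[OF this disj] have "E8_theta \<tau> y = infsum (lattice_exp \<tau> y) (E 0) + infsum (lattice_exp \<tau> y) (E (1/2))"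
    unfolding E8_theta_def E8 .
  then show ?thesis by (simp add: half add_divide_distrib)
qed

theorem E8_theta_inversion:
  assumes \<tau>: "Im \<tau> > 0"
  shows "E8_theta (- 1 / \<tau>) ((1 / \<tau>) *s y) = \<tau> ^ 4 * e2pi (bilin y y / (2 * \<tau>)) * E8_theta \<tau> y"
proof -
  note inv = box_theta_inversion[OF \<tau>]
  have "box_theta 0 0 (- 1 / \<tau>) ((1 / \<tau>) *s y) = \<tau> ^ 4 * e2pi (bilin y y / (2 * \<tau>)) * box_theta 0 0 \<tau> y"
    "box_theta 0 (1/2) (- 1 / \<tau>) ((1 / \<tau>) *s y) = \<tau> ^ 4 * e2pi (bilin y y / (2 * \<tau>)) * box_theta (1/2) 0 \<tau> y"
    "box_theta (1/2) 0 (- 1 / \<tau>) ((1 / \<tau>) *s y) = \<tau> ^ 4 * e2pi (bilin y y / (2 * \<tau>)) * box_theta 0 (1/2) \<tau> y"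
    "box_theta (1/2) (1/2) (- 1 / \<tau>) ((1 / \<tau>) *s y) = \<tau> ^ 4 * e2pi (bilin y y / (2 * \<tau>)) * box_theta (1/2) (1/2) \<tau> y"
    by (rule inv; simp)+
  then show ?thesis
    unfolding E8_theta_boxes[OF \<tau>] E8_theta_boxes[OF Im_inverse_pos[OF \<tau>]]
    by (simp only: distrib_left[symmetric] times_divide_eq_right add_ac)
qed

section \<open>Spherical coefficients\<close>

lemma exp_coefficients_has_sum:
  fixes C b :: "'a \<Rightarrow> complex"
  assumes summable: "(\<lambda>x. norm (C x) * exp (norm (b x))) summable_on A" and s: "norm s \<le> 1"
  shows "((\<lambda>k. infsum (\<lambda>x. C x * (b x ^ k / fact k)) A * s ^ k) has_sum infsum (\<lambda>x. C x * exp (s * b x)) A) (UNIV :: nat set)"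
proof -
  let ?g = "\<lambda>(x, k :: nat). C x * (b x ^ k / fact k) * s ^ k"
  have exp_hs: "((\<lambda>k. z ^ k / fact k) has_sum exp z) UNIV" for z :: complex
  proof (rule norm_summable_imp_has_sum)
    show "(\<lambda>k. z ^ k / fact k) sums exp z"
      using exp_converges[of z] by (simp add: scaleR_conv_of_real divide_inverse mult_ac)
    show "summable (\<lambda>k. norm (z ^ k / fact k))"
      using summable_norm_exp[of z] by (simp add: scaleR_conv_of_real divide_inverse mult_ac)
  qed
  have exp_hs_real: "((\<lambda>k. t ^ k / fact k) has_sum exp t) UNIV" if "t \<ge> 0" for t :: real
  proof (rule norm_summable_imp_has_sum)
    show "(\<lambda>k. t ^ k / fact k) sums exp t"
      using exp_converges[of t] by (simp add: divide_inverse mult_ac)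
    show "summable (\<lambda>k. norm (t ^ k / fact k))"
      using summable_norm_exp[of t] by (simp add: divide_inverse mult_ac)
  qed
  have "(\<lambda>(x, k :: nat). norm (C x) * (norm (b x) ^ k / fact k)) summable_on A \<times> UNIV"
    by (rule summable_on_SigmaI[where g = "\<lambda>x. norm (C x) * exp (norm (b x))"])
       (simp_all only: prod.case has_sum_cmult_right exp_hs_real norm_ge_zero summable, simp)
  then have "(\<lambda>p. norm (?g p)) summable_on A \<times> UNIV"
  proof (rule Infinite_Sum.abs_summable_on_comparison_test')
    fix p :: "'a \<times> nat" assume "p \<in> A \<times> UNIV"
    obtain x k where p: "p = (x, k)" by (cases p)
    have "norm s ^ k \<le> 1" using s by (intro power_le_one) auto
    then have "norm (C x) * (norm (b x) ^ k / fact k) * norm s ^ k \<le> norm (C x) * (norm (b x) ^ k / fact k) * 1"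
      by (intro mult_left_mono) auto
    then show "norm (?g p) \<le> (case p of (x, k) \<Rightarrow> norm (C x) * (norm (b x) ^ k / fact k))"
      by (simp add: p norm_mult norm_divide norm_power)
  qed
  then have "?g summable_on A \<times> UNIV" by (rule abs_summable_summable)
  then obtain S where S: "(?g has_sum S) (A \<times> UNIV)" by (auto simp: summable_on_def)
  have "((\<lambda>x. C x * exp (s * b x)) has_sum S) A"
  proof (rule has_sum_SigmaD[OF S])
    fix x
    show "((\<lambda>k. ?g (x, k)) has_sum C x * exp (s * b x)) UNIV"
      by (rule has_sum_eqI[OF has_sum_cmult_right[OF exp_hs[of "s * b x"], of "C x"]])
         (auto simp: power_mult_distrib)
  qed
  then have "infsum (\<lambda>x. C x * exp (s * b x)) A = S" by (rule infsumI)
  moreover have "((\<lambda>k. infsum (\<lambda>x. C x * (b x ^ k / fact k)) A * s ^ k) has_sum S) UNIV"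
  proof (rule has_sum_SigmaD)
    show sw: "((\<lambda>(k, x). ?g (x, k)) has_sum S) (UNIV \<times> A)"
      using S by (subst has_sum_swap) simp
    fix k :: nat
    have "(\<lambda>x. C x * (b x ^ k / fact k)) summable_on A"
    proof (rule abs_summable_summable)
      have k: "norm (C x * (b x ^ k / fact k)) \<le> norm (C x) * exp (norm (b x))" for x
      proof -
        have "norm (b x) ^ k / fact k \<le> exp (norm (b x))"
          using finite_sum_le_has_sum[OF exp_hs_real[of "norm (b x)"], of "{k}"] by simp
        then have "norm (C x) * (norm (b x) ^ k / fact k) \<le> norm (C x) * exp (norm (b x))"
          by (rule mult_left_mono) simp
        then show ?thesis by (simp add: norm_mult norm_divide norm_power)
      qed
      show "(\<lambda>x. norm (C x * (b x ^ k / fact k))) summable_on A"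
        by (rule Infinite_Sum.abs_summable_on_comparison_test'[OF summable]) (rule k)
    qed
    then have "((\<lambda>x. C x * (b x ^ k / fact k)) has_sum infsum (\<lambda>x. C x * (b x ^ k / fact k)) A) A" by simp
    from has_sum_cmult_left[OF this, of "s ^ k"]
    show "((\<lambda>x. (\<lambda>(k, x). ?g (x, k)) (k, x)) has_sum infsum (\<lambda>x. C x * (b x ^ k / fact k)) A * s ^ k) A"
      by simp
  qed
  ultimately show ?thesis by simp
qed

definition E8_spherical :: "nat \<Rightarrow> complex^8 \<Rightarrow> complex \<Rightarrow> complex^8 \<Rightarrow> complex" where
  "E8_spherical k w \<tau> y = infsum (\<lambda>x. bilin (rc x) w ^ k * lattice_exp \<tau> y x) E8"

text \<open>Adding a multiple \<open>s w\<close> of an isotropic vector orthogonal to \<open>y\<close> does not change the Gaussian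
  factor of the inversion formula, so that formula holds for each coefficient in the expansion in powers
  of \<open>s\<close>. Each factor \<open>x \<cdot> w\<close> raises the weight by one.\<close>
theorem E8_spherical_inversion:
  assumes \<tau>: "Im \<tau> > 0" and w: "bilin w w = 0" and yw: "bilin y w = 0"
  shows "E8_spherical k w (- 1 / \<tau>) ((1 / \<tau>) *s y)
    = \<tau> ^ (4 + k) * e2pi (bilin y y / (2 * \<tau>)) * E8_spherical k w \<tau> y"
proof -
  have t0: "\<tau> \<noteq> 0" using \<tau> by auto
  define D where "D = \<tau> ^ 4 * e2pi (bilin y y / (2 * \<tau>))"
  define b where "b x = 2 * of_real pi * \<i> * bilin (rc x) w" for x
  define M where "M = 2 * pi * (\<Sum>i\<in>UNIV. norm (w $ i))"
  have bM: "norm (b x) \<le> M * norm x" for x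
    using norm_bilin_rc[of x w] by (simp add: b_def M_def norm_mult mult_ac)
  have sm: "(\<lambda>x. norm (lattice_exp \<sigma> v x) * exp (norm (b x * c))) summable_on E8" if \<sigma>: "Im \<sigma> > 0" for \<sigma> v c
  proof -
    have "(\<lambda>x. norm (norm (lattice_exp \<sigma> v x) * exp (norm (b x * c)))) summable_on E8"
    proof (rule Infinite_Sum.abs_summable_on_comparison_test')
      show "(\<lambda>x. norm (lattice_exp \<sigma> v x) * exp (M * norm c * norm x)) summable_on E8"
        by (rule summable_on_subset_banach[OF lattice_exp_summable[OF \<sigma>] E8_half_integers])
      fix x
      have "norm (b x * c) \<le> M * norm c * norm x"
        using mult_right_mono[OF bM, of "norm c" x] by (simp add: norm_mult mult_ac)
      then show "norm (norm (lattice_exp \<sigma> v x) * exp (norm (b x * c))) \<le> norm (lattice_exp \<sigma> v x) * exp (M * norm c * norm x)"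
        by (simp add: mult_left_mono)
    qed
    then show ?thesis by simp
  qed
  have shift: "E8_theta \<sigma> (v + s *s (c *s w)) = infsum (\<lambda>x. lattice_exp \<sigma> v x * exp (s * (b x * c))) E8" for \<sigma> v s c
    unfolding E8_theta_def lattice_exp_def b_def e2pi_def exp_add[symmetric]
    by (intro infsum_cong arg_cong[of _ _ exp]) (simp add: bilin_add bilin_scale algebra_simps)
  have 1: "((\<lambda>k. infsum (\<lambda>x. lattice_exp (- 1 / \<tau>) ((1 / \<tau>) *s y) x * ((b x * (1 / \<tau>)) ^ k / fact k)) E8 * s ^ k)
      has_sum E8_theta (- 1 / \<tau>) ((1 / \<tau>) *s (y + s *s w))) UNIV" if s: "norm s \<le> 1" for s
  proof -
    have "(1 / \<tau>) *s (y + s *s w) = (1 / \<tau>) *s y + s *s ((1 / \<tau>) *s w)"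
      by (simp add: vec_eq_iff algebra_simps)
    then show ?thesis
      using exp_coefficients_has_sum[OF sm[OF Im_inverse_pos[OF \<tau>]] s] by (simp only: shift)
  qed
  have 2: "((\<lambda>k. D * infsum (\<lambda>x. lattice_exp \<tau> y x * ((b x * 1) ^ k / fact k)) E8 * s ^ k)
      has_sum E8_theta (- 1 / \<tau>) ((1 / \<tau>) *s (y + s *s w))) UNIV" if s: "norm s \<le> 1" for s
  proof -
    have yy: "bilin (y + s *s w) (y + s *s w) = bilin y y"
      using w yw by (simp add: bilin_add bilin_scale bilin_commute[of w y])
    have eq: "E8_theta (- 1 / \<tau>) ((1 / \<tau>) *s (y + s *s w)) = D * E8_theta \<tau> (y + s *s (1 *s w))"
      unfolding E8_theta_inversion[OF \<tau>] yy D_def by simp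
    show ?thesis
      unfolding eq shift mult.assoc[of D]
      by (intro has_sum_cmult_right exp_coefficients_has_sum[OF sm[OF \<tau>] s])
  qed
  have eq: "infsum (\<lambda>x. lattice_exp (- 1 / \<tau>) ((1 / \<tau>) *s y) x * ((b x * (1 / \<tau>)) ^ k / fact k)) E8
      = D * infsum (\<lambda>x. lattice_exp \<tau> y x * ((b x * 1) ^ k / fact k)) E8"
  proof (rule fourier_coefficients_unique[where h = real and I = UNIV])
    fix t :: real
    have s: "norm (e2pi (of_real t)) \<le> 1" by (simp add: norm_e2pi)
    have pw: "e2pi (of_real t) ^ k = e2pi (of_real (real k \<bullet> t))" for k
      by (simp add: e2pi_of_nat_mult[symmetric])
    show "((\<lambda>k. infsum (\<lambda>x. lattice_exp (- 1 / \<tau>) ((1 / \<tau>) *s y) x * ((b x * (1 / \<tau>)) ^ k / fact k)) E8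
        * e2pi (of_real (real k \<bullet> t))) has_sum E8_theta (- 1 / \<tau>) ((1 / \<tau>) *s (y + e2pi (of_real t) *s w))) UNIV"
      using 1[OF s] by (simp only: pw)
    show "((\<lambda>k. D * infsum (\<lambda>x. lattice_exp \<tau> y x * ((b x * 1) ^ k / fact k)) E8
        * e2pi (of_real (real k \<bullet> t))) has_sum E8_theta (- 1 / \<tau>) ((1 / \<tau>) *s (y + e2pi (of_real t) *s w))) UNIV"
      using 2[OF s] by (simp only: pw)
  qed (auto simp: inj_on_def)
  define q :: complex where "q = (2 * of_real pi * \<i>) ^ k / fact k"
  have q: "q \<noteq> 0" by (simp add: q_def)
  have conv: "infsum (\<lambda>x. lattice_exp \<sigma> v x * ((b x * c) ^ k / fact k)) E8 = q * c ^ k * E8_spherical k w \<sigma> v" for \<sigma> v c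
    unfolding E8_spherical_def
    by (subst infsum_cmult_right'[symmetric], rule infsum_cong) (simp add: b_def q_def power_mult_distrib mult_ac)
  from eq have "q * (1 / \<tau>) ^ k * E8_spherical k w (- 1 / \<tau>) ((1 / \<tau>) *s y) = D * (q * E8_spherical k w \<tau> y)"
    unfolding conv by simp
  then show ?thesis
    using q t0 by (simp add: D_def power_add field_simps)
qed

section \<open>Integrality of the lattice\<close>

lemma shifted_add:
  assumes "x \<in> shifted_integers a" "y \<in> shifted_integers b" "a + b - c \<in> \<int>"
  shows "x + y \<in> shifted_integers c"
  unfolding shifted_integers_def mem_Collect_eq
proof
  fix i
  have "(x $ i - a) + (y $ i - b) + (a + b - c) \<in> \<int>"
    using assms by (intro Ints_add) (auto simp: shifted_integers_def)
  then show "(x + y) $ i - c \<in> \<int>" by (simp add: algebra_simps)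
qed

lemma shifted_minus:
  assumes "x \<in> shifted_integers a" "2 * a \<in> \<int>"
  shows "- x \<in> shifted_integers a"
  unfolding shifted_integers_def mem_Collect_eq
proof
  fix i
  have "x $ i - a \<in> \<int>" using assms(1) by (simp add: shifted_integers_def)
  from Ints_diff[OF Ints_minus[OF this] assms(2)] have "- (x $ i - a) - 2 * a \<in> \<int>" .
  moreover have "- (x $ i - a) - 2 * a = (- x) $ i - a" by simp
  ultimately show "(- x) $ i - a \<in> \<int>" by (simp only:)
qed

lemma E8_add:
  assumes "x \<in> E8" "y \<in> E8" shows "x + y \<in> E8"
proof -
  have "(\<Sum>i\<in>UNIV. x $ i) / 2 + (\<Sum>i\<in>UNIV. y $ i) / 2 \<in> \<int>"
    using assms by (intro Ints_add) (auto simp: E8_def)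
  then have s: "(\<Sum>i\<in>UNIV. (x + y) $ i) / 2 \<in> \<int>" by (simp add: sum.distrib add_divide_distrib)
  from assms consider "x \<in> shifted_integers 0" "y \<in> shifted_integers 0" | "x \<in> shifted_integers 0" "y \<in> shifted_integers (1/2)"
    | "x \<in> shifted_integers (1/2)" "y \<in> shifted_integers 0" | "x \<in> shifted_integers (1/2)" "y \<in> shifted_integers (1/2)"
    by (auto simp: E8_def)
  then have "x + y \<in> shifted_integers 0 \<or> x + y \<in> shifted_integers (1/2)"
  proof cases
    case 1 then show ?thesis using shifted_add[of x "0" y "0" "0"] by simp
  next
    case 2 then show ?thesis using shifted_add[of x "0" y "1/2" "1/2"] by simp
  next
    case 3 then show ?thesis using shifted_add[of x "1/2" y "0" "1/2"] by simp
  next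
    case 4 then show ?thesis using shifted_add[of x "1/2" y "1/2" "0"] by simp
  qed
  with s show ?thesis by (simp add: E8_def)
qed

lemma E8_minus:
  assumes "x \<in> E8" shows "- x \<in> E8"
proof -
  have "- ((\<Sum>i\<in>UNIV. x $ i) / 2) \<in> \<int>" using assms by (intro Ints_minus) (simp add: E8_def)
  then have "(\<Sum>i\<in>UNIV. (- x) $ i) / 2 \<in> \<int>" by (simp add: sum_negf)
  moreover have "- x \<in> shifted_integers 0 \<or> - x \<in> shifted_integers (1/2)"
    using assms shifted_minus[of x 0] shifted_minus[of x "1/2"] unfolding E8_def by fastforce
  ultimately show ?thesis by (simp add: E8_def)
qed

lemma E8_zero: "0 \<in> E8"
  by (simp add: E8_def shifted_integers_def)

lemma E8_scale:
  assumes x: "x \<in> E8" shows "of_int n *\<^sub>R x \<in> E8"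
proof -
  have nat: "real m *\<^sub>R x \<in> E8" for m
    by (induction m) (simp_all add: E8_zero scaleR_add_left E8_add x)
  show ?thesis
  proof (cases "n \<ge> 0")
    case True then show ?thesis using nat[of "nat n"] by simp
  next
    case False then show ?thesis using E8_minus[OF nat[of "nat (- n)"]] by simp
  qed
qed

lemma E8_coordinates:
  assumes "x \<in> E8"
  obtains a m s where "a = 0 \<or> a = (1 / 2 :: real)" "\<And>i. x $ i = a + of_int (m i)" "(\<Sum>i\<in>UNIV. m i) = 2 * s"
proof -
  from assms obtain a where a: "a = 0 \<or> a = (1 / 2 :: real)" and xa: "x \<in> shifted_integers a"
    unfolding E8_def by blast
  define m where "m i = \<lfloor>x $ i - a\<rfloor>" for i
  have m: "x $ i = a + of_int (m i)" for i
  proof -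
    have "x $ i - a \<in> \<int>" using xa by (simp add: shifted_integers_def)
    then have "of_int (m i) = x $ i - a" unfolding m_def by (rule of_int_floor)
    then show ?thesis by simp
  qed
  have "(\<Sum>i\<in>UNIV. x $ i) / 2 \<in> \<int>" using assms by (simp add: E8_def)
  then obtain q :: int where q: "(\<Sum>i\<in>UNIV. x $ i) / 2 = of_int q" by (rule Ints_cases)
  have "(\<Sum>i\<in>UNIV. x $ i) = 8 * a + of_int (\<Sum>i\<in>UNIV. m i)" by (simp add: m sum.distrib)
  with q have e: "of_int (\<Sum>i\<in>UNIV. m i) = 2 * real_of_int q - 8 * a" by simp
  have "\<exists>s. (\<Sum>i\<in>UNIV. m i) = 2 * s"
  proof (cases "a = 0")
    case True
    with e have "real_of_int (\<Sum>i\<in>UNIV. m i) = of_int (2 * q)" by simp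
    then show ?thesis by (simp only: of_int_eq_iff) blast
  next
    case False
    with a e have "real_of_int (\<Sum>i\<in>UNIV. m i) = of_int (2 * (q - 2))" by simp
    then show ?thesis by (simp only: of_int_eq_iff) blast
  qed
  then show thesis using that[OF a m] by blast
qed

lemma E8_inner_int:
  assumes "x \<in> E8" "y \<in> E8" shows "x \<bullet> y \<in> \<int>"
proof -
  obtain a m s where x: "a = 0 \<or> a = (1 / 2 :: real)" "\<And>i. x $ i = a + of_int (m i)" "(\<Sum>i\<in>UNIV. m i) = 2 * s"
    by (rule E8_coordinates[OF assms(1)]) blast
  obtain b n t where y: "b = 0 \<or> b = (1 / 2 :: real)" "\<And>i. y $ i = b + of_int (n i)" "(\<Sum>i\<in>UNIV. n i) = 2 * t"
    by (rule E8_coordinates[OF assms(2)]) blast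
  have "x \<bullet> y = 8 * a * b + a * of_int (\<Sum>i\<in>UNIV. n i) + b * of_int (\<Sum>i\<in>UNIV. m i) + of_int (\<Sum>i\<in>UNIV. m i * n i)"
    by (simp add: inner_vec_def x(2) y(2) sum.distrib sum_distrib_left distrib_left distrib_right mult_ac)
  also have "\<dots> = 2 * (2 * a) * (2 * b) + (2 * a) * of_int t + (2 * b) * of_int s + of_int (\<Sum>i\<in>UNIV. m i * n i)"
    unfolding x(3) y(3) by simp
  also have "\<dots> \<in> \<int>"
  proof -
    have "2 * a \<in> \<int>" "2 * b \<in> \<int>" using x(1) y(1) by (elim disjE; hypsubst; simp)+
    then show ?thesis using Ints_of_int Ints_numeral by (meson Ints_add Ints_mult)
  qed
  finally show ?thesis .
qed

lemma E8_even:
  assumes "x \<in> E8" shows "(x \<bullet> x) / 2 \<in> \<int>"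
proof -
  obtain a m s where x: "a = 0 \<or> a = (1 / 2 :: real)" "\<And>i. x $ i = a + of_int (m i)" "(\<Sum>i\<in>UNIV. m i) = 2 * s"
    by (rule E8_coordinates[OF assms(1)]) blast
  have "even (\<Sum>i\<in>UNIV. m i * m i - m i)" by (rule dvd_sum) simp
  then have "even ((\<Sum>i\<in>UNIV. m i * m i) - (\<Sum>i\<in>UNIV. m i))" by (simp only: sum_subtractf)
  then have "even (\<Sum>i\<in>UNIV. m i * m i)" using x(3) by simp
  then obtain q where q: "(\<Sum>i\<in>UNIV. m i * m i) = 2 * q" by (elim evenE)
  have "x \<bullet> x = 8 * a * a + 2 * (a * of_int (\<Sum>i\<in>UNIV. m i)) + of_int (\<Sum>i\<in>UNIV. m i * m i)"
    by (simp add: inner_vec_def x(2) sum.distrib sum_distrib_left distrib_left distrib_right mult_ac)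
  then have "(x \<bullet> x) / 2 = (2 * a) * (2 * a) + (2 * a) * of_int s + of_int q"
    unfolding x(3) q by simp
  also have "\<dots> \<in> \<int>"
  proof -
    have "2 * a \<in> \<int>" using x(1) by (elim disjE; hypsubst; simp)
    then show ?thesis using Ints_of_int by (meson Ints_add Ints_mult)
  qed
  finally show ?thesis .
qed

lemma half_integers_finite: "finite {x \<in> half_integers. norm x \<le> R}"
proof -
  let ?A = "(\<lambda>n::int. of_int n / 2 :: real) ` {- \<lceil>2 * R\<rceil>..\<lceil>2 * R\<rceil>}"
  have "{x \<in> half_integers. norm x \<le> R} \<subseteq> vec_lambda ` (PiE UNIV (\<lambda>_. ?A))"
  proof
    fix x assume "x \<in> {x \<in> half_integers. norm x \<le> R}"
    then have x: "\<And>i. 2 * x $ i \<in> \<int>" "norm x \<le> R" by (auto simp: half_integers_def)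
    have "x $ i \<in> ?A" for i
    proof -
      obtain n :: int where n: "2 * x $ i = of_int n" using x(1)[of i] by (rule Ints_cases)
      have "\<bar>x $ i\<bar> \<le> R" using component_le_norm_cart[of x i] x(2) by linarith
      then have "- (2 * R) \<le> of_int n" "of_int n \<le> 2 * R" using n by linarith+
      then have "- \<lceil>2 * R\<rceil> \<le> n" "n \<le> \<lceil>2 * R\<rceil>" by linarith+
      moreover have "x $ i = of_int n / 2" using n by simp
      ultimately show ?thesis by (intro image_eqI[of _ _ n]) simp_all
    qed
    then have "vec_nth x \<in> PiE UNIV (\<lambda>_. ?A)" by auto
    then show "x \<in> vec_lambda ` (PiE UNIV (\<lambda>_. ?A))" by (rule image_eqI[rotated]) simp
  qed
  moreover have "finite (PiE (UNIV :: 8 set) (\<lambda>_. ?A))" by (rule finite_PiE) auto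
  ultimately show ?thesis by (rule finite_subset[OF _ finite_imageI])
qed

lemma has_sum_group:
  fixes f :: "'a \<Rightarrow> complex"
  assumes f: "(f has_sum s) A" and g: "\<And>a. a \<in> A \<Longrightarrow> g a \<in> B"
  shows "((\<lambda>b. infsum f {a \<in> A. g a = b}) has_sum s) B"
proof (rule has_sum_SigmaD)
  have inj: "inj_on snd (SIGMA b:B. {a \<in> A. g a = b})" by (auto simp: inj_on_def)
  have im: "snd ` (SIGMA b:B. {a \<in> A. g a = b}) = A" using g by force
  have "((f \<circ> snd) has_sum s) (SIGMA b:B. {a \<in> A. g a = b})"
    unfolding has_sum_reindex[OF inj, symmetric] im by (rule f)
  then show "((\<lambda>p. f (snd p)) has_sum s) (SIGMA b:B. {a \<in> A. g a = b})" by (simp add: o_def)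
  fix b
  have "f summable_on {a \<in> A. g a = b}"
    by (rule summable_on_subset_banach[OF has_sum_imp_summable[OF f]]) auto
  then show "((\<lambda>a. f (snd (b, a))) has_sum infsum f {a \<in> A. g a = b}) {a \<in> A. g a = b}" by simp
qed

section \<open>Theta series with determinant powers\<close>

locale spherical_theta =
  fixes v :: "real^8" and u1 u2 :: "complex^8" and k :: nat
  assumes v: "v \<in> E8" "v \<bullet> v = 2"
    and isotropic: "bilin u1 u1 = 0" "bilin u1 u2 = 0" "bilin u2 u2 = 0"
    and orthogonal: "bilin (rc v) u1 = 0" "bilin (rc v) u2 = 0"
    and k: "k \<ge> 1"
begin

definition minor :: "(real^8) \<times> (real^8) \<Rightarrow> complex" where
  "minor = (\<lambda>(x1, x2). bilin (rc x1) u1 * bilin (rc x2) u2 - bilin (rc x1) u2 * bilin (rc x2) u1)"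

definition pair_exp :: "complex^2^2 \<Rightarrow> complex^2 \<Rightarrow> (real^8) \<times> (real^8) \<Rightarrow> complex" where
  "pair_exp Z z = (\<lambda>(x1, x2). e2pi (of_real (x1 \<bullet> x1) * Z $ 1 $ 1 / 2 + of_real (x1 \<bullet> x2) * Z $ 1 $ 2
     + of_real (x2 \<bullet> x2) * Z $ 2 $ 2 / 2 + of_real (x1 \<bullet> v) * z $ 1 + of_real (x2 \<bullet> v) * z $ 2))"

definition phi :: "(complex^2^2) \<times> (complex^2) \<Rightarrow> complex" where
  "phi = (\<lambda>(Z, z). if Z \<in> siegel_space then infsum (\<lambda>p. minor p ^ k * pair_exp Z z p) (E8 \<times> E8) else 0)"

lemma pair_exp_bound:
  assumes Z: "Z \<in> siegel_space"
  obtains \<delta> b1 b2 where "\<delta> > 0" "\<And>x1 x2. norm (pair_exp Z z (x1, x2))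
    \<le> exp (- (pi * \<delta>) * ((norm x1)\<^sup>2 + (norm x2)\<^sup>2) + b1 * norm x1 + b2 * norm x2)"
proof -
  have "positive_definite (map_matrix Im Z)" using Z by (simp add: siegel_space_def)
  then obtain \<delta> where \<delta>: "\<delta> > 0" "\<And>a b. \<delta> * (a\<^sup>2 + b\<^sup>2)
      \<le> Im (Z $ 1 $ 1) * a\<^sup>2 + 2 * Im (Z $ 1 $ 2) * a * b + Im (Z $ 2 $ 2) * b\<^sup>2"
    using positive_definite_2_lower[of "map_matrix Im Z"] by auto
  define b where "b i = 2 * pi * (norm v * \<bar>Im (z $ i)\<bar>)" for i
  have "norm (pair_exp Z z (x1, x2))
      \<le> exp (- (pi * \<delta>) * ((norm x1)\<^sup>2 + (norm x2)\<^sup>2) + b 1 * norm x1 + b 2 * norm x2)" for x1 x2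
  proof -
    have n: "(norm x)\<^sup>2 = (\<Sum>i\<in>UNIV. (x $ i)\<^sup>2)" for x :: "real^8"
      by (simp add: norm_vec_def L2_set_def sum_nonneg)
    have q: "\<delta> * ((norm x1)\<^sup>2 + (norm x2)\<^sup>2)
        \<le> Im (Z $ 1 $ 1) * (x1 \<bullet> x1) + 2 * Im (Z $ 1 $ 2) * (x1 \<bullet> x2) + Im (Z $ 2 $ 2) * (x2 \<bullet> x2)"
    proof -
      have "\<delta> * ((norm x1)\<^sup>2 + (norm x2)\<^sup>2) = (\<Sum>i\<in>UNIV. \<delta> * ((x1 $ i)\<^sup>2 + (x2 $ i)\<^sup>2))"
        by (simp add: n sum_distrib_left sum.distrib distrib_left)
      also have "\<dots> \<le> (\<Sum>i\<in>UNIV. Im (Z $ 1 $ 1) * (x1 $ i)\<^sup>2 + 2 * Im (Z $ 1 $ 2) * x1 $ i * x2 $ i + Im (Z $ 2 $ 2) * (x2 $ i)\<^sup>2)"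
        by (rule sum_mono) (rule \<delta>(2))
      also have "\<dots> = Im (Z $ 1 $ 1) * (x1 \<bullet> x1) + 2 * Im (Z $ 1 $ 2) * (x1 \<bullet> x2) + Im (Z $ 2 $ 2) * (x2 \<bullet> x2)"
        by (simp add: inner_vec_def sum_distrib_left sum.distrib power2_eq_square mult_ac)
      finally show ?thesis .
    qed
    have l: "- (2 * pi * ((x \<bullet> v) * Im (z $ i))) \<le> b i * norm x" for x :: "real^8" and i
    proof -
      have "- ((x \<bullet> v) * Im (z $ i)) \<le> \<bar>x \<bullet> v\<bar> * \<bar>Im (z $ i)\<bar>" by (metis abs_ge_minus_self abs_mult)
      also have "\<dots> \<le> norm x * norm v * \<bar>Im (z $ i)\<bar>"
        by (rule mult_right_mono[OF Cauchy_Schwarz_ineq2]) simp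
      finally have "2 * pi * (- ((x \<bullet> v) * Im (z $ i))) \<le> 2 * pi * (norm x * norm v * \<bar>Im (z $ i)\<bar>)"
        by (rule mult_left_mono) simp
      then show ?thesis by (simp add: b_def mult_ac)
    qed
    have "norm (pair_exp Z z (x1, x2)) = exp (- (pi * (Im (Z $ 1 $ 1) * (x1 \<bullet> x1) + 2 * Im (Z $ 1 $ 2) * (x1 \<bullet> x2) + Im (Z $ 2 $ 2) * (x2 \<bullet> x2)))
        + - (2 * pi * ((x1 \<bullet> v) * Im (z $ 1))) + - (2 * pi * ((x2 \<bullet> v) * Im (z $ 2))))"
      unfolding pair_exp_def prod.case norm_e2pi by (simp add: algebra_simps)
    also have "\<dots> \<le> exp (- (pi * \<delta>) * ((norm x1)\<^sup>2 + (norm x2)\<^sup>2) + b 1 * norm x1 + b 2 * norm x2)"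
    proof -
      have "pi * (\<delta> * ((norm x1)\<^sup>2 + (norm x2)\<^sup>2)) \<le> pi * (Im (Z $ 1 $ 1) * (x1 \<bullet> x1) + 2 * Im (Z $ 1 $ 2) * (x1 \<bullet> x2) + Im (Z $ 2 $ 2) * (x2 \<bullet> x2))"
        by (rule mult_left_mono[OF q]) simp
      then have "- (pi * (Im (Z $ 1 $ 1) * (x1 \<bullet> x1) + 2 * Im (Z $ 1 $ 2) * (x1 \<bullet> x2) + Im (Z $ 2 $ 2) * (x2 \<bullet> x2)))
          \<le> - (pi * \<delta>) * ((norm x1)\<^sup>2 + (norm x2)\<^sup>2)"
        by (simp only: mult_minus_left neg_le_iff_le mult.assoc)
      from add_mono[OF add_mono[OF this l[of x1 1]] l[of x2 2]] show ?thesis by (simp only: exp_le_cancel_iff)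
    qed
    finally show ?thesis .
  qed
  then show thesis using that[OF \<delta>(1)] by blast
qed

lemma summable_pairs:
  assumes Z: "Z \<in> siegel_space"
  shows "(\<lambda>p. norm (minor p ^ k * pair_exp Z z p)) summable_on E8 \<times> E8"
proof -
  obtain \<delta> b1 b2 where \<delta>: "\<delta> > 0" and pe: "\<And>x1 x2. norm (pair_exp Z z (x1, x2))
    \<le> exp (- (pi * \<delta>) * ((norm x1)\<^sup>2 + (norm x2)\<^sup>2) + b1 * norm x1 + b2 * norm x2)"
    by (rule pair_exp_bound[OF Z, of z]) blast
  define K1 K2 where "K1 = (\<Sum>i\<in>UNIV. norm (u1 $ i))" and "K2 = (\<Sum>i\<in>UNIV. norm (u2 $ i))"
  have K: "K1 \<ge> 0" "K2 \<ge> 0" by (simp_all add: K1_def K2_def sum_nonneg)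
  define \<epsilon> where "\<epsilon> = pi * \<delta>"
  have \<epsilon>: "\<epsilon> > 0" using \<delta> by (simp add: \<epsilon>_def)
  define C where "C = (2 * K1 * K2 / \<epsilon>) ^ k * fact k"
  have C0: "C \<ge> 0" using K \<epsilon> by (simp add: C_def)
  have minor_bound: "norm (minor (x1, x2)) ^ k \<le> C * exp (\<epsilon> / 2 * ((norm x1)\<^sup>2 + (norm x2)\<^sup>2))" for x1 x2
  proof -
    have n1: "norm (bilin (rc x) u1) \<le> norm x * K1" and n2: "norm (bilin (rc x) u2) \<le> norm x * K2" for x
      using norm_bilin_rc[of x] by (simp_all add: K1_def K2_def)
    have "norm (minor (x1, x2)) \<le> norm (bilin (rc x1) u1 * bilin (rc x2) u2) + norm (bilin (rc x1) u2 * bilin (rc x2) u1)"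
      unfolding minor_def prod.case by (rule norm_triangle_ineq4)
    also have "\<dots> \<le> (norm x1 * K1) * (norm x2 * K2) + (norm x1 * K2) * (norm x2 * K1)"
      unfolding norm_mult by (intro add_mono mult_mono n1 n2) (use K in auto)
    also have "\<dots> = 2 * K1 * K2 / \<epsilon> * (\<epsilon> * (norm x1 * norm x2))" using \<epsilon> by simp
    finally have "norm (minor (x1, x2)) ^ k \<le> (2 * K1 * K2 / \<epsilon> * (\<epsilon> * (norm x1 * norm x2))) ^ k"
      by (rule power_mono) simp
    also have "\<dots> = (2 * K1 * K2 / \<epsilon>) ^ k * (\<epsilon> * (norm x1 * norm x2)) ^ k" by (rule power_mult_distrib)
    also have "\<dots> \<le> (2 * K1 * K2 / \<epsilon>) ^ k * (fact k * exp (\<epsilon> * (norm x1 * norm x2)))"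
    proof (rule mult_left_mono)
      have pos: "\<epsilon> * (norm x1 * norm x2) \<ge> 0" using \<epsilon> by simp
      have "(\<lambda>n. (\<epsilon> * (norm x1 * norm x2)) ^ n / fact n) sums exp (\<epsilon> * (norm x1 * norm x2))"
        using exp_converges[of "\<epsilon> * (norm x1 * norm x2)"] by (simp add: divide_inverse mult_ac)
      then have "(\<epsilon> * (norm x1 * norm x2)) ^ k / fact k \<le> exp (\<epsilon> * (norm x1 * norm x2))"
        using sum_le_suminf[of "\<lambda>n. (\<epsilon> * (norm x1 * norm x2)) ^ n / fact n" "{k}"] pos
        by (simp add: sums_iff)
      then show "(\<epsilon> * (norm x1 * norm x2)) ^ k \<le> fact k * exp (\<epsilon> * (norm x1 * norm x2))"
        by (simp add: field_simps)
    qed (use K \<epsilon> in simp)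
    also have "\<dots> \<le> (2 * K1 * K2 / \<epsilon>) ^ k * (fact k * exp (\<epsilon> / 2 * ((norm x1)\<^sup>2 + (norm x2)\<^sup>2)))"
    proof -
      have "\<epsilon> * (norm x1 * norm x2) \<le> \<epsilon> * (((norm x1)\<^sup>2 + (norm x2)\<^sup>2) / 2)"
        using sum_squares_bound[of "norm x1" "norm x2"] \<epsilon> by (intro mult_left_mono) auto
      then have "exp (\<epsilon> * (norm x1 * norm x2)) \<le> exp (\<epsilon> / 2 * ((norm x1)\<^sup>2 + (norm x2)\<^sup>2))" by simp
      then show ?thesis by (intro mult_left_mono) (use K \<epsilon> in auto)
    qed
    finally show ?thesis by (simp add: C_def mult_ac)
  qed
  define g where "g b x = exp (- (\<epsilon> / 2) * (norm x)\<^sup>2 + b * norm x)" for b :: real and x :: "real^8"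
  have g: "g b summable_on E8" for b
  proof -
    have "(\<lambda>x. norm (g b x)) summable_on half_integers"
      by (rule half_integers_dominated[of "\<epsilon> / 2" _ b]) (use \<epsilon> in \<open>simp_all add: g_def\<close>)
    then have "g b summable_on half_integers" by (rule abs_summable_summable)
    then show ?thesis by (rule summable_on_subset_banach[OF _ E8_half_integers])
  qed
  have gg: "(\<lambda>(x1, x2). C * (g b1 x1 * g b2 x2)) summable_on E8 \<times> E8"
  proof (rule summable_on_SigmaI)
    fix x1
    show "((\<lambda>x2. (\<lambda>(x1, x2). C * (g b1 x1 * g b2 x2)) (x1, x2)) has_sum C * (g b1 x1 * infsum (g b2) E8)) E8"
      unfolding prod.case using g by (intro has_sum_cmult_right) simp
  next
    show "(\<lambda>x1. C * (g b1 x1 * infsum (g b2) E8)) summable_on E8"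
      by (intro summable_on_cmult_right summable_on_cmult_left g)
  qed (use C0 in \<open>auto simp: g_def\<close>)
  show ?thesis
  proof (rule Infinite_Sum.abs_summable_on_comparison_test'[OF gg])
    fix p :: "(real^8) \<times> (real^8)"
    obtain x1 x2 where p: "p = (x1, x2)" by (cases p)
    have "norm (minor p ^ k * pair_exp Z z p) \<le> C * exp (\<epsilon> / 2 * ((norm x1)\<^sup>2 + (norm x2)\<^sup>2))
        * exp (- (pi * \<delta>) * ((norm x1)\<^sup>2 + (norm x2)\<^sup>2) + b1 * norm x1 + b2 * norm x2)"
      unfolding norm_mult norm_power p by (intro mult_mono minor_bound pe) (use C0 in auto)
    also have "\<dots> = C * (g b1 x1 * g b2 x2)"
      unfolding g_def exp_add[symmetric] mult.assoc by (simp add: \<epsilon>_def algebra_simps)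
    finally show "norm (minor p ^ k * pair_exp Z z p) \<le> (case p of (x1, x2) \<Rightarrow> C * (g b1 x1 * g b2 x2))"
      by (simp add: p)
  qed
qed

lemma phi_has_sum:
  assumes Z: "Z \<in> siegel_space"
  shows "((\<lambda>p. minor p ^ k * pair_exp Z z p) has_sum phi (Z, z)) (E8 \<times> E8)"
  using abs_summable_summable[OF summable_pairs[OF Z, of z]] Z by (simp add: phi_def)

lemma phi_translation:
  assumes Z: "Z \<in> siegel_space" and B: "transpose B = B"
  shows "phi (Z + cmat B, z) = phi (Z, z)"
proof -
  have "pair_exp (Z + cmat B) z p = pair_exp Z z p" if p: "p \<in> E8 \<times> E8" for p
  proof -
    obtain x1 x2 where x: "p = (x1, x2)" "x1 \<in> E8" "x2 \<in> E8" using p by auto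
    have "(x1 \<bullet> x1) / 2 * of_int (B $ 1 $ 1) + (x1 \<bullet> x2) * of_int (B $ 1 $ 2) + (x2 \<bullet> x2) / 2 * of_int (B $ 2 $ 2) \<in> \<int>"
      by (intro Ints_add Ints_mult E8_even E8_inner_int x) simp_all
    then obtain n :: int where n: "(x1 \<bullet> x1) / 2 * of_int (B $ 1 $ 1) + (x1 \<bullet> x2) * of_int (B $ 1 $ 2) + (x2 \<bullet> x2) / 2 * of_int (B $ 2 $ 2) = of_int n"
      by (rule Ints_cases)
    define m where "m = complex_of_real ((x1 \<bullet> x1) / 2 * of_int (B $ 1 $ 1) + (x1 \<bullet> x2) * of_int (B $ 1 $ 2) + (x2 \<bullet> x2) / 2 * of_int (B $ 2 $ 2))"
    have "e2pi m = 1" unfolding m_def n by simp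
    moreover have "pair_exp (Z + cmat B) z p = pair_exp Z z p * e2pi m"
      unfolding x(1) pair_exp_def prod.case e2pi_add[symmetric]
      by (rule arg_cong[of _ _ e2pi]) (simp add: m_def field_simps)
    ultimately show ?thesis by simp
  qed
  then show ?thesis
    using Z translation_siegel_int[OF Z B] by (simp add: phi_def cong: infsum_cong)
qed

lemma phi_linear:
  assumes Z: "Z \<in> siegel_space" and UW: "transpose U ** W = mat 1"
  shows "phi (cmat U ** Z ** transpose (cmat U), cmat U *v z) = of_int (det U) ^ k * phi (Z, z)"
proof -
  define f where "f = (\<lambda>(x1 :: real^8, x2 :: real^8). (of_int (U $ 1 $ 1) *\<^sub>R x1 + of_int (U $ 2 $ 1) *\<^sub>R x2,
      of_int (U $ 1 $ 2) *\<^sub>R x1 + of_int (U $ 2 $ 2) *\<^sub>R x2))"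
  define g where "g = (\<lambda>(x1 :: real^8, x2 :: real^8). (of_int (W $ 1 $ 1) *\<^sub>R x1 + of_int (W $ 1 $ 2) *\<^sub>R x2,
      of_int (W $ 2 $ 1) *\<^sub>R x1 + of_int (W $ 2 $ 2) *\<^sub>R x2))"
  have "(transpose U ** W) $ i $ j = mat 1 $ i $ j" "(W ** transpose U) $ i $ j = mat 1 $ i $ j" for i j
    by (simp_all add: UW int_matrix_left_right_inverse[THEN iffD1, OF UW])
  note e = this(1)[of 1 1] this(1)[of 1 2] this(1)[of 2 1] this(1)[of 2 2]
    this(2)[of 1 1] this(2)[of 1 2] this(2)[of 2 1] this(2)[of 2 2]
  have ei: "U $ 1 $ 1 * W $ 1 $ 1 + U $ 2 $ 1 * W $ 2 $ 1 = 1" "U $ 1 $ 1 * W $ 1 $ 2 + U $ 2 $ 1 * W $ 2 $ 2 = 0"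
    "U $ 1 $ 2 * W $ 1 $ 1 + U $ 2 $ 2 * W $ 2 $ 1 = 0" "U $ 1 $ 2 * W $ 1 $ 2 + U $ 2 $ 2 * W $ 2 $ 2 = 1"
    "W $ 1 $ 1 * U $ 1 $ 1 + W $ 1 $ 2 * U $ 1 $ 2 = 1" "W $ 1 $ 1 * U $ 2 $ 1 + W $ 1 $ 2 * U $ 2 $ 2 = 0"
    "W $ 2 $ 1 * U $ 1 $ 1 + W $ 2 $ 2 * U $ 1 $ 2 = 0" "W $ 2 $ 1 * U $ 2 $ 1 + W $ 2 $ 2 * U $ 2 $ 2 = 1"
    using e by (simp_all add: matrix_matrix_mult_def transpose_def sum_2 mat_def)
  have lin2: "of_int a *\<^sub>R (of_int b *\<^sub>R x + of_int c *\<^sub>R y) + of_int a' *\<^sub>R (of_int b' *\<^sub>R x + of_int c' *\<^sub>R y)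
      = of_int (a * b + a' * b') *\<^sub>R x + of_int (a * c + a' * c') *\<^sub>R (y :: real^8)" for a b c a' b' c' x y
    by (simp add: algebra_simps)
  have bij: "bij_betw f (E8 \<times> E8) (E8 \<times> E8)"
  proof (rule bij_betwI[where g = g])
    show "f \<in> E8 \<times> E8 \<rightarrow> E8 \<times> E8" "g \<in> E8 \<times> E8 \<rightarrow> E8 \<times> E8"
      by (auto simp: f_def g_def intro!: E8_add E8_scale)
    show "g (f p) = p" "f (g p) = p" for p
      by (cases p; simp only: f_def g_def prod.case lin2 ei; simp)+
  qed
  have minor_f: "minor (f p) = of_int (det U) * minor p" for p
    by (cases p) (simp add: f_def minor_def rc_linear bilin_add bilin_scale det_2 algebra_simps)
  have d: "of_int (det U) ^ k * (of_int (det U) ^ k :: complex) = 1"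
    using det_unimodular(1)[OF UW] by (auto simp: power_mult_distrib[symmetric])
  have pf: "pair_exp (cmat U ** Z ** transpose (cmat U)) (cmat U *v z) p = pair_exp Z z (f p)" for p
  proof -
    obtain x1 x2 where p: "p = (x1, x2)" by (cases p)
    have Zs: "Z $ 2 $ 1 = Z $ 1 $ 2" by (rule siegel_space_sym_nth[OF Z])
    show ?thesis
      unfolding p f_def pair_exp_def prod.case
      by (rule arg_cong[of _ _ e2pi])
        (simp add: matrix_matrix_mult_def matrix_vector_mult_def transpose_def sum_2 Zs inner_add_left inner_add_right
          inner_commute[of x2 x1] field_simps)
  qed
  have "((\<lambda>p. minor (f p) ^ k * pair_exp Z z (f p)) has_sum phi (Z, z)) (E8 \<times> E8)"
    by (subst has_sum_reindex_bij_betw[OF bij]) (rule phi_has_sum[OF Z])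
  from has_sum_cmult_right[OF this, of "of_int (det U) ^ k"]
  have "((\<lambda>p. minor p ^ k * pair_exp (cmat U ** Z ** transpose (cmat U)) (cmat U *v z) p)
      has_sum of_int (det U) ^ k * phi (Z, z)) (E8 \<times> E8)"
  proof (rule has_sum_eqI)
    fix p
    show "of_int (det U) ^ k * (minor (f p) ^ k * pair_exp Z z (f p))
        = minor p ^ k * pair_exp (cmat U ** Z ** transpose (cmat U)) (cmat U *v z) p"
      unfolding minor_f pf power_mult_distrib mult.assoc[symmetric] d by simp
  qed simp
  with phi_has_sum[OF linear_siegel[OF Z UW], of "cmat U *v z"] show ?thesis by (rule has_sum_unique)
qed

text \<open>For a fixed second vector the sum over the first one is a spherical theta series of \<open>E\<^sub>8\<close> whose
  isotropic vector is the determinant expanded along the second vector.\<close>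
lemma phi_inversion_1:
  assumes Z: "Z \<in> siegel_space"
  shows "phi (partial_inversion 1 Z, partial_inversion_vec 1 Z z) * e2pi (- ((z $ 1)\<^sup>2 / Z $ 1 $ 1))
    = Z $ 1 $ 1 ^ (4 + k) * phi (Z, z)"
proof -
  define w where "w x2 = bilin (rc x2) u2 *s u1 - bilin (rc x2) u1 *s u2" for x2
  define y where "y Z z x2 = Z $ 1 $ 2 *s rc x2 + z $ 1 *s rc v" for Z :: "complex^2^2" and z :: "complex^2" and x2
  define r where "r Z z x2 = e2pi (of_real (x2 \<bullet> x2) * Z $ 2 $ 2 / 2 + of_real (x2 \<bullet> v) * z $ 2)" for Z :: "complex^2^2" and z :: "complex^2" and x2
  have bilin_diff: "bilin a (b - c) = bilin a b - bilin a c" "bilin (a - b) c = bilin a c - bilin b c" for a b c :: "complex^8"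
    by (simp_all add: bilin_def sum_subtractf algebra_simps)
  have minor: "minor (x1, x2) = bilin (rc x1) (w x2)" for x1 x2
    by (simp add: minor_def w_def bilin_diff bilin_scale mult_ac)
  have pe: "pair_exp Z z (x1, x2) = lattice_exp (Z $ 1 $ 1) (y Z z x2) x1 * r Z z x2" for Z z x1 x2
    unfolding pair_exp_def lattice_exp_def r_def y_def prod.case e2pi_add[symmetric]
    by (rule arg_cong[of _ _ e2pi]) (simp add: bilin_add bilin_scale bilin_rc algebra_simps)
  have ww: "bilin (w x2) (w x2) = 0" for x2
    by (simp add: w_def bilin_diff bilin_scale isotropic bilin_commute[of u2 u1])
  have yw: "bilin (y Z z x2) (w x2) = 0" for Z z x2
    by (simp add: w_def y_def bilin_diff bilin_add bilin_scale orthogonal)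
  have sum: "phi (Z, z) = infsum (\<lambda>x2. E8_spherical k (w x2) (Z $ 1 $ 1) (y Z z x2) * r Z z x2) E8"
    if Z: "Z \<in> siegel_space" for Z z
  proof -
    have s: "(\<lambda>(x1, x2). minor (x1, x2) ^ k * pair_exp Z z (x1, x2)) summable_on E8 \<times> E8"
      using abs_summable_summable[OF summable_pairs[OF Z, of z]] by (simp add: case_prod_unfold)
    have "phi (Z, z) = infsum (\<lambda>(x1, x2). minor (x1, x2) ^ k * pair_exp Z z (x1, x2)) (E8 \<times> E8)"
      using Z by (simp add: phi_def case_prod_unfold)
    also have "\<dots> = infsum (\<lambda>x1. infsum (\<lambda>x2. minor (x1, x2) ^ k * pair_exp Z z (x1, x2)) E8) E8"
      by (rule infsum_Sigma'_banach[OF s, symmetric])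
    also have "\<dots> = infsum (\<lambda>x2. infsum (\<lambda>x1. minor (x1, x2) ^ k * pair_exp Z z (x1, x2)) E8) E8"
      by (rule infsum_swap_banach[OF s])
    also have "\<dots> = infsum (\<lambda>x2. E8_spherical k (w x2) (Z $ 1 $ 1) (y Z z x2) * r Z z x2) E8"
      by (rule infsum_cong) (simp add: minor pe E8_spherical_def infsum_cmult_left'[symmetric] mult.assoc)
    finally show ?thesis .
  qed
  let ?\<tau> = "Z $ 1 $ 1"
  let ?Z = "partial_inversion 1 Z" and ?z = "partial_inversion_vec 1 Z z"
  have \<tau>: "Im ?\<tau> > 0" "?\<tau> \<noteq> 0" using siegel_space_diagonal[OF Z] by auto
  have Zs: "Z $ 2 $ 1 = Z $ 1 $ 2" by (rule siegel_space_sym_nth[OF Z])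
  have summand: "E8_spherical k (w x2) (?Z $ 1 $ 1) (y ?Z ?z x2) * r ?Z ?z x2 * e2pi (- ((z $ 1)\<^sup>2 / ?\<tau>))
      = ?\<tau> ^ (4 + k) * (E8_spherical k (w x2) ?\<tau> (y Z z x2) * r Z z x2)" for x2
  proof -
    have y': "y ?Z ?z x2 = (1 / ?\<tau>) *s y Z z x2"
      by (simp add: y_def partial_inversion_def partial_inversion_vec_def vec_eq_iff add_divide_distrib)
    have t': "?Z $ 1 $ 1 = - 1 / ?\<tau>" by (simp add: partial_inversion_def)
    have yy: "bilin (y Z z x2) (y Z z x2) = (Z $ 1 $ 2)\<^sup>2 * of_real (x2 \<bullet> x2) + 2 * Z $ 1 $ 2 * z $ 1 * of_real (x2 \<bullet> v) + 2 * (z $ 1)\<^sup>2"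
      by (simp add: y_def bilin_add bilin_scale bilin_rc v(2) inner_commute[of v x2] power2_eq_square algebra_simps)
    have ex: "e2pi (bilin (y Z z x2) (y Z z x2) / (2 * ?\<tau>)) * r ?Z ?z x2 * e2pi (- ((z $ 1)\<^sup>2 / ?\<tau>)) = r Z z x2"
      unfolding r_def e2pi_add[symmetric] yy
      by (rule arg_cong[of _ _ e2pi])
         (use \<tau> in \<open>simp add: partial_inversion_def partial_inversion_vec_def Zs power2_eq_square field_simps\<close>)
    show ?thesis
      unfolding y' t' E8_spherical_inversion[OF \<tau>(1) ww yw] ex[symmetric] by (simp only: mult_ac)
  qed
  have "phi (?Z, ?z) * e2pi (- ((z $ 1)\<^sup>2 / ?\<tau>))
      = infsum (\<lambda>x2. E8_spherical k (w x2) (?Z $ 1 $ 1) (y ?Z ?z x2) * r ?Z ?z x2 * e2pi (- ((z $ 1)\<^sup>2 / ?\<tau>))) E8"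
    unfolding sum[OF partial_inversion_siegel_2[OF Z]] by (rule infsum_cmult_left'[symmetric])
  also have "\<dots> = ?\<tau> ^ (4 + k) * phi (Z, z)"
    unfolding summand sum[OF Z] by (rule infsum_cmult_right')
  finally show ?thesis .
qed

lemma weight_power: "x powi (4 + int k) = (x ^ (4 + k) :: complex)"
proof -
  have "4 + int k = int (4 + k)" by simp
  then show ?thesis by (simp only: power_int_of_nat)
qed

lemma phi_modular: "jacobi_modular_transformation (4 + int k) phi"
proof (rule jacobi_modular_transformationI)
  fix B :: "int^2^2" and Z :: "complex^2^2" and z
  assume "Z \<in> siegel_space" "transpose B = B"
  then show "phi (Z + cmat B, z) = phi (Z, z)" by (rule phi_translation)
next
  have lin: "phi (cmat U ** Z ** transpose (cmat U), cmat U *v z) = of_int (det U) powi (4 + int k) * phi (Z, z)"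
    if Z: "Z \<in> siegel_space" and UW: "transpose U ** W = mat 1" for U W :: "int^2^2" and Z :: "complex^2^2" and z
  proof -
    have "det U = 1 \<or> det U = - 1" by (rule det_unimodular(1)[OF UW])
    then have "(of_int (det U) ^ (4 + k) :: complex) = of_int (det U) ^ k"
      by (elim disjE) (simp_all add: power_add)
    then show ?thesis by (simp only: phi_linear[OF Z UW] weight_power)
  qed
  then show "phi (cmat U ** Z ** transpose (cmat U), cmat U *v z) = of_int (det U) powi (4 + int k) * phi (Z, z)"
    if "Z \<in> siegel_space" "transpose U ** W = mat 1" for U W :: "int^2^2" and Z :: "complex^2^2" and z
    using that by blast
  have one: "phi (partial_inversion 1 Z, partial_inversion_vec 1 Z z) * e2pi (- ((z $ 1)\<^sup>2 / Z $ 1 $ 1))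
    = Z $ 1 $ 1 powi (4 + int k) * phi (Z, z)" if Z: "Z \<in> siegel_space" for Z z
    unfolding weight_power by (rule phi_inversion_1[OF Z])
  show "phi (partial_inversion i Z, partial_inversion_vec i Z z) * e2pi (- ((z $ i)\<^sup>2 / Z $ i $ i))
        = Z $ i $ i powi (4 + int k) * phi (Z, z)" if Z: "Z \<in> siegel_space" for i Z z
  proof (cases "i = 1")
    case True
    then show ?thesis using one[OF Z] by simp
  next
    case False
    then have i: "i = 2" using exhaust_2[of i] by auto
    define S :: "int^2^2" where "S = vector [vector [0, 1], vector [1, 0]]"
    have SS: "transpose S ** S = mat 1"
      by (simp add: vec_eq_iff forall_2 matrix_matrix_mult_def transpose_def sum_2 mat_def S_def)
    have Zs: "Z $ 2 $ 1 = Z $ 1 $ 2" by (rule siegel_space_sym_nth[OF Z])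
    define d :: complex where "d = of_int (det S) powi (4 + int k)"
    have d: "d * d = 1"
      unfolding d_def weight_power power_mult_distrib[symmetric] by (simp add: S_def det_2)
    let ?SZ = "cmat S ** Z ** transpose (cmat S)" and ?Sz = "cmat S *v z"
    have SZ: "?SZ \<in> siegel_space" by (rule linear_siegel[OF Z SS])
    have n: "?SZ $ 1 $ 1 = Z $ 2 $ 2" "?Sz $ 1 = z $ 2"
      by (simp_all add: matrix_matrix_mult_def matrix_vector_mult_def transpose_def sum_2 S_def)
    have e: "partial_inversion 2 Z = cmat S ** partial_inversion 1 ?SZ ** transpose (cmat S)"
      "partial_inversion_vec 2 Z z = cmat S *v partial_inversion_vec 1 ?SZ ?Sz"
      by (simp_all add: vec_eq_iff forall_2 matrix_matrix_mult_def matrix_vector_mult_def transpose_def sum_2 S_def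
          partial_inversion_def partial_inversion_vec_def Zs)
    have "phi (partial_inversion 2 Z, partial_inversion_vec 2 Z z) * e2pi (- ((z $ 2)\<^sup>2 / Z $ 2 $ 2))
        = d * (phi (partial_inversion 1 ?SZ, partial_inversion_vec 1 ?SZ ?Sz) * e2pi (- ((?Sz $ 1)\<^sup>2 / ?SZ $ 1 $ 1)))"
      unfolding e lin[OF partial_inversion_siegel_2[OF SZ] SS] d_def n by (rule mult.assoc)
    also have "\<dots> = d * (?SZ $ 1 $ 1 powi (4 + int k) * phi (?SZ, ?Sz))"
      by (simp only: one[OF SZ])
    also have "\<dots> = d * d * (Z $ 2 $ 2 powi (4 + int k) * phi (Z, z))"
      unfolding lin[OF Z SS] d_def n by (simp only: mult_ac)
    finally show ?thesis unfolding i d by simp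
  qed
qed

lemma phi_lattice: "jacobi_lattice_transformation phi"
  unfolding jacobi_lattice_transformation_def
proof (intro allI ballI)
  fix l m :: "int^2" and Z :: "complex^2^2" and z
  assume Z: "Z \<in> siegel_space"
  have Zs: "Z $ 2 $ 1 = Z $ 1 $ 2" by (rule siegel_space_sym_nth[OF Z])
  define f where "f = (\<lambda>(x1 :: real^8, x2 :: real^8). (x1 + of_int (l $ 1) *\<^sub>R v, x2 + of_int (l $ 2) *\<^sub>R v))"
  define g where "g = (\<lambda>(x1 :: real^8, x2 :: real^8). (x1 + of_int (- l $ 1) *\<^sub>R v, x2 + of_int (- l $ 2) *\<^sub>R v))"
  have bij: "bij_betw f (E8 \<times> E8) (E8 \<times> E8)"
  proof (rule bij_betwI[where g = g])
    show "f \<in> E8 \<times> E8 \<rightarrow> E8 \<times> E8" "g \<in> E8 \<times> E8 \<rightarrow> E8 \<times> E8"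
      unfolding f_def g_def by (auto intro!: E8_add E8_scale v(1) simp del: of_int_minus)
    show "g (f p) = p" "f (g p) = p" for p by (cases p; simp add: f_def g_def)+
  qed
  define q where "q = bilin (cvec l) (Z *v cvec l) + 2 * bilin (cvec l) z"
  have minor_f: "minor (f p) = minor p" for p
    by (cases p) (simp add: f_def minor_def rc_linear bilin_add bilin_scale orthogonal)
  have pf: "pair_exp Z (z + Z *v cvec l + cvec m) p = e2pi (- q) * pair_exp Z z (f p)" if p: "p \<in> E8 \<times> E8" for p
  proof -
    obtain x1 x2 where x: "p = (x1, x2)" "x1 \<in> E8" "x2 \<in> E8" using p by auto
    have "(x1 \<bullet> v) * of_int (m $ 1) + (x2 \<bullet> v) * of_int (m $ 2) \<in> \<int>"
      by (intro Ints_add Ints_mult E8_inner_int x v(1)) simp_all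
    then obtain n :: int where n: "(x1 \<bullet> v) * of_int (m $ 1) + (x2 \<bullet> v) * of_int (m $ 2) = of_int n" by (rule Ints_cases)
    define j where "j = complex_of_real ((x1 \<bullet> v) * of_int (m $ 1) + (x2 \<bullet> v) * of_int (m $ 2))"
    have "e2pi j = 1" unfolding j_def n by simp
    moreover have "pair_exp Z (z + Z *v cvec l + cvec m) p = e2pi (- q) * pair_exp Z z (f p) * e2pi j"
      unfolding x(1) pair_exp_def f_def prod.case e2pi_add[symmetric]
      by (rule arg_cong[of _ _ e2pi])
         (simp add: j_def q_def bilin_def cvec_def matrix_vector_mult_def sum_2 Zs inner_add_left inner_add_right
           inner_commute[of v x1] inner_commute[of v x2] v(2) algebra_simps add_divide_distrib)
    ultimately show ?thesis by simp
  qed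
  have "((\<lambda>p. minor (f p) ^ k * pair_exp Z z (f p)) has_sum phi (Z, z)) (E8 \<times> E8)"
    by (subst has_sum_reindex_bij_betw[OF bij]) (rule phi_has_sum[OF Z])
  from has_sum_cmult_right[OF this, of "e2pi (- q)"]
  have "((\<lambda>p. minor p ^ k * pair_exp Z (z + Z *v cvec l + cvec m) p) has_sum e2pi (- q) * phi (Z, z)) (E8 \<times> E8)"
    by (rule has_sum_eqI) (simp_all add: pf minor_f mult_ac)
  with phi_has_sum[OF Z, of "z + Z *v cvec l + cvec m"]
  show "phi (Z, z + Z *v cvec l + cvec m) = e2pi (- (bilin (cvec l) (Z *v cvec l) + 2 * bilin (cvec l) z)) * phi (Z, z)"
    unfolding q_def by (rule has_sum_unique)
qed

definition gram :: "(real^8) \<times> (real^8) \<Rightarrow> (real^2^2) \<times> (int^2)" where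
  "gram = (\<lambda>(x1, x2). (vector [vector [x1 \<bullet> x1 / 2, x1 \<bullet> x2 / 2], vector [x1 \<bullet> x2 / 2, x2 \<bullet> x2 / 2]],
     vector [\<lfloor>x1 \<bullet> v\<rfloor>, \<lfloor>x2 \<bullet> v\<rfloor>]))"

definition coefficient :: "real^2^2 \<Rightarrow> int^2 \<Rightarrow> complex" where
  "coefficient T t = (\<Sum>p\<in>{p \<in> E8 \<times> E8. gram p = (T, t)}. minor p ^ k)"

lemma E8_floor: "x \<in> E8 \<Longrightarrow> real_of_int \<lfloor>x \<bullet> v\<rfloor> = x \<bullet> v"
  using E8_inner_int[OF _ v(1)] by (simp only: of_int_floor)

lemma fiber_finite: "finite {p \<in> E8 \<times> E8. gram p = (T, t)}"
proof (rule finite_subset)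
  show "{p \<in> E8 \<times> E8. gram p = (T, t)} \<subseteq> {x \<in> half_integers. norm x \<le> sqrt (2 * T $ 1 $ 1)} \<times> {x \<in> half_integers. norm x \<le> sqrt (2 * T $ 2 $ 2)}"
    using E8_half_integers by (auto simp: gram_def norm_eq_sqrt_inner)
  show "finite ({x \<in> half_integers. norm x \<le> sqrt (2 * T $ 1 $ 1)} \<times> {x \<in> half_integers. norm x \<le> sqrt (2 * T $ 2 $ 2)})"
    by (intro finite_cartesian_product half_integers_finite)
qed

lemma gram_half_integral: "p \<in> E8 \<times> E8 \<Longrightarrow> gram p \<in> half_integral \<times> UNIV"
  by (cases p) (simp add: gram_def half_integral_def transpose_def vec_eq_iff forall_2 E8_even E8_inner_int)

lemma phi_fourier: "jacobi_fourier_expansion phi coefficient"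
  unfolding jacobi_fourier_expansion_def
proof (intro ballI allI)
  fix Z :: "complex^2^2" and z
  assume Z: "Z \<in> siegel_space"
  have Zs: "Z $ 2 $ 1 = Z $ 1 $ 2" by (rule siegel_space_sym_nth[OF Z])
  have "((\<lambda>b. infsum (\<lambda>p. minor p ^ k * pair_exp Z z p) {p \<in> E8 \<times> E8. gram p = b}) has_sum phi (Z, z)) (half_integral \<times> UNIV)"
    by (rule has_sum_group[OF phi_has_sum[OF Z] gram_half_integral])
  then show "((\<lambda>(T, t). coefficient T t * e2pi (trace (map_matrix of_real T ** Z) + bilin (cvec t) z)) has_sum phi (Z, z)) (half_integral \<times> UNIV)"
  proof (rule has_sum_eqI)
    fix b :: "(real^2^2) \<times> (int^2)"
    obtain T t where b: "b = (T, t)" by (cases b)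
    have "pair_exp Z z p = e2pi (trace (map_matrix of_real T ** Z) + bilin (cvec t) z)"
      if p: "p \<in> {p \<in> E8 \<times> E8. gram p = b}" for p
    proof -
      obtain x1 x2 where x: "p = (x1, x2)" "x1 \<in> E8" "x2 \<in> E8" "gram (x1, x2) = (T, t)" using p b by auto
      then have T: "T = vector [vector [x1 \<bullet> x1 / 2, x1 \<bullet> x2 / 2], vector [x1 \<bullet> x2 / 2, x2 \<bullet> x2 / 2]]"
        and t: "t = vector [\<lfloor>x1 \<bullet> v\<rfloor>, \<lfloor>x2 \<bullet> v\<rfloor>]" by (simp_all add: gram_def)
      have "complex_of_int \<lfloor>x \<bullet> v\<rfloor> = of_real (x \<bullet> v)" if "x \<in> E8" for x
        by (metis E8_floor[OF that] of_real_of_int_eq)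
      then show ?thesis
        unfolding x(1) pair_exp_def prod.case T t
        by (intro arg_cong[of _ _ e2pi])
           (simp add: trace_def matrix_matrix_mult_def sum_2 bilin_def cvec_def Zs x(2,3) field_simps)
    qed
    then have "infsum (\<lambda>p. minor p ^ k * pair_exp Z z p) {p \<in> E8 \<times> E8. gram p = b}
        = infsum (\<lambda>p. minor p ^ k * e2pi (trace (map_matrix of_real T ** Z) + bilin (cvec t) z)) {p \<in> E8 \<times> E8. gram p = b}"
      by (intro infsum_cong) simp
    also have "\<dots> = coefficient T t * e2pi (trace (map_matrix of_real T ** Z) + bilin (cvec t) z)"
      unfolding infsum_cmult_left' coefficient_def b using fiber_finite by simp
    finally show "infsum (\<lambda>p. minor p ^ k * pair_exp Z z p) {p \<in> E8 \<times> E8. gram p = b}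
        = (case b of (T, t) \<Rightarrow> coefficient T t * e2pi (trace (map_matrix of_real T ** Z) + bilin (cvec t) z))"
      by (simp add: b)
  qed simp
qed

text \<open>The bordered matrix is half the Gram matrix of \<open>x\<^sub>1, x\<^sub>2, v\<close>. A linear relation between these
  vectors makes the determinant factor vanish because \<open>u\<^sub>1, u\<^sub>2\<close> are orthogonal to \<open>v\<close>.\<close>
lemma phi_cusp:
  assumes nz: "coefficient T t \<noteq> 0"
  shows "positive_definite (bordered_matrix T (\<chi> i. of_int (t $ i) / 2) 1)"
proof -
  obtain p where "p \<in> {p \<in> E8 \<times> E8. gram p = (T, t)}" "minor p ^ k \<noteq> 0"
    using nz unfolding coefficient_def by (rule sum.not_neutral_contains_not_neutral)
  then obtain x1 x2 where x: "x1 \<in> E8" "x2 \<in> E8" "gram (x1, x2) = (T, t)" and m: "minor (x1, x2) \<noteq> 0"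
    using k by (cases p) auto
  have T: "T = vector [vector [x1 \<bullet> x1 / 2, x1 \<bullet> x2 / 2], vector [x1 \<bullet> x2 / 2, x2 \<bullet> x2 / 2]]"
    and t: "t = vector [\<lfloor>x1 \<bullet> v\<rfloor>, \<lfloor>x2 \<bullet> v\<rfloor>]" using x(3) by (simp_all add: gram_def)
  let ?M = "bordered_matrix T (\<chi> i. of_int (t $ i) / 2) 1"
  have "0 < y \<bullet> (?M *v y)" if y: "y \<noteq> 0" for y
  proof -
    define s where "s = (y $ 1) *\<^sub>R x1 + (y $ 2) *\<^sub>R x2 + (y $ 3) *\<^sub>R v"
    have eq: "y \<bullet> (?M *v y) = (s \<bullet> s) / 2"
      by (simp add: inner_vec_def[of y] matrix_vector_mult_def sum_3 T t E8_floor x(1,2) s_def inner_add_left inner_add_right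
          inner_commute[of x2 x1] inner_commute[of v x1] inner_commute[of v x2] v(2) algebra_simps add_divide_distrib)
    have "s \<noteq> 0"
    proof
      assume s: "s = 0"
      have "bilin (rc s) u = of_real (y $ 1) * bilin (rc x1) u + of_real (y $ 2) * bilin (rc x2) u + of_real (y $ 3) * bilin (rc v) u" for u
        by (simp add: s_def rc_linear bilin_add bilin_scale)
      moreover have "bilin (rc s) u = 0" for u by (simp add: s bilin_def)
      ultimately have r: "of_real (y $ 1) * bilin (rc x1) u1 + of_real (y $ 2) * bilin (rc x2) u1 = 0"
        "of_real (y $ 1) * bilin (rc x1) u2 + of_real (y $ 2) * bilin (rc x2) u2 = 0"
        using orthogonal by (metis add.right_neutral mult_zero_right)+
      have "of_real (y $ 1) * minor (x1, x2) = bilin (rc x2) u2 * (of_real (y $ 1) * bilin (rc x1) u1 + of_real (y $ 2) * bilin (rc x2) u1)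
          - bilin (rc x2) u1 * (of_real (y $ 1) * bilin (rc x1) u2 + of_real (y $ 2) * bilin (rc x2) u2)"
        by (simp add: minor_def algebra_simps)
      then have y1: "y $ 1 = 0" unfolding r using m by simp
      have "of_real (y $ 2) * minor (x1, x2) = bilin (rc x1) u1 * (of_real (y $ 1) * bilin (rc x1) u2 + of_real (y $ 2) * bilin (rc x2) u2)
          - bilin (rc x1) u2 * (of_real (y $ 1) * bilin (rc x1) u1 + of_real (y $ 2) * bilin (rc x2) u1)"
        by (simp add: minor_def algebra_simps)
      then have y2: "y $ 2 = 0" unfolding r using m by simp
      from s y1 y2 have "(y $ 3) *\<^sub>R v = 0" by (simp add: s_def)
      moreover have "v \<noteq> 0" using v(2) by auto
      ultimately have "y $ 3 = 0" by simp
      with y1 y2 y show False by (simp add: vec_eq_iff forall_3)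
    qed
    then show ?thesis unfolding eq by simp
  qed
  moreover have "transpose ?M = ?M" by (simp add: vec_eq_iff forall_3 transpose_def T)
  ultimately show ?thesis by (simp add: positive_definite_def)
qed

theorem phi_cusp_form: "phi \<in> jacobi_cusp_forms (4 + int k)"
  unfolding jacobi_cusp_forms_def mem_Collect_eq
proof (intro conjI)
  show "holomorphic_wrt (\<lambda>c (Z, z). (mscale c Z, c *s z)) phi jacobi_domain"
    by (rule jacobi_series_holomorphic[OF phi_fourier])
  show "\<forall>x. x \<notin> jacobi_domain \<longrightarrow> phi x = 0" by (auto simp: phi_def jacobi_domain_def)
  show "\<exists>c. jacobi_fourier_expansion phi c \<and> (\<forall>T\<in>half_integral. \<forall>t. c T t \<noteq> 0 \<longrightarrow>
             positive_definite (bordered_matrix T (\<chi> i. of_int (t $ i) / 2) 1))"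
    using phi_fourier phi_cusp by blast
qed (rule phi_modular phi_lattice)+

end

section \<open>Powers of dominant terms\<close>
lemma powers_differ_from_dominated_powers:
  fixes d :: "'a \<Rightarrow> complex" and A :: real
  assumes S: "finite S" "\<And>p. p \<in> S \<Longrightarrow> norm (d p) \<le> A" and p0: "p0 \<in> S" "norm (d p0) = A"
    and S': "finite S'" "\<And>p. p \<in> S' \<Longrightarrow> norm (d p) < A" and A: "A > 0"
  shows "\<exists>K. \<forall>k\<ge>K. (\<forall>p\<in>S. norm (d p) = A \<longrightarrow> d p ^ k = of_real A ^ k)
    \<longrightarrow> (\<Sum>p\<in>S. d p ^ k) \<noteq> (\<Sum>p\<in>S'. d p ^ k)"
proof -
  define L where "L = {p \<in> S. norm (d p) < A}"
  define M where "M = {p \<in> S. norm (d p) = A}"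
  have fin: "finite L" "finite M" using S(1) by (simp_all add: L_def M_def)
  have SLM: "S = L \<union> M" "L \<inter> M = {}" using S(2) by (force simp: L_def M_def)+
  have lim: "(\<lambda>k. (\<Sum>p\<in>T. (norm (d p) / A) ^ k)) \<longlonglongrightarrow> 0" if "\<And>p. p \<in> T \<Longrightarrow> norm (d p) < A" for T
  proof -
    have "(\<lambda>k. (\<Sum>p\<in>T. (norm (d p) / A) ^ k)) \<longlonglongrightarrow> (\<Sum>p\<in>T. 0)"
      by (intro tendsto_sum LIMSEQ_realpow_zero) (use that A in auto)
    then show ?thesis by simp
  qed
  have "(\<lambda>k. (\<Sum>p\<in>L. (norm (d p) / A) ^ k) + (\<Sum>p\<in>S'. (norm (d p) / A) ^ k)) \<longlonglongrightarrow> 0 + 0"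
    by (intro tendsto_add lim) (auto simp: L_def S'(2))
  then have "\<forall>\<^sub>F k in sequentially. (\<Sum>p\<in>L. (norm (d p) / A) ^ k) + (\<Sum>p\<in>S'. (norm (d p) / A) ^ k) < 1"
    by (rule order_tendstoD(2)) simp
  then obtain K where K: "\<And>k. k \<ge> K \<Longrightarrow> (\<Sum>p\<in>L. (norm (d p) / A) ^ k) + (\<Sum>p\<in>S'. (norm (d p) / A) ^ k) < 1"
    unfolding eventually_sequentially by blast
  show ?thesis
  proof (intro exI[of _ K] allI impI notI)
    fix k assume k: "k \<ge> K" and top: "\<forall>p\<in>S. norm (d p) = A \<longrightarrow> d p ^ k = of_real A ^ k"
      and eq: "(\<Sum>p\<in>S. d p ^ k) = (\<Sum>p\<in>S'. d p ^ k)"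
    have bd: "norm (\<Sum>p\<in>T. d p ^ k) \<le> A ^ k * (\<Sum>p\<in>T. (norm (d p) / A) ^ k)" for T
    proof -
      have "norm (\<Sum>p\<in>T. d p ^ k) \<le> (\<Sum>p\<in>T. norm (d p) ^ k)"
        using norm_sum[of "\<lambda>p. d p ^ k" T] by (simp add: norm_power)
      also have "\<dots> = A ^ k * (\<Sum>p\<in>T. (norm (d p) / A) ^ k)"
        using A by (simp add: sum_distrib_left power_divide)
      finally show ?thesis .
    qed
    have "card M \<ge> 1" using p0 fin(2) by (auto simp: M_def Suc_le_eq card_gt_0_iff)
    then have "A ^ k \<le> real (card M) * A ^ k" using A by simp
    also have "\<dots> = norm (\<Sum>p\<in>M. d p ^ k)"
    proof -
      have "(\<Sum>p\<in>M. d p ^ k) = (\<Sum>p\<in>M. of_real A ^ k)" by (rule sum.cong[OF refl], rule top[rule_format]) (simp_all add: M_def)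
      then show ?thesis using A by (simp add: norm_mult norm_power)
    qed
    also have "(\<Sum>p\<in>M. d p ^ k) = (\<Sum>p\<in>S'. d p ^ k) - (\<Sum>p\<in>L. d p ^ k)"
      using eq sum.union_disjoint[OF fin SLM(2), of "\<lambda>p. d p ^ k"] by (simp add: SLM(1)[symmetric])
    also have "norm \<dots> \<le> A ^ k * ((\<Sum>p\<in>L. (norm (d p) / A) ^ k) + (\<Sum>p\<in>S'. (norm (d p) / A) ^ k))"
      using norm_triangle_ineq4[of "\<Sum>p\<in>S'. d p ^ k" "\<Sum>p\<in>L. d p ^ k"] bd[of L] bd[of S'] by (simp add: distrib_left)
    also have "\<dots> < A ^ k * 1" using K[OF k] A by (intro mult_strict_left_mono) simp_all
    finally show False by simp
  qed
qed

section \<open>A plane without rational vectors\<close>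

lemma exhaust_8: "x = 1 \<or> x = 2 \<or> x = 3 \<or> x = 4 \<or> x = 5 \<or> x = 6 \<or> x = 7 \<or> x = (8 :: 8)"
proof (induct x)
  case (of_int z)
  then have "0 \<le> z" "z < 8" by simp_all
  then have "z = 0 \<or> z = 1 \<or> z = 2 \<or> z = 3 \<or> z = 4 \<or> z = 5 \<or> z = 6 \<or> z = 7" by arith
  then show ?case by auto
qed
lemma UNIV_8: "UNIV = {1, 2, 3, 4, 5, 6, 7, 8 :: 8}" using exhaust_8 by blast
lemma sum_8: "sum f (UNIV :: 8 set) = f 1 + f 2 + f 3 + f 4 + f 5 + f 6 + f 7 + f 8"
  unfolding UNIV_8 by (simp add: ac_simps)
lemma forall_8: "(\<forall>i :: 8. P i) \<longleftrightarrow> P 1 \<and> P 2 \<and> P 3 \<and> P 4 \<and> P 5 \<and> P 6 \<and> P 7 \<and> P 8"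
  by (metis exhaust_8)
lemma vector_8: "(vector [a, b, c, d, e, f, g, h] :: ('a :: zero)^8) $ 1 = a"
  "(vector [a, b, c, d, e, f, g, h] :: ('a :: zero)^8) $ 2 = b"
  "(vector [a, b, c, d, e, f, g, h] :: ('a :: zero)^8) $ 3 = c"
  "(vector [a, b, c, d, e, f, g, h] :: ('a :: zero)^8) $ 4 = d"
  "(vector [a, b, c, d, e, f, g, h] :: ('a :: zero)^8) $ 5 = e"
  "(vector [a, b, c, d, e, f, g, h] :: ('a :: zero)^8) $ 6 = f"
  "(vector [a, b, c, d, e, f, g, h] :: ('a :: zero)^8) $ 7 = g"
  "(vector [a, b, c, d, e, f, g, h] :: ('a :: zero)^8) $ 8 = h"
  unfolding vector_def by simp_all
lemma square_multiple_eq_0: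
  fixes a c n :: int
  assumes "a\<^sup>2 = n * c\<^sup>2" and n: "\<And>m. m\<^sup>2 \<noteq> n"
  shows "c = 0"
proof (rule ccontr)
  assume c: "c \<noteq> 0"
  have "c ^ 2 dvd a ^ 2" using assms(1) by simp
  then have "c dvd a" by (simp add: pow_divides_pow_iff)
  then obtain m where "a = c * m" by (elim dvdE)
  with assms(1) c have "m\<^sup>2 = n" by (simp add: power_mult_distrib)
  with n show False by blast
qed
lemma nonsquare: "m\<^sup>2 \<noteq> (2::int)" "m\<^sup>2 \<noteq> (3::int)" "m\<^sup>2 \<noteq> (6::int)"
proof -
  have "m\<^sup>2 \<notin> {2, 3, 6}"
  proof
    assume m: "m\<^sup>2 \<in> {2, 3, 6}"
    then have "\<bar>m\<bar>\<^sup>2 < 3\<^sup>2" by auto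
    then have "\<bar>m\<bar> < 3" by (rule power_less_imp_less_base) simp
    then have "m \<in> {-2, -1, 0, 1, 2}" by auto
    with m show False by auto
  qed
  then show "m\<^sup>2 \<noteq> (2::int)" "m\<^sup>2 \<noteq> (3::int)" "m\<^sup>2 \<noteq> (6::int)" by auto
qed
lemma sqrt_2_3_independent:
  fixes a b c :: int
  assumes "of_int a + sqrt 2 * of_int b + sqrt 3 * of_int c = 0"
  shows "a = 0" "b = 0" "c = 0"
proof -
  have "(of_int a + sqrt 2 * of_int b)\<^sup>2 = (sqrt 3 * of_int c)\<^sup>2" using assms
    by (metis add_eq_0_iff power2_minus)
  then have e: "of_int (a\<^sup>2 + 2 * b\<^sup>2 - 3 * c\<^sup>2) = - (2 * of_int (a * b)) * sqrt 2"
    by (simp add: power2_sum power_mult_distrib algebra_simps)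
  then have "(of_int (a\<^sup>2 + 2 * b\<^sup>2 - 3 * c\<^sup>2))\<^sup>2 = (- (2 * of_int (a * b)) * sqrt 2)\<^sup>2" by (rule arg_cong)
  also have "\<dots> = real_of_int (2 * (2 * (a * b))\<^sup>2)" by (simp add: power_mult_distrib)
  finally have "real_of_int ((a\<^sup>2 + 2 * b\<^sup>2 - 3 * c\<^sup>2)\<^sup>2) = of_int (2 * (2 * (a * b))\<^sup>2)"
    by (simp only: of_int_power)
  then have "(a\<^sup>2 + 2 * b\<^sup>2 - 3 * c\<^sup>2)\<^sup>2 = 2 * (2 * (a * b))\<^sup>2" by (simp only: of_int_eq_iff)
  from square_multiple_eq_0[OF this nonsquare(1)] have ab: "a = 0 \<or> b = 0" by simp
  then have "- (2 * of_int (a * b)) * sqrt 2 = of_int 0" by auto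
  with e have "real_of_int (a\<^sup>2 + 2 * b\<^sup>2 - 3 * c\<^sup>2) = of_int 0" by (simp only:)
  then have "a\<^sup>2 + 2 * b\<^sup>2 - 3 * c\<^sup>2 = 0" by (simp only: of_int_eq_iff)
  then have z: "a\<^sup>2 + 2 * b\<^sup>2 = 3 * c\<^sup>2" by simp
  have c: "c = 0"
  proof (cases "a = 0")
    case True
    then have "(3 * c)\<^sup>2 = 6 * b\<^sup>2" using z by (simp add: power_mult_distrib)
    from square_multiple_eq_0[OF this nonsquare(3)] z True show ?thesis by simp
  next
    case False
    with ab z have "a\<^sup>2 = 3 * c\<^sup>2" by simp
    from square_multiple_eq_0[OF this nonsquare(2)] show ?thesis .
  qed
  with z have "a\<^sup>2 + 2 * b\<^sup>2 = 0" by simp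
  then have "a\<^sup>2 = 0 \<and> b\<^sup>2 = 0" using zero_le_power2[of a] zero_le_power2[of b] by linarith
  with c show "a = 0" "b = 0" "c = 0" by auto
qed

section \<open>The extremal pairs\<close>

lemma (in spherical_theta) gram_eqD:
  assumes x: "x1 \<in> E8" "x2 \<in> E8" and g: "gram (x1, x2) = (binary_form 1 b d, vector [s, t])"
  shows "x1 \<bullet> x1 = 2" "x1 \<bullet> x2 = 2 * b" "x2 \<bullet> x2 = 2 * d" "x1 \<bullet> v = of_int s" "x2 \<bullet> v = of_int t"
proof -
  from g have T: "vector [vector [x1 \<bullet> x1 / 2, x1 \<bullet> x2 / 2], vector [x1 \<bullet> x2 / 2, x2 \<bullet> x2 / 2]] = binary_form 1 b d"
    and t: "vector [\<lfloor>x1 \<bullet> v\<rfloor>, \<lfloor>x2 \<bullet> v\<rfloor>] = (vector [s, t] :: int^2)" by (simp_all add: gram_def)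
  show "x1 \<bullet> x1 = 2" using arg_cong[OF T, of "\<lambda>M. M $ 1 $ 1"] by (simp add: binary_form_def)
  show "x1 \<bullet> x2 = 2 * b" using arg_cong[OF T, of "\<lambda>M. M $ 1 $ 2"] by (simp add: binary_form_def)
  show "x2 \<bullet> x2 = 2 * d" using arg_cong[OF T, of "\<lambda>M. M $ 2 $ 2"] by (simp add: binary_form_def)
  show "x1 \<bullet> v = of_int s" using arg_cong[OF t, of "\<lambda>M. M $ 1"] E8_floor[OF x(1)] by simp
  show "x2 \<bullet> v = of_int t" using arg_cong[OF t, of "\<lambda>M. M $ 2"] E8_floor[OF x(2)] by simp
qed

definition isotropic_vector :: "real^8 \<Rightarrow> real^8 \<Rightarrow> complex^8" where
  "isotropic_vector e f = rc e + \<i> *s rc f"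

lemma bilin_isotropic_vector:
  "bilin (rc x) (isotropic_vector e f) = of_real (x \<bullet> e) + \<i> * of_real (x \<bullet> f)"
  "bilin (isotropic_vector e f) (isotropic_vector e' f')
    = of_real (e \<bullet> e' - f \<bullet> f') + \<i> * of_real (e \<bullet> f' + f \<bullet> e')"
  by (simp_all add: isotropic_vector_def bilin_add bilin_scale bilin_rc algebra_simps)

definition irrational_1 :: "real^8" where
  "irrational_1 = vector [0, 0, 0, 0, 0, sqrt 2, - 1, 0]"

definition irrational_2 :: "real^8" where
  "irrational_2 = vector [0, 0, 0, 0, 0, sqrt 3, sqrt 6, - 3]"

lemma sqrt_2_6: "sqrt 2 * sqrt 6 = 2 * sqrt 3"
proof -
  have "sqrt 2 * sqrt 6 = sqrt (2\<^sup>2 * 3)" by (simp flip: real_sqrt_mult)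
  then show ?thesis by (simp only: real_sqrt_mult real_sqrt_abs abs_numeral)
qed

lemma sqrt_2_3: "sqrt 2 * sqrt 3 = sqrt 6"
  by (simp flip: real_sqrt_mult)

lemma irrational_inner:
  "irrational_1 \<bullet> irrational_1 = 3" "irrational_2 \<bullet> irrational_2 = 18" "irrational_1 \<bullet> irrational_2 = 0"
  by (simp_all add: inner_vec_def sum_8 vector_8 irrational_1_def irrational_2_def sqrt_2_3)

locale extremal_frame =
  fixes v e1 e2 :: "real^8" and E1 E2 :: real
  assumes root: "v \<in> E8" "v \<bullet> v = 2"
    and norms: "e1 \<bullet> e1 = E1" "e2 \<bullet> e2 = E2" and positive: "E1 > 0" "E2 > 0"
    and perp: "e1 \<bullet> e2 = 0" "v \<bullet> e1 = 0" "v \<bullet> e2 = 0"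
    and support: "\<And>i. i \<in> {6, 7, 8} \<Longrightarrow> v $ i = 0 \<and> e1 $ i = 0 \<and> e2 $ i = 0"
begin

definition f1 :: "real^8" where "f1 = sqrt (E1 / 3) *\<^sub>R irrational_1"

definition f2 :: "real^8" where "f2 = sqrt (E2 / 18) *\<^sub>R irrational_2"

lemma disjoint_support:
  assumes "\<And>i. i \<in> {6, 7, 8} \<Longrightarrow> x $ i = 0"
  shows "x \<bullet> irrational_1 = 0" "x \<bullet> irrational_2 = 0"
  using assms[of 6] assms[of 7] assms[of 8]
  by (simp_all add: inner_vec_def sum_8 vector_8 irrational_1_def irrational_2_def)

lemma f_inner:
  "f1 \<bullet> f1 = E1" "f2 \<bullet> f2 = E2" "f1 \<bullet> f2 = 0"
  "v \<bullet> f1 = 0" "v \<bullet> f2 = 0" "e1 \<bullet> f1 = 0" "e1 \<bullet> f2 = 0" "e2 \<bullet> f1 = 0" "e2 \<bullet> f2 = 0"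
proof -
  have "f1 \<bullet> f1 = sqrt (E1 / 3) * (sqrt (E1 / 3) * 3)" "f2 \<bullet> f2 = sqrt (E2 / 18) * (sqrt (E2 / 18) * 18)"
    by (simp_all add: f1_def f2_def irrational_inner)
  then show "f1 \<bullet> f1 = E1" "f2 \<bullet> f2 = E2"
    unfolding mult.assoc[symmetric] real_sqrt_mult_self using positive by simp_all
qed (use disjoint_support[of v] disjoint_support[of e1] disjoint_support[of e2] support in
      \<open>simp_all add: f1_def f2_def irrational_inner\<close>)

sublocale theta: spherical_theta v "isotropic_vector e1 f1" "isotropic_vector e2 f2" "Suc k" for k
  by unfold_locales
     (simp_all add: root bilin_isotropic_vector norms perp f_inner inner_commute[of f1 e1] inner_commute[of f1 e2]
       inner_commute[of f2 e2])

definition proj :: "real^8 \<Rightarrow> real^8" where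
  "proj x = x - (x \<bullet> v / 2) *\<^sub>R v"

definition frame_part :: "real^8 \<Rightarrow> real^8" where
  "frame_part x = (x \<bullet> e1 / E1) *\<^sub>R e1 + (x \<bullet> f1 / E1) *\<^sub>R f1 + (x \<bullet> e2 / E2) *\<^sub>R e2 + (x \<bullet> f2 / E2) *\<^sub>R f2"

definition frame_norm :: "real^8 \<Rightarrow> real" where
  "frame_norm x = ((x \<bullet> e1)\<^sup>2 + (x \<bullet> f1)\<^sup>2) / E1 + ((x \<bullet> e2)\<^sup>2 + (x \<bullet> f2)\<^sup>2) / E2"

lemma proj_inner: "proj x \<bullet> proj y = x \<bullet> y - (x \<bullet> v) * (y \<bullet> v) / 2"
  by (simp add: proj_def inner_diff_left inner_diff_right root inner_commute[of v y])

lemma linear_parts: "proj (x - c *\<^sub>R y) = proj x - c *\<^sub>R proj y"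
  "frame_part (x - c *\<^sub>R y) = frame_part x - c *\<^sub>R frame_part y"
  by (simp_all add: proj_def frame_part_def inner_diff_left algebra_simps diff_divide_distrib)

lemma bessel:
  shows "frame_norm x \<le> proj x \<bullet> proj x" "frame_norm x = proj x \<bullet> proj x \<Longrightarrow> proj x = frame_part x"
proof -
  have pos: "E1 \<noteq> 0" "E2 \<noteq> 0" using positive by auto
  have frame: "y \<bullet> frame_part x = (x \<bullet> e1 / E1) * (y \<bullet> e1) + (x \<bullet> f1 / E1) * (y \<bullet> f1) + (x \<bullet> e2 / E2) * (y \<bullet> e2) + (x \<bullet> f2 / E2) * (y \<bullet> f2)" for y
    by (simp add: frame_part_def inner_add_right)
  have pe: "proj x \<bullet> e1 = x \<bullet> e1" "proj x \<bullet> f1 = x \<bullet> f1" "proj x \<bullet> e2 = x \<bullet> e2" "proj x \<bullet> f2 = x \<bullet> f2"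
    by (simp_all add: proj_def inner_diff_left perp f_inner)
  have fe: "frame_part x \<bullet> e1 = x \<bullet> e1" "frame_part x \<bullet> f1 = x \<bullet> f1" "frame_part x \<bullet> e2 = x \<bullet> e2" "frame_part x \<bullet> f2 = x \<bullet> f2"
    using pos by (simp_all add: frame_part_def inner_add_left norms perp f_inner inner_commute[of f1 e1]
        inner_commute[of f1 e2] inner_commute[of f2 e1] inner_commute[of f2 e2] inner_commute[of f2 f1] inner_commute[of e2 e1])
  have N: "proj x \<bullet> frame_part x = frame_norm x" "frame_part x \<bullet> frame_part x = frame_norm x"
    unfolding frame pe fe by (simp_all add: frame_norm_def power2_eq_square add_divide_distrib)
  have eq: "(proj x - frame_part x) \<bullet> (proj x - frame_part x) = proj x \<bullet> proj x - frame_norm x"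
    using N by (simp add: inner_diff_left inner_diff_right inner_commute[of "frame_part x" "proj x"])
  show "frame_norm x \<le> proj x \<bullet> proj x" using eq inner_ge_zero[of "proj x - frame_part x"] by linarith
  show "proj x = frame_part x" if "frame_norm x = proj x \<bullet> proj x"
  proof -
    have "(proj x - frame_part x) \<bullet> (proj x - frame_part x) = 0" using eq that by simp
    then show ?thesis by simp
  qed
qed

lemma hadamard: "(norm (theta.minor (x, y)))\<^sup>2 \<le> E1 * E2 * (frame_norm x * frame_norm y)"
proof -
  define p where "p x = norm (bilin (rc x) (isotropic_vector e1 f1))" for x
  define q where "q x = norm (bilin (rc x) (isotropic_vector e2 f2))" for x
  have pq: "frame_norm x = (p x)\<^sup>2 / E1 + (q x)\<^sup>2 / E2" for x
    by (simp add: frame_norm_def p_def q_def bilin_isotropic_vector cmod_power2)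
  have "norm (theta.minor (x, y)) \<le> p x * q y + q x * p y"
    unfolding theta.minor_def prod.case p_def q_def norm_mult[symmetric] by (rule norm_triangle_ineq4)
  then have "(norm (theta.minor (x, y)))\<^sup>2 \<le> (p x * q y + q x * p y)\<^sup>2"
    by (rule power_mono) simp
  also have "\<dots> \<le> (p x * q y + q x * p y)\<^sup>2 + (p x * p y * E2 - q x * q y * E1)\<^sup>2 / (E1 * E2)"
    using positive by simp
  also have "\<dots> = E1 * E2 * (frame_norm x * frame_norm y)"
    unfolding pq using positive by (simp add: field_simps power2_eq_square)
  finally show ?thesis .
qed

lemma minor_bound:
  assumes g: "(proj x \<bullet> proj x) * (proj y \<bullet> proj y) - (proj x \<bullet> proj y)\<^sup>2 = E1 * E2"
  shows "norm (theta.minor (x, y)) \<le> E1 * E2"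
    and "norm (theta.minor (x, y)) = E1 * E2 \<Longrightarrow> proj x = frame_part x \<and> proj y = frame_part y"
proof -
  have EE: "E1 * E2 > 0" using positive by simp
  have q: "proj x \<bullet> proj x > 0"
  proof (rule ccontr)
    assume "\<not> 0 < proj x \<bullet> proj x"
    then have "proj x = 0" by simp
    with g EE show False by (metis diff_0 inner_zero_left less_irrefl mult_zero_left neg_0_equal_iff_equal power_zero_numeral)
  qed
  define c where "c = (proj x \<bullet> proj y) / (proj x \<bullet> proj x)"
  define y' where "y' = y - c *\<^sub>R x"
  have m: "theta.minor (x, y') = theta.minor (x, y)"
    by (simp add: theta.minor_def y'_def bilin_isotropic_vector inner_diff_left algebra_simps)
  have "proj y' \<bullet> proj y' = proj y \<bullet> proj y - 2 * c * (proj x \<bullet> proj y) + c\<^sup>2 * (proj x \<bullet> proj x)"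
    by (simp add: y'_def linear_parts inner_diff_left inner_diff_right inner_commute[of "proj y" "proj x"] power2_eq_square algebra_simps)
  also have "\<dots> = proj y \<bullet> proj y - (proj x \<bullet> proj y)\<^sup>2 / (proj x \<bullet> proj x)"
    using q by (simp add: c_def power2_eq_square)
  finally have g': "(proj x \<bullet> proj x) * (proj y' \<bullet> proj y') = E1 * E2"
    using q g by (simp add: right_diff_distrib)
  have q': "proj y' \<bullet> proj y' > 0" using g' EE q by (metis zero_less_mult_pos)
  have N0: "frame_norm x \<ge> 0" "frame_norm y' \<ge> 0" using positive by (simp_all add: frame_norm_def)
  have le: "frame_norm x * frame_norm y' \<le> E1 * E2"
    unfolding g'[symmetric] by (rule mult_mono) (use bessel(1) N0 in simp_all)
  have h: "(norm (theta.minor (x, y)))\<^sup>2 \<le> E1 * E2 * (frame_norm x * frame_norm y')"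
    using hadamard[of x y'] by (simp only: m)
  also have "\<dots> \<le> E1 * E2 * (E1 * E2)" using le EE by (intro mult_left_mono) simp_all
  finally have "(norm (theta.minor (x, y)))\<^sup>2 \<le> (E1 * E2)\<^sup>2" by (simp only: power2_eq_square)
  then show "norm (theta.minor (x, y)) \<le> E1 * E2" by (rule power2_le_imp_le) (use EE in simp)
  assume "norm (theta.minor (x, y)) = E1 * E2"
  with h have "E1 * E2 * (E1 * E2) \<le> E1 * E2 * (frame_norm x * frame_norm y')" by (simp only: power2_eq_square)
  then have ge: "E1 * E2 \<le> frame_norm x * frame_norm y'" using EE by (simp only: mult_le_cancel_left_pos)
  have "frame_norm x = proj x \<bullet> proj x"
  proof (rule ccontr)
    assume "\<not> ?thesis"
    then have "frame_norm x < proj x \<bullet> proj x" using bessel(1)[of x] by linarith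
    then have "frame_norm x * (proj y' \<bullet> proj y') < E1 * E2" unfolding g'[symmetric] using q' by (rule mult_strict_right_mono)
    moreover have "frame_norm x * frame_norm y' \<le> frame_norm x * (proj y' \<bullet> proj y')"
      by (rule mult_left_mono[OF bessel(1) N0(1)])
    ultimately show False using ge by linarith
  qed
  then have x: "proj x = frame_part x" by (rule bessel(2))
  have "frame_norm y' = proj y' \<bullet> proj y'"
  proof (rule ccontr)
    assume "\<not> ?thesis"
    then have "frame_norm y' < proj y' \<bullet> proj y'" using bessel(1)[of y'] by linarith
    then have "(proj x \<bullet> proj x) * frame_norm y' < E1 * E2" unfolding g'[symmetric] using q by (rule mult_strict_left_mono)
    moreover have "frame_norm x * frame_norm y' \<le> (proj x \<bullet> proj x) * frame_norm y'"
      by (rule mult_right_mono[OF bessel(1) N0(2)])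
    ultimately show False using ge by linarith
  qed
  then have "proj y' = frame_part y'" by (rule bessel(2))
  then have "proj y = frame_part y" unfolding y'_def linear_parts x by simp
  with x show "proj x = frame_part x \<and> proj y = frame_part y" ..
qed

lemma extremal_integral:
  assumes x: "x \<in> E8" and ext: "proj x = frame_part x"
  shows "x = (x \<bullet> v / 2) *\<^sub>R v + (x \<bullet> e1 / E1) *\<^sub>R e1 + (x \<bullet> e2 / E2) *\<^sub>R e2"
    and "x \<bullet> f1 = 0" "x \<bullet> f2 = 0" "x $ i \<in> \<int>"
proof -
  define p where "p = (x \<bullet> f1 / E1) * sqrt (E1 / 3)"
  define q where "q = (x \<bullet> f2 / E2) * sqrt (E2 / 18)"
  have dec: "x = (x \<bullet> v / 2) *\<^sub>R v + (x \<bullet> e1 / E1) *\<^sub>R e1 + (x \<bullet> e2 / E2) *\<^sub>R e2 + p *\<^sub>R irrational_1 + q *\<^sub>R irrational_2"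
    using ext by (simp add: proj_def frame_part_def f1_def f2_def p_def q_def algebra_simps)
  have c: "x $ 6 = p * sqrt 2 + q * sqrt 3" "x $ 7 = - p + q * sqrt 6" "x $ 8 = - 3 * q"
    using arg_cong[OF dec, of "\<lambda>x. x $ 6"] arg_cong[OF dec, of "\<lambda>x. x $ 7"] arg_cong[OF dec, of "\<lambda>x. x $ 8"]
      support[of 6] support[of 7] support[of 8]
    by (simp_all add: irrational_1_def irrational_2_def vector_8)
  have "2 * x $ i \<in> \<int>" for i using x E8_half_integers by (auto simp: half_integers_def)
  then have "\<forall>i. \<exists>n. 2 * x $ i = of_int n" by (auto elim: Ints_cases)
  then obtain n where n: "\<And>i. 2 * x $ i = of_int (n i)" by metis
  have "of_int (n 6) + sqrt 2 * of_int (n 7) + sqrt 3 * of_int (n 8) = 2 * q * (sqrt 2 * sqrt 6 - 2 * sqrt 3)"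
    unfolding n[symmetric] c by (simp add: algebra_simps)
  then have "of_int (n 6) + sqrt 2 * of_int (n 7) + sqrt 3 * of_int (n 8) = 0" by (simp only: sqrt_2_6) simp
  note zero = sqrt_2_3_independent[OF this]
  have x0: "x $ 6 = 0" "x $ 7 = 0" "x $ 8 = 0" using n[of 6] n[of 7] n[of 8] zero by simp_all
  then have q: "q = 0" using c(3) by simp
  with c(2) x0 have p: "p = 0" by simp
  show "x = (x \<bullet> v / 2) *\<^sub>R v + (x \<bullet> e1 / E1) *\<^sub>R e1 + (x \<bullet> e2 / E2) *\<^sub>R e2"
    using dec unfolding p q by simp
  show "x \<bullet> f1 = 0" "x \<bullet> f2 = 0" using x0 disjoint_support[of x] by (auto simp: f1_def f2_def)
  show "x $ i \<in> \<int>"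
  proof -
    have "x \<notin> shifted_integers (1 / 2)"
    proof
      assume "x \<in> shifted_integers (1 / 2)"
      then have "x $ 6 - 1 / 2 \<in> \<int>" unfolding shifted_integers_def by blast
      then obtain m :: int where "x $ 6 - 1 / 2 = of_int m" by (rule Ints_cases)
      then have "real_of_int (2 * m) = of_int (- 1)" using x0 by simp
      then have "2 * m = - 1" by (simp only: of_int_eq_iff)
      then show False by presburger
    qed
    then have "x \<in> shifted_integers 0" using x by (auto simp: E8_def)
    then show ?thesis by (simp add: shifted_integers_def)
  qed
qed

lemma extremal_minor:
  assumes "x \<in> E8" "y \<in> E8" "proj x = frame_part x" "proj y = frame_part y"
  shows "theta.minor (x, y) = of_real ((x \<bullet> e1) * (y \<bullet> e2) - (x \<bullet> e2) * (y \<bullet> e1))"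
  by (simp add: theta.minor_def bilin_isotropic_vector extremal_integral(2,3) assms)

end

section \<open>Two special frames\<close>

definition root :: "real^8" where "root = vector [0, 0, 1, - 1, 0, 0, 0, 0]"

lemma integral_E8:
  assumes "\<And>i. x $ i \<in> \<int>" "(\<Sum>i\<in>UNIV. x $ i) / 2 \<in> \<int>"
  shows "x \<in> E8"
  using assms by (simp add: E8_def shifted_integers_def)

lemma inner_8: "x \<bullet> y = x $ 1 * y $ 1 + x $ 2 * y $ 2 + x $ 3 * y $ 3 + x $ 4 * y $ 4 + x $ 5 * y $ 5 + x $ 6 * y $ 6
    + x $ 7 * y $ 7 + x $ 8 * y $ (8 :: 8)" for x y :: "real^8"
  by (simp add: inner_vec_def sum_8)

lemma root_E8: "root \<in> E8"
proof (rule integral_E8)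
  have "\<forall>i. root $ i \<in> \<int>" unfolding forall_8 by (simp add: root_def vector_8)
  then show "root $ i \<in> \<int>" for i by blast
qed (simp add: sum_8 root_def vector_8)

definition even_e1 :: "real^8" where "even_e1 = vector [1, 1, 0, 0, 0, 0, 0, 0]"

definition even_e2 :: "real^8" where "even_e2 = vector [1, - 1, 1 / 2, 1 / 2, 1, 0, 0, 0]"

interpretation even_frame: extremal_frame root even_e1 even_e2 2 "7 / 2"
  by unfold_locales (rule root_E8, auto simp: inner_8 root_def even_e1_def even_e2_def vector_8)

lemma even_extremal:
  assumes x: "x \<in> E8" and ext: "even_frame.proj x = even_frame.frame_part x"
  obtains a c g :: int where "x = vector [of_int (a + c), of_int (a - c), of_int g, of_int (c - g), of_int c, 0, 0, 0]"
proof -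
  define s where "s = x \<bullet> root / 2"
  define \<alpha> where "\<alpha> = x \<bullet> even_e1 / 2"
  define \<gamma> where "\<gamma> = x \<bullet> even_e2 / (7 / 2)"
  have dec: "x = s *\<^sub>R root + \<alpha> *\<^sub>R even_e1 + \<gamma> *\<^sub>R even_e2"
    unfolding s_def \<alpha>_def \<gamma>_def by (rule even_frame.extremal_integral(1)[OF x ext])
  have nth: "x $ i = s * root $ i + \<alpha> * even_e1 $ i + \<gamma> * even_e2 $ i" for i
    using arg_cong[OF dec, of "\<lambda>x. x $ i"] by simp
  have c: "x $ 1 = \<alpha> + \<gamma>" "x $ 2 = \<alpha> - \<gamma>" "x $ 3 = \<gamma> / 2 + s" "x $ 4 = \<gamma> / 2 - s" "x $ 5 = \<gamma>"
    "x $ 6 = 0" "x $ 7 = 0" "x $ 8 = 0"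
    by (simp_all add: nth[of 1] nth[of 2] nth[of 3] nth[of 4] nth[of 5] nth[of 6] nth[of 7] nth[of 8]
        root_def even_e1_def even_e2_def vector_8)
  obtain m where m: "x $ 1 = of_int m" using even_frame.extremal_integral(4)[OF x ext, of 1] by (rule Ints_cases)
  obtain g where g: "x $ 3 = of_int g" using even_frame.extremal_integral(4)[OF x ext, of 3] by (rule Ints_cases)
  obtain c' where c': "x $ 5 = of_int c'" using even_frame.extremal_integral(4)[OF x ext, of 5] by (rule Ints_cases)
  have "x = vector [of_int ((m - c') + c'), of_int ((m - c') - c'), of_int g, of_int (c' - g), of_int c', 0, 0, 0]"
    unfolding vec_eq_iff forall_8 vector_8 using m g c' c by simp
  then show thesis by (rule that)
qed

lemma even_gram:
  assumes x: "x \<in> E8" "y \<in> E8" and g: "even_frame.theta.gram (x, y) = (binary_form 1 b 2, vector [0, t])"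
    and bt: "4 * b\<^sup>2 + (of_int t)\<^sup>2 = 1"
  shows "norm (even_frame.theta.minor (x, y)) \<le> 7"
    and "norm (even_frame.theta.minor (x, y)) = 7
      \<Longrightarrow> even_frame.proj x = even_frame.frame_part x \<and> even_frame.proj y = even_frame.frame_part y"
proof -
  note i = even_frame.theta.gram_eqD[OF x g]
  have "(even_frame.proj x \<bullet> even_frame.proj x) * (even_frame.proj y \<bullet> even_frame.proj y)
      - (even_frame.proj x \<bullet> even_frame.proj y)\<^sup>2 = 8 - (4 * b\<^sup>2 + (of_int t)\<^sup>2)"
    by (simp add: even_frame.proj_inner i power2_eq_square)
  then have "(even_frame.proj x \<bullet> even_frame.proj x) * (even_frame.proj y \<bullet> even_frame.proj y)
      - (even_frame.proj x \<bullet> even_frame.proj y)\<^sup>2 = 2 * (7 / 2)"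
    unfolding bt by simp
  from even_frame.minor_bound[OF this] show "norm (even_frame.theta.minor (x, y)) \<le> 7"
    "norm (even_frame.theta.minor (x, y)) = 7
      \<Longrightarrow> even_frame.proj x = even_frame.frame_part x \<and> even_frame.proj y = even_frame.frame_part y" by simp_all
qed

lemma even_extremal_excluded:
  assumes x: "x \<in> E8" "y \<in> E8" and g: "even_frame.theta.gram (x, y) = (binary_form 1 (1 / 2) 2, vector [0, 0])"
  shows "norm (even_frame.theta.minor (x, y)) < 7"
proof -
  note b = even_gram[OF x g]
  have "norm (even_frame.theta.minor (x, y)) \<noteq> 7"
  proof
    assume "norm (even_frame.theta.minor (x, y)) = 7"
    with b(2) have ext: "even_frame.proj x = even_frame.frame_part x" "even_frame.proj y = even_frame.frame_part y"
      by (simp_all add: power2_eq_square)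
    obtain a c h where xe: "x = vector [of_int (a + c), of_int (a - c), of_int h, of_int (c - h), of_int c, 0, 0, 0]"
      by (rule even_extremal[OF x(1) ext(1)])
    obtain a' c' h' where ye: "y = vector [of_int (a' + c'), of_int (a' - c'), of_int h', of_int (c' - h'), of_int c', 0, 0, 0]"
      by (rule even_extremal[OF x(2) ext(2)])
    note i = even_frame.theta.gram_eqD[OF x g]
    have "real_of_int (h - (c - h)) = of_int 0" using i(4) by (simp add: xe inner_8 vector_8 root_def)
    then have c: "c = 2 * h" by (simp only: of_int_eq_iff)
    have "real_of_int ((a + c) * (a + c) + (a - c) * (a - c) + h * h + (c - h) * (c - h) + c * c) = of_int 2"
      using i(1) unfolding xe inner_8 vector_8 by simp
    then have "(a + c) * (a + c) + (a - c) * (a - c) + h * h + (c - h) * (c - h) + c * c = 2"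
      by (simp only: of_int_eq_iff)
    then have e: "a\<^sup>2 + 7 * h\<^sup>2 = 1" unfolding c by (simp add: power2_eq_square algebra_simps)
    have h: "h = 0"
    proof (rule ccontr)
      assume "h \<noteq> 0"
      then have "h\<^sup>2 \<ge> 1" by (simp add: int_one_le_iff_zero_less)
      with e zero_le_power2[of a] show False by linarith
    qed
    have "real_of_int ((a + c) * (a' + c') + (a - c) * (a' - c') + h * h' + (c - h) * (c' - h') + c * c') = of_int 1"
      using i(2) unfolding xe ye inner_8 vector_8 by simp
    then have "(a + c) * (a' + c') + (a - c) * (a' - c') + h * h' + (c - h) * (c' - h') + c * c' = 1"
      by (simp only: of_int_eq_iff)
    then have "2 * (a * a') = 1" unfolding c h by (simp add: algebra_simps)
    then show False by presburger
  qed
  with b(1) show ?thesis by (simp add: power2_eq_square less_le)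
qed

lemma even_extremal_power:
  assumes x: "x \<in> E8" "y \<in> E8" and g: "even_frame.theta.gram (x, y) = (binary_form 1 0 2, vector [0, 1])"
    and n: "norm (even_frame.theta.minor (x, y)) = 7" and k: "even k"
  shows "even_frame.theta.minor (x, y) ^ k = of_real 7 ^ k"
proof -
  from even_gram(2)[OF x g _ n] have ext: "even_frame.proj x = even_frame.frame_part x" "even_frame.proj y = even_frame.frame_part y"
    by simp_all
  define d where "d = (x \<bullet> even_e1) * (y \<bullet> even_e2) - (x \<bullet> even_e2) * (y \<bullet> even_e1)"
  have m: "even_frame.theta.minor (x, y) = of_real d" unfolding d_def by (rule even_frame.extremal_minor[OF x ext])
  with n have "\<bar>d\<bar> = 7" by simp
  then have "d ^ k = 7 ^ k" using power_even_abs[OF k, of d] by simp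
  then show ?thesis unfolding m by (metis of_real_power)
qed

lemma even_coefficients_differ:
  "\<exists>K. \<forall>k\<ge>K. even (Suc k) \<longrightarrow> even_frame.theta.coefficient k (binary_form 1 0 2) (vector [0, 1])
    \<noteq> even_frame.theta.coefficient k (binary_form 1 (1 / 2) 2) (vector [0, 0])"
proof -
  let ?S = "\<lambda>b t. {p \<in> E8 \<times> E8. even_frame.theta.gram p = (binary_form 1 b 2, vector [0, t])}"
  let ?y = "vector [1, - 1, 1, 0, 1, 0, 0, 0] :: real^8"
  have e: "even_e1 \<in> E8" "?y \<in> E8"
  proof -
    have "\<forall>i. even_e1 $ i \<in> \<int>" "\<forall>i. ?y $ i \<in> \<int>" unfolding forall_8 by (simp_all add: even_e1_def vector_8)
    then show "even_e1 \<in> E8" "?y \<in> E8" by (auto intro!: integral_E8 simp: even_e1_def sum_8 vector_8)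
  qed
  have p0: "(even_e1, ?y) \<in> ?S 0 1"
    using e by (simp add: even_frame.theta.gram_def) (simp add: binary_form_def inner_8 even_e1_def root_def vector_8)
  have n0: "norm (even_frame.theta.minor (even_e1, ?y)) = 7"
  proof -
    have "?y \<bullet> even_frame.f1 = 0" "?y \<bullet> even_frame.f2 = 0"
      by (simp_all add: even_frame.f1_def even_frame.f2_def inner_8 vector_8 irrational_1_def irrational_2_def)
    then show ?thesis
      by (simp add: even_frame.theta.minor_def bilin_isotropic_vector even_frame.f_inner)
         (simp add: inner_8 even_e1_def even_e2_def vector_8 norm_mult)
  qed
  have fin: "finite (?S b t)" for b t by (rule even_frame.theta.fiber_finite)
  have "\<exists>K. \<forall>k\<ge>K. (\<forall>p\<in>?S 0 1. norm (even_frame.theta.minor p) = 7 \<longrightarrow>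
      even_frame.theta.minor p ^ k = of_real 7 ^ k)
    \<longrightarrow> (\<Sum>p\<in>?S 0 1. even_frame.theta.minor p ^ k) \<noteq> (\<Sum>p\<in>?S (1 / 2) 0. even_frame.theta.minor p ^ k)"
  proof (rule powers_differ_from_dominated_powers[where d = even_frame.theta.minor, OF fin[of 0 1] _ p0 n0 fin[of "1 / 2" 0]])
    show "norm (even_frame.theta.minor p) \<le> 7" if "p \<in> ?S 0 1" for p
      using that even_gram(1)[of "fst p" "snd p" 0 1] by auto
    show "norm (even_frame.theta.minor p) < 7" if "p \<in> ?S (1 / 2) 0" for p
      using that even_extremal_excluded[of "fst p" "snd p"] by auto
  qed simp
  then obtain K where K: "\<And>k. k \<ge> K \<Longrightarrow> \<forall>p\<in>?S 0 1. norm (even_frame.theta.minor p) = 7 \<longrightarrow>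
      even_frame.theta.minor p ^ k = of_real 7 ^ k
    \<Longrightarrow> (\<Sum>p\<in>?S 0 1. even_frame.theta.minor p ^ k) \<noteq> (\<Sum>p\<in>?S (1 / 2) 0. even_frame.theta.minor p ^ k)"
    by blast
  show ?thesis
  proof (intro exI[of _ K] allI impI)
    fix k assume k: "k \<ge> K" "even (Suc k)"
    have "\<forall>p\<in>?S 0 1. norm (even_frame.theta.minor p) = 7 \<longrightarrow> even_frame.theta.minor p ^ Suc k = of_real 7 ^ Suc k"
      using even_extremal_power[OF _ _ _ _ k(2)] by blast
    from K[OF _ this] k(1) show "even_frame.theta.coefficient k (binary_form 1 0 2) (vector [0, 1])
      \<noteq> even_frame.theta.coefficient k (binary_form 1 (1 / 2) 2) (vector [0, 0])"
      unfolding even_frame.theta.coefficient_def by simp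
  qed
qed

definition odd_e1 :: "real^8" where "odd_e1 = vector [0, 1, 1 / 2, 1 / 2, 0, 0, 0, 0]"

definition odd_e2 :: "real^8" where "odd_e2 = vector [2, 1 / 3, - 1 / 3, - 1 / 3, 1, 0, 0, 0]"

interpretation odd_frame: extremal_frame root odd_e1 odd_e2 "3 / 2" "16 / 3"
  by unfold_locales (rule root_E8, auto simp: inner_8 root_def odd_e1_def odd_e2_def vector_8)

lemma odd_extremal:
  assumes x: "x \<in> E8" and ext: "odd_frame.proj x = odd_frame.frame_part x"
  obtains a c g :: int where "x = vector [of_int (2 * c), of_int (a + c), of_int (a + g), of_int (- g), of_int c, 0, 0, 0]"
proof -
  define s where "s = x \<bullet> root / 2"
  define \<alpha> where "\<alpha> = x \<bullet> odd_e1 / (3 / 2)"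
  define \<gamma> where "\<gamma> = x \<bullet> odd_e2 / (16 / 3)"
  have dec: "x = s *\<^sub>R root + \<alpha> *\<^sub>R odd_e1 + \<gamma> *\<^sub>R odd_e2"
    unfolding s_def \<alpha>_def \<gamma>_def by (rule odd_frame.extremal_integral(1)[OF x ext])
  have nth: "x $ i = s * root $ i + \<alpha> * odd_e1 $ i + \<gamma> * odd_e2 $ i" for i
    using arg_cong[OF dec, of "\<lambda>x. x $ i"] by simp
  have c: "x $ 1 = 2 * \<gamma>" "x $ 2 = \<alpha> + \<gamma> / 3" "x $ 3 = \<alpha> / 2 - \<gamma> / 3 + s" "x $ 4 = \<alpha> / 2 - \<gamma> / 3 - s" "x $ 5 = \<gamma>"
    "x $ 6 = 0" "x $ 7 = 0" "x $ 8 = 0"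
    by (simp_all add: nth[of 1] nth[of 2] nth[of 3] nth[of 4] nth[of 5] nth[of 6] nth[of 7] nth[of 8]
        root_def odd_e1_def odd_e2_def vector_8)
  obtain m where m: "x $ 2 = of_int m" using odd_frame.extremal_integral(4)[OF x ext, of 2] by (rule Ints_cases)
  obtain g where g: "x $ 4 = of_int g" using odd_frame.extremal_integral(4)[OF x ext, of 4] by (rule Ints_cases)
  obtain c' where c': "x $ 5 = of_int c'" using odd_frame.extremal_integral(4)[OF x ext, of 5] by (rule Ints_cases)
  have "x = vector [of_int (2 * c'), of_int ((m - c') + c'), of_int ((m - c') + (- g)), of_int (- (- g)), of_int c', 0, 0, 0]"
    unfolding vec_eq_iff forall_8 vector_8 using m g c' c by simp
  then show thesis by (rule that)
qed

lemma odd_gram: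
  assumes x: "x \<in> E8" "y \<in> E8" and g: "odd_frame.theta.gram (x, y) = (binary_form 1 (1 / 2) 3, vector [1, 0])"
  shows "norm (odd_frame.theta.minor (x, y)) \<le> 8"
    and "norm (odd_frame.theta.minor (x, y)) = 8
      \<Longrightarrow> odd_frame.proj x = odd_frame.frame_part x \<and> odd_frame.proj y = odd_frame.frame_part y"
proof -
  have "(odd_frame.proj x \<bullet> odd_frame.proj x) * (odd_frame.proj y \<bullet> odd_frame.proj y)
      - (odd_frame.proj x \<bullet> odd_frame.proj y)\<^sup>2 = 3 / 2 * (16 / 3)"
    by (simp add: odd_frame.proj_inner odd_frame.theta.gram_eqD[OF x g])
  from odd_frame.minor_bound[OF this] show "norm (odd_frame.theta.minor (x, y)) \<le> 8"
    "norm (odd_frame.theta.minor (x, y)) = 8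
      \<Longrightarrow> odd_frame.proj x = odd_frame.frame_part x \<and> odd_frame.proj y = odd_frame.frame_part y" by simp_all
qed

lemma odd_gram_solutions:
  fixes a c g a' c' g' :: int
  assumes xv: "a + 2 * g = 1" and yv: "a' + 2 * g' = 0"
    and xx: "4 * c\<^sup>2 + (a + c)\<^sup>2 + (a + g)\<^sup>2 + g\<^sup>2 + c\<^sup>2 = 2"
    and xy: "4 * c * c' + (a + c) * (a' + c') + (a + g) * (a' + g') + g * g' + c * c' = 1"
    and yy: "4 * c'\<^sup>2 + (a' + c')\<^sup>2 + (a' + g')\<^sup>2 + g'\<^sup>2 + c'\<^sup>2 = 6"
  shows "c = 0" "a * c' = 1"
proof -
  have a: "a = 1 - 2 * g" and a': "a' = - (2 * g')" using xv yv by simp_all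
  have "(6 * c - (2 * g - 1))\<^sup>2 + 8 * (2 * g - 1)\<^sup>2 = 9"
    using xx unfolding a by (simp add: power2_eq_square algebra_simps)
  moreover from this have "(2 * g - 1)\<^sup>2 < 4" using zero_le_power2[of "6 * c - (2 * g - 1)"] by linarith
  then have "\<bar>2 * g - 1\<bar>\<^sup>2 < 2\<^sup>2" by simp
  then have "\<bar>2 * g - 1\<bar> < 2" by (rule power_less_imp_less_base) simp
  then have g: "g = 0 \<or> g = 1" by presburger
  ultimately have "(6 * c + 1)\<^sup>2 = 1 \<or> (6 * c - 1)\<^sup>2 = 1" by auto
  then show c: "c = 0" by (auto simp: power2_eq_1_iff)
  have y: "6 * c'\<^sup>2 - 4 * c' * g' + 6 * g'\<^sup>2 = 6"
    using yy unfolding a' by (simp add: power2_eq_square algebra_simps)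
  from g show "a * c' = 1"
  proof
    assume g0: "g = 0"
    then have c': "c' = 1 + 3 * g'" using xy unfolding a a' c by (simp add: algebra_simps)
    from y have "g' * (3 * g' + 2) = 0" unfolding c' by (simp add: power2_eq_square algebra_simps)
    then have "g' = 0 \<or> 3 * g' + 2 = 0" by simp
    then have "g' = 0" by presburger
    with c' a g0 show ?thesis by simp
  next
    assume g1: "g = 1"
    then have c': "c' = 3 * g' - 1" using xy unfolding a a' c by (simp add: algebra_simps)
    from y have "g' * (3 * g' - 2) = 0" unfolding c' by (simp add: power2_eq_square algebra_simps)
    then have "g' = 0 \<or> 3 * g' - 2 = 0" by simp
    then have "g' = 0" by presburger
    with c' a g1 show ?thesis by simp
  qed
qed

lemma odd_extremal_value:
  assumes x: "x \<in> E8" "y \<in> E8" and gr: "odd_frame.theta.gram (x, y) = (binary_form 1 (1 / 2) 3, vector [1, 0])"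
    and n: "norm (odd_frame.theta.minor (x, y)) = 8"
  shows "odd_frame.theta.minor (x, y) = 8"
proof -
  from odd_gram(2)[OF x gr n] have ext: "odd_frame.proj x = odd_frame.frame_part x" "odd_frame.proj y = odd_frame.frame_part y"
    by simp_all
  obtain a c g where xe: "x = vector [of_int (2 * c), of_int (a + c), of_int (a + g), of_int (- g), of_int c, 0, 0, 0]"
    by (rule odd_extremal[OF x(1) ext(1)])
  obtain a' c' g' where ye: "y = vector [of_int (2 * c'), of_int (a' + c'), of_int (a' + g'), of_int (- g'), of_int c', 0, 0, 0]"
    by (rule odd_extremal[OF x(2) ext(2)])
  note i = odd_frame.theta.gram_eqD[OF x gr]
  have "real_of_int (a + 2 * g) = of_int 1" using i(4) by (simp add: xe inner_8 vector_8 root_def)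
  moreover have "real_of_int (a' + 2 * g') = of_int 0" using i(5) by (simp add: ye inner_8 vector_8 root_def)
  moreover have "real_of_int (4 * c\<^sup>2 + (a + c)\<^sup>2 + (a + g)\<^sup>2 + g\<^sup>2 + c\<^sup>2) = of_int 2"
    using i(1) by (simp add: xe inner_8 vector_8 power2_eq_square)
  moreover have "real_of_int (4 * c * c' + (a + c) * (a' + c') + (a + g) * (a' + g') + g * g' + c * c') = of_int 1"
    using i(2) by (simp add: xe ye inner_8 vector_8)
  moreover have "real_of_int (4 * c'\<^sup>2 + (a' + c')\<^sup>2 + (a' + g')\<^sup>2 + g'\<^sup>2 + c'\<^sup>2) = of_int 6"
    using i(3) by (simp add: ye inner_8 vector_8 power2_eq_square)
  ultimately have s: "c = 0" "a * c' = 1"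
    unfolding of_int_eq_iff using odd_gram_solutions[of a g a' g' c c'] by blast+
  have "(x \<bullet> odd_e1) * (y \<bullet> odd_e2) - (x \<bullet> odd_e2) * (y \<bullet> odd_e1) = 8 * of_int (a * c' - a' * c)"
    by (simp add: xe ye inner_8 vector_8 odd_e1_def odd_e2_def field_simps)
  then show ?thesis unfolding odd_frame.extremal_minor[OF x ext] s by simp
qed

lemma odd_coefficient_nonzero:
  "\<exists>K. \<forall>k\<ge>K. odd_frame.theta.coefficient k (binary_form 1 (1 / 2) 3) (vector [1, 0]) \<noteq> 0"
proof -
  let ?S = "{p \<in> E8 \<times> E8. odd_frame.theta.gram p = (binary_form 1 (1 / 2) 3, vector [1, 0])}"
  let ?x = "vector [0, 1, 1, 0, 0, 0, 0, 0] :: real^8" and ?y = "vector [2, 1, 0, 0, 1, 0, 0, 0] :: real^8"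
  have e: "?x \<in> E8" "?y \<in> E8"
  proof -
    have "\<forall>i. ?x $ i \<in> \<int>" "\<forall>i. ?y $ i \<in> \<int>" unfolding forall_8 by (simp_all add: vector_8)
    then show "?x \<in> E8" "?y \<in> E8" by (auto intro!: integral_E8 simp: sum_8 vector_8)
  qed
  have p0: "(?x, ?y) \<in> ?S"
    using e by (simp add: odd_frame.theta.gram_def) (simp add: binary_form_def inner_8 root_def vector_8)
  have n0: "norm (odd_frame.theta.minor (?x, ?y)) = 8"
  proof -
    have "?x \<bullet> odd_frame.f1 = 0" "?x \<bullet> odd_frame.f2 = 0" "?y \<bullet> odd_frame.f1 = 0" "?y \<bullet> odd_frame.f2 = 0"
      by (simp_all add: odd_frame.f1_def odd_frame.f2_def inner_8 vector_8 irrational_1_def irrational_2_def)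
    then show ?thesis
      by (simp add: odd_frame.theta.minor_def bilin_isotropic_vector)
         (simp add: inner_8 odd_e1_def odd_e2_def vector_8 norm_mult)
  qed
  have fin: "finite ?S" by (rule odd_frame.theta.fiber_finite)
  have "\<exists>K. \<forall>k\<ge>K. (\<forall>p\<in>?S. norm (odd_frame.theta.minor p) = 8 \<longrightarrow>
      odd_frame.theta.minor p ^ k = of_real 8 ^ k)
    \<longrightarrow> (\<Sum>p\<in>?S. odd_frame.theta.minor p ^ k) \<noteq> (\<Sum>p\<in>{}. odd_frame.theta.minor p ^ k)"
  proof (rule powers_differ_from_dominated_powers[where d = odd_frame.theta.minor, OF fin _ p0 n0 finite.emptyI])
    show "norm (odd_frame.theta.minor p) \<le> 8" if "p \<in> ?S" for p
      using that odd_gram(1)[of "fst p" "snd p"] by auto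
  qed simp_all
  then obtain K where K: "\<And>k. k \<ge> K \<Longrightarrow> \<forall>p\<in>?S. norm (odd_frame.theta.minor p) = 8 \<longrightarrow>
      odd_frame.theta.minor p ^ k = of_real 8 ^ k
    \<Longrightarrow> (\<Sum>p\<in>?S. odd_frame.theta.minor p ^ k) \<noteq> (\<Sum>p\<in>{}. odd_frame.theta.minor p ^ k)"
    by blast
  show ?thesis
  proof (intro exI[of _ K] allI impI)
    fix k assume k: "k \<ge> K"
    have "\<forall>p\<in>?S. norm (odd_frame.theta.minor p) = 8 \<longrightarrow> odd_frame.theta.minor p ^ Suc k = of_real 8 ^ Suc k"
    proof (intro ballI impI)
      fix p assume p: "p \<in> ?S" "norm (odd_frame.theta.minor p) = 8"
      obtain x y where xy: "p = (x, y)" by (cases p)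
      have "odd_frame.theta.minor (x, y) = of_real 8"
        using odd_extremal_value[of x y] p unfolding xy by simp
      then show "odd_frame.theta.minor p ^ Suc k = of_real 8 ^ Suc k" by (simp only: xy)
    qed
    from K[OF _ this] k show "odd_frame.theta.coefficient k (binary_form 1 (1 / 2) 3) (vector [1, 0]) \<noteq> 0"
      unfolding odd_frame.theta.coefficient_def by simp
  qed
qed

section \<open>The inclusion is proper\<close>

theorem theorem2:
  shows "\<exists>r\<^sub>0 :: int. \<forall>r \<ge> r\<^sub>0.
           module.subspace (\<lambda>(a :: complex) \<phi> x. a * \<phi> x) (fourier_jacobi_cusp_forms r) \<and>
           fourier_jacobi_cusp_forms r \<subset> jacobi_cusp_forms r"
proof -
  from even_coefficients_differ obtain K1 where K1: "\<forall>k\<ge>K1. even (Suc k)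
      \<longrightarrow> even_frame.theta.coefficient k (binary_form 1 0 2) (vector [0, 1])
        \<noteq> even_frame.theta.coefficient k (binary_form 1 (1 / 2) 2) (vector [0, 0])" ..
  from odd_coefficient_nonzero obtain K2
    where K2: "\<forall>k\<ge>K2. odd_frame.theta.coefficient k (binary_form 1 (1 / 2) 3) (vector [1, 0]) \<noteq> 0" ..
  have proper: "fourier_jacobi_cusp_forms r \<subset> jacobi_cusp_forms r" if r: "r \<ge> 5 + int (max K1 K2)" for r
  proof -
    define k where "k = nat (r - 5)"
    have rk: "r = 4 + int (Suc k)" using r by (simp add: k_def)
    have k: "k \<ge> K1" "k \<ge> K2" using r unfolding rk by simp_all
    have "\<exists>\<phi>\<in>jacobi_cusp_forms r. \<phi> \<notin> fourier_jacobi_cusp_forms r"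
    proof (cases "even r")
      case True
      then have ev: "even (Suc k)" unfolding rk by presburger
      have "even_frame.theta.phi k \<notin> fourier_jacobi_cusp_forms r"
      proof
        assume "even_frame.theta.phi k \<in> fourier_jacobi_cusp_forms r"
        from fourier_jacobi_coefficients_even[OF this even_frame.theta.phi_fourier True, of 0 2 0 1]
        have "even_frame.theta.coefficient k (binary_form 1 0 2) (vector [0, 1])
          = even_frame.theta.coefficient k (binary_form 1 (1 / 2) 2) (vector [0, 0])"
          by (simp only: of_int_0 of_int_1 of_int_numeral div_0)
        with K1[rule_format, OF k(1) ev] show False ..
      qed
      moreover have "even_frame.theta.phi k \<in> jacobi_cusp_forms r"
        unfolding rk by (rule even_frame.theta.phi_cusp_form)
      ultimately show ?thesis by (rule bexI)
    next
      case False
      have "odd_frame.theta.phi k \<notin> fourier_jacobi_cusp_forms r"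
      proof
        assume FJ: "odd_frame.theta.phi k \<in> fourier_jacobi_cusp_forms r"
        have "binary_form 1 (1 / 2) 3 \<in> half_integral"
          by (simp add: half_integral_def binary_form_def transpose_def vec_eq_iff forall_2)
        from fourier_jacobi_coefficients_odd[OF FJ odd_frame.theta.phi_fourier False this]
        have "odd_frame.theta.coefficient k (binary_form 1 (1 / 2) 3) (vector [1, 0]) = 0" .
        with K2[rule_format, OF k(2)] show False ..
      qed
      moreover have "odd_frame.theta.phi k \<in> jacobi_cusp_forms r"
        unfolding rk by (rule odd_frame.theta.phi_cusp_form)
      ultimately show ?thesis by (rule bexI)
    qed
    then have "fourier_jacobi_cusp_forms r \<noteq> jacobi_cusp_forms r" by (elim bexE) (rule notI, simp)
    with fourier_jacobi_subset show ?thesis by (rule psubsetI)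
  qed
  show ?thesis
    by (intro exI[of _ "5 + int (max K1 K2)"] allI impI conjI fourier_jacobi_subspace proper)
qed

end
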